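(* Let $A$ be a self-injective algebra and let $\mathcal{S}$ be a finite orthogonal system in $A\text{-}\underline{\mathrm{mod}}$ such that $\Sigma(\mathcal{S})\subseteq\mathcal{F}(\mathcal{S})$. Suppose that $\mathcal{S}$ is a weakly simple-minded system, that is, $\mathcal{S}^{\perp}=\{0\}$ in $A\text{-}\underline{\mathrm{mod}}$, and suppose that the following condition holds: if $\mathcal{S}^{\perp}=\{0\}$ in $A\text{-}\underline{\mathrm{mod}}$, then $\mathcal{S}^{\perp}=\{0\}$ in $A\text{-}\underline{\mathrm{Mod}}$. Then $\mathcal{S}$ is a simple-minded system in $A\text{-}\underline{\mathrm{mod}}$.
   Context: Algebras are finite-dimensional associative unital algebras over an algebraically closed field $k$. $A\text{-}\mathrm{mod}$ denotes the category of finitely presented left $A$-modules and $A\text{-}\mathrm{Mod}$ the category of all left $A$-modules. The stable categories $A\text{-}\underline{\mathrm{mod}}$ and $A\text{-}\underline{\mathrm{Mod}}$ have the same objects, with morphisms $\underline{\mathrm{Hom}}_A(X,Y)=\mathrm{Hom}_A(X,Y)/\mathcal{P}(X,Y)$, where $\mathcal{P}(X,Y)$ is the subgroup of homomorphisms factoring through a projective module. For $A$ self-injective both are triangulated, with suspension $\Sigma=[1]$ the cosyzygy functor (cokernel of the injective envelope). For a triangulated category $\mathcal{T}$ and families $\mathcal{S}_1,\mathcal{S}_2$ of objects, $\mathcal{S}_1\star\mathcal{S}_2$ is the family of all $X\in\mathcal{T}$ admitting a triangle $S_1\to X\to S_2\to\Sigma S_1$ with $S_1\in\mathcal{S}_1$,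 $S_2\in\mathcal{S}_2$. Put $(\mathcal{S})_0=\{0\}$, $(\mathcal{S})_n=(\mathcal{S})_{n-1}\star(\mathcal{S}\cup\{0\})$ for $n\geq 1$, and let the extension closure be $\mathcal{F}(\mathcal{S})=\bigcup_{n\ge 0}(\mathcal{S})_n$ (here formed in $\mathcal{T}=A\text{-}\underline{\mathrm{mod}}$). An orthogonal system in $\mathcal{T}$ is a family $\mathcal{S}$ of objects $M$ with $\mathcal{T}(M,M)\cong k$ (stable bricks) such that $\mathcal{T}(M,N)=0$ for all distinct $M,N\in\mathcal{S}$. For a family $\mathcal{S}$, $\mathcal{S}^{\perp}=\{Y\in\mathcal{T}\mid \mathcal{T}(X,Y)=0\text{ for all }X\in\mathcal{S}\}$; "in $A\text{-}\underline{\mathrm{mod}}$" or "in $A\text{-}\underline{\mathrm{Mod}}$" indicates which category plays the role of $\mathcal{T}$. A weakly simple-minded system in $\mathcal{T}$ is an orthogonal system $\mathcal{S}$ such that for every non-zero $X\in\mathcal{T}$ there is $S\in\mathcal{S}$ with $\mathcal{T}(S,X)\neq 0$. A simple-minded system in $\mathcal{T}$ is an orthogonal system $\mathcal{S}$ with $\mathcal{F}(\mathcal{S})=\mathcal{T}$. *)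

theory Defs
  imports "HOL-Algebra.Algebra" "HOL-Algebra.Algebraic_Closure" "HOL-Library.FuncSet"
begin

section \<open>Algebras and left modules\<close>

text \<open>
  The library locales \<open>module\<close> and \<open>algebra\<close> require commutative rings, so the non-commutative
  notions are defined here on the library record \<open>('r, 'm) module\<close>.  An algebra uses all fields of
  this record; for a module over an algebra the fields \<open>mult\<close> and \<open>one\<close> are never looked at.
\<close>

definition is_fd_algebra :: "'k ring \<Rightarrow> ('k, 'a) module \<Rightarrow> bool" where
  "is_fd_algebra k A \<longleftrightarrow>
     algebraically_closed k \<and> ring A \<and> module k A \<and>
     (\<forall>c\<in>carrier k. \<forall>x\<in>carrier A. \<forall>y\<in>carrier A.
        (c \<odot>\<^bsub>A\<^esub> x) \<otimes>\<^bsub>A\<^esub> y = c \<odot>\<^bsub>A\<^esub> (x \<otimes>\<^bsub>A\<^esub> y) \<and>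
        x \<otimes>\<^bsub>A\<^esub> (c \<odot>\<^bsub>A\<^esub> y) = c \<odot>\<^bsub>A\<^esub> (x \<otimes>\<^bsub>A\<^esub> y)) \<and>
     (\<exists>B\<subseteq>carrier A. finite B \<and>
        (\<forall>x\<in>carrier A. \<exists>c\<in>B \<rightarrow> carrier k. x = (\<Oplus>\<^bsub>A\<^esub>b\<in>B. c b \<odot>\<^bsub>A\<^esub> b)))"

locale left_module = R?: ring R + M?: abelian_group M
  for R :: "('r, 'z) ring_scheme" and M :: "('r, 'm) module" +
  assumes smult_closed: "\<lbrakk>a \<in> carrier R; x \<in> carrier M\<rbrakk> \<Longrightarrow> a \<odot>\<^bsub>M\<^esub> x \<in> carrier M"
    and smult_l_distr: "\<lbrakk>a \<in> carrier R; b \<in> carrier R; x \<in> carrier M\<rbrakk> \<Longrightarrow>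
      (a \<oplus>\<^bsub>R\<^esub> b) \<odot>\<^bsub>M\<^esub> x = a \<odot>\<^bsub>M\<^esub> x \<oplus>\<^bsub>M\<^esub> b \<odot>\<^bsub>M\<^esub> x"
    and smult_r_distr: "\<lbrakk>a \<in> carrier R; x \<in> carrier M; y \<in> carrier M\<rbrakk> \<Longrightarrow>
      a \<odot>\<^bsub>M\<^esub> (x \<oplus>\<^bsub>M\<^esub> y) = a \<odot>\<^bsub>M\<^esub> x \<oplus>\<^bsub>M\<^esub> a \<odot>\<^bsub>M\<^esub> y"
    and smult_assoc: "\<lbrakk>a \<in> carrier R; b \<in> carrier R; x \<in> carrier M\<rbrakk> \<Longrightarrow>
      (a \<otimes>\<^bsub>R\<^esub> b) \<odot>\<^bsub>M\<^esub> x = a \<odot>\<^bsub>M\<^esub> (b \<odot>\<^bsub>M\<^esub> x)"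
    and smult_one: "x \<in> carrier M \<Longrightarrow> \<one>\<^bsub>R\<^esub> \<odot>\<^bsub>M\<^esub> x = x"

text \<open>Homomorphisms are extensional functions, so that equality of morphisms is equality in HOL.\<close>

definition mod_hom ::
  "('r, 'z) ring_scheme \<Rightarrow> ('r, 'm) module \<Rightarrow> ('r, 'n) module \<Rightarrow> ('m \<Rightarrow> 'n) set" where
  "mod_hom R L M = {f \<in> carrier L \<rightarrow>\<^sub>E carrier M.
     (\<forall>x\<in>carrier L. \<forall>y\<in>carrier L. f (x \<oplus>\<^bsub>L\<^esub> y) = f x \<oplus>\<^bsub>M\<^esub> f y) \<and>
     (\<forall>a\<in>carrier R. \<forall>x\<in>carrier L. f (a \<odot>\<^bsub>L\<^esub> x) = a \<odot>\<^bsub>M\<^esub> f x)}"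

definition id_hom :: "('r, 'm) module \<Rightarrow> 'm \<Rightarrow> 'm" where
  "id_hom L = (\<lambda>x\<in>carrier L. x)"

definition short_exact ::
  "('r, 'z) ring_scheme \<Rightarrow> ('r, 'm) module \<Rightarrow> ('r, 'm) module \<Rightarrow> ('r, 'm) module
    \<Rightarrow> ('m \<Rightarrow> 'm) \<Rightarrow> ('m \<Rightarrow> 'm) \<Rightarrow> bool" where
  "short_exact R L M N f g \<longleftrightarrow>
     left_module R L \<and> left_module R M \<and> left_module R N \<and>
     f \<in> mod_hom R L M \<and> g \<in> mod_hom R M N \<and>
     inj_on f (carrier L) \<and> f ` carrier L = a_kernel M N g \<and> g ` carrier M = carrier N"

definition regular_module :: "('r, 'z) ring_scheme \<Rightarrow> ('r, 'r) module" where
  "regular_module R = \<lparr>carrier = carrier R, monoid.mult = monoid.mult R, one = one R,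
     ring.zero = ring.zero R, add = add R, smult = monoid.mult R\<rparr>"

definition free_module :: "('r, 'z) ring_scheme \<Rightarrow> nat \<Rightarrow> ('r, nat \<Rightarrow> 'r) module" where
  "free_module R n = \<lparr>carrier = {..<n} \<rightarrow>\<^sub>E carrier R, monoid.mult = undefined, one = undefined,
     ring.zero = (\<lambda>i\<in>{..<n}. \<zero>\<^bsub>R\<^esub>), add = (\<lambda>v w. \<lambda>i\<in>{..<n}. v i \<oplus>\<^bsub>R\<^esub> w i),
     smult = (\<lambda>a v. \<lambda>i\<in>{..<n}. a \<otimes>\<^bsub>R\<^esub> v i)\<rparr>"

definition finitely_presented :: "('r, 'z) ring_scheme \<Rightarrow> ('r, 'm) module \<Rightarrow> bool" where
  "finitely_presented R M \<longleftrightarrow> (\<exists>m n.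
     \<exists>f\<in>mod_hom R (free_module R m) (free_module R n). \<exists>g\<in>mod_hom R (free_module R n) M.
       f ` carrier (free_module R m) = a_kernel (free_module R n) M g \<and>
       g ` carrier (free_module R n) = carrier M)"

text \<open>
  HOL cannot quantify over the modules of all types at once, so the type variable \<open>'m\<close> acts as the
  universe: the objects of A-Mod are the left modules whose carrier is a set of elements of \<open>'m\<close>.
  It has to be large enough to contain a copy of the algebra; then it contains a copy of every
  finitely presented module, every projective cover, every injective envelope and every module of
  countable dimension.  It may be arbitrarily large.
\<close>

definition left_modules :: "('k, 'a) module \<Rightarrow> ('a, 'm) module set" where
  "left_modules A = {M. left_module A M}"

definition fp_left_modules :: "('k, 'a) module \<Rightarrow> ('a, 'm) module set" where
  "fp_left_modules A = {M. left_module A M \<and> finitely_presented A M}"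

text \<open>
  The test modules in the next two definitions have carriers in the same type as the module itself.
  As soon as that type contains a copy of the algebra (and the algebra is infinite or zero, as it is
  over an algebraically closed field), this is no restriction: by Baer's criterion for injectivity,
  and because the free module on the elements of \<open>P\<close> then fits into the type for projectivity.
\<close>

definition injective :: "('r, 'z) ring_scheme \<Rightarrow> ('r, 'm) module \<Rightarrow> bool" where
  "injective R I \<longleftrightarrow> left_module R I \<and>
     (\<forall>(L :: ('r, 'm) module) (M :: ('r, 'm) module) i f.
        left_module R L \<and> left_module R M \<and> i \<in> mod_hom R L M \<and> inj_on i (carrier L) \<and>
        f \<in> mod_hom R L I \<longrightarrow> (\<exists>g\<in>mod_hom R M I. compose (carrier L) g i = f))"

definition projective :: "('r, 'z) ring_scheme \<Rightarrow> ('r, 'm) module \<Rightarrow> bool" where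
  "projective R P \<longleftrightarrow> left_module R P \<and>
     (\<forall>(L :: ('r, 'm) module) (M :: ('r, 'm) module) p f.
        left_module R L \<and> left_module R M \<and> p \<in> mod_hom R L M \<and> p ` carrier L = carrier M \<and>
        f \<in> mod_hom R P M \<longrightarrow> (\<exists>g\<in>mod_hom R P L. compose (carrier P) p g = f))"

definition self_injective :: "('k, 'a) module \<Rightarrow> bool" where
  "self_injective A \<longleftrightarrow> injective A (regular_module A)"

definition injective_envelope ::
  "('r, 'z) ring_scheme \<Rightarrow> ('r, 'm) module \<Rightarrow> ('r, 'm) module \<Rightarrow> ('m \<Rightarrow> 'm) \<Rightarrow> bool" where
  "injective_envelope R L I \<iota> \<longleftrightarrow>
     injective R I \<and> \<iota> \<in> mod_hom R L I \<and> inj_on \<iota> (carrier L) \<and>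
     (\<forall>U. submodule U R I \<and> U \<inter> \<iota> ` carrier L = {\<zero>\<^bsub>I\<^esub>} \<longrightarrow> U = {\<zero>\<^bsub>I\<^esub>})"


section \<open>The stable category\<close>

definition Hom_module ::
  "('k, 'a) module \<Rightarrow> ('a, 'm) module \<Rightarrow> ('a, 'm) module \<Rightarrow> ('k, 'm \<Rightarrow> 'm) module" where
  "Hom_module A L M = \<lparr>carrier = mod_hom A L M, monoid.mult = undefined, one = undefined,
     ring.zero = (\<lambda>x\<in>carrier L. \<zero>\<^bsub>M\<^esub>), add = (\<lambda>f g. \<lambda>x\<in>carrier L. f x \<oplus>\<^bsub>M\<^esub> g x),
     smult = (\<lambda>c f. \<lambda>x\<in>carrier L. (c \<odot>\<^bsub>A\<^esub> \<one>\<^bsub>A\<^esub>) \<odot>\<^bsub>M\<^esub> f x)\<rparr>"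

definition proj_hom ::
  "('k, 'a) module \<Rightarrow> ('a, 'm) module \<Rightarrow> ('a, 'm) module \<Rightarrow> ('m \<Rightarrow> 'm) set" where
  "proj_hom A L M = {f \<in> mod_hom A L M. \<exists>P :: ('a, 'm) module. projective A P \<and>
     (\<exists>g\<in>mod_hom A L P. \<exists>h\<in>mod_hom A P M. f = compose (carrier L) h g)}"

definition stable_class ::
  "('k, 'a) module \<Rightarrow> ('a, 'm) module \<Rightarrow> ('a, 'm) module \<Rightarrow> ('m \<Rightarrow> 'm) \<Rightarrow> ('m \<Rightarrow> 'm) set" where
  "stable_class A L M f = proj_hom A L M +>\<^bsub>Hom_module A L M\<^esub> f"

definition stable_Hom ::
  "('k, 'a) module \<Rightarrow> ('a, 'm) module \<Rightarrow> ('a, 'm) module \<Rightarrow> ('k, ('m \<Rightarrow> 'm) set) module" where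
  "stable_Hom A L M = \<lparr>carrier = a_rcosets\<^bsub>Hom_module A L M\<^esub> (proj_hom A L M),
     monoid.mult = undefined, one = undefined,
     ring.zero = proj_hom A L M, add = set_add (Hom_module A L M),
     smult = (\<lambda>c F. \<Union>f\<in>F. stable_class A L M (c \<odot>\<^bsub>Hom_module A L M\<^esub> f))\<rparr>"

text \<open>The composite of the classes of \<open>f : L \<rightarrow> M\<close> and \<open>g : M \<rightarrow> N\<close>, written \<open>g \<circ> f\<close>.\<close>

definition stable_comp ::
  "('k, 'a) module \<Rightarrow> ('a, 'm) module \<Rightarrow> ('a, 'm) module
    \<Rightarrow> ('m \<Rightarrow> 'm) set \<Rightarrow> ('m \<Rightarrow> 'm) set \<Rightarrow> ('m \<Rightarrow> 'm) set" where
  "stable_comp A L N G F = (\<Union>g\<in>G. \<Union>f\<in>F. stable_class A L N (compose (carrier L) g f))"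

definition stable_End ::
  "('k, 'a) module \<Rightarrow> ('a, 'm) module \<Rightarrow> ('k, ('m \<Rightarrow> 'm) set) module" where
  "stable_End A L = (stable_Hom A L L)
     \<lparr>monoid.mult := stable_comp A L L, one := stable_class A L L (id_hom L)\<rparr>"

definition stable_Hom_zero :: "('k, 'a) module \<Rightarrow> ('a, 'm) module \<Rightarrow> ('a, 'm) module \<Rightarrow> bool" where
  "stable_Hom_zero A L M \<longleftrightarrow> carrier (stable_Hom A L M) = {\<zero>\<^bsub>stable_Hom A L M\<^esub>}"

definition stable_iso ::
  "('k, 'a) module \<Rightarrow> ('a, 'm) module \<Rightarrow> ('a, 'm) module \<Rightarrow> ('m \<Rightarrow> 'm) set \<Rightarrow> bool" where
  "stable_iso A L M F \<longleftrightarrow> F \<in> carrier (stable_Hom A L M) \<and>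
     (\<exists>G\<in>carrier (stable_Hom A M L).
        stable_comp A L L G F = stable_class A L L (id_hom L) \<and>
        stable_comp A M M F G = stable_class A M M (id_hom M))"

text \<open>
  In the following, \<open>\<T>\<close> is a class of modules, standing for the full subcategory of the stable
  category of all modules on these objects; it is used for \<open>fp_left_modules A\<close> and \<open>left_modules A\<close>.  The set of all
  zero objects of \<open>\<T>\<close> plays the role of \<open>{0}\<close>, subcategories being closed under isomorphism.
\<close>

definition zero_objects ::
  "('k, 'a) module \<Rightarrow> ('a, 'm) module set \<Rightarrow> ('a, 'm) module set" where
  "zero_objects A \<T> = {N \<in> \<T>. \<forall>M\<in>\<T>. stable_Hom_zero A N M \<and> stable_Hom_zero A M N}"


section \<open>The triangulated structure\<close>

text \<open>
  A choice, for every module \<open>L\<close>, of a short exact sequence \<open>0 \<rightarrow> L \<rightarrow> I \<rightarrow> C \<rightarrow> 0\<close> starting with an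
  injective envelope; the suspension of \<open>L\<close> is \<open>C\<close>.
\<close>

definition cosyzygy_seq ::
  "('k, 'a) module \<Rightarrow> ('a, 'm) module
    \<Rightarrow> ('a, 'm) module \<times> ('m \<Rightarrow> 'm) \<times> ('m \<Rightarrow> 'm) \<times> ('a, 'm) module" where
  "cosyzygy_seq A L =
     (SOME (I, \<iota>, \<pi>, C). injective_envelope A L I \<iota> \<and> short_exact A L I C \<iota> \<pi>)"

definition Sigma_obj :: "('k, 'a) module \<Rightarrow> ('a, 'm) module \<Rightarrow> ('a, 'm) module" where
  "Sigma_obj A L = (case cosyzygy_seq A L of (I, \<iota>, \<pi>, C) \<Rightarrow> C)"

text \<open>
  On morphisms: extend \<open>f : L \<rightarrow> M\<close> to the injective envelopes and pass to cokernels.  All classes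
  obtained in this way coincide, so their union is the class of the suspension of \<open>f\<close>.
\<close>

definition Sigma_mor ::
  "('k, 'a) module \<Rightarrow> ('a, 'm) module \<Rightarrow> ('a, 'm) module
    \<Rightarrow> ('m \<Rightarrow> 'm) set \<Rightarrow> ('m \<Rightarrow> 'm) set" where
  "Sigma_mor A L M F =
     (case cosyzygy_seq A L of (I, \<iota>, \<pi>, C) \<Rightarrow>
      case cosyzygy_seq A M of (J, \<kappa>, \<rho>, D) \<Rightarrow>
        \<Union>{stable_class A C D s | s f j.
             f \<in> F \<and> j \<in> mod_hom A I J \<and> s \<in> mod_hom A C D \<and>
             compose (carrier L) j \<iota> = compose (carrier L) \<kappa> f \<and>
             compose (carrier I) s \<pi> = compose (carrier I) \<rho> j})"

text \<open>
  The standard triangle \<open>L \<rightarrow> M \<rightarrow> N \<rightarrow> \<Sigma>L\<close> on \<open>f\<close> is given by the pushout \<open>N\<close> of the chosen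
  \<open>\<iota> : L \<rightarrow> I\<close> along \<open>f\<close>, that is, by a commutative diagram with exact rows
  \<open>0 \<rightarrow> L \<rightarrow> I \<rightarrow> \<Sigma>L \<rightarrow> 0\<close> and \<open>0 \<rightarrow> M \<rightarrow> N \<rightarrow> \<Sigma>L \<rightarrow> 0\<close> and vertical maps \<open>f\<close>, \<open>u\<close> and the identity.
\<close>

definition standard_triangle ::
  "('k, 'a) module \<Rightarrow> ('a, 'm) module \<Rightarrow> ('a, 'm) module \<Rightarrow> ('a, 'm) module
    \<Rightarrow> ('m \<Rightarrow> 'm) \<Rightarrow> ('m \<Rightarrow> 'm) \<Rightarrow> ('m \<Rightarrow> 'm) \<Rightarrow> bool" where
  "standard_triangle A L M N f g h \<longleftrightarrow>
     (case cosyzygy_seq A L of (I, \<iota>, \<pi>, C) \<Rightarrow>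
        f \<in> mod_hom A L M \<and> short_exact A M N C g h \<and>
        (\<exists>u\<in>mod_hom A I N.
           compose (carrier L) u \<iota> = compose (carrier L) g f \<and>
           compose (carrier I) h u = \<pi>))"

text \<open>The triangles are the candidate triangles isomorphic, in the stable category, to standard ones.\<close>

definition is_triangle ::
  "('k, 'a) module \<Rightarrow> ('a, 'm) module set
    \<Rightarrow> ('a, 'm) module \<Rightarrow> ('a, 'm) module \<Rightarrow> ('a, 'm) module
    \<Rightarrow> ('m \<Rightarrow> 'm) set \<Rightarrow> ('m \<Rightarrow> 'm) set \<Rightarrow> ('m \<Rightarrow> 'm) set \<Rightarrow> bool" where
  "is_triangle A \<T> L M N F G H \<longleftrightarrow>
     L \<in> \<T> \<and> M \<in> \<T> \<and> N \<in> \<T> \<and>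
     F \<in> carrier (stable_Hom A L M) \<and> G \<in> carrier (stable_Hom A M N) \<and>
     H \<in> carrier (stable_Hom A N (Sigma_obj A L)) \<and>
     (\<exists>L'\<in>\<T>. \<exists>M'\<in>\<T>. \<exists>N'\<in>\<T>. \<exists>f g h a b c.
        standard_triangle A L' M' N' f g h \<and>
        stable_iso A L L' a \<and> stable_iso A M M' b \<and> stable_iso A N N' c \<and>
        stable_comp A L M' b F = stable_comp A L M' (stable_class A L' M' f) a \<and>
        stable_comp A M N' c G = stable_comp A M N' (stable_class A M' N' g) b \<and>
        stable_comp A N (Sigma_obj A L') (Sigma_mor A L L' a) H =
          stable_comp A N (Sigma_obj A L') (stable_class A N' (Sigma_obj A L') h) c)"

definition star ::
  "('k, 'a) module \<Rightarrow> ('a, 'm) module set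
    \<Rightarrow> ('a, 'm) module set \<Rightarrow> ('a, 'm) module set \<Rightarrow> ('a, 'm) module set" where
  "star A \<T> \<S>1 \<S>2 = {L \<in> \<T>. \<exists>M\<in>\<S>1. \<exists>N\<in>\<S>2. \<exists>F G H. is_triangle A \<T> M L N F G H}"

primrec ext_power ::
  "('k, 'a) module \<Rightarrow> ('a, 'm) module set \<Rightarrow> ('a, 'm) module set \<Rightarrow> nat \<Rightarrow> ('a, 'm) module set" where
  "ext_power A \<T> \<S> 0 = zero_objects A \<T>"
| "ext_power A \<T> \<S> (Suc n) = star A \<T> (ext_power A \<T> \<S> n) (\<S> \<union> zero_objects A \<T>)"

definition ext_closure ::
  "('k, 'a) module \<Rightarrow> ('a, 'm) module set \<Rightarrow> ('a, 'm) module set \<Rightarrow> ('a, 'm) module set" where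
  "ext_closure A \<T> \<S> = (\<Union>n. ext_power A \<T> \<S> n)"


section \<open>Simple-minded systems\<close>

definition stable_brick :: "'k ring \<Rightarrow> ('k, 'a) module \<Rightarrow> ('a, 'm) module \<Rightarrow> bool" where
  "stable_brick k A M \<longleftrightarrow>
     (\<exists>\<phi>\<in>ring_iso (stable_End A M) k. \<forall>c\<in>carrier k. \<forall>F\<in>carrier (stable_End A M).
        \<phi> (c \<odot>\<^bsub>stable_End A M\<^esub> F) = c \<otimes>\<^bsub>k\<^esub> \<phi> F)"

definition orthogonal_system ::
  "'k ring \<Rightarrow> ('k, 'a) module \<Rightarrow> ('a, 'm) module set \<Rightarrow> ('a, 'm) module set \<Rightarrow> bool" where
  "orthogonal_system k A \<T> \<S> \<longleftrightarrow>
     \<S> \<subseteq> \<T> \<and> (\<forall>M\<in>\<S>. stable_brick k A M) \<and>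
     (\<forall>M\<in>\<S>. \<forall>N\<in>\<S>. M \<noteq> N \<longrightarrow> stable_Hom_zero A M N)"

definition perp ::
  "('k, 'a) module \<Rightarrow> ('a, 'm) module set \<Rightarrow> ('a, 'm) module set \<Rightarrow> ('a, 'm) module set" where
  "perp A \<T> \<S> = {M \<in> \<T>. \<forall>L\<in>\<S>. stable_Hom_zero A L M}"

definition weakly_simple_minded_system ::
  "'k ring \<Rightarrow> ('k, 'a) module \<Rightarrow> ('a, 'm) module set \<Rightarrow> ('a, 'm) module set \<Rightarrow> bool" where
  "weakly_simple_minded_system k A \<T> \<S> \<longleftrightarrow>
     orthogonal_system k A \<T> \<S> \<and>
     (\<forall>L\<in>\<T>. L \<notin> zero_objects A \<T> \<longrightarrow> (\<exists>M\<in>\<S>. \<not> stable_Hom_zero A M L))"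

definition simple_minded_system ::
  "'k ring \<Rightarrow> ('k, 'a) module \<Rightarrow> ('a, 'm) module set \<Rightarrow> ('a, 'm) module set \<Rightarrow> bool" where
  "simple_minded_system k A \<T> \<S> \<longleftrightarrow>
     orthogonal_system k A \<T> \<S> \<and> ext_closure A \<T> \<S> = \<T>"

end

theory Submission
  imports Defs
begin

text \<open>
  The bricks in \<open>\<S>\<close> are used to kill a finitely presented module \<open>X\<close>, by an infinite process that is forced to stop
  after finitely many steps.  Given \<open>X\<close>, attach cones of maps from bricks until every map from a brick to
  \<open>X\<close> has become zero in the stable category; as the Hom spaces are finite-dimensional and there are
  finitely many bricks, finitely many cones suffice (\<open>kill_all_bricks\<close>).  Repeating this gives a sequence
  \<open>X = M\<^sub>0 \<rightarrow> M\<^sub>1 \<rightarrow> M\<^sub>2 \<rightarrow> \<dots>\<close> of monomorphisms.  A map from a brick to its colimit \<open>Y\<close> comes from some \<open>M\<^sub>n\<close> and so is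
  stably zero.  Now \<open>Y\<close> is usually not finitely presented, and this is where the perpendicular category in all
  modules enters: since it is zero, \<open>Y\<close> is projective.  As \<open>X\<close> is finitely generated, the map \<open>X \<rightarrow> Y\<close> factoring
  through a projective module implies that some \<open>X \<rightarrow> M\<^sub>N\<close> does (\<open>stz_push\<close>).  Since \<open>M\<^sub>N\<close> arises from \<open>X\<close> by finitely many cones of maps
  from bricks, pulling the projective module back along them shows that \<open>X\<close> is a retract of an object of the
  extension closure \<open>\<F>(\<S>)\<close> (\<open>filt_retract_of_chain\<close>).

  It remains to see that \<open>\<F>(\<S>)\<close> is closed under retracts (\<open>filt_retract\<close>).  The key is that the cone of a non-zero map
  from a brick to an object of \<open>(\<S>)\<^sub>n\<close> lies in \<open>(\<S>)\<^sub>n\<^sub>-\<^sub>1\<close> (\<open>filt_cone\<close>), a version of Schur's lemma for orthogonal systems.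
  If \<open>X\<close> is a retract of \<open>F\<close> in \<open>(\<S>)\<^sub>n\<close> and non-zero, there is a non-zero map \<open>S \<rightarrow> X\<close>, as \<open>\<S>\<close> is weakly simple-minded; its cone
  is a retract of the cone of \<open>S \<rightarrow> F\<close>, to which induction on \<open>n\<close> applies, and \<open>X\<close> is an extension of its cone by \<open>S\<close>.

  All this is carried out with exact sequences of modules instead of triangles: the cone of \<open>f : S \<rightarrow> X\<close> is the
  cokernel of \<open>S \<rightarrow> X \<oplus> I\<close> for an embedding of \<open>S\<close> into an injective module \<open>I\<close>, and stable isomorphisms amount to
  adding and removing projective summands.  The translation back is \<open>triangle_of_ses\<close>.  It needs that projective and
  injective modules of finite length are the same, with enough of them on both sides.  The delicate point is the
  embedding of modules of finite length into free modules (\<open>ex_embedding\<close>), which comes down to the fact that every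
  simple module is a left ideal of \<open>A\<close> (\<open>right_annihilator_nonzero\<close>).

  The modules in question have their carriers in one fixed type \<open>'m\<close>.  Direct sums, quotients and the colimit \<open>Y\<close> are
  constructed inside this type, which is infinite unless \<open>A\<close> is zero, because
  an algebraically closed field is infinite.
\<close>

section \<open>Linear maps\<close>

text \<open>
  Only the values on the carrier count, and the two modules may live on different types; so maps
  compose as plain functions, and the extensional homomorphisms enter in the final translation only.
\<close>

definition lin :: "('r, 'z) ring_scheme \<Rightarrow> ('r, 'm) module \<Rightarrow> ('r, 'n) module \<Rightarrow> ('m \<Rightarrow> 'n) \<Rightarrow> bool" where
  "lin R L M f \<longleftrightarrow> left_module R L \<and> left_module R M \<and>
     (\<forall>x\<in>carrier L. f x \<in> carrier M) \<and>
     (\<forall>x\<in>carrier L. \<forall>y\<in>carrier L. f (x \<oplus>\<^bsub>L\<^esub> y) = f x \<oplus>\<^bsub>M\<^esub> f y) \<and>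
     (\<forall>a\<in>carrier R. \<forall>x\<in>carrier L. f (a \<odot>\<^bsub>L\<^esub> x) = a \<odot>\<^bsub>M\<^esub> f x)"

definition submod :: "('r, 'z) ring_scheme \<Rightarrow> ('r, 'm) module \<Rightarrow> 'm set \<Rightarrow> bool" where
  "submod R M U \<longleftrightarrow> U \<subseteq> carrier M \<and> \<zero>\<^bsub>M\<^esub> \<in> U \<and>
     (\<forall>x\<in>U. \<forall>y\<in>U. x \<oplus>\<^bsub>M\<^esub> y \<in> U) \<and> (\<forall>a\<in>carrier R. \<forall>x\<in>U. a \<odot>\<^bsub>M\<^esub> x \<in> U)"

definition ses where
  "ses R L M N f g \<longleftrightarrow> lin R L M f \<and> lin R M N g \<and> inj_on f (carrier L) \<and>
     g ` carrier M = carrier N \<and> (\<forall>x\<in>carrier M. g x = \<zero>\<^bsub>N\<^esub> \<longleftrightarrow> x \<in> f ` carrier L)"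

lemma lm_grp: "left_module R M \<Longrightarrow> abelian_group M"
  by (simp add: left_module_def)

lemma lm_ring: "left_module R M \<Longrightarrow> ring R"
  by (simp add: left_module_def)

lemma lm_closed:
  assumes "left_module R M"
  shows "x \<in> carrier M \<Longrightarrow> y \<in> carrier M \<Longrightarrow> x \<oplus>\<^bsub>M\<^esub> y \<in> carrier M"
    and "\<zero>\<^bsub>M\<^esub> \<in> carrier M"
    and "x \<in> carrier M \<Longrightarrow> \<ominus>\<^bsub>M\<^esub> x \<in> carrier M"
    and "x \<in> carrier M \<Longrightarrow> y \<in> carrier M \<Longrightarrow> x \<ominus>\<^bsub>M\<^esub> y \<in> carrier M"
    and "a \<in> carrier R \<Longrightarrow> x \<in> carrier M \<Longrightarrow> a \<odot>\<^bsub>M\<^esub> x \<in> carrier M"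
proof -
  interpret left_module R M by fact
  show "x \<in> carrier M \<Longrightarrow> y \<in> carrier M \<Longrightarrow> x \<oplus>\<^bsub>M\<^esub> y \<in> carrier M"
    and "\<zero>\<^bsub>M\<^esub> \<in> carrier M"
    and "x \<in> carrier M \<Longrightarrow> \<ominus>\<^bsub>M\<^esub> x \<in> carrier M"
    and "x \<in> carrier M \<Longrightarrow> y \<in> carrier M \<Longrightarrow> x \<ominus>\<^bsub>M\<^esub> y \<in> carrier M"
    and "a \<in> carrier R \<Longrightarrow> x \<in> carrier M \<Longrightarrow> a \<odot>\<^bsub>M\<^esub> x \<in> carrier M"
    by (auto intro: smult_closed)
qed

lemma lm_add:
  assumes "left_module R M" and x: "x \<in> carrier M"
  shows "\<zero>\<^bsub>M\<^esub> \<oplus>\<^bsub>M\<^esub> x = x"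
    and "x \<oplus>\<^bsub>M\<^esub> \<zero>\<^bsub>M\<^esub> = x"
    and "x \<ominus>\<^bsub>M\<^esub> x = \<zero>\<^bsub>M\<^esub>"
    and "x \<ominus>\<^bsub>M\<^esub> \<zero>\<^bsub>M\<^esub> = x"
    and "\<zero>\<^bsub>M\<^esub> \<ominus>\<^bsub>M\<^esub> x = \<ominus>\<^bsub>M\<^esub> x"
    and "x \<oplus>\<^bsub>M\<^esub> \<ominus>\<^bsub>M\<^esub> x = \<zero>\<^bsub>M\<^esub>"
    and "\<ominus>\<^bsub>M\<^esub> x \<oplus>\<^bsub>M\<^esub> x = \<zero>\<^bsub>M\<^esub>"
    and "\<ominus>\<^bsub>M\<^esub> (\<ominus>\<^bsub>M\<^esub> x) = x"
proof -
  interpret abelian_group M using assms(1) by (rule lm_grp)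
  show "\<zero>\<^bsub>M\<^esub> \<oplus>\<^bsub>M\<^esub> x = x"
    and "x \<oplus>\<^bsub>M\<^esub> \<zero>\<^bsub>M\<^esub> = x"
    and "x \<ominus>\<^bsub>M\<^esub> x = \<zero>\<^bsub>M\<^esub>"
    and "x \<ominus>\<^bsub>M\<^esub> \<zero>\<^bsub>M\<^esub> = x"
    and "\<zero>\<^bsub>M\<^esub> \<ominus>\<^bsub>M\<^esub> x = \<ominus>\<^bsub>M\<^esub> x"
    and "x \<oplus>\<^bsub>M\<^esub> \<ominus>\<^bsub>M\<^esub> x = \<zero>\<^bsub>M\<^esub>"
    and "\<ominus>\<^bsub>M\<^esub> x \<oplus>\<^bsub>M\<^esub> x = \<zero>\<^bsub>M\<^esub>"
    and "\<ominus>\<^bsub>M\<^esub> (\<ominus>\<^bsub>M\<^esub> x) = x"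
    using x by (simp_all add: minus_eq r_neg l_neg)
qed

lemma lm_cancel:
  assumes "left_module R M" and x: "x \<in> carrier M" and y: "y \<in> carrier M"
  shows "x \<ominus>\<^bsub>M\<^esub> y = \<zero>\<^bsub>M\<^esub> \<longleftrightarrow> x = y"
    and "x \<ominus>\<^bsub>M\<^esub> y \<oplus>\<^bsub>M\<^esub> y = x"
    and "y \<oplus>\<^bsub>M\<^esub> (x \<ominus>\<^bsub>M\<^esub> y) = x"
    and "x \<oplus>\<^bsub>M\<^esub> y \<ominus>\<^bsub>M\<^esub> y = x"
    and "y \<oplus>\<^bsub>M\<^esub> x \<ominus>\<^bsub>M\<^esub> y = x"
    and "x \<ominus>\<^bsub>M\<^esub> (x \<ominus>\<^bsub>M\<^esub> y) = y"
    and "x \<oplus>\<^bsub>M\<^esub> y = y \<oplus>\<^bsub>M\<^esub> x"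
proof -
  interpret abelian_group M using assms(1) by (rule lm_grp)
  show "x \<ominus>\<^bsub>M\<^esub> y = \<zero>\<^bsub>M\<^esub> \<longleftrightarrow> x = y"
    using x y by (metis minus_equality minus_eq minus_minus r_neg a_inv_closed)
  show c: "x \<ominus>\<^bsub>M\<^esub> y \<oplus>\<^bsub>M\<^esub> y = x" "x \<oplus>\<^bsub>M\<^esub> y \<ominus>\<^bsub>M\<^esub> y = x"
    using x y by (simp_all add: minus_eq a_assoc l_neg r_neg)
  show "y \<oplus>\<^bsub>M\<^esub> (x \<ominus>\<^bsub>M\<^esub> y) = x" "y \<oplus>\<^bsub>M\<^esub> x \<ominus>\<^bsub>M\<^esub> y = x"
    using x y c by (simp_all add: a_comm[of y])
  show "x \<ominus>\<^bsub>M\<^esub> (x \<ominus>\<^bsub>M\<^esub> y) = y" using x y by (simp add: minus_eq minus_add r_neg2)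
  show "x \<oplus>\<^bsub>M\<^esub> y = y \<oplus>\<^bsub>M\<^esub> x" using x y by (simp add: a_comm)
qed

lemma lm_smult:
  assumes "left_module R M"
  shows "a \<in> carrier R \<Longrightarrow> b \<in> carrier R \<Longrightarrow> x \<in> carrier M \<Longrightarrow>
      (a \<oplus>\<^bsub>R\<^esub> b) \<odot>\<^bsub>M\<^esub> x = a \<odot>\<^bsub>M\<^esub> x \<oplus>\<^bsub>M\<^esub> b \<odot>\<^bsub>M\<^esub> x"
    and "a \<in> carrier R \<Longrightarrow> x \<in> carrier M \<Longrightarrow> y \<in> carrier M \<Longrightarrow>
      a \<odot>\<^bsub>M\<^esub> (x \<oplus>\<^bsub>M\<^esub> y) = a \<odot>\<^bsub>M\<^esub> x \<oplus>\<^bsub>M\<^esub> a \<odot>\<^bsub>M\<^esub> y"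
    and "a \<in> carrier R \<Longrightarrow> b \<in> carrier R \<Longrightarrow> x \<in> carrier M \<Longrightarrow>
      (a \<otimes>\<^bsub>R\<^esub> b) \<odot>\<^bsub>M\<^esub> x = a \<odot>\<^bsub>M\<^esub> (b \<odot>\<^bsub>M\<^esub> x)"
  using left_module.smult_l_distr[OF assms] left_module.smult_r_distr[OF assms]
    left_module.smult_assoc[OF assms] by blast+

lemma lm_one: "left_module R M \<Longrightarrow> x \<in> carrier M \<Longrightarrow> \<one>\<^bsub>R\<^esub> \<odot>\<^bsub>M\<^esub> x = x"
  by (rule left_module.smult_one)

lemma lm_smult0:
  assumes M: "left_module R M"
  shows "x \<in> carrier M \<Longrightarrow> \<zero>\<^bsub>R\<^esub> \<odot>\<^bsub>M\<^esub> x = \<zero>\<^bsub>M\<^esub>"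
    and "a \<in> carrier R \<Longrightarrow> a \<odot>\<^bsub>M\<^esub> \<zero>\<^bsub>M\<^esub> = \<zero>\<^bsub>M\<^esub>"
    and "a \<in> carrier R \<Longrightarrow> x \<in> carrier M \<Longrightarrow> a \<odot>\<^bsub>M\<^esub> (\<ominus>\<^bsub>M\<^esub> x) = \<ominus>\<^bsub>M\<^esub> (a \<odot>\<^bsub>M\<^esub> x)"
    and "a \<in> carrier R \<Longrightarrow> x \<in> carrier M \<Longrightarrow> (\<ominus>\<^bsub>R\<^esub> a) \<odot>\<^bsub>M\<^esub> x = \<ominus>\<^bsub>M\<^esub> (a \<odot>\<^bsub>M\<^esub> x)"
    and "a \<in> carrier R \<Longrightarrow> x \<in> carrier M \<Longrightarrow> y \<in> carrier M \<Longrightarrow> a \<odot>\<^bsub>M\<^esub> (x \<ominus>\<^bsub>M\<^esub> y) = a \<odot>\<^bsub>M\<^esub> x \<ominus>\<^bsub>M\<^esub> a \<odot>\<^bsub>M\<^esub> y"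
    and "a \<in> carrier R \<Longrightarrow> b \<in> carrier R \<Longrightarrow> x \<in> carrier M \<Longrightarrow> (a \<ominus>\<^bsub>R\<^esub> b) \<odot>\<^bsub>M\<^esub> x = a \<odot>\<^bsub>M\<^esub> x \<ominus>\<^bsub>M\<^esub> b \<odot>\<^bsub>M\<^esub> x"
proof -
  interpret left_module R M by fact
  show 1: "\<zero>\<^bsub>R\<^esub> \<odot>\<^bsub>M\<^esub> x = \<zero>\<^bsub>M\<^esub>" if "x \<in> carrier M" for x
    using smult_l_distr[of "\<zero>\<^bsub>R\<^esub>" "\<zero>\<^bsub>R\<^esub>" x] that smult_closed[of "\<zero>\<^bsub>R\<^esub>" x]
    by (metis M.add.r_cancel_one' R.zero_closed R.r_zero)
  show 2: "a \<odot>\<^bsub>M\<^esub> \<zero>\<^bsub>M\<^esub> = \<zero>\<^bsub>M\<^esub>" if "a \<in> carrier R" for a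
    using smult_r_distr[of a "\<zero>\<^bsub>M\<^esub>" "\<zero>\<^bsub>M\<^esub>"] that smult_closed[of a "\<zero>\<^bsub>M\<^esub>"]
    by (metis M.add.r_cancel_one' M.zero_closed M.r_zero)
  show 3: "a \<odot>\<^bsub>M\<^esub> (\<ominus>\<^bsub>M\<^esub> x) = \<ominus>\<^bsub>M\<^esub> (a \<odot>\<^bsub>M\<^esub> x)" if "a \<in> carrier R" "x \<in> carrier M" for a x
    using smult_r_distr[of a "\<ominus>\<^bsub>M\<^esub> x" x] that smult_closed[of a] M.minus_equality
    by (metis 2 M.a_inv_closed M.l_neg)
  show 4: "(\<ominus>\<^bsub>R\<^esub> a) \<odot>\<^bsub>M\<^esub> x = \<ominus>\<^bsub>M\<^esub> (a \<odot>\<^bsub>M\<^esub> x)" if "a \<in> carrier R" "x \<in> carrier M" for a x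
    using smult_l_distr[of "\<ominus>\<^bsub>R\<^esub> a" a x] that smult_closed M.minus_equality
    by (metis 1 R.a_inv_closed R.l_neg)
  show "a \<odot>\<^bsub>M\<^esub> (x \<ominus>\<^bsub>M\<^esub> y) = a \<odot>\<^bsub>M\<^esub> x \<ominus>\<^bsub>M\<^esub> a \<odot>\<^bsub>M\<^esub> y" if "a \<in> carrier R" "x \<in> carrier M" "y \<in> carrier M" for a x y
    using that by (simp add: M.minus_eq smult_r_distr 3)
  show "(a \<ominus>\<^bsub>R\<^esub> b) \<odot>\<^bsub>M\<^esub> x = a \<odot>\<^bsub>M\<^esub> x \<ominus>\<^bsub>M\<^esub> b \<odot>\<^bsub>M\<^esub> x" if "a \<in> carrier R" "b \<in> carrier R" "x \<in> carrier M"
    using that by (simp add: M.minus_eq R.minus_eq smult_l_distr 4)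
qed

lemma lm_neg_one: "left_module R M \<Longrightarrow> x \<in> carrier M \<Longrightarrow> (\<ominus>\<^bsub>R\<^esub> \<one>\<^bsub>R\<^esub>) \<odot>\<^bsub>M\<^esub> x = \<ominus>\<^bsub>M\<^esub> x"
  by (simp add: lm_smult0(4) lm_one lm_ring ring.ring_simprules(6))

lemma linI:
  assumes "left_module R L" "left_module R M"
    and "\<And>x. x \<in> carrier L \<Longrightarrow> f x \<in> carrier M"
    and "\<And>x y. x \<in> carrier L \<Longrightarrow> y \<in> carrier L \<Longrightarrow> f (x \<oplus>\<^bsub>L\<^esub> y) = f x \<oplus>\<^bsub>M\<^esub> f y"
    and "\<And>a x. a \<in> carrier R \<Longrightarrow> x \<in> carrier L \<Longrightarrow> f (a \<odot>\<^bsub>L\<^esub> x) = a \<odot>\<^bsub>M\<^esub> f x"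
  shows "lin R L M f"
  using assms by (auto simp: lin_def)

lemma lin_mods: "lin R L M f \<Longrightarrow> left_module R L" "lin R L M f \<Longrightarrow> left_module R M"
  by (auto simp: lin_def)

lemma lin_simps:
  assumes f: "lin R L M f"
  shows "x \<in> carrier L \<Longrightarrow> f x \<in> carrier M"
    and "x \<in> carrier L \<Longrightarrow> y \<in> carrier L \<Longrightarrow> f (x \<oplus>\<^bsub>L\<^esub> y) = f x \<oplus>\<^bsub>M\<^esub> f y"
    and "a \<in> carrier R \<Longrightarrow> x \<in> carrier L \<Longrightarrow> f (a \<odot>\<^bsub>L\<^esub> x) = a \<odot>\<^bsub>M\<^esub> f x"
    and "f \<zero>\<^bsub>L\<^esub> = \<zero>\<^bsub>M\<^esub>"
    and "x \<in> carrier L \<Longrightarrow> f (\<ominus>\<^bsub>L\<^esub> x) = \<ominus>\<^bsub>M\<^esub> f x"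
    and "x \<in> carrier L \<Longrightarrow> y \<in> carrier L \<Longrightarrow> f (x \<ominus>\<^bsub>L\<^esub> y) = f x \<ominus>\<^bsub>M\<^esub> f y"
proof -
  note mL = lin_mods(1)[OF f] and mM = lin_mods(2)[OF f]
  show 1: "f x \<in> carrier M" if "x \<in> carrier L" for x using f that by (auto simp: lin_def)
  show 2: "f (x \<oplus>\<^bsub>L\<^esub> y) = f x \<oplus>\<^bsub>M\<^esub> f y" if "x \<in> carrier L" "y \<in> carrier L" for x y
    using f that by (auto simp: lin_def)
  show 3: "f (a \<odot>\<^bsub>L\<^esub> x) = a \<odot>\<^bsub>M\<^esub> f x" if "a \<in> carrier R" "x \<in> carrier L" for a x
    using f that by (auto simp: lin_def)
  show "f \<zero>\<^bsub>L\<^esub> = \<zero>\<^bsub>M\<^esub>"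
    using 3[of "\<zero>\<^bsub>R\<^esub>" "\<zero>\<^bsub>L\<^esub>"] 1 lm_smult0(1)[OF mL] lm_smult0(1)[OF mM] lm_closed(2)[OF mL]
      ring.ring_simprules(2)[OF lm_ring[OF mL]] by simp
  have m1: "\<ominus>\<^bsub>R\<^esub> \<one>\<^bsub>R\<^esub> \<in> carrier R"
    using lm_ring[OF mL] by (simp add: ring.ring_simprules)
  show 4: "f (\<ominus>\<^bsub>L\<^esub> x) = \<ominus>\<^bsub>M\<^esub> f x" if "x \<in> carrier L" for x
    using 3[OF m1 that] lm_neg_one[OF mL that] lm_neg_one[OF mM 1[OF that]] by simp
  show "f (x \<ominus>\<^bsub>L\<^esub> y) = f x \<ominus>\<^bsub>M\<^esub> f y" if "x \<in> carrier L" "y \<in> carrier L" for x y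
    using that 2 4 lm_closed(3)[OF mL] by (simp add: a_minus_def)
qed

lemmas lin_closed = lin_simps(1)

lemma lin_comp:
  assumes f: "lin R L M f" and g: "lin R M N g"
  shows "lin R L N (\<lambda>x. g (f x))"
  by (rule linI[OF lin_mods(1)[OF f] lin_mods(2)[OF g]])
    (simp_all add: lin_simps(1,2,3)[OF f] lin_simps(1,2,3)[OF g])

lemma lin_cong:
  assumes f: "lin R L M f" and eq: "\<And>x. x \<in> carrier L \<Longrightarrow> f x = g x"
  shows "lin R L M g"
  by (rule linI[OF lin_mods[OF f]])
    (simp_all add: lin_simps(1,2,3)[OF f] eq[symmetric] lm_closed[OF lin_mods(1)[OF f]])

lemma lin_id: "left_module R L \<Longrightarrow> lin R L L (\<lambda>x. x)"
  by (rule linI) auto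

lemma lin_zero:
  assumes L: "left_module R L" and M: "left_module R M"
  shows "lin R L M (\<lambda>x. \<zero>\<^bsub>M\<^esub>)"
  by (rule linI[OF L M]) (simp_all add: lm_closed[OF M] lm_add[OF M] lm_smult0[OF M])

lemma lm_add4:
  assumes "left_module R M" "x \<in> carrier M" "y \<in> carrier M" "z \<in> carrier M" "w \<in> carrier M"
  shows "(x \<oplus>\<^bsub>M\<^esub> y) \<oplus>\<^bsub>M\<^esub> (z \<oplus>\<^bsub>M\<^esub> w) = (x \<oplus>\<^bsub>M\<^esub> z) \<oplus>\<^bsub>M\<^esub> (y \<oplus>\<^bsub>M\<^esub> w)"
    and "(x \<oplus>\<^bsub>M\<^esub> y) \<ominus>\<^bsub>M\<^esub> (z \<oplus>\<^bsub>M\<^esub> w) = (x \<ominus>\<^bsub>M\<^esub> z) \<oplus>\<^bsub>M\<^esub> (y \<ominus>\<^bsub>M\<^esub> w)"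
proof -
  interpret abelian_group M using assms(1) by (rule lm_grp)
  show "(x \<oplus>\<^bsub>M\<^esub> y) \<oplus>\<^bsub>M\<^esub> (z \<oplus>\<^bsub>M\<^esub> w) = (x \<oplus>\<^bsub>M\<^esub> z) \<oplus>\<^bsub>M\<^esub> (y \<oplus>\<^bsub>M\<^esub> w)"
    "(x \<oplus>\<^bsub>M\<^esub> y) \<ominus>\<^bsub>M\<^esub> (z \<oplus>\<^bsub>M\<^esub> w) = (x \<ominus>\<^bsub>M\<^esub> z) \<oplus>\<^bsub>M\<^esub> (y \<ominus>\<^bsub>M\<^esub> w)"
    using assms by (simp_all add: a_ac minus_eq minus_add)
qed

lemma lin_add:
  assumes f: "lin R L M f" and g: "lin R L M g"
  shows "lin R L M (\<lambda>x. f x \<oplus>\<^bsub>M\<^esub> g x)"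
proof -
  note L = lin_mods(1)[OF f] and M = lin_mods(2)[OF f]
  show ?thesis
    by (rule linI[OF L M])
      (simp_all add: lin_simps[OF f] lin_simps[OF g] lm_closed[OF M] lm_add4[OF M] lm_smult(2)[OF M])
qed

lemma lin_sub:
  assumes f: "lin R L M f" and g: "lin R L M g"
  shows "lin R L M (\<lambda>x. f x \<ominus>\<^bsub>M\<^esub> g x)"
proof -
  note L = lin_mods(1)[OF f] and M = lin_mods(2)[OF f]
  show ?thesis
    by (rule linI[OF L M])
      (simp_all add: lin_simps[OF f] lin_simps[OF g] lm_closed[OF M] lm_add4[OF M] lm_smult0(5)[OF M])
qed

section \<open>Submodules, quotients and copies\<close>

lemma left_moduleI:
  assumes R: "ring R"
    and "\<And>x y. x \<in> carrier M \<Longrightarrow> y \<in> carrier M \<Longrightarrow> x \<oplus>\<^bsub>M\<^esub> y \<in> carrier M"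
    and "\<zero>\<^bsub>M\<^esub> \<in> carrier M"
    and "\<And>x y z. x \<in> carrier M \<Longrightarrow> y \<in> carrier M \<Longrightarrow> z \<in> carrier M \<Longrightarrow>
      (x \<oplus>\<^bsub>M\<^esub> y) \<oplus>\<^bsub>M\<^esub> z = x \<oplus>\<^bsub>M\<^esub> (y \<oplus>\<^bsub>M\<^esub> z)"
    and "\<And>x y. x \<in> carrier M \<Longrightarrow> y \<in> carrier M \<Longrightarrow> x \<oplus>\<^bsub>M\<^esub> y = y \<oplus>\<^bsub>M\<^esub> x"
    and "\<And>x. x \<in> carrier M \<Longrightarrow> \<zero>\<^bsub>M\<^esub> \<oplus>\<^bsub>M\<^esub> x = x"
    and "\<And>x. x \<in> carrier M \<Longrightarrow> \<exists>y\<in>carrier M. y \<oplus>\<^bsub>M\<^esub> x = \<zero>\<^bsub>M\<^esub>"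
    and "\<And>a x. a \<in> carrier R \<Longrightarrow> x \<in> carrier M \<Longrightarrow> a \<odot>\<^bsub>M\<^esub> x \<in> carrier M"
    and "\<And>a b x. a \<in> carrier R \<Longrightarrow> b \<in> carrier R \<Longrightarrow> x \<in> carrier M \<Longrightarrow>
      (a \<oplus>\<^bsub>R\<^esub> b) \<odot>\<^bsub>M\<^esub> x = a \<odot>\<^bsub>M\<^esub> x \<oplus>\<^bsub>M\<^esub> b \<odot>\<^bsub>M\<^esub> x"
    and "\<And>a x y. a \<in> carrier R \<Longrightarrow> x \<in> carrier M \<Longrightarrow> y \<in> carrier M \<Longrightarrow>
      a \<odot>\<^bsub>M\<^esub> (x \<oplus>\<^bsub>M\<^esub> y) = a \<odot>\<^bsub>M\<^esub> x \<oplus>\<^bsub>M\<^esub> a \<odot>\<^bsub>M\<^esub> y"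
    and "\<And>a b x. a \<in> carrier R \<Longrightarrow> b \<in> carrier R \<Longrightarrow> x \<in> carrier M \<Longrightarrow>
      (a \<otimes>\<^bsub>R\<^esub> b) \<odot>\<^bsub>M\<^esub> x = a \<odot>\<^bsub>M\<^esub> (b \<odot>\<^bsub>M\<^esub> x)"
    and "\<And>x. x \<in> carrier M \<Longrightarrow> \<one>\<^bsub>R\<^esub> \<odot>\<^bsub>M\<^esub> x = x"
  shows "left_module R M"
  by (intro left_module.intro left_module_axioms.intro R abelian_groupI assms)

lemma submod_neg:
  assumes M: "left_module R M" and U: "submod R M U"
  shows "x \<in> U \<Longrightarrow> \<ominus>\<^bsub>M\<^esub> x \<in> U" and "x \<in> U \<Longrightarrow> y \<in> U \<Longrightarrow> x \<ominus>\<^bsub>M\<^esub> y \<in> U"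
proof -
  have m1: "\<ominus>\<^bsub>R\<^esub> \<one>\<^bsub>R\<^esub> \<in> carrier R" using lm_ring[OF M] by (simp add: ring.ring_simprules)
  show neg: "\<ominus>\<^bsub>M\<^esub> x \<in> U" if "x \<in> U" for x
    using U m1 that lm_neg_one[OF M, of x] unfolding submod_def by (metis subsetD)
  show "x \<in> U \<Longrightarrow> y \<in> U \<Longrightarrow> x \<ominus>\<^bsub>M\<^esub> y \<in> U"
    using neg U unfolding submod_def a_minus_def by blast
qed

lemma submod_module:
  assumes M: "left_module R M" and U: "submod R M U"
  shows "left_module R (M\<lparr>carrier := U\<rparr>)" and "lin R (M\<lparr>carrier := U\<rparr>) M (\<lambda>x. x)"
proof -
  interpret left_module R M by fact
  have sub: "x \<in> U \<Longrightarrow> x \<in> carrier M" for x using U by (auto simp: submod_def)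
  show *: "left_module R (M\<lparr>carrier := U\<rparr>)"
  proof (rule left_moduleI[OF lm_ring[OF M]], goal_cases)
    case (6 x)
    then show ?case using submod_neg(1)[OF M U, of x] sub
      by (auto intro!: bexI[of _ "\<ominus>\<^bsub>M\<^esub> x"] simp: lm_add[OF M])
  qed (use U sub in \<open>auto simp: submod_def M.a_ac smult_l_distr smult_r_distr smult_assoc smult_one\<close>)
  show "lin R (M\<lparr>carrier := U\<rparr>) M (\<lambda>x. x)"
    by (rule linI[OF * M]) (use sub in auto)
qed

lemma lin_inj_iff:
  assumes f: "lin R L M f"
  shows "inj_on f (carrier L) \<longleftrightarrow> (\<forall>x\<in>carrier L. f x = \<zero>\<^bsub>M\<^esub> \<longrightarrow> x = \<zero>\<^bsub>L\<^esub>)"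
proof -
  note L = lin_mods(1)[OF f] and M = lin_mods(2)[OF f]
  show ?thesis
  proof
    assume "inj_on f (carrier L)"
    then show "\<forall>x\<in>carrier L. f x = \<zero>\<^bsub>M\<^esub> \<longrightarrow> x = \<zero>\<^bsub>L\<^esub>"
      using lin_simps(4)[OF f] lm_closed(2)[OF L] by (metis inj_onD)
  next
    assume *: "\<forall>x\<in>carrier L. f x = \<zero>\<^bsub>M\<^esub> \<longrightarrow> x = \<zero>\<^bsub>L\<^esub>"
    show "inj_on f (carrier L)"
    proof (rule inj_onI)
      fix x y assume xy: "x \<in> carrier L" "y \<in> carrier L" "f x = f y"
      then have "f (x \<ominus>\<^bsub>L\<^esub> y) = \<zero>\<^bsub>M\<^esub>" by (simp add: lin_simps[OF f] lm_add[OF M])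
      then show "x = y" using * xy lm_closed(4)[OF L] lm_cancel(1)[OF L] by blast
    qed
  qed
qed

lemma submod_ker:
  assumes f: "lin R L M f"
  shows "submod R L {x \<in> carrier L. f x = \<zero>\<^bsub>M\<^esub>}"
  by (auto simp: submod_def lin_simps[OF f] lm_closed[OF lin_mods(1)[OF f]] lm_closed[OF lin_mods(2)[OF f]]
      lm_add[OF lin_mods(2)[OF f]] lm_smult0[OF lin_mods(2)[OF f]])

lemma submod_vimage:
  assumes f: "lin R L M f" and U: "submod R M U"
  shows "submod R L {x \<in> carrier L. f x \<in> U}"
  using U by (auto simp: submod_def lin_simps[OF f] lm_closed[OF lin_mods(1)[OF f]])

lemma submod_image:
  assumes f: "lin R L M f" and U: "submod R L U"
  shows "submod R M (f ` U)"
proof -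
  have sub: "x \<in> U \<Longrightarrow> x \<in> carrier L" for x using U by (auto simp: submod_def)
  show ?thesis unfolding submod_def
  proof (intro conjI ballI subsetI)
    show "x \<in> f ` U \<Longrightarrow> x \<in> carrier M" for x using sub lin_simps(1)[OF f] by auto
    show "\<zero>\<^bsub>M\<^esub> \<in> f ` U" using U lin_simps(4)[OF f] by (metis submod_def image_eqI)
    show "x \<oplus>\<^bsub>M\<^esub> y \<in> f ` U" if xy: "x \<in> f ` U" "y \<in> f ` U" for x y
    proof -
      obtain a b where ab: "x = f a" "y = f b" "a \<in> U" "b \<in> U" using xy by blast
      then have "x \<oplus>\<^bsub>M\<^esub> y = f (a \<oplus>\<^bsub>L\<^esub> b)" using sub by (simp add: lin_simps[OF f])
      then show ?thesis using U ab by (auto simp: submod_def)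
    qed
    show "a \<odot>\<^bsub>M\<^esub> x \<in> f ` U" if ax: "a \<in> carrier R" "x \<in> f ` U" for a x
    proof -
      obtain b where b: "x = f b" "b \<in> U" using ax by blast
      then have "a \<odot>\<^bsub>M\<^esub> x = f (a \<odot>\<^bsub>L\<^esub> b)" using sub ax by (simp add: lin_simps[OF f])
      then show ?thesis using U b ax by (auto simp: submod_def)
    qed
  qed
qed

lemma submod_carrier: "left_module R M \<Longrightarrow> submod R M (carrier M)"
  by (simp add: submod_def lm_closed)

lemma submod_zero: "left_module R M \<Longrightarrow> submod R M {\<zero>\<^bsub>M\<^esub>}"
  by (simp add: submod_def lm_closed lm_add lm_smult0)

text \<open>
  The module structure transported along a map whose fibres are the cosets of a submodule.  It serves for
  quotients (with a choice of representatives) and for copies in another type (with an injection).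
\<close>

definition image_module :: "('r, 'b) module \<Rightarrow> ('b \<Rightarrow> 'm) \<Rightarrow> ('r, 'm) module" where
  "image_module M q = \<lparr>carrier = q ` carrier M, monoid.mult = undefined, one = undefined,
     ring.zero = q \<zero>\<^bsub>M\<^esub>,
     add = (\<lambda>u v. q (inv_into (carrier M) q u \<oplus>\<^bsub>M\<^esub> inv_into (carrier M) q v)),
     smult = (\<lambda>a u. q (a \<odot>\<^bsub>M\<^esub> inv_into (carrier M) q u))\<rparr>"

lemma lin_image_module:
  assumes M: "left_module R M" and U: "submod R M U"
    and q: "\<And>x y. x \<in> carrier M \<Longrightarrow> y \<in> carrier M \<Longrightarrow> q x = q y \<longleftrightarrow> x \<ominus>\<^bsub>M\<^esub> y \<in> U"
  shows "lin R M (image_module M q) q"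
proof -
  interpret left_module R M by fact
  define s where "s = inv_into (carrier M) q"
  have s: "s (q x) \<in> carrier M" "q (s (q x)) = q x" if "x \<in> carrier M" for x
    using that unfolding s_def by (auto intro: inv_into_into f_inv_into_f)
  have s': "s (q x) \<ominus>\<^bsub>M\<^esub> x \<in> U" if "x \<in> carrier M" for x
    using s[OF that] q[of "s (q x)" x] that by simp
  have add: "q x \<oplus>\<^bsub>image_module M q\<^esub> q y = q (x \<oplus>\<^bsub>M\<^esub> y)" if "x \<in> carrier M" "y \<in> carrier M" for x y
  proof -
    have "(s (q x) \<oplus>\<^bsub>M\<^esub> s (q y)) \<ominus>\<^bsub>M\<^esub> (x \<oplus>\<^bsub>M\<^esub> y) = (s (q x) \<ominus>\<^bsub>M\<^esub> x) \<oplus>\<^bsub>M\<^esub> (s (q y) \<ominus>\<^bsub>M\<^esub> y)"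
      using lm_add4(2)[OF M s(1)[OF that(1)] s(1)[OF that(2)] that] .
    then have "(s (q x) \<oplus>\<^bsub>M\<^esub> s (q y)) \<ominus>\<^bsub>M\<^esub> (x \<oplus>\<^bsub>M\<^esub> y) \<in> U"
      using s'[OF that(1)] s'[OF that(2)] U by (simp add: submod_def)
    then have "q (s (q x) \<oplus>\<^bsub>M\<^esub> s (q y)) = q (x \<oplus>\<^bsub>M\<^esub> y)"
      using q that s by simp
    then show ?thesis by (simp add: image_module_def s_def)
  qed
  have smu: "a \<odot>\<^bsub>image_module M q\<^esub> q x = q (a \<odot>\<^bsub>M\<^esub> x)" if "x \<in> carrier M" "a \<in> carrier R" for x a
  proof -
    have "a \<odot>\<^bsub>M\<^esub> s (q x) \<ominus>\<^bsub>M\<^esub> a \<odot>\<^bsub>M\<^esub> x = a \<odot>\<^bsub>M\<^esub> (s (q x) \<ominus>\<^bsub>M\<^esub> x)"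
      using that s by (simp add: lm_smult0[OF M])
    then have "a \<odot>\<^bsub>M\<^esub> s (q x) \<ominus>\<^bsub>M\<^esub> a \<odot>\<^bsub>M\<^esub> x \<in> U"
      using s'[OF that(1)] U that by (simp add: submod_def)
    then have "q (a \<odot>\<^bsub>M\<^esub> s (q x)) = q (a \<odot>\<^bsub>M\<^esub> x)"
      using q that s by (simp add: smult_closed)
    then show ?thesis by (simp add: image_module_def s_def)
  qed
  have car: "carrier (image_module M q) = q ` carrier M" by (simp add: image_module_def)
  have zer: "\<zero>\<^bsub>image_module M q\<^esub> = q \<zero>\<^bsub>M\<^esub>" by (simp add: image_module_def)
  have "left_module R (image_module M q)"
  proof (rule left_moduleI[OF lm_ring[OF M]], unfold car, goal_cases)
    case (6 x)
    then obtain y where y: "x = q y" "y \<in> carrier M" by auto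
    show ?case
      by (rule bexI[of _ "q (\<ominus>\<^bsub>M\<^esub> y)"]) (use y in \<open>auto simp: add zer lm_add[OF M]\<close>)
  qed (auto simp: add smu zer smult_closed M.a_ac smult_l_distr smult_r_distr smult_assoc smult_one)
  then show ?thesis
    by (intro linI[OF M]) (auto simp: add smu car)
qed

text \<open>
  Coset representatives carry the quotient, so it lives on the same type as the module itself.  This is
  what keeps cokernels inside the universe \<open>'m\<close>.
\<close>

lemma ex_quotient:
  fixes M :: "('r, 'b) module"
  assumes M: "left_module R M" and U: "submod R M U"
  shows "\<exists>(Q :: ('r, 'b) module) q. lin R M Q q \<and> q ` carrier M = carrier Q \<and>
    (\<forall>x\<in>carrier M. q x = \<zero>\<^bsub>Q\<^esub> \<longleftrightarrow> x \<in> U)"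
proof -
  interpret left_module R M by fact
  define q where "q x = (SOME y. y \<in> carrier M \<and> x \<ominus>\<^bsub>M\<^esub> y \<in> U)" for x
  have U0: "\<zero>\<^bsub>M\<^esub> \<in> U" using U by (simp add: submod_def)
  have q1: "q x \<in> carrier M \<and> x \<ominus>\<^bsub>M\<^esub> q x \<in> U" if "x \<in> carrier M" for x
    unfolding q_def by (rule someI[of _ x]) (use that U0 in \<open>simp add: lm_add[OF M]\<close>)
  have tr: "x \<ominus>\<^bsub>M\<^esub> z \<in> U" if "x \<ominus>\<^bsub>M\<^esub> y \<in> U" "y \<ominus>\<^bsub>M\<^esub> z \<in> U" "x \<in> carrier M" "y \<in> carrier M" "z \<in> carrier M" for x y z
  proof -
    have "(x \<ominus>\<^bsub>M\<^esub> y) \<oplus>\<^bsub>M\<^esub> (y \<ominus>\<^bsub>M\<^esub> z) = x \<ominus>\<^bsub>M\<^esub> z"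
      using that by (simp add: M.minus_eq M.a_assoc M.r_neg1)
    then show ?thesis using that U unfolding submod_def by metis
  qed
  have sy: "y \<ominus>\<^bsub>M\<^esub> x \<in> U" if "x \<ominus>\<^bsub>M\<^esub> y \<in> U" "x \<in> carrier M" "y \<in> carrier M" for x y
  proof -
    have "\<ominus>\<^bsub>M\<^esub> (x \<ominus>\<^bsub>M\<^esub> y) = y \<ominus>\<^bsub>M\<^esub> x" using that by (simp add: M.minus_eq M.minus_add M.a_comm)
    then show ?thesis using submod_neg(1)[OF M U that(1)] by simp
  qed
  have q: "q x = q y \<longleftrightarrow> x \<ominus>\<^bsub>M\<^esub> y \<in> U" if xy: "x \<in> carrier M" "y \<in> carrier M" for x y
  proof
    assume "q x = q y"
    then show "x \<ominus>\<^bsub>M\<^esub> y \<in> U" using q1[of x] q1[of y] xy tr[of x "q x" y] sy[of y "q y"] by auto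
  next
    assume a: "x \<ominus>\<^bsub>M\<^esub> y \<in> U"
    have "z \<in> carrier M \<and> x \<ominus>\<^bsub>M\<^esub> z \<in> U \<longleftrightarrow> z \<in> carrier M \<and> y \<ominus>\<^bsub>M\<^esub> z \<in> U" for z
      using a xy tr[of x y z] tr[of y x z] sy[of x y] by blast
    then show "q x = q y" by (simp add: q_def)
  qed
  have l: "lin R M (image_module M q) q" by (rule lin_image_module[OF M U q])
  have "q x = \<zero>\<^bsub>image_module M q\<^esub> \<longleftrightarrow> x \<in> U" if "x \<in> carrier M" for x
    using q[OF that, of "\<zero>\<^bsub>M\<^esub>"] that by (simp add: image_module_def lm_add[OF M])
  then show ?thesis
    using l by (intro exI[of _ "image_module M q"] exI[of _ q]) (simp add: image_module_def)
qed

lemma ex_copy: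
  assumes M: "left_module R M" and h: "inj_on h (carrier M)"
  shows "\<exists>N. lin R M N h \<and> h ` carrier M = carrier N"
proof (intro exI conjI)
  show "lin R M (image_module M h) h"
  proof (rule lin_image_module[OF M submod_zero[OF M]])
    fix x y assume "x \<in> carrier M" "y \<in> carrier M"
    then show "h x = h y \<longleftrightarrow> x \<ominus>\<^bsub>M\<^esub> y \<in> {\<zero>\<^bsub>M\<^esub>}"
      using h lm_cancel(1)[OF M] by (metis inj_onD singleton_iff)
  qed
  show "h ` carrier M = carrier (image_module M h)" by (simp add: image_module_def)
qed

lemma lin_factor:
  assumes g: "lin R M N g" and surj: "g ` carrier M = carrier N" and h: "lin R M Z h"
    and ker: "\<And>x. x \<in> carrier M \<Longrightarrow> g x = \<zero>\<^bsub>N\<^esub> \<Longrightarrow> h x = \<zero>\<^bsub>Z\<^esub>"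
  shows "\<exists>h'. lin R N Z h' \<and> (\<forall>x\<in>carrier M. h' (g x) = h x)"
proof -
  note M = lin_mods(1)[OF g] and N = lin_mods(2)[OF g] and Z = lin_mods(2)[OF h]
  define h' where "h' y = h (inv_into (carrier M) g y)" for y
  have eq: "h' (g x) = h x" if x: "x \<in> carrier M" for x
  proof -
    let ?y = "inv_into (carrier M) g (g x)"
    have y: "?y \<in> carrier M" "g ?y = g x" using x by (auto intro: inv_into_into f_inv_into_f)
    then have "g (?y \<ominus>\<^bsub>M\<^esub> x) = \<zero>\<^bsub>N\<^esub>"
      using x by (simp add: lin_simps[OF g] lm_add[OF N])
    then have "h (?y \<ominus>\<^bsub>M\<^esub> x) = \<zero>\<^bsub>Z\<^esub>" using ker lm_closed(4)[OF M y(1) x] by blast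
    then have "h ?y = h x" using x y lm_cancel(1)[OF Z] lin_simps(1,6)[OF h] by metis
    then show ?thesis by (simp add: h'_def)
  qed
  have "lin R N Z h'"
  proof (rule linI[OF N Z])
    fix y assume "y \<in> carrier N"
    then obtain x where x: "x \<in> carrier M" "y = g x" using surj by auto
    then show "h' y \<in> carrier Z" by (simp add: eq lin_simps[OF h])
    fix y' assume "y' \<in> carrier N"
    then obtain x' where x': "x' \<in> carrier M" "y' = g x'" using surj by auto
    show "h' (y \<oplus>\<^bsub>N\<^esub> y') = h' y \<oplus>\<^bsub>Z\<^esub> h' y'"
      using x x' eq[of "x \<oplus>\<^bsub>M\<^esub> x'"] by (simp add: eq lin_simps[OF h] lin_simps[OF g] lm_closed[OF M])
  next
    fix a y assume a: "a \<in> carrier R" and "y \<in> carrier N"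
    then obtain x where x: "x \<in> carrier M" "y = g x" using surj by auto
    then show "h' (a \<odot>\<^bsub>N\<^esub> y) = a \<odot>\<^bsub>Z\<^esub> h' y"
      using a eq[of "a \<odot>\<^bsub>M\<^esub> x"] by (simp add: eq lin_simps[OF h] lin_simps[OF g] lm_closed[OF M])
  qed
  then show ?thesis using eq by blast
qed

lemma lin_corestrict:
  assumes f: "lin R L M f" and inj: "inj_on f (carrier L)" and h: "lin R Z M h"
    and im: "\<And>z. z \<in> carrier Z \<Longrightarrow> h z \<in> f ` carrier L"
  shows "\<exists>h'. lin R Z L h' \<and> (\<forall>z\<in>carrier Z. f (h' z) = h z)"
proof -
  note L = lin_mods(1)[OF f] and M = lin_mods(2)[OF f] and Z = lin_mods(1)[OF h]
  define h' where "h' z = inv_into (carrier L) f (h z)" for z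
  have h': "h' z \<in> carrier L" "f (h' z) = h z" if "z \<in> carrier Z" for z
    using im[OF that] by (auto simp: h'_def intro: inv_into_into f_inv_into_f)
  have "lin R Z L h'"
  proof (rule linI[OF Z L])
    fix x y assume xy: "x \<in> carrier Z" "y \<in> carrier Z"
    have "f (h' (x \<oplus>\<^bsub>Z\<^esub> y)) = f (h' x \<oplus>\<^bsub>L\<^esub> h' y)"
      using xy by (simp add: h' lm_closed[OF Z] lin_simps[OF f] lin_simps[OF h])
    then show "h' (x \<oplus>\<^bsub>Z\<^esub> y) = h' x \<oplus>\<^bsub>L\<^esub> h' y"
      using inj xy h' lm_closed(1)[OF L] lm_closed(1)[OF Z] by (metis inj_onD)
  next
    fix a x assume xy: "a \<in> carrier R" "x \<in> carrier Z"
    have "f (h' (a \<odot>\<^bsub>Z\<^esub> x)) = f (a \<odot>\<^bsub>L\<^esub> h' x)"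
      using xy by (simp add: h' lm_closed[OF Z] lin_simps[OF f] lin_simps[OF h])
    then show "h' (a \<odot>\<^bsub>Z\<^esub> x) = a \<odot>\<^bsub>L\<^esub> h' x"
      using inj xy h' lm_closed(5)[OF L] lm_closed(5)[OF Z] by (metis inj_onD)
  qed (simp add: h')
  then show ?thesis using h' by blast
qed

lemma lin_inverse:
  assumes f: "lin R L M f" and inj: "inj_on f (carrier L)" and surj: "f ` carrier L = carrier M"
  shows "\<exists>g. lin R M L g \<and> (\<forall>x\<in>carrier L. g (f x) = x) \<and> (\<forall>y\<in>carrier M. f (g y) = y)"
proof -
  obtain g where g: "lin R M L g" "\<forall>y\<in>carrier M. f (g y) = y"
    using lin_corestrict[OF f inj lin_id[OF lin_mods(2)[OF f]]] surj by auto
  moreover have "g (f x) = x" if "x \<in> carrier L" for x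
    using inj g that lin_simps(1)[OF f that] lin_simps(1)[OF g(1)] by (metis inj_onD)
  ultimately show ?thesis by blast
qed

lemma sesD:
  assumes "ses R L M N f g"
  shows "lin R L M f" "lin R M N g" "inj_on f (carrier L)" "g ` carrier M = carrier N"
    "\<And>x. x \<in> carrier M \<Longrightarrow> g x = \<zero>\<^bsub>N\<^esub> \<longleftrightarrow> x \<in> f ` carrier L"
    "\<And>x. x \<in> carrier L \<Longrightarrow> g (f x) = \<zero>\<^bsub>N\<^esub>"
    "left_module R L" "left_module R M" "left_module R N"
proof -
  show "lin R L M f" "lin R M N g" "inj_on f (carrier L)" "g ` carrier M = carrier N"
    "\<And>x. x \<in> carrier M \<Longrightarrow> g x = \<zero>\<^bsub>N\<^esub> \<longleftrightarrow> x \<in> f ` carrier L"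
    using assms by (auto simp: ses_def)
  then show "\<And>x. x \<in> carrier L \<Longrightarrow> g (f x) = \<zero>\<^bsub>N\<^esub>"
    "left_module R L" "left_module R M" "left_module R N"
    by (blast dest: lin_closed lin_mods)+
qed

lemma ses_cokernel:
  fixes M :: "('r, 'b) module"
  assumes f: "lin R L M f" and inj: "inj_on f (carrier L)"
  shows "\<exists>(N :: ('r, 'b) module) g. ses R L M N f g"
proof -
  obtain N :: "('r, 'b) module" and g where "lin R M N g" "g ` carrier M = carrier N"
      "\<forall>x\<in>carrier M. g x = \<zero>\<^bsub>N\<^esub> \<longleftrightarrow> x \<in> f ` carrier L"
    using ex_quotient[OF lin_mods(2)[OF f] submod_image[OF f submod_carrier[OF lin_mods(1)[OF f]]]] by blast
  then show ?thesis using f inj by (auto simp: ses_def)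
qed

lemma ses_factor:
  assumes s: "ses R L M N f g" and h: "lin R M Z h"
    and ker: "\<And>x. x \<in> carrier L \<Longrightarrow> h (f x) = \<zero>\<^bsub>Z\<^esub>"
  shows "\<exists>h'. lin R N Z h' \<and> (\<forall>x\<in>carrier M. h' (g x) = h x)"
proof (rule lin_factor[OF sesD(2)[OF s] sesD(4)[OF s] h])
  fix x assume "x \<in> carrier M" "g x = \<zero>\<^bsub>N\<^esub>"
  then show "h x = \<zero>\<^bsub>Z\<^esub>" using sesD(5)[OF s] ker by auto
qed

section \<open>Simple modules over a self-injective ring with the descending chain condition\<close>

text \<open>
  The assumption \<open>ext\<close> is self-injectivity in the form of Baer's criterion, and the strictly monotone measure
  \<open>dd\<close> stands for finite length of the left regular module.  The aim of this part is that every simple left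
  module occurs as a left ideal: then maps into the regular module detect non-zero elements.  A simple module
  \<open>R/M\<close> is sent to a simple left ideal in the left annihilator of \<open>ann M\<close>, and this turns out to be injective on
  isomorphism classes of simple modules.  As there are finitely many classes, it is a permutation of them
  (up to inversion the Nakayama permutation), and every class is hit.
\<close>

locale artinian_self_injective = ring R for R (structure) +
  fixes dd :: "'a set \<Rightarrow> nat"
  assumes dd: "\<And>I J. submod R (regular_module R) I \<Longrightarrow> submod R (regular_module R) J \<Longrightarrow> I \<subset> J \<Longrightarrow> dd I < dd J"
    and ext: "\<And>I f. submod R (regular_module R) I \<Longrightarrow>
      lin R ((regular_module R)\<lparr>carrier := I\<rparr>) (regular_module R) f \<Longrightarrow>
      \<exists>c\<in>carrier R. \<forall>x\<in>I. f x = x \<otimes> c"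
begin

definition lideal :: "'a set \<Rightarrow> bool" where
  "lideal I \<longleftrightarrow> I \<subseteq> carrier R \<and> \<zero> \<in> I \<and> (\<forall>x\<in>I. \<forall>y\<in>I. x \<oplus> y \<in> I) \<and> (\<forall>a\<in>carrier R. \<forall>x\<in>I. a \<otimes> x \<in> I)"

lemma regular_left_module: "left_module R (regular_module R)"
  by (rule left_moduleI[OF ring_axioms])
    (auto simp: regular_module_def a_ac l_distr r_distr m_assoc intro: l_neg a_inv_closed)

lemma lideal_iff: "submod R (regular_module R) I \<longleftrightarrow> lideal I"
  by (simp add: lideal_def submod_def regular_module_def)

lemma lidealD:
  assumes "lideal I"
  shows "x \<in> I \<Longrightarrow> x \<in> carrier R" "\<zero> \<in> I" "x \<in> I \<Longrightarrow> y \<in> I \<Longrightarrow> x \<oplus> y \<in> I"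
    "a \<in> carrier R \<Longrightarrow> x \<in> I \<Longrightarrow> a \<otimes> x \<in> I" "x \<in> I \<Longrightarrow> \<ominus> x \<in> I" "x \<in> I \<Longrightarrow> y \<in> I \<Longrightarrow> x \<ominus> y \<in> I"
proof -
  show 1: "x \<in> I \<Longrightarrow> x \<in> carrier R" "\<zero> \<in> I" "x \<in> I \<Longrightarrow> y \<in> I \<Longrightarrow> x \<oplus> y \<in> I"
    "a \<in> carrier R \<Longrightarrow> x \<in> I \<Longrightarrow> a \<otimes> x \<in> I" for x y a
    using assms by (auto simp: lideal_def)
  show 2: "\<ominus> x \<in> I" if "x \<in> I" for x
    using 1(4)[of "\<ominus> \<one>" x] 1(1)[OF that] that by (simp add: l_minus)
  show "x \<in> I \<Longrightarrow> y \<in> I \<Longrightarrow> x \<ominus> y \<in> I"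
    using 1 2 by (simp add: minus_eq)
qed

lemma dd_less: "lideal I \<Longrightarrow> lideal J \<Longrightarrow> I \<subset> J \<Longrightarrow> dd I < dd J"
  using dd by (simp add: lideal_iff)

lemma dd_eq: "lideal I \<Longrightarrow> lideal J \<Longrightarrow> I \<subseteq> J \<Longrightarrow> dd J \<le> dd I \<Longrightarrow> I = J"
  using dd_less[of I J] by fastforce

lemma lideal_carrier: "lideal (carrier R)"
  by (simp add: lideal_def)

text \<open>Linear maps defined on the cyclic left ideal \<open>Ab\<close>, or a part of it, are right multiplications.\<close>

lemma ext_cyclic:
  assumes I: "lideal I" and b: "b \<in> carrier R" and y: "y \<in> carrier R"
    and wd: "\<And>a. a \<in> I \<Longrightarrow> a \<otimes> b = \<zero> \<Longrightarrow> a \<otimes> y = \<zero>"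
  shows "\<exists>z\<in>carrier R. \<forall>a\<in>I. a \<otimes> y = a \<otimes> b \<otimes> z"
proof -
  let ?J = "(\<lambda>a. a \<otimes> b) ` I"
  let ?M = "regular_module R"
  have lb: "lin R ?M ?M (\<lambda>a. a \<otimes> b)" and ly: "lin R ?M ?M (\<lambda>a. a \<otimes> y)"
    by (rule linI[OF regular_left_module regular_left_module];
      use b y in \<open>simp add: regular_module_def l_distr m_assoc\<close>)+
  have I': "submod R ?M I" using I by (simp add: lideal_iff)
  have J: "submod R ?M ?J" by (rule submod_image[OF lb I'])
  note MI = submod_module[OF regular_left_module I'] and MJ = submod_module[OF regular_left_module J]
  have b': "lin R (?M\<lparr>carrier := I\<rparr>) (?M\<lparr>carrier := ?J\<rparr>) (\<lambda>a. a \<otimes> b)"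
    by (rule linI[OF MI(1) MJ(1)])
      (use I b in \<open>auto simp: regular_module_def l_distr m_assoc lidealD(1)\<close>)
  have "\<exists>h. lin R (?M\<lparr>carrier := ?J\<rparr>) ?M h \<and>
      (\<forall>x\<in>carrier (?M\<lparr>carrier := I\<rparr>). h (x \<otimes> b) = x \<otimes> y)"
    by (rule lin_factor[OF b' _ lin_comp[OF MI(2) ly]])
      (use wd in \<open>auto simp: regular_module_def\<close>)
  then obtain h where h: "lin R (?M\<lparr>carrier := ?J\<rparr>) ?M h" "\<forall>x\<in>I. h (x \<otimes> b) = x \<otimes> y" by auto
  obtain z where "z \<in> carrier R" "\<forall>x\<in>?J. h x = x \<otimes> z" using ext[OF J h(1)] by blast
  then show ?thesis using h(2) by (intro bexI[of _ z]) auto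
qed

text \<open>
  Double annihilators: an element killed by everything that kills \<open>B\<close> lies in every right ideal \<open>J\<close> containing \<open>B\<close>.
  To split off \<open>b\<close>, observe that \<open>a b \<mapsto> a y\<close> is well defined for \<open>a\<close> killing the rest of \<open>B\<close>, hence is right
  multiplication by some \<open>z\<close>; then \<open>y - b z\<close> is killed by everything that kills the rest.
\<close>

lemma mem_right_ideal_of_annihilator:
  assumes "finite B" and J: "B \<subseteq> J" "J \<subseteq> carrier R" "\<zero> \<in> J"
      "\<And>x y. x \<in> J \<Longrightarrow> y \<in> J \<Longrightarrow> x \<oplus> y \<in> J" "\<And>x a. x \<in> J \<Longrightarrow> a \<in> carrier R \<Longrightarrow> x \<otimes> a \<in> J"
    and y: "y \<in> carrier R" "\<And>a. a \<in> carrier R \<Longrightarrow> (\<And>b. b \<in> B \<Longrightarrow> a \<otimes> b = \<zero>) \<Longrightarrow> a \<otimes> y = \<zero>"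
  shows "y \<in> J"
  using assms(1) J(1) y
proof (induction B arbitrary: y rule: finite_induct)
  case empty
  have "\<one> \<otimes> y = \<zero>" by (rule empty.prems(3)) auto
  then show ?case using J(3) empty.prems(2) by simp
next
  case (insert b B)
  define I where "I = {a \<in> carrier R. \<forall>c\<in>B. a \<otimes> c = \<zero>}"
  have B: "c \<in> B \<Longrightarrow> c \<in> carrier R" for c using insert.prems(1) J(2) by auto
  have b: "b \<in> J" "b \<in> carrier R" using insert.prems(1) J(2) by auto
  have I: "lideal I" unfolding lideal_def I_def by (auto simp: B l_distr m_assoc)
  have wd: "a \<otimes> y = \<zero>" if "a \<in> I" "a \<otimes> b = \<zero>" for a
    by (rule insert.prems(3)) (use that in \<open>auto simp: I_def\<close>)
  obtain z where z: "z \<in> carrier R" "\<And>a. a \<in> I \<Longrightarrow> a \<otimes> y = a \<otimes> b \<otimes> z"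
    using ext_cyclic[OF I b(2) insert.prems(2) wd] by metis
  have "y \<ominus> b \<otimes> z \<in> J"
  proof (rule insert.IH)
    fix a assume a: "a \<in> carrier R" "\<And>c. c \<in> B \<Longrightarrow> a \<otimes> c = \<zero>"
    then have "a \<otimes> y = a \<otimes> b \<otimes> z" using z(2) by (simp add: I_def)
    then show "a \<otimes> (y \<ominus> b \<otimes> z) = \<zero>"
      using a z(1) b insert.prems(2) by (simp add: minus_eq r_distr r_minus m_assoc r_neg)
  qed (use insert.prems(1,2) b z in auto)
  then have "(y \<ominus> b \<otimes> z) \<oplus> b \<otimes> z \<in> J" using J(4) J(5)[OF b(1) z(1)] by simp
  then show ?case using b z insert.prems(2) by (simp add: minus_eq a_assoc l_neg)
qed

text \<open>
  By finite length the left annihilator of \<open>J\<close> is already that of a finite subset.  If it vanished, the double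
  annihilator property would put \<open>\<one>\<close> into \<open>J\<close>.
\<close>

lemma left_annihilator_nonzero:
  assumes J: "J \<subseteq> carrier R" "\<zero> \<in> J"
      "\<And>x y. x \<in> J \<Longrightarrow> y \<in> J \<Longrightarrow> x \<oplus> y \<in> J" "\<And>x a. x \<in> J \<Longrightarrow> a \<in> carrier R \<Longrightarrow> x \<otimes> a \<in> J"
    and proper: "\<one> \<notin> J"
  shows "\<exists>x\<in>carrier R. x \<noteq> \<zero> \<and> (\<forall>b\<in>J. x \<otimes> b = \<zero>)"
proof (rule ccontr)
  assume none: "\<not> ?thesis"
  define l where "l B = {a \<in> carrier R. \<forall>c\<in>B. a \<otimes> c = \<zero>}" for B
  have ll: "lideal (l B)" if "B \<subseteq> J" for B
    using that J(1) unfolding lideal_def l_def by (auto simp: l_distr m_assoc subset_iff)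
  obtain B where B: "finite B" "B \<subseteq> J" and min: "\<And>C. finite C \<Longrightarrow> C \<subseteq> J \<Longrightarrow> dd (l B) \<le> dd (l C)"
    using ex_has_least_nat[of "\<lambda>B. finite B \<and> B \<subseteq> J" "{}" "\<lambda>B. dd (l B)"] by auto
  have "a = \<zero>" if a: "a \<in> l B" for a
  proof (rule ccontr)
    assume "a \<noteq> \<zero>"
    then obtain b where b: "b \<in> J" "a \<otimes> b \<noteq> \<zero>" using none a by (auto simp: l_def)
    have "l (insert b B) = l B"
      by (rule dd_eq) (use ll[of "insert b B"] ll[of B] min[of "insert b B"] b B in \<open>auto simp: l_def\<close>)
    then show False using a b by (auto simp: l_def)
  qed
  then have z: "a = \<zero>" if "a \<in> carrier R" "\<And>b. b \<in> B \<Longrightarrow> a \<otimes> b = \<zero>" for a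
    using that by (simp add: l_def)
  have "\<one> \<in> J"
    by (rule mem_right_ideal_of_annihilator[OF B J]) (use z in simp_all)
  then show False using proper by contradiction
qed

text \<open>Maximal left ideals, in elementwise form.\<close>

definition mlideal :: "'a set \<Rightarrow> bool" where
  "mlideal M \<longleftrightarrow> lideal M \<and> \<one> \<notin> M \<and>
     (\<forall>x\<in>carrier R - M. \<exists>a\<in>carrier R. \<one> \<ominus> a \<otimes> x \<in> M)"

lemma ex_mlideal:
  assumes I: "lideal I" "\<one> \<notin> I"
  shows "\<exists>M. mlideal M \<and> I \<subseteq> M"
proof -
  have "\<exists>M. (lideal M \<and> \<one> \<notin> M \<and> I \<subseteq> M) \<and> (\<forall>N. lideal N \<and> \<one> \<notin> N \<and> I \<subseteq> N \<longrightarrow> dd N \<le> dd M)"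
  proof (rule ex_has_greatest_nat[of _ I _ "dd (carrier R) + 1"])
    show "\<forall>N. lideal N \<and> \<one> \<notin> N \<and> I \<subseteq> N \<longrightarrow> dd N < dd (carrier R) + 1"
    proof (intro allI impI)
      fix N assume "lideal N \<and> \<one> \<notin> N \<and> I \<subseteq> N"
      then have "lideal N" "N \<subset> carrier R" by (auto dest: lidealD(1))
      then show "dd N < dd (carrier R) + 1" using dd_less[OF _ lideal_carrier, of N] by simp
    qed
  qed (use I in auto)
  then obtain M where M: "lideal M" "\<one> \<notin> M" "I \<subseteq> M"
    and max: "\<And>N. lideal N \<Longrightarrow> \<one> \<notin> N \<Longrightarrow> I \<subseteq> N \<Longrightarrow> dd N \<le> dd M" by blast
  have "\<exists>a\<in>carrier R. \<one> \<ominus> a \<otimes> x \<in> M" if x: "x \<in> carrier R" "x \<notin> M" for x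
  proof -
    define N where "N = {y \<in> carrier R. \<exists>a\<in>carrier R. y \<ominus> a \<otimes> x \<in> M}"
    have N: "lideal N" unfolding lideal_def
    proof (intro conjI ballI)
      show "\<zero> \<in> N" using lidealD(2)[OF M(1)] x by (auto simp: N_def minus_eq intro!: bexI[of _ \<zero>])
      show "y \<oplus> y' \<in> N" if yy: "y \<in> N" "y' \<in> N" for y y'
      proof -
        obtain a a' where a: "a \<in> carrier R" "a' \<in> carrier R" "y \<ominus> a \<otimes> x \<in> M" "y' \<ominus> a' \<otimes> x \<in> M"
          "y \<in> carrier R" "y' \<in> carrier R" using yy by (auto simp: N_def)
        have "(y \<ominus> a \<otimes> x) \<oplus> (y' \<ominus> a' \<otimes> x) = (y \<oplus> y') \<ominus> (a \<oplus> a') \<otimes> x"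
          using a x by (simp add: minus_eq l_distr minus_add a_ac)
        then show ?thesis using a lidealD(3)[OF M(1) a(3,4)] by (auto simp: N_def)
      qed
      show "r \<otimes> y \<in> N" if ry: "r \<in> carrier R" "y \<in> N" for r y
      proof -
        obtain a where a: "a \<in> carrier R" "y \<ominus> a \<otimes> x \<in> M" "y \<in> carrier R" using ry by (auto simp: N_def)
        have "r \<otimes> (y \<ominus> a \<otimes> x) = r \<otimes> y \<ominus> (r \<otimes> a) \<otimes> x"
          using a x ry by (simp add: minus_eq r_distr r_minus m_assoc)
        then have "r \<otimes> y \<ominus> (r \<otimes> a) \<otimes> x \<in> M" using lidealD(4)[OF M(1) ry(1) a(2)] by simp
        then show ?thesis using a(1,3) ry(1) unfolding N_def by blast
      qed
    qed (auto simp: N_def)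
    have MN: "M \<subseteq> N" using x lidealD(1)[OF M(1)] by (auto simp: N_def minus_eq intro!: bexI[of _ \<zero>])
    have "x \<in> N" using x lidealD(2)[OF M(1)] by (auto simp: N_def r_neg minus_eq intro!: bexI[of _ \<one>])
    then have "M \<subset> N" using MN x by auto
    then have "\<one> \<in> N" using max[OF N] M(3) dd_less[OF M(1) N] MN by fastforce
    then show ?thesis by (auto simp: N_def)
  qed
  then have "mlideal M" using M by (auto simp: mlideal_def)
  then show ?thesis using M by blast
qed

text \<open>
  Right multiplication by \<open>b\<close> is a non-zero map \<open>R/M \<rightarrow> R/N\<close>; for maximal \<open>M\<close> and \<open>N\<close> this says that the two
  simple modules are isomorphic.
\<close>

definition same_simple :: "'a set \<Rightarrow> 'a set \<Rightarrow> bool" where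
  "same_simple M N \<longleftrightarrow> (\<exists>b\<in>carrier R - N. \<forall>m\<in>M. m \<otimes> b \<in> N)"

lemma mlidealD:
  assumes "mlideal M"
  shows "lideal M" "\<one> \<notin> M" "x \<in> carrier R \<Longrightarrow> x \<notin> M \<Longrightarrow> \<exists>a\<in>carrier R. \<one> \<ominus> a \<otimes> x \<in> M"
  using assms by (auto simp: mlideal_def)

lemma same_simple_sym:
  assumes M: "mlideal M" and N: "mlideal N" and "same_simple M N"
  shows "same_simple N M"
proof -
  obtain b where b: "b \<in> carrier R" "b \<notin> N" "\<And>m. m \<in> M \<Longrightarrow> m \<otimes> b \<in> N"
    using assms(3) by (auto simp: same_simple_def)
  obtain c where c: "c \<in> carrier R" "\<one> \<ominus> c \<otimes> b \<in> N" using mlidealD(3)[OF N b(1,2)] by blast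
  note ld = lidealD[OF mlidealD(1)[OF N]] and ldM = lidealD[OF mlidealD(1)[OF M]]
  have "c \<notin> M"
  proof
    assume "c \<in> M"
    then have "(\<one> \<ominus> c \<otimes> b) \<oplus> c \<otimes> b \<in> N" using b(3) c ld(3) by blast
    then show False using b c mlidealD(2)[OF N] by (simp add: minus_eq a_assoc l_neg)
  qed
  moreover have "y \<otimes> c \<in> M" if y: "y \<in> N" for y
  proof (rule ccontr)
    assume n: "y \<otimes> c \<notin> M"
    note yc = ld(1)[OF y] c(1) b(1)
    have "y \<ominus> y \<otimes> (\<one> \<ominus> c \<otimes> b) = y \<otimes> c \<otimes> b"
      using yc by (simp add: minus_eq r_distr r_minus minus_add m_assoc r_neg1 r_neg2)
    then have ycb: "y \<otimes> c \<otimes> b \<in> N" using ld y c yc by metis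
    obtain a where a: "a \<in> carrier R" "\<one> \<ominus> a \<otimes> (y \<otimes> c) \<in> M"
      using mlidealD(3)[OF M _ n] yc by auto
    have "(\<one> \<ominus> a \<otimes> (y \<otimes> c)) \<otimes> b \<oplus> a \<otimes> (y \<otimes> c \<otimes> b) = b"
      using a yc by (simp add: minus_eq l_distr l_minus m_assoc a_assoc l_neg)
    then have "b \<in> N" using b(3)[OF a(2)] ld(3)[OF _ ld(4)[OF a(1) ycb]] by metis
    then show False using b by simp
  qed
  ultimately show ?thesis using c by (auto simp: same_simple_def)
qed

lemma same_simple_trans:
  assumes M: "mlideal M" and N: "mlideal N" and P: "mlideal P" and "same_simple M N" "same_simple N P"
  shows "same_simple M P"
proof -
  obtain b where b: "b \<in> carrier R" "b \<notin> N" "\<And>m. m \<in> M \<Longrightarrow> m \<otimes> b \<in> N"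
    using assms(4) by (auto simp: same_simple_def)
  obtain c where c: "c \<in> carrier R" "c \<notin> P" "\<And>m. m \<in> N \<Longrightarrow> m \<otimes> c \<in> P"
    using assms(5) by (auto simp: same_simple_def)
  obtain a where a: "a \<in> carrier R" "\<one> \<ominus> a \<otimes> b \<in> N" using mlidealD(3)[OF N b(1,2)] by blast
  note ld = lidealD[OF mlidealD(1)[OF P]]
  have "b \<otimes> c \<notin> P"
  proof
    assume n: "b \<otimes> c \<in> P"
    have "(\<one> \<ominus> a \<otimes> b) \<otimes> c \<oplus> a \<otimes> (b \<otimes> c) = c"
      using a b c by (simp add: minus_eq l_distr l_minus m_assoc a_assoc l_neg)
    then show False using ld(3)[OF c(3)[OF a(2)] ld(4)[OF a(1) n]] c by simp
  qed
  moreover have "m \<otimes> (b \<otimes> c) \<in> P" if "m \<in> M" for m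
    using c(3)[OF b(3)[OF that]] b c lidealD(1)[OF mlidealD(1)[OF M] that] by (simp add: m_assoc)
  ultimately show ?thesis using b c by (auto simp: same_simple_def)
qed

text \<open>
  The ideal \<open>N\<close> is the annihilator of the non-zero element \<open>t\<close> of the simple module \<open>R/M\<close>.
\<close>

lemma mlideal_colon:
  assumes M: "mlideal M" and t: "t \<in> carrier R" "t \<notin> M"
  defines "N \<equiv> {a \<in> carrier R. a \<otimes> t \<in> M}"
  shows "mlideal N" "same_simple N M"
proof -
  note ld = lidealD[OF mlidealD(1)[OF M]]
  have "lideal N" unfolding lideal_def N_def using t ld by (auto simp: l_distr m_assoc)
  moreover have "\<one> \<notin> N" using t by (simp add: N_def)
  moreover have "\<exists>a\<in>carrier R. \<one> \<ominus> a \<otimes> u \<in> N" if u: "u \<in> carrier R" "u \<notin> N" for u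
  proof -
    have "u \<otimes> t \<notin> M" using u by (simp add: N_def)
    then obtain a where a: "a \<in> carrier R" "\<one> \<ominus> a \<otimes> (u \<otimes> t) \<in> M" using mlidealD(3)[OF M] u t by blast
    have "t \<otimes> (\<one> \<ominus> a \<otimes> (u \<otimes> t)) = (\<one> \<ominus> (t \<otimes> a) \<otimes> u) \<otimes> t"
      using a u t by (simp add: minus_eq r_distr l_distr r_minus l_minus m_assoc)
    then have "(\<one> \<ominus> (t \<otimes> a) \<otimes> u) \<otimes> t \<in> M" using ld(4)[OF t(1) a(2)] by simp
    then show ?thesis using a u t by (intro bexI[of _ "t \<otimes> a"]) (auto simp: N_def)
  qed
  ultimately show "mlideal N" by (simp add: mlideal_def)
  show "same_simple N M" using t by (auto simp: same_simple_def N_def)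
qed

text \<open>
  The module \<open>R/\<Inter>F\<close> embeds into the direct sum of the \<open>R/M\<close>, so its simple quotient \<open>R/N\<close> is one of them.
  In the induction step an element \<open>d\<close> that lies in the other ideals and is \<open>\<one>\<close> modulo \<open>M\<close> provides the map.
\<close>

lemma same_simple_of_Inter_subset:
  assumes "finite F" and "\<And>M. M \<in> F \<Longrightarrow> mlideal M" and N: "mlideal N"
    and "carrier R \<inter> \<Inter>F \<subseteq> N"
  shows "\<exists>M\<in>F. same_simple M N"
  using assms(1,2,4)
proof (induction F rule: finite_induct)
  case empty
  then show ?case using mlidealD(2)[OF N] by auto
next
  case (insert M F)
  define K where "K = carrier R \<inter> \<Inter>F"
  have M: "mlideal M" and F: "\<And>P. P \<in> F \<Longrightarrow> lideal P" using insert.prems mlidealD(1) by auto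
  note ldM = lidealD[OF mlidealD(1)[OF M]] and ldN = lidealD[OF mlidealD(1)[OF N]]
  have K: "lideal K" unfolding lideal_def K_def using lidealD[OF F] by auto
  note ldK = lidealD[OF K]
  have KM: "K \<inter> M \<subseteq> N" using insert.prems(2) by (auto simp: K_def)
  show ?case
  proof (cases "K \<subseteq> N")
    case True
    then show ?thesis using insert by (auto simp: K_def)
  next
    case False
    then obtain w where w: "w \<in> K" "w \<notin> M" using KM by blast
    obtain a where a: "a \<in> carrier R" "\<one> \<ominus> a \<otimes> w \<in> M" using mlidealD(3)[OF M ldK(1)[OF w(1)] w(2)] by blast
    define d where "d = a \<otimes> w"
    have d: "d \<in> K" "\<one> \<ominus> d \<in> M" using a w ldK by (auto simp: d_def)
    note dR = ldK(1)[OF d(1)]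
    have md: "x \<otimes> (\<one> \<ominus> d) = x \<ominus> x \<otimes> d" if "x \<in> carrier R" for x
      using that dR by (simp add: minus_eq r_distr r_minus)
    have "m \<otimes> d \<in> N" if m: "m \<in> M" for m
    proof -
      have mR: "m \<in> carrier R" using ldM(1)[OF m] .
      have "m \<ominus> m \<otimes> (\<one> \<ominus> d) = m \<otimes> d" using mR dR by (simp add: md[OF mR]) (simp add: minus_eq minus_add r_neg2)
      then have "m \<otimes> d \<in> M" using ldM(6)[OF m ldM(4)[OF mR d(2)]] by simp
      then show ?thesis using KM ldK(4)[OF mR d(1)] by blast
    qed
    moreover have "d \<notin> N"
    proof
      assume dN: "d \<in> N"
      have "x \<in> N" if x: "x \<in> K" for x
      proof -
        have xR: "x \<in> carrier R" using ldK(1)[OF x] .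
        have "x \<ominus> x \<otimes> d \<in> M" using ldM(4)[OF xR d(2)] md[OF xR] by simp
        then have "x \<ominus> x \<otimes> d \<in> N" using KM ldK(6)[OF x ldK(4)[OF xR d(1)]] by blast
        then have "(x \<ominus> x \<otimes> d) \<oplus> x \<otimes> d \<in> N" using ldN(3) ldN(4)[OF xR dN] by blast
        then show ?thesis using xR dR by (simp add: minus_eq a_assoc l_neg)
      qed
      then show False using False by blast
    qed
    ultimately show ?thesis using dR by (auto simp: same_simple_def)
  qed
qed

text \<open>The annihilator of the simple module \<open>R/M\<close>, a two-sided ideal.\<close>

definition ann :: "'a set \<Rightarrow> 'a set" where
  "ann M = {a \<in> carrier R. \<forall>t\<in>carrier R. a \<otimes> t \<in> M}"

lemma ann_closed:
  assumes M: "mlideal M"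
  shows "lideal (ann M)" "a \<in> ann M \<Longrightarrow> b \<in> carrier R \<Longrightarrow> a \<otimes> b \<in> ann M" "\<one> \<notin> ann M" "ann M \<subseteq> M"
proof -
  note ld = lidealD[OF mlidealD(1)[OF M]]
  show "lideal (ann M)" unfolding lideal_def ann_def using ld by (auto simp: l_distr m_assoc)
  show "a \<in> ann M \<Longrightarrow> b \<in> carrier R \<Longrightarrow> a \<otimes> b \<in> ann M" by (auto simp: ann_def m_assoc)
  show "ann M \<subseteq> M"
  proof
    fix a assume "a \<in> ann M"
    then have "a \<in> carrier R" "a \<otimes> \<one> \<in> M" unfolding ann_def by blast+
    then show "a \<in> M" by simp
  qed
  then show "\<one> \<notin> ann M" using mlidealD(2)[OF M] by auto
qed

text \<open>
  By finite length \<open>ann M\<close> is the annihilator of finitely many elements of \<open>R/M\<close>, that is, an intersection of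
  finitely many maximal left ideals belonging to the same simple module.
\<close>

lemma same_simple_of_ann_subset:
  assumes M: "mlideal M" and N: "mlideal N" and sub: "ann M \<subseteq> N"
  shows "same_simple M N"
proof -
  note ld = lidealD[OF mlidealD(1)[OF M]]
  define c where "c T = {a \<in> carrier R. \<forall>t\<in>T. a \<otimes> t \<in> M}" for T
  have cl: "lideal (c T)" if "T \<subseteq> carrier R" for T
    using that ld unfolding lideal_def c_def by (auto simp: l_distr m_assoc subset_iff)
  obtain T where T: "finite T" "T \<subseteq> carrier R"
    and min: "\<And>C. finite C \<Longrightarrow> C \<subseteq> carrier R \<Longrightarrow> dd (c T) \<le> dd (c C)"
    using ex_has_least_nat[of "\<lambda>B. finite B \<and> B \<subseteq> carrier R" "{}" "\<lambda>B. dd (c B)"] by auto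
  have "c T \<subseteq> ann M"
  proof
    fix a assume a: "a \<in> c T"
    have "a \<otimes> t \<in> M" if t: "t \<in> carrier R" for t
    proof -
      have "c (insert t T) = c T"
        by (rule dd_eq) (use cl[of "insert t T"] cl[of T] min[of "insert t T"] t T in \<open>auto simp: c_def\<close>)
      then show ?thesis using a by (auto simp: c_def)
    qed
    then show "a \<in> ann M" using a by (auto simp: ann_def c_def)
  qed
  moreover define F where "F = (\<lambda>t. {a \<in> carrier R. a \<otimes> t \<in> M}) ` (T - M)"
  moreover have "carrier R \<inter> \<Inter>F \<subseteq> c T"
    using ld(4) by (auto simp: F_def c_def)
  ultimately have "carrier R \<inter> \<Inter>F \<subseteq> N" using sub by blast
  moreover have "mlideal P" "same_simple P M" if "P \<in> F" for P
    using that mlideal_colon[OF M] T by (auto simp: F_def)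
  moreover have "finite F" using T by (simp add: F_def)
  ultimately obtain P where "P \<in> F" "same_simple P N" "mlideal P" "same_simple P M"
    using same_simple_of_Inter_subset[of F N] N by blast
  then show ?thesis using same_simple_trans[OF M _ N same_simple_sym[OF _ M]] by blast
qed

text \<open>
  A minimal non-zero left ideal is \<open>R x \<cong> R/{a. a x = 0}\<close>, and it is simple.
\<close>

lemma ex_minimal_generator:
  assumes I: "lideal I" and nz: "z \<in> I" "z \<noteq> \<zero>"
  shows "\<exists>x\<in>I. x \<noteq> \<zero> \<and> mlideal {a \<in> carrier R. a \<otimes> x = \<zero>}"
proof -
  obtain U where U: "lideal U" "U \<subseteq> I" "\<exists>x\<in>U. x \<noteq> \<zero>"
    and min: "\<And>V. lideal V \<Longrightarrow> V \<subseteq> I \<Longrightarrow> \<exists>x\<in>V. x \<noteq> \<zero> \<Longrightarrow> dd U \<le> dd V"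
    using ex_has_least_nat[of "\<lambda>U. lideal U \<and> U \<subseteq> I \<and> (\<exists>x\<in>U. x \<noteq> \<zero>)" I dd] I nz by blast
  obtain x where x: "x \<in> U" "x \<noteq> \<zero>" using U by blast
  have xR: "x \<in> carrier R" using lidealD(1)[OF U(1) x(1)] .
  let ?M = "{a \<in> carrier R. a \<otimes> x = \<zero>}"
  have "lideal ?M" unfolding lideal_def using xR by (auto simp: l_distr m_assoc)
  moreover have "\<one> \<notin> ?M" using x xR by simp
  moreover have "\<exists>a\<in>carrier R. \<one> \<ominus> a \<otimes> y \<in> ?M" if y: "y \<in> carrier R" "y \<notin> ?M" for y
  proof -
    let ?V = "(\<lambda>a. a \<otimes> (y \<otimes> x)) ` carrier R"
    have yx: "y \<otimes> x \<noteq> \<zero>" "y \<otimes> x \<in> U" "y \<otimes> x \<in> carrier R" using y xR lidealD(4)[OF U(1) _ x(1)] by auto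
    have V: "lideal ?V" unfolding lideal_def
    proof (intro conjI ballI)
      show "?V \<subseteq> carrier R" using yx by auto
      show "\<zero> \<in> ?V" using yx by (intro image_eqI[of _ _ \<zero>]) auto
      show "u \<oplus> v \<in> ?V" if "u \<in> ?V" "v \<in> ?V" for u v
        using that yx(3) by (auto simp: l_distr[symmetric])
      show "a \<otimes> u \<in> ?V" if "a \<in> carrier R" "u \<in> ?V" for a u
        using that yx(3) by (auto simp: m_assoc[symmetric])
    qed
    have VU: "?V \<subseteq> U" using lidealD(4)[OF U(1) _ yx(2)] by auto
    have yxV: "y \<otimes> x \<in> ?V" using yx(3) by (intro image_eqI[of _ _ \<one>]) auto
    have "dd U \<le> dd ?V" using min[OF V] VU U(2) yxV yx(1) by blast
    then have "?V = U" using dd_eq[OF V U(1) VU] by simp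
    then obtain a where a: "a \<in> carrier R" "x = a \<otimes> (y \<otimes> x)" using x by auto
    then have "(\<one> \<ominus> a \<otimes> y) \<otimes> x = \<zero>"
      using y xR by (simp add: minus_eq l_distr l_minus m_assoc r_neg)
    then show ?thesis using a y by auto
  qed
  ultimately have "mlideal ?M" by (simp add: mlideal_def)
  then show ?thesis using x U by blast
qed

text \<open>
  The map on simple modules: \<open>R/M\<close> goes to a simple left ideal \<open>R x\<close> with \<open>x ann M = 0\<close>.
\<close>

lemma ex_next:
  assumes M: "mlideal M"
  shows "\<exists>x\<in>carrier R. x \<noteq> \<zero> \<and> (\<forall>b\<in>ann M. x \<otimes> b = \<zero>) \<and> mlideal {a \<in> carrier R. a \<otimes> x = \<zero>}"
proof -
  define I where "I = {x \<in> carrier R. \<forall>b\<in>ann M. x \<otimes> b = \<zero>}"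
  have sub: "b \<in> ann M \<Longrightarrow> b \<in> carrier R" for b by (simp add: ann_def)
  have "lideal I" unfolding lideal_def I_def by (auto simp: sub l_distr m_assoc)
  moreover have "\<exists>z\<in>carrier R. z \<noteq> \<zero> \<and> (\<forall>b\<in>ann M. z \<otimes> b = \<zero>)"
    by (rule left_annihilator_nonzero)
      (use sub ann_closed[OF M] lidealD(2,3)[OF ann_closed(1)[OF M]] in simp_all, blast)
  then obtain z where "z \<in> I" "z \<noteq> \<zero>" by (auto simp: I_def)
  ultimately obtain x where "x \<in> I" "x \<noteq> \<zero>" "mlideal {a \<in> carrier R. a \<otimes> x = \<zero>}"
    using ex_minimal_generator by blast
  then show ?thesis by (auto simp: I_def)
qed

text \<open>
  An isomorphism \<open>R x \<cong> R y\<close> extends to a right multiplication, so \<open>b y = x z \<noteq> 0\<close> for suitable \<open>b\<close> and \<open>z\<close>.  This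
  element is killed from the right by \<open>ann M'\<close>, and by \<open>ann M\<close> because that ideal is two-sided.  So \<open>ann M + ann M'\<close>
  is proper, and the simple module over a maximal left ideal containing it is both \<open>R/M\<close> and \<open>R/M'\<close>.
\<close>

lemma next_inj:
  assumes M: "mlideal M" and M': "mlideal M'"
    and x: "x \<in> carrier R" "\<And>b. b \<in> ann M \<Longrightarrow> x \<otimes> b = \<zero>" "mlideal {a \<in> carrier R. a \<otimes> x = \<zero>}"
    and y: "y \<in> carrier R" "\<And>b. b \<in> ann M' \<Longrightarrow> y \<otimes> b = \<zero>"
    and same_simple: "same_simple {a \<in> carrier R. a \<otimes> x = \<zero>} {a \<in> carrier R. a \<otimes> y = \<zero>}"
  shows "same_simple M M'"
proof -
  obtain b where b: "b \<in> carrier R" "b \<otimes> y \<noteq> \<zero>" "\<And>a. a \<in> carrier R \<Longrightarrow> a \<otimes> x = \<zero> \<Longrightarrow> a \<otimes> b \<otimes> y = \<zero>"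
    using same_simple by (auto simp: same_simple_def)
  have "\<exists>z\<in>carrier R. \<forall>a\<in>carrier R. a \<otimes> (b \<otimes> y) = a \<otimes> x \<otimes> z"
    by (rule ext_cyclic[OF lideal_carrier]) (use b x y in \<open>auto simp: m_assoc\<close>)
  then obtain z where z: "z \<in> carrier R" "b \<otimes> y = x \<otimes> z"
    using b x y by (metis l_one one_closed m_closed)
  define N where "N = {n \<oplus> n' |n n'. n \<in> ann M \<and> n' \<in> ann M'}"
  note l1 = lidealD[OF ann_closed(1)[OF M]] and l2 = lidealD[OF ann_closed(1)[OF M']]
  have N: "lideal N" unfolding lideal_def
  proof (intro conjI ballI)
    show "N \<subseteq> carrier R" using l1(1) l2(1) by (auto simp: N_def)
    show "\<zero> \<in> N" using l1(2) l2(2) by (force simp: N_def)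
    show "u \<oplus> v \<in> N" if uv: "u \<in> N" "v \<in> N" for u v
    proof -
      obtain n n' m m' where *: "u = n \<oplus> n'" "v = m \<oplus> m'" "n \<in> ann M" "m \<in> ann M" "n' \<in> ann M'" "m' \<in> ann M'"
        using uv by (auto simp: N_def)
      then have "u \<oplus> v = (n \<oplus> m) \<oplus> (n' \<oplus> m')" using l1(1) l2(1) by (simp add: a_ac)
      then show ?thesis using l1(3)[OF *(3,4)] l2(3)[OF *(5,6)] unfolding N_def by blast
    qed
    show "a \<otimes> u \<in> N" if au: "a \<in> carrier R" "u \<in> N" for a u
    proof -
      obtain n n' where *: "u = n \<oplus> n'" "n \<in> ann M" "n' \<in> ann M'" using au by (auto simp: N_def)
      then have "a \<otimes> u = (a \<otimes> n) \<oplus> (a \<otimes> n')" using au l1(1) l2(1) by (simp add: r_distr)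
      then show ?thesis using l1(4)[OF au(1) *(2)] l2(4)[OF au(1) *(3)] unfolding N_def by blast
    qed
  qed
  have "\<one> \<notin> N"
  proof
    assume "\<one> \<in> N"
    then obtain n n' where n: "\<one> = n \<oplus> n'" "n \<in> ann M" "n' \<in> ann M'" by (auto simp: N_def)
    have nR: "n \<in> carrier R" "n' \<in> carrier R" using n l1(1) l2(1) by auto
    have "b \<otimes> y = (b \<otimes> y) \<otimes> (n \<oplus> n')" using b(1) y(1) by (simp flip: n(1))
    also have "\<dots> = (x \<otimes> z) \<otimes> n \<oplus> (b \<otimes> y) \<otimes> n'" using nR b y z x by (simp add: r_distr)
    also have "\<dots> = x \<otimes> (z \<otimes> n) \<oplus> b \<otimes> (y \<otimes> n')" using nR b(1) y(1) z(1) x(1) by (simp add: m_assoc)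
    also have "\<dots> = \<zero>" using x(2)[OF l1(4)[OF z(1) n(2)]] y(2)[OF n(3)] b by simp
    finally show False using b(2) by contradiction
  qed
  then obtain P where P: "mlideal P" "N \<subseteq> P" using ex_mlideal[OF N] by blast
  have "ann M \<subseteq> P"
  proof
    fix n assume n: "n \<in> ann M"
    then have "n \<oplus> \<zero> \<in> N" using l2(2) unfolding N_def by blast
    then show "n \<in> P" using n l1(1) P by auto
  qed
  moreover have "ann M' \<subseteq> P"
  proof
    fix n assume n: "n \<in> ann M'"
    then have "\<zero> \<oplus> n \<in> N" using l1(2) unfolding N_def by blast
    then show "n \<in> P" using n l2(1) P by auto
  qed
  ultimately have "same_simple M P" "same_simple M' P" using same_simple_of_ann_subset M M' P by auto
  then show ?thesis using same_simple_trans[OF M P(1) M'] same_simple_sym[OF M' P(1)] by blast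
qed

text \<open>
  Iterating the map on simple modules, some class repeats, since otherwise the intersections of the
  maximal left ideals would descend for ever.  Injectivity moves the repetition back to the start, so \<open>R/M\<close>
  itself is isomorphic to a left ideal.
\<close>

theorem right_annihilator_nonzero:
  assumes "lideal I" "\<one> \<notin> I"
  shows "\<exists>x\<in>carrier R. x \<noteq> \<zero> \<and> (\<forall>a\<in>I. a \<otimes> x = \<zero>)"
proof -
  obtain M where M: "mlideal M" "I \<subseteq> M" using ex_mlideal assms by blast
  define gen where "gen N = (SOME x. x \<in> carrier R \<and> x \<noteq> \<zero> \<and> (\<forall>b\<in>ann N. x \<otimes> b = \<zero>) \<and>
      mlideal {a \<in> carrier R. a \<otimes> x = \<zero>})" for N
  have gen: "gen N \<in> carrier R" "gen N \<noteq> \<zero>" "\<And>b. b \<in> ann N \<Longrightarrow> gen N \<otimes> b = \<zero>"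
      "mlideal {a \<in> carrier R. a \<otimes> gen N = \<zero>}" if "mlideal N" for N
    using someI_ex[OF ex_next[OF that, unfolded bex_simps Bex_def]] unfolding gen_def by blast+
  define Ms where "Ms n = ((\<lambda>N. {a \<in> carrier R. a \<otimes> gen N = \<zero>}) ^^ n) M" for n
  have Ms0: "Ms 0 = M" and MsS: "Ms (Suc n) = {a \<in> carrier R. a \<otimes> gen (Ms n) = \<zero>}" for n
    by (simp_all add: Ms_def)
  have ml: "mlideal (Ms n)" for n
    by (induction n) (simp_all add: Ms0 MsS M gen)
  \<comment> \<open>Injectivity, applied \<open>i\<close> times.\<close>
  have down: "same_simple (Ms 0) (Ms d)" if "same_simple (Ms i) (Ms (i + d))" for i d
    using that
  proof (induction i)
    case (Suc i)
    have "same_simple (Ms i) (Ms (i + d))"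
      using next_inj[OF ml ml gen(1)[OF ml] gen(3)[OF ml] gen(4)[OF ml] gen(1)[OF ml] gen(3)[OF ml]] Suc.prems
      by (simp add: MsS)
    then show ?case by (rule Suc.IH)
  qed simp
  have "\<exists>i j. i < j \<and> same_simple (Ms i) (Ms j)"
  proof (rule ccontr)
    assume none: "\<not> ?thesis"
    define K where "K n = carrier R \<inter> \<Inter>(Ms ` {..<n})" for n
    have K: "lideal (K n)" for n
      using lidealD[OF mlidealD(1)[OF ml]] unfolding K_def lideal_def by auto
    have "dd (K (Suc n)) < dd (K n)" for n
    proof (rule dd_less[OF K K])
      have "\<not> K n \<subseteq> Ms n"
        using same_simple_of_Inter_subset[of "Ms ` {..<n}" "Ms n"] ml none by (auto simp: K_def)
      then show "K (Suc n) \<subset> K n" by (auto simp: K_def lessThan_Suc)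
    qed
    then show False using wf_iff_no_infinite_down_chain[of "measure dd"] wf_measure by (metis in_measure)
  qed
  then obtain i j where "i < j" "same_simple (Ms i) (Ms j)" by blast
  then have "same_simple (Ms 0) (Ms (Suc (j - i - 1)))" using down[of i "j - i"] by (simp add: Suc_diff_Suc)
  then obtain b where b: "b \<in> carrier R" "b \<otimes> gen (Ms (j - i - 1)) \<noteq> \<zero>"
     "\<And>m. m \<in> M \<Longrightarrow> m \<otimes> b \<otimes> gen (Ms (j - i - 1)) = \<zero>"
    by (auto simp: same_simple_def Ms0 MsS)
  then show ?thesis
    using M lidealD(1)[OF mlidealD(1)[OF M(1)]] gen(1)[OF ml]
    by (intro bexI[of _ "b \<otimes> gen (Ms (j - i - 1))"]) (auto simp: m_assoc subset_iff)
qed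

end

section \<open>Finite length\<close>

definition subsp :: "'r set \<Rightarrow> ('r, 'm) module \<Rightarrow> 'm set \<Rightarrow> bool" where
  "subsp K M U \<longleftrightarrow> U \<subseteq> carrier M \<and> \<zero>\<^bsub>M\<^esub> \<in> U \<and>
     (\<forall>x\<in>U. \<forall>y\<in>U. x \<ominus>\<^bsub>M\<^esub> y \<in> U) \<and> (\<forall>c\<in>K. \<forall>x\<in>U. c \<odot>\<^bsub>M\<^esub> x \<in> U)"

text \<open>
  With the base field as \<open>K\<close> this is finite dimension.  A strictly monotone measure on subspaces gives both
  chain conditions, and unlike a basis it passes directly to submodules, quotients and extensions.
\<close>

definition finlen :: "'r set \<Rightarrow> ('r, 'm) module \<Rightarrow> bool" where
  "finlen K M \<longleftrightarrow> (\<exists>d :: 'm set \<Rightarrow> nat. \<forall>U V. subsp K M U \<longrightarrow> subsp K M V \<longrightarrow> U \<subset> V \<longrightarrow> d U < d V)"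

lemma subsp_add:
  assumes M: "left_module R M" and U: "subsp K M U" and x: "x \<in> U" and y: "y \<in> U"
  shows "x \<oplus>\<^bsub>M\<^esub> y \<in> U"
proof -
  have xy: "x \<in> carrier M" "y \<in> carrier M" and z: "\<zero>\<^bsub>M\<^esub> \<in> U"
    and cl: "\<And>u v. u \<in> U \<Longrightarrow> v \<in> U \<Longrightarrow> u \<ominus>\<^bsub>M\<^esub> v \<in> U"
    using U x y by (auto simp: subsp_def)
  have "x \<ominus>\<^bsub>M\<^esub> (\<zero>\<^bsub>M\<^esub> \<ominus>\<^bsub>M\<^esub> y) = x \<oplus>\<^bsub>M\<^esub> y"
    using xy by (simp add: lm_add[OF M]) (simp add: a_minus_def lm_add[OF M])
  then show ?thesis using cl[OF x cl[OF z y]] by simp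
qed

lemma submod_subsp:
  assumes K: "K \<subseteq> carrier R" and M: "left_module R M" and U: "submod R M U"
  shows "subsp K M U"
  using U K submod_neg(2)[OF M U] unfolding subsp_def submod_def by blast

lemma subsp_vimage:
  assumes K: "K \<subseteq> carrier R" and f: "lin R L M f" and U: "subsp K M U"
  shows "subsp K L {x \<in> carrier L. f x \<in> U}"
  using U K by (auto simp: subsp_def lin_simps[OF f] lm_closed[OF lin_mods(1)[OF f]] subset_iff)

lemma subsp_image:
  assumes K: "K \<subseteq> carrier R" and f: "lin R L M f" and U: "subsp K L U"
  shows "subsp K M (f ` U)"
proof -
  have sub: "x \<in> U \<Longrightarrow> x \<in> carrier L" for x using U by (auto simp: subsp_def)
  show ?thesis unfolding subsp_def
  proof (intro conjI ballI subsetI)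
    show "x \<in> f ` U \<Longrightarrow> x \<in> carrier M" for x using sub lin_simps(1)[OF f] by auto
    show "\<zero>\<^bsub>M\<^esub> \<in> f ` U" using U lin_simps(4)[OF f] by (metis subsp_def image_eqI)
    show "x \<ominus>\<^bsub>M\<^esub> y \<in> f ` U" if xy: "x \<in> f ` U" "y \<in> f ` U" for x y
    proof -
      obtain a b where ab: "x = f a" "y = f b" "a \<in> U" "b \<in> U" using xy by blast
      then have "x \<ominus>\<^bsub>M\<^esub> y = f (a \<ominus>\<^bsub>L\<^esub> b)" using sub by (simp add: lin_simps[OF f])
      then show ?thesis using U ab by (auto simp: subsp_def)
    qed
    show "a \<odot>\<^bsub>M\<^esub> x \<in> f ` U" if ax: "a \<in> K" "x \<in> f ` U" for a x
    proof -
      obtain b where b: "x = f b" "b \<in> U" using ax by blast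
      then have "a \<odot>\<^bsub>M\<^esub> x = f (a \<odot>\<^bsub>L\<^esub> b)" using sub ax K by (auto simp: lin_simps[OF f])
      then show ?thesis using U b ax by (auto simp: subsp_def)
    qed
  qed
qed

lemma subsp_mono: "subsp K M U \<Longrightarrow> subsp K M V \<Longrightarrow> U \<subset> V \<Longrightarrow>
    \<forall>U V. subsp K M U \<longrightarrow> subsp K M V \<longrightarrow> U \<subset> V \<longrightarrow> d U < d V \<Longrightarrow> (d U :: nat) < d V"
  by blast

lemma finlen_image:
  assumes K: "K \<subseteq> carrier R" and f: "lin R L M f" and surj: "f ` carrier L = carrier M" and L: "finlen K L"
  shows "finlen K M"
proof -
  obtain d :: "_ set \<Rightarrow> nat" where d: "\<forall>U V. subsp K L U \<longrightarrow> subsp K L V \<longrightarrow> U \<subset> V \<longrightarrow> d U < d V"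
    using L by (auto simp: finlen_def)
  show ?thesis unfolding finlen_def
  proof (intro exI[of _ "\<lambda>U. d {x \<in> carrier L. f x \<in> U}"] allI impI)
    fix U V assume UV: "subsp K M U" "subsp K M V" "U \<subset> V"
    obtain v where v: "v \<in> V" "v \<notin> U" using UV by auto
    have "v \<in> f ` carrier L" using v UV(2) surj by (auto simp: subsp_def)
    then obtain x where "x \<in> carrier L" "f x = v" by (metis imageE)
    then have "{x \<in> carrier L. f x \<in> U} \<subset> {x \<in> carrier L. f x \<in> V}" using UV(3) v by blast
    then show "d {x \<in> carrier L. f x \<in> U} < d {x \<in> carrier L. f x \<in> V}"
      using subsp_mono[OF subsp_vimage[OF K f UV(1)] subsp_vimage[OF K f UV(2)] _ d] by blast
  qed
qed

lemma finlen_inj: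
  assumes K: "K \<subseteq> carrier R" and f: "lin R L M f" and inj: "inj_on f (carrier L)" and M: "finlen K M"
  shows "finlen K L"
proof -
  obtain d :: "_ set \<Rightarrow> nat" where d: "\<forall>U V. subsp K M U \<longrightarrow> subsp K M V \<longrightarrow> U \<subset> V \<longrightarrow> d U < d V"
    using M by (auto simp: finlen_def)
  show ?thesis unfolding finlen_def
  proof (intro exI[of _ "\<lambda>U. d (f ` U)"] allI impI)
    fix U V assume UV: "subsp K L U" "subsp K L V" "U \<subset> V"
    have "U \<subseteq> carrier L" "V \<subseteq> carrier L" using UV by (auto simp: subsp_def)
    then have "f ` U \<subset> f ` V" using UV(3) inj by (metis inj_on_image_eq_iff image_mono psubset_eq)
    then show "d (f ` U) < d (f ` V)"
      using subsp_mono[OF subsp_image[OF K f UV(1)] subsp_image[OF K f UV(2)] _ d] by blast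
  qed
qed

text \<open>
  Measure a subspace by its intersection with the submodule and its image in the quotient; the modular
  law makes the sum strictly monotone.
\<close>

lemma finlen_ses:
  assumes K: "K \<subseteq> carrier R" and s: "ses R L M N f g" and L: "finlen K L" and N: "finlen K N"
  shows "finlen K M"
proof -
  note f = sesD(1)[OF s] and g = sesD(2)[OF s] and M = sesD(8)[OF s]
  obtain d1 :: "_ set \<Rightarrow> nat" where d1: "\<forall>U V. subsp K L U \<longrightarrow> subsp K L V \<longrightarrow> U \<subset> V \<longrightarrow> d1 U < d1 V"
    using L by (auto simp: finlen_def)
  obtain d2 :: "_ set \<Rightarrow> nat" where d2: "\<forall>U V. subsp K N U \<longrightarrow> subsp K N V \<longrightarrow> U \<subset> V \<longrightarrow> d2 U < d2 V"
    using N by (auto simp: finlen_def)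
  show ?thesis unfolding finlen_def
  proof (intro exI[of _ "\<lambda>U. d1 {x \<in> carrier L. f x \<in> U} + d2 (g ` U)"] allI impI)
    fix U V assume UV: "subsp K M U" "subsp K M V" "U \<subset> V"
    define U1 V1 where "U1 = {x \<in> carrier L. f x \<in> U}" and "V1 = {x \<in> carrier L. f x \<in> V}"
    have s1: "subsp K L U1" "subsp K L V1" "subsp K N (g ` U)" "subsp K N (g ` V)"
      using subsp_vimage[OF K f] subsp_image[OF K g] UV by (auto simp: U1_def V1_def)
    have sub: "U1 \<subseteq> V1" "g ` U \<subseteq> g ` V" using UV(3) by (auto simp: U1_def V1_def)
    have carU: "u \<in> U \<Longrightarrow> u \<in> carrier M" and carV: "u \<in> V \<Longrightarrow> u \<in> carrier M" for u
      using UV by (auto simp: subsp_def)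
    have "\<not> (U1 = V1 \<and> g ` U = g ` V)"
    proof
      assume eq: "U1 = V1 \<and> g ` U = g ` V"
      have "v \<in> U" if v: "v \<in> V" for v
      proof -
        have "g v \<in> g ` U" using eq v by blast
        then obtain u where u: "u \<in> U" "g u = g v" by (metis imageE)
        have vu: "v \<ominus>\<^bsub>M\<^esub> u \<in> V" using UV u v by (auto simp: subsp_def)
        have "g (v \<ominus>\<^bsub>M\<^esub> u) = \<zero>\<^bsub>N\<^esub>"
          using carU[OF u(1)] carV[OF v] u(2) by (simp add: lin_simps[OF g] lm_add[OF sesD(9)[OF s]])
        then obtain l where l: "l \<in> carrier L" "f l = v \<ominus>\<^bsub>M\<^esub> u"
          using sesD(5)[OF s carV[OF vu]] by (metis imageE)
        then have "l \<in> U1" using eq vu by (auto simp: V1_def)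
        then have "v \<ominus>\<^bsub>M\<^esub> u \<in> U" using l by (simp add: U1_def)
        then have "(v \<ominus>\<^bsub>M\<^esub> u) \<oplus>\<^bsub>M\<^esub> u \<in> U" using subsp_add[OF M UV(1)] u by blast
        then show "v \<in> U" using lm_cancel(2)[OF M carV[OF v] carU[OF u(1)]] by simp
      qed
      then show False using UV(3) by blast
    qed
    then have "U1 \<subset> V1 \<or> g ` U \<subset> g ` V" "U1 \<subset> V1 \<or> U1 = V1" "g ` U \<subset> g ` V \<or> g ` U = g ` V"
      using sub by blast+
    then show "d1 {x \<in> carrier L. f x \<in> U} + d2 (g ` U) < d1 {x \<in> carrier L. f x \<in> V} + d2 (g ` V)"
      using subsp_mono[OF s1(1,2) _ d1] subsp_mono[OF s1(3,4) _ d2]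
      unfolding U1_def[symmetric] V1_def[symmetric] by (metis add_less_mono add_less_mono1 add_strict_left_mono)
  qed
qed

lemma subsp_carrier:
  assumes "K \<subseteq> carrier R" "left_module R M" shows "subsp K M (carrier M)"
  by (rule submod_subsp[OF assms submod_carrier[OF assms(2)]])

lemma finlen_maximal:
  assumes K: "K \<subseteq> carrier R" and M: "left_module R M" and fl: "finlen K M"
    and P: "P x0" and sub: "\<And>x. P x \<Longrightarrow> subsp K M (u x)"
  shows "\<exists>x. P x \<and> (\<forall>y. P y \<longrightarrow> u x \<subseteq> u y \<longrightarrow> u y = u x)"
proof -
  obtain d :: "_ set \<Rightarrow> nat" where d: "\<forall>U V. subsp K M U \<longrightarrow> subsp K M V \<longrightarrow> U \<subset> V \<longrightarrow> d U < d V"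
    using fl by (auto simp: finlen_def)
  have bound: "\<forall>x. P x \<longrightarrow> d (u x) < Suc (d (carrier M))"
  proof (intro allI impI)
    fix x assume "P x"
    note s = sub[OF this]
    show "d (u x) < Suc (d (carrier M))"
    proof (cases "u x = carrier M")
      case False
      then have "u x \<subset> carrier M" using s by (auto simp: subsp_def)
      then show ?thesis using subsp_mono[OF s subsp_carrier[OF K M] _ d] by simp
    qed simp
  qed
  obtain x where x: "P x" "\<forall>y. P y \<longrightarrow> d (u y) \<le> d (u x)"
    using ex_has_greatest_nat[OF P bound] by blast
  then show ?thesis using subsp_mono[OF sub sub _ d] by (metis leD psubset_eq)
qed

lemma finlen_minimal:
  assumes fl: "finlen K M"
    and P: "P x0" and sub: "\<And>x. P x \<Longrightarrow> subsp K M (u x)"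
  shows "\<exists>x. P x \<and> (\<forall>y. P y \<longrightarrow> u y \<subseteq> u x \<longrightarrow> u y = u x)"
proof -
  obtain d :: "_ set \<Rightarrow> nat" where d: "\<forall>U V. subsp K M U \<longrightarrow> subsp K M V \<longrightarrow> U \<subset> V \<longrightarrow> d U < d V"
    using fl by (auto simp: finlen_def)
  obtain x where x: "P x" "\<forall>y. P y \<longrightarrow> d (u x) \<le> d (u y)"
    using ex_has_least_nat[of P, OF P, of "\<lambda>x. d (u x)"] by blast
  then show ?thesis using subsp_mono[OF sub sub _ d] by (metis leD psubset_eq)
qed

section \<open>Extensional homomorphisms, projective and injective modules\<close>

lemma lin_of_mod_hom: "left_module R L \<Longrightarrow> left_module R M \<Longrightarrow> f \<in> mod_hom R L M \<Longrightarrow> lin R L M f"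
  by (auto simp: mod_hom_def lin_def)

lemma mod_hom_of_lin: "lin R L M f \<Longrightarrow> restrict f (carrier L) \<in> mod_hom R L M"
  using lm_closed(1,5)[OF lin_mods(1)[of R L M f]] by (auto simp: mod_hom_def lin_def)

lemma mod_hom_restrict: "f \<in> mod_hom R L M \<Longrightarrow> restrict f (carrier L) = f"
  by (auto simp: mod_hom_def PiE_def extensional_restrict)

lemma projective_iff:
  fixes P :: "('r, 'm) module"
  shows "projective R P \<longleftrightarrow> left_module R P \<and>
    (\<forall>(L :: ('r, 'm) module) (M :: ('r, 'm) module) p f.
       lin R L M p \<and> p ` carrier L = carrier M \<and> lin R P M f \<longrightarrow>
       (\<exists>g. lin R P L g \<and> (\<forall>x\<in>carrier P. p (g x) = f x)))" (is "_ \<longleftrightarrow> ?rhs")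
proof
  assume P: "projective R P"
  then have mP: "left_module R P" by (simp add: projective_def)
  show ?rhs
  proof (intro conjI allI impI mP)
    fix L M :: "('r, 'm) module" and p f
    assume a: "lin R L M p \<and> p ` carrier L = carrier M \<and> lin R P M f"
    note mods = lin_mods[OF conjunct1[OF a]]
    have "\<exists>g\<in>mod_hom R P L. compose (carrier P) (restrict p (carrier L)) g = restrict f (carrier P)"
      using P[unfolded projective_def, THEN conjunct2, rule_format, of L M "restrict p (carrier L)" "restrict f (carrier P)"]
        a mods mod_hom_of_lin[of R L M p] mod_hom_of_lin[of R P M f] by simp
    then obtain g where g: "g \<in> mod_hom R P L"
      and eq: "compose (carrier P) (restrict p (carrier L)) g = restrict f (carrier P)" by blast
    have lg: "lin R P L g" using lin_of_mod_hom[OF mP mods(1) g] .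
    have "p (g x) = f x" if "x \<in> carrier P" for x
      using fun_cong[OF eq, of x] that lin_simps(1)[OF lg that] by (simp add: compose_def)
    then show "\<exists>g. lin R P L g \<and> (\<forall>x\<in>carrier P. p (g x) = f x)" using lg by blast
  qed
next
  assume r: ?rhs
  show "projective R P" unfolding projective_def
  proof (intro conjI allI impI)
    show mP: "left_module R P" using r by simp
    fix L M :: "('r, 'm) module" and p f
    assume a: "left_module R L \<and> left_module R M \<and> p \<in> mod_hom R L M \<and> p ` carrier L = carrier M \<and> f \<in> mod_hom R P M"
    then have "lin R L M p" "lin R P M f" using lin_of_mod_hom mP by blast+
    then obtain g where g: "lin R P L g" "\<forall>x\<in>carrier P. p (g x) = f x" using r a by blast
    have "compose (carrier P) p (restrict g (carrier P)) = restrict f (carrier P)"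
      using g(2) by (auto simp: compose_def)
    then show "\<exists>g\<in>mod_hom R P L. compose (carrier P) p g = f"
      using mod_hom_of_lin[OF g(1)] a by (metis mod_hom_restrict)
  qed
qed

lemma injective_iff:
  fixes I :: "('r, 'm) module"
  shows "injective R I \<longleftrightarrow> left_module R I \<and>
    (\<forall>(L :: ('r, 'm) module) (M :: ('r, 'm) module) i f.
       lin R L M i \<and> inj_on i (carrier L) \<and> lin R L I f \<longrightarrow>
       (\<exists>g. lin R M I g \<and> (\<forall>x\<in>carrier L. g (i x) = f x)))" (is "_ \<longleftrightarrow> ?rhs")
proof
  assume I: "injective R I"
  then have mI: "left_module R I" by (simp add: injective_def)
  show ?rhs
  proof (intro conjI allI impI mI)
    fix L M :: "('r, 'm) module" and i f
    assume a: "lin R L M i \<and> inj_on i (carrier L) \<and> lin R L I f"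
    note mods = lin_mods[OF conjunct1[OF a]]
    have "\<exists>g\<in>mod_hom R M I. compose (carrier L) g (restrict i (carrier L)) = restrict f (carrier L)"
      using I[unfolded injective_def, THEN conjunct2, rule_format, of L M "restrict i (carrier L)" "restrict f (carrier L)"]
        a mods mod_hom_of_lin[of R L M i] mod_hom_of_lin[of R L I f] by simp
    then obtain g where g: "g \<in> mod_hom R M I"
      and eq: "compose (carrier L) g (restrict i (carrier L)) = restrict f (carrier L)" by blast
    have lg: "lin R M I g" using lin_of_mod_hom[OF mods(2) mI g] .
    have "g (i x) = f x" if "x \<in> carrier L" for x
      using fun_cong[OF eq, of x] that by (simp add: compose_def)
    then show "\<exists>g. lin R M I g \<and> (\<forall>x\<in>carrier L. g (i x) = f x)" using lg by blast
  qed
next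
  assume r: ?rhs
  show "injective R I" unfolding injective_def
  proof (intro conjI allI impI)
    show mI: "left_module R I" using r by simp
    fix L M :: "('r, 'm) module" and i f
    assume a: "left_module R L \<and> left_module R M \<and> i \<in> mod_hom R L M \<and> inj_on i (carrier L) \<and> f \<in> mod_hom R L I"
    then have l: "lin R L M i" "lin R L I f" using lin_of_mod_hom mI by blast+
    then obtain g where g: "lin R M I g" "\<forall>x\<in>carrier L. g (i x) = f x" using r a by blast
    have "compose (carrier L) (restrict g (carrier M)) i = restrict f (carrier L)"
      using g(2) lin_simps(1)[OF l(1)] by (auto simp: compose_def)
    then show "\<exists>g\<in>mod_hom R M I. compose (carrier L) g i = f"
      using mod_hom_of_lin[OF g(1)] a by (metis mod_hom_restrict)
  qed
qed

section \<open>Direct sums inside an infinite type\<close>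

text \<open>
  For an infinite type there is an injection \<open>'m \<times> 'm \<rightarrow> 'm\<close>.  Coding pairs by it keeps direct sums, and with
  them cones, on the type \<open>'m\<close>.
\<close>

definition prc :: "'m \<Rightarrow> 'm \<Rightarrow> 'm" where
  "prc x y = (SOME h :: 'm \<times> 'm \<Rightarrow> 'm. inj h) (x, y)"

definition fs :: "'m \<Rightarrow> 'm" where "fs u = fst (inv_into UNIV (SOME h :: 'm \<times> 'm \<Rightarrow> 'm. inj h) u)"
definition sn :: "'m \<Rightarrow> 'm" where "sn u = snd (inv_into UNIV (SOME h :: 'm \<times> 'm \<Rightarrow> 'm. inj h) u)"

lemma ex_inj_prod:
  assumes "infinite (UNIV :: 'm set)"
  shows "\<exists>h :: 'm \<times> 'm \<Rightarrow> 'm. inj h"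
proof -
  have "|(UNIV :: 'm set) \<times> (UNIV :: 'm set)| \<le>o |UNIV :: 'm set|"
    using card_of_Times_same_infinite[OF assms] by (rule ordIso_imp_ordLeq)
  then show ?thesis by (auto simp: card_of_ordLeq[symmetric])
qed

lemma prc_simps:
  fixes x y :: 'm
  assumes "infinite (UNIV :: 'm set)"
  shows "fs (prc x y) = x" "sn (prc x y) = y"
  using someI_ex[OF ex_inj_prod[OF assms]] by (simp_all add: prc_def fs_def sn_def)

definition dsum :: "('r, 'm) module \<Rightarrow> ('r, 'm) module \<Rightarrow> ('r, 'm) module" where
  "dsum L M = \<lparr>carrier = {prc x y |x y. x \<in> carrier L \<and> y \<in> carrier M},
     monoid.mult = undefined, one = undefined, ring.zero = prc \<zero>\<^bsub>L\<^esub> \<zero>\<^bsub>M\<^esub>,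
     add = (\<lambda>u v. prc (fs u \<oplus>\<^bsub>L\<^esub> fs v) (sn u \<oplus>\<^bsub>M\<^esub> sn v)),
     smult = (\<lambda>a u. prc (a \<odot>\<^bsub>L\<^esub> fs u) (a \<odot>\<^bsub>M\<^esub> sn u))\<rparr>"

context
  assumes inf: "infinite (UNIV :: 'm set)"
begin

lemma dsum_carrier:
  fixes L M :: "('r, 'm) module"
  shows "u \<in> carrier (dsum L M) \<longleftrightarrow> fs u \<in> carrier L \<and> sn u \<in> carrier M \<and> u = prc (fs u) (sn u)"
  by (auto simp: dsum_def prc_simps[OF inf])

lemma dsum_simps:
  fixes L M :: "('r, 'm) module"
  shows "prc x y \<in> carrier (dsum L M) \<longleftrightarrow> x \<in> carrier L \<and> y \<in> carrier M"
    and "prc x y \<oplus>\<^bsub>dsum L M\<^esub> prc x' y' = prc (x \<oplus>\<^bsub>L\<^esub> x') (y \<oplus>\<^bsub>M\<^esub> y')"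
    and "a \<odot>\<^bsub>dsum L M\<^esub> prc x y = prc (a \<odot>\<^bsub>L\<^esub> x) (a \<odot>\<^bsub>M\<^esub> y)"
    and "\<zero>\<^bsub>dsum L M\<^esub> = prc \<zero>\<^bsub>L\<^esub> \<zero>\<^bsub>M\<^esub>"
    and "prc x y = prc x' y' \<longleftrightarrow> x = x' \<and> y = y'"
  by (auto simp: dsum_def prc_simps[OF inf]) (metis prc_simps[OF inf])+

lemma dsumE:
  fixes L M :: "('r, 'm) module"
  assumes "u \<in> carrier (dsum L M)"
  obtains x y where "u = prc x y" "x \<in> carrier L" "y \<in> carrier M"
  using assms by (auto simp: dsum_def)

lemma dsum_module:
  fixes L M :: "('r, 'm) module"
  assumes L: "left_module R L" and M: "left_module R M"
  shows "left_module R (dsum L M)"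
proof (rule left_moduleI[OF lm_ring[OF L]], goal_cases)
  case (6 u)
  then obtain x y where u: "u = prc x y" "x \<in> carrier L" "y \<in> carrier M" by (rule dsumE)
  show ?case
    by (rule bexI[of _ "prc (\<ominus>\<^bsub>L\<^esub> x) (\<ominus>\<^bsub>M\<^esub> y)"])
      (use u in \<open>simp_all add: dsum_simps lm_closed[OF L] lm_closed[OF M] lm_add[OF L] lm_add[OF M]\<close>)
next
  case (3 u v w)
  interpret L: abelian_group L by (rule lm_grp[OF L])
  interpret M: abelian_group M by (rule lm_grp[OF M])
  show ?case using 3 by (auto elim!: dsumE simp: dsum_simps L.a_assoc M.a_assoc)
qed (auto elim!: dsumE simp: dsum_simps lm_closed[OF L] lm_closed[OF M] lm_add[OF L] lm_add[OF M]
    lm_smult[OF L] lm_smult[OF M] lm_one[OF L] lm_one[OF M] intro: lm_cancel(7)[OF L] lm_cancel(7)[OF M])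

lemma lin_dsum:
  fixes L M :: "('r, 'm) module"
  assumes L: "left_module R L" and M: "left_module R M"
  shows "lin R L (dsum L M) (\<lambda>x. prc x \<zero>\<^bsub>M\<^esub>)" "lin R M (dsum L M) (\<lambda>y. prc \<zero>\<^bsub>L\<^esub> y)"
    "lin R (dsum L M) L fs" "lin R (dsum L M) M sn"
  by (rule linI[OF L dsum_module[OF L M]] linI[OF M dsum_module[OF L M]] linI[OF dsum_module[OF L M] L] linI[OF dsum_module[OF L M] M];
    auto elim!: dsumE simp: dsum_simps prc_simps[OF inf] lm_closed[OF L] lm_closed[OF M] lm_add[OF L] lm_add[OF M]
    lm_smult0[OF L] lm_smult0[OF M])+

lemma lin_pair:
  fixes L M :: "('r, 'm) module" and Z :: "('r, 'c) module"
  assumes f: "lin R Z L f" and g: "lin R Z M g"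
  shows "lin R Z (dsum L M) (\<lambda>z. prc (f z) (g z))"
  by (rule linI[OF lin_mods(1)[OF f] dsum_module[OF lin_mods(2)[OF f] lin_mods(2)[OF g]]])
    (simp_all add: dsum_simps lin_simps[OF f] lin_simps[OF g])

lemma lin_copair:
  fixes L M :: "('r, 'm) module" and Z :: "('r, 'c) module"
  assumes f: "lin R L Z f" and g: "lin R M Z g"
  shows "lin R (dsum L M) Z (\<lambda>u. f (fs u) \<oplus>\<^bsub>Z\<^esub> g (sn u))"
  by (rule lin_add[OF lin_comp[OF lin_dsum(3) f] lin_comp[OF lin_dsum(4) g]])
    (use lin_mods[OF f] lin_mods[OF g] in auto)

lemma ses_dsum:
  fixes L M :: "('r, 'm) module"
  assumes L: "left_module R L" and M: "left_module R M"
  shows "ses R L (dsum L M) M (\<lambda>x. prc x \<zero>\<^bsub>M\<^esub>) sn" "ses R M (dsum L M) L (\<lambda>y. prc \<zero>\<^bsub>L\<^esub> y) fs"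
proof -
  have "sn ` carrier (dsum L M) = carrier M" "fs ` carrier (dsum L M) = carrier L"
    using lm_closed(2)[OF L] lm_closed(2)[OF M]
    by (auto simp: dsum_def prc_simps[OF inf] image_iff) (metis prc_simps[OF inf])+
  then show "ses R L (dsum L M) M (\<lambda>x. prc x \<zero>\<^bsub>M\<^esub>) sn" "ses R M (dsum L M) L (\<lambda>y. prc \<zero>\<^bsub>L\<^esub> y) fs"
    unfolding ses_def
    by (auto simp: lin_dsum[OF L M] inj_on_def dsum_simps prc_simps[OF inf] elim!: dsumE)
qed

end

section \<open>Modules over a self-injective algebra\<close>

\<comment> \<open>Polynomial rings claim the letter \<open>X\<close> for their variable; here it stands for modules.\<close>
no_notation var (\<open>X\<index>\<close>)

text \<open>
  The central subset \<open>K\<close> is the image of the base field.  The embedding \<open>e\<close> puts a copy of the algebra on the type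
  \<open>'m\<close>, on which all modules of the stable category live.
\<close>

locale self_injective_algebra = ring R for R :: "('a, 'r) ring_scheme" (structure) +
  fixes K :: "'a set" and e :: "'a \<Rightarrow> 'm"
  assumes K: "K \<subseteq> carrier R"
    and K_central: "\<And>c a. c \<in> K \<Longrightarrow> a \<in> carrier R \<Longrightarrow> c \<otimes> a = a \<otimes> c"
    and regular_finlen: "finlen K (regular_module R)"
    and regular_injective: "injective R (regular_module R)"
    and inf: "infinite (UNIV :: 'm set)"
    and e: "inj_on e (carrier R)"
begin

lemma regular_left_module: "left_module R (regular_module R)"
  using regular_injective by (simp add: injective_def)

lemma ext_ideal:
  assumes I: "submod R (regular_module R) I"
    and f: "lin R ((regular_module R)\<lparr>carrier := I\<rparr>) (regular_module R) f"
  shows "\<exists>c\<in>carrier R. \<forall>x\<in>I. f x = x \<otimes> c"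
proof -
  note i = submod_module[OF regular_left_module I]
  obtain g where g: "lin R (regular_module R) (regular_module R) g" "\<forall>x\<in>I. g x = f x"
    using regular_injective[unfolded injective_iff, THEN conjunct2, rule_format, OF conjI[OF i(2) conjI[OF _ f]]]
    by auto
  have "f x = x \<otimes> g \<one>" if x: "x \<in> I" for x
  proof -
    have "x \<in> carrier R" using I x by (auto simp: submod_def regular_module_def)
    then show ?thesis using lin_simps(3)[OF g(1), of x \<one>] g(2) x by (simp add: regular_module_def)
  qed
  moreover have "g \<one> \<in> carrier R" using lin_simps(1)[OF g(1), of \<one>] by (simp add: regular_module_def)
  ultimately show ?thesis by blast
qed

lemma right_annihilator_nonzero:
  assumes I: "submod R (regular_module R) I" "\<one> \<notin> I"
  shows "\<exists>x\<in>carrier R. x \<noteq> \<zero> \<and> (\<forall>a\<in>I. a \<otimes> x = \<zero>)"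
proof -
  obtain d :: "_ set \<Rightarrow> nat" where d: "\<forall>U V. subsp K (regular_module R) U \<longrightarrow> subsp K (regular_module R) V \<longrightarrow> U \<subset> V \<longrightarrow> d U < d V"
    using regular_finlen by (auto simp: finlen_def)
  interpret artinian_self_injective R d
    by unfold_locales (use d submod_subsp[OF K regular_left_module] ext_ideal in blast)+
  show ?thesis using right_annihilator_nonzero I by (simp add: lideal_iff)
qed

text \<open>
  Baer's criterion.  Self-injectivity is only tested on modules on the type of the algebra; this passes to
  modules on all types.  A partial extension is a submodule \<open>G\<close> of \<open>M \<times> R\<close> that is the graph of a function, and Zorn's
  lemma gives a maximal one.  For \<open>m\<close> outside its domain, the elements \<open>a\<close> with \<open>a m\<close> in the domain form a left
  ideal, on which the extension is right multiplication by some \<open>c\<close>; so \<open>m \<mapsto> c\<close> would enlarge \<open>G\<close>.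
\<close>

lemma extend_to_regular:
  fixes L :: "('a, 'l) module" and M :: "('a, 'n) module"
  assumes i: "lin R L M i" and inj: "inj_on i (carrier L)" and f: "lin R L (regular_module R) f"
  shows "\<exists>g. lin R M (regular_module R) g \<and> (\<forall>x\<in>carrier L. g (i x) = f x)"
proof -
  let ?A = "regular_module R"
  note L = lin_mods(1)[OF i] and M = lin_mods(2)[OF i]
  interpret M: abelian_group M by (rule lm_grp[OF M])
  have A: "carrier ?A = carrier R" "\<zero>\<^bsub>?A\<^esub> = \<zero>" "x \<oplus>\<^bsub>?A\<^esub> y = x \<oplus> y" "x \<odot>\<^bsub>?A\<^esub> y = x \<otimes> y" for x y
    by (simp_all add: regular_module_def)
  note fs = lin_simps[OF f, unfolded A] and ii = lin_simps[OF i]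
  define \<G> where "\<G> = {G. G \<subseteq> carrier M \<times> carrier R \<and> (\<lambda>x. (i x, f x)) ` carrier L \<subseteq> G \<and>
      (\<forall>p\<in>G. \<forall>q\<in>G. (fst p \<oplus>\<^bsub>M\<^esub> fst q, snd p \<oplus> snd q) \<in> G) \<and>
      (\<forall>a\<in>carrier R. \<forall>p\<in>G. (a \<odot>\<^bsub>M\<^esub> fst p, a \<otimes> snd p) \<in> G) \<and>
      (\<forall>r. (\<zero>\<^bsub>M\<^esub>, r) \<in> G \<longrightarrow> r = \<zero>)}"
  have "(\<lambda>x. (i x, f x)) ` carrier L \<in> \<G>"
  proof -
    have "r = \<zero>" if zr: "(\<zero>\<^bsub>M\<^esub>, r) \<in> (\<lambda>x. (i x, f x)) ` carrier L" for r
    proof -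
      obtain x where x: "x \<in> carrier L" "i x = \<zero>\<^bsub>M\<^esub>" "r = f x" using zr by auto
      then have "x = \<zero>\<^bsub>L\<^esub>" using inj lin_inj_iff[OF i] by blast
      then show "r = \<zero>" using x fs(4) by simp
    qed
    moreover have "(i x \<oplus>\<^bsub>M\<^esub> i y, f x \<oplus> f y) \<in> (\<lambda>x. (i x, f x)) ` carrier L" if "x \<in> carrier L" "y \<in> carrier L" for x y
      by (rule image_eqI[of _ _ "x \<oplus>\<^bsub>L\<^esub> y"]) (use that in \<open>simp_all add: fs ii lm_closed[OF L]\<close>)
    moreover have "(a \<odot>\<^bsub>M\<^esub> i x, a \<otimes> f x) \<in> (\<lambda>x. (i x, f x)) ` carrier L" if "x \<in> carrier L" "a \<in> carrier R" for x a
      by (rule image_eqI[of _ _ "a \<odot>\<^bsub>L\<^esub> x"]) (use that in \<open>simp_all add: fs ii lm_closed[OF L]\<close>)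
    ultimately show ?thesis unfolding \<G>_def by (auto simp: fs ii)
  qed
  then have ne: "\<G> \<noteq> {}" by blast
  have "\<exists>G\<in>\<G>. \<forall>H\<in>\<G>. G \<subseteq> H \<longrightarrow> H = G"
  proof (rule subset_Zorn_nonempty[OF ne])
    fix C assume C: "C \<noteq> {}" "subset.chain \<G> C"
    have CG: "G \<in> \<G>" if "G \<in> C" for G using C(2) that by (auto simp: subset.chain_def)
    have pair: "\<exists>G\<in>C. p \<in> G \<and> q \<in> G" if pq: "p \<in> \<Union>C" "q \<in> \<Union>C" for p q
    proof -
      obtain G H where GH: "G \<in> C" "H \<in> C" "p \<in> G" "q \<in> H" using pq by blast
      then have "G \<subseteq> H \<or> H \<subseteq> G" using C(2) by (auto simp: subset.chain_def)
      then show ?thesis using GH by blast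
    qed
    have "(fst p \<oplus>\<^bsub>M\<^esub> fst q, snd p \<oplus> snd q) \<in> \<Union>C" if pq: "p \<in> \<Union>C" "q \<in> \<Union>C" for p q
    proof -
      obtain G where G: "G \<in> C" "p \<in> G" "q \<in> G" using pair[OF pq] by blast
      then show ?thesis using CG[OF G(1)] unfolding \<G>_def by blast
    qed
    moreover have "\<Union>C \<subseteq> carrier M \<times> carrier R" "(\<lambda>x. (i x, f x)) ` carrier L \<subseteq> \<Union>C"
      using CG C(1) unfolding \<G>_def by blast+
    moreover have "(a \<odot>\<^bsub>M\<^esub> fst p, a \<otimes> snd p) \<in> \<Union>C" if ap: "a \<in> carrier R" "p \<in> \<Union>C" for a p
    proof -
      obtain G where G: "G \<in> C" "p \<in> G" using ap by blast
      then show ?thesis using CG[OF G(1)] ap unfolding \<G>_def by blast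
    qed
    moreover have "r = \<zero>" if zr: "(\<zero>\<^bsub>M\<^esub>, r) \<in> \<Union>C" for r
    proof -
      obtain G where G: "G \<in> C" "(\<zero>\<^bsub>M\<^esub>, r) \<in> G" using zr by blast
      then show ?thesis using CG[OF G(1)] unfolding \<G>_def by blast
    qed
    ultimately show "\<Union>C \<in> \<G>" unfolding \<G>_def by blast
  qed
  then obtain G where G: "G \<in> \<G>" and max: "\<And>H. H \<in> \<G> \<Longrightarrow> G \<subseteq> H \<Longrightarrow> H = G" by blast
  have G1: "(m, r) \<in> G \<Longrightarrow> m \<in> carrier M" "(m, r) \<in> G \<Longrightarrow> r \<in> carrier R" "x \<in> carrier L \<Longrightarrow> (i x, f x) \<in> G"
    "(m, r) \<in> G \<Longrightarrow> (m', r') \<in> G \<Longrightarrow> (m \<oplus>\<^bsub>M\<^esub> m', r \<oplus> r') \<in> G"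
    "a \<in> carrier R \<Longrightarrow> (m, r) \<in> G \<Longrightarrow> (a \<odot>\<^bsub>M\<^esub> m, a \<otimes> r) \<in> G" "(\<zero>\<^bsub>M\<^esub>, r) \<in> G \<Longrightarrow> r = \<zero>" for x m r m' r' a
    using G unfolding \<G>_def by force+
  have G2: "(\<ominus>\<^bsub>M\<^esub> m, \<ominus> r) \<in> G" if "(m, r) \<in> G" for m r
    using G1(5)[of "\<ominus> \<one>", OF _ that] G1(1,2)[OF that] by (simp add: lm_neg_one[OF M] l_minus)
  have uniq: "r = r'" if "(m, r) \<in> G" "(m, r') \<in> G" for m r r'
  proof -
    have c: "m \<in> carrier M" "r \<in> carrier R" "r' \<in> carrier R" using that G1(1,2) by blast+
    have "(m \<oplus>\<^bsub>M\<^esub> \<ominus>\<^bsub>M\<^esub> m, r \<oplus> \<ominus> r') \<in> G" using G1(4)[OF that(1) G2[OF that(2)]] .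
    then have "r \<oplus> \<ominus> r' = \<zero>" using G1(6) c by (simp add: lm_add[OF M])
    then show ?thesis using c by (metis minus_equality minus_minus a_inv_closed a_comm)
  qed
  have dom: "\<exists>r. (m, r) \<in> G" if m: "m \<in> carrier M" for m
  proof -
    define I where "I = {a \<in> carrier R. \<exists>r. (a \<odot>\<^bsub>M\<^esub> m, r) \<in> G}"
    define \<phi> where "\<phi> a = (THE r. (a \<odot>\<^bsub>M\<^esub> m, r) \<in> G)" for a
    have \<phi>: "\<phi> a = r" if "(a \<odot>\<^bsub>M\<^esub> m, r) \<in> G" for a r
      unfolding \<phi>_def using that uniq by blast
    have \<phi>': "(a \<odot>\<^bsub>M\<^esub> m, \<phi> a) \<in> G" if "a \<in> I" for a using that \<phi> by (auto simp: I_def)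
    have IR: "a \<in> carrier R" if "a \<in> I" for a using that by (simp add: I_def)
    have Iadd: "((a \<oplus> b) \<odot>\<^bsub>M\<^esub> m, \<phi> a \<oplus> \<phi> b) \<in> G" if "a \<in> I" "b \<in> I" for a b
      using G1(4)[OF \<phi>'[OF that(1)] \<phi>'[OF that(2)]] IR[OF that(1)] IR[OF that(2)] m by (simp add: lm_smult[OF M])
    have Ismult: "((a \<otimes> b) \<odot>\<^bsub>M\<^esub> m, a \<otimes> \<phi> b) \<in> G" if "a \<in> carrier R" "b \<in> I" for a b
      using G1(5)[OF that(1) \<phi>'[OF that(2)]] that(1) IR[OF that(2)] m by (simp add: lm_smult[OF M])
    have z: "(\<zero>\<^bsub>M\<^esub>, \<zero>) \<in> G" using G1(3)[OF lm_closed(2)[OF L]] ii(4) fs(4) by simp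
    have I: "submod R ?A I" unfolding submod_def A
    proof (intro conjI ballI)
      show "\<zero> \<in> I" using z m by (auto simp: I_def lm_smult0[OF M])
      show "a \<oplus> b \<in> I" if "a \<in> I" "b \<in> I" for a b using Iadd[OF that] IR that by (auto simp: I_def)
      show "a \<otimes> b \<in> I" if "a \<in> carrier R" "b \<in> I" for a b using Ismult[OF that] IR that by (auto simp: I_def)
    qed (use IR in blast)
    have "lin R (?A\<lparr>carrier := I\<rparr>) ?A \<phi>"
      by (rule linI[OF submod_module(1)[OF regular_left_module I] regular_left_module])
        (use \<phi>[OF Iadd] \<phi>[OF Ismult] G1(2)[OF \<phi>'] in \<open>simp_all add: A\<close>)
    then obtain c where c: "c \<in> carrier R" "\<And>a. a \<in> I \<Longrightarrow> \<phi> a = a \<otimes> c" using ext_ideal[OF I] by blast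
    define H where "H = {(u \<oplus>\<^bsub>M\<^esub> a \<odot>\<^bsub>M\<^esub> m, r \<oplus> a \<otimes> c) |u r a. (u, r) \<in> G \<and> a \<in> carrier R}"
    have Hz: "r = \<zero>" if zr: "(\<zero>\<^bsub>M\<^esub>, r) \<in> H" for r
    proof -
      obtain u s a where u: "\<zero>\<^bsub>M\<^esub> = u \<oplus>\<^bsub>M\<^esub> a \<odot>\<^bsub>M\<^esub> m" "r = s \<oplus> a \<otimes> c" "(u, s) \<in> G" "a \<in> carrier R"
        using zr unfolding H_def by blast
      have cl: "u \<in> carrier M" "s \<in> carrier R" "a \<odot>\<^bsub>M\<^esub> m \<in> carrier M" using u G1(1,2) m lm_closed(5)[OF M] by blast+
      have "a \<odot>\<^bsub>M\<^esub> m = \<ominus>\<^bsub>M\<^esub> u" using u(1) cl by (metis M.minus_equality M.a_comm M.minus_minus)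
      then have g: "(a \<odot>\<^bsub>M\<^esub> m, \<ominus> s) \<in> G" using G2[OF u(3)] by simp
      then have "a \<in> I" using u(4) by (auto simp: I_def)
      then have "a \<otimes> c = \<ominus> s" using \<phi>[OF g] c by simp
      then show "r = \<zero>" using u(2) cl by (simp add: r_neg)
    qed
    have "H \<in> \<G>" unfolding \<G>_def mem_Collect_eq
    proof (intro conjI ballI allI impI)
      show "H \<subseteq> carrier M \<times> carrier R" using G1(1,2) c m by (auto simp: H_def lm_closed[OF M])
      show "(\<lambda>x. (i x, f x)) ` carrier L \<subseteq> H"
      proof clarify
        fix x assume x: "x \<in> carrier L"
        have "(i x, f x) = (i x \<oplus>\<^bsub>M\<^esub> \<zero> \<odot>\<^bsub>M\<^esub> m, f x \<oplus> \<zero> \<otimes> c)"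
          using x m c(1) by (simp add: lm_smult0[OF M] lm_add[OF M] fs ii)
        then show "(i x, f x) \<in> H" using G1(3)[OF x] unfolding H_def by blast
      qed
      fix p assume "p \<in> H"
      then obtain u s a where p: "p = (u \<oplus>\<^bsub>M\<^esub> a \<odot>\<^bsub>M\<^esub> m, s \<oplus> a \<otimes> c)" "(u, s) \<in> G" "a \<in> carrier R"
        unfolding H_def by blast
      have cl: "u \<in> carrier M" "s \<in> carrier R" "a \<odot>\<^bsub>M\<^esub> m \<in> carrier M" using p G1(1,2) m lm_closed(5)[OF M] by blast+
      {
        fix q assume "q \<in> H"
        then obtain u' s' a' where q: "q = (u' \<oplus>\<^bsub>M\<^esub> a' \<odot>\<^bsub>M\<^esub> m, s' \<oplus> a' \<otimes> c)" "(u', s') \<in> G" "a' \<in> carrier R"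
          unfolding H_def by blast
        have cl': "u' \<in> carrier M" "s' \<in> carrier R" "a' \<odot>\<^bsub>M\<^esub> m \<in> carrier M" using q G1(1,2) m lm_closed(5)[OF M] by blast+
        have "(fst p \<oplus>\<^bsub>M\<^esub> fst q, snd p \<oplus> snd q) =
            ((u \<oplus>\<^bsub>M\<^esub> u') \<oplus>\<^bsub>M\<^esub> (a \<oplus> a') \<odot>\<^bsub>M\<^esub> m, (s \<oplus> s') \<oplus> (a \<oplus> a') \<otimes> c)"
          using p q cl cl' m c(1) by (simp add: lm_smult(1)[OF M] l_distr M.a_ac a_ac)
        then show "(fst p \<oplus>\<^bsub>M\<^esub> fst q, snd p \<oplus> snd q) \<in> H"
          using G1(4)[OF p(2) q(2)] p(3) q(3) unfolding H_def by blast
      }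
      fix b assume b: "b \<in> carrier R"
      have "(b \<odot>\<^bsub>M\<^esub> fst p, b \<otimes> snd p) = (b \<odot>\<^bsub>M\<^esub> u \<oplus>\<^bsub>M\<^esub> (b \<otimes> a) \<odot>\<^bsub>M\<^esub> m, b \<otimes> s \<oplus> (b \<otimes> a) \<otimes> c)"
        using p b cl m c(1) by (simp add: lm_smult[OF M] r_distr m_assoc)
      then show "(b \<odot>\<^bsub>M\<^esub> fst p, b \<otimes> snd p) \<in> H"
        using G1(5)[OF b p(2)] p(3) b unfolding H_def by blast
    qed (use Hz in blast)
    moreover have "G \<subseteq> H"
    proof clarify
      fix u s assume us: "(u, s) \<in> G"
      have "(u, s) = (u \<oplus>\<^bsub>M\<^esub> \<zero> \<odot>\<^bsub>M\<^esub> m, s \<oplus> \<zero> \<otimes> c)"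
        using us m c(1) G1(1,2)[OF us] by (simp add: lm_smult0[OF M] lm_add[OF M])
      then show "(u, s) \<in> H" using us unfolding H_def by blast
    qed
    ultimately have "H = G" by (rule max)
    moreover have "(\<zero>\<^bsub>M\<^esub> \<oplus>\<^bsub>M\<^esub> \<one> \<odot>\<^bsub>M\<^esub> m, \<zero> \<oplus> \<one> \<otimes> c) \<in> H" using z unfolding H_def by blast
    ultimately show ?thesis using m c(1) by (auto simp: lm_one[OF M] lm_add[OF M])
  qed
  define g where "g m = (THE r. (m, r) \<in> G)" for m
  have g: "g m = r" if "(m, r) \<in> G" for m r unfolding g_def using that uniq by blast
  have g': "(m, g m) \<in> G" if "m \<in> carrier M" for m using dom[OF that] g by auto
  have "lin R M ?A g"
    by (rule linI[OF M regular_left_module], unfold A)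
      (use G1(2)[OF g'] g[OF G1(4)[OF g' g']] g[OF G1(5)[OF _ g']] in simp_all)
  then show ?thesis using g[OF G1(3)] by blast
qed

definition Acopy :: "('a, 'm) module" where
  "Acopy = (SOME A'. lin R (regular_module R) A' e \<and> e ` carrier R = carrier A')"

lemma Acopy: "lin R (regular_module R) Acopy e" "e ` carrier R = carrier Acopy"
proof -
  have "\<exists>A'. lin R (regular_module R) A' e \<and> e ` carrier R = carrier A'"
    using ex_copy[OF regular_left_module, of e] e by (simp add: regular_module_def)
  from someI_ex[OF this] show "lin R (regular_module R) Acopy e" "e ` carrier R = carrier Acopy"
    by (simp_all add: Acopy_def)
qed

lemma Acopy_inverse:
  "\<exists>h. lin R Acopy (regular_module R) h \<and> (\<forall>x\<in>carrier R. h (e x) = x) \<and> (\<forall>y\<in>carrier Acopy. e (h y) = y)"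
  using lin_inverse[OF Acopy(1)] Acopy(2) e by (simp add: regular_module_def)

lemma lin_from_regular:
  assumes M: "left_module R M" and m: "m \<in> carrier M"
  shows "lin R (regular_module R) M (\<lambda>a. a \<odot>\<^bsub>M\<^esub> m)"
  by (rule linI[OF regular_left_module M])
    (simp_all add: regular_module_def m lm_closed[OF M] lm_smult[OF M])

lemma ex_lin_from_Acopy:
  assumes M: "left_module R M" and m: "m \<in> carrier M"
  shows "\<exists>f. lin R Acopy M f \<and> f (e \<one>) = m"
proof -
  obtain h where h: "lin R Acopy (regular_module R) h" "\<forall>x\<in>carrier R. h (e x) = x"
    using Acopy_inverse by blast
  show ?thesis
    by (rule exI[of _ "\<lambda>x. h x \<odot>\<^bsub>M\<^esub> m"])
      (use lin_comp[OF h(1) lin_from_regular[OF M m]] h(2) in \<open>simp add: lm_one[OF M m]\<close>)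
qed

lemma lin_Acopy_eqI:
  assumes f: "lin R Acopy M f" and g: "lin R Acopy M g" and eq: "f (e \<one>) = g (e \<one>)" and x: "x \<in> carrier Acopy"
  shows "f x = g x"
proof -
  obtain a where a: "a \<in> carrier R" "x = e a" using x Acopy(2) by auto
  have "x = a \<odot>\<^bsub>Acopy\<^esub> e \<one>"
    using lin_simps(3)[OF Acopy(1), of a \<one>] a by (simp add: regular_module_def)
  moreover have "e \<one> \<in> carrier Acopy" using Acopy(2) by auto
  ultimately show ?thesis using a eq by (simp add: lin_simps[OF f] lin_simps[OF g])
qed

lemma projective_Acopy: "projective R Acopy"
  unfolding projective_iff
proof (intro conjI allI impI)
  show "left_module R Acopy" using Acopy(1) by (rule lin_mods)
  fix L M :: "('a, 'm) module" and p f
  assume a: "lin R L M p \<and> p ` carrier L = carrier M \<and> lin R Acopy M f"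
  have e1: "e \<one> \<in> carrier Acopy" using Acopy(2) by auto
  obtain l where l: "l \<in> carrier L" "p l = f (e \<one>)"
    using a lin_simps(1)[of R Acopy M f, OF _ e1] by (metis imageE)
  obtain g where g: "lin R Acopy L g" "g (e \<one>) = l"
    using ex_lin_from_Acopy[OF lin_mods(1) l(1), of M p] a by blast
  then show "\<exists>g. lin R Acopy L g \<and> (\<forall>x\<in>carrier Acopy. p (g x) = f x)"
    using lin_Acopy_eqI[OF lin_comp[OF g(1)], of M p f] a l by auto
qed

lemma injective_Acopy: "injective R Acopy"
  unfolding injective_iff
proof (intro conjI allI impI)
  show "left_module R Acopy" using Acopy(1) by (rule lin_mods)
  fix L M :: "('a, 'm) module" and i f
  assume a: "lin R L M i \<and> inj_on i (carrier L) \<and> lin R L Acopy f"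
  obtain h where h: "lin R Acopy (regular_module R) h" "\<forall>y\<in>carrier Acopy. e (h y) = y"
    using Acopy_inverse by blast
  obtain g where g: "lin R M (regular_module R) g" "\<forall>x\<in>carrier L. g (i x) = h (f x)"
    using extend_to_regular[of L M i "\<lambda>x. h (f x)"] lin_comp[OF _ h(1)] a by blast
  show "\<exists>g. lin R M Acopy g \<and> (\<forall>x\<in>carrier L. g (i x) = f x)"
    by (rule exI[of _ "\<lambda>x. e (g x)"])
      (use lin_comp[OF g(1) Acopy(1)] g(2) h(2) a lin_closed[of R L Acopy f] in auto)
qed

text \<open>
  Projective, injective and of finite length.  For finite length the first two properties turn out to be
  equivalent, but having both at hand makes these modules closed under everything needed below.
\<close>

definition pif :: "('a, 'm) module \<Rightarrow> bool" where
  "pif P \<longleftrightarrow> finlen K P \<and> projective R P \<and> injective R P"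

lemma pif_module: "pif P \<Longrightarrow> left_module R P"
  by (simp add: pif_def projective_def)

lemma pif_Acopy: "pif Acopy"
  using finlen_image[OF K Acopy(1) _ regular_finlen] Acopy(2) projective_Acopy injective_Acopy
  by (simp add: pif_def regular_module_def)

lemma projective_lift:
  fixes P :: "('a, 'm) module" and L M :: "('a, 'm) module"
  assumes "projective R P" "lin R L M p" "p ` carrier L = carrier M" "lin R P M f"
  shows "\<exists>g. lin R P L g \<and> (\<forall>x\<in>carrier P. p (g x) = f x)"
  using assms by (auto simp: projective_iff)

lemma injective_extend:
  fixes I :: "('a, 'm) module" and L M :: "('a, 'm) module"
  assumes "injective R I" "lin R L M i" "inj_on i (carrier L)" "lin R L I f"
  shows "\<exists>g. lin R M I g \<and> (\<forall>x\<in>carrier L. g (i x) = f x)"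
  using assms by (auto simp: injective_iff)

lemma projective_retract:
  fixes X P :: "('a, 'm) module"
  assumes P: "projective R P" and s: "lin R X P s" and r: "lin R P X r" and rs: "\<And>x. x \<in> carrier X \<Longrightarrow> r (s x) = x"
  shows "projective R X"
  unfolding projective_iff
proof (intro conjI allI impI)
  show "left_module R X" using s by (rule lin_mods)
  fix L M :: "('a, 'm) module" and p f
  assume a: "lin R L M p \<and> p ` carrier L = carrier M \<and> lin R X M f"
  obtain g where g: "lin R P L g" "\<forall>x\<in>carrier P. p (g x) = f (r x)"
    using projective_lift[OF P, of L M p "\<lambda>x. f (r x)"] lin_comp[OF r] a by blast
  show "\<exists>g. lin R X L g \<and> (\<forall>x\<in>carrier X. p (g x) = f x)"
    by (rule exI[of _ "\<lambda>x. g (s x)"]) (use lin_comp[OF s g(1)] g(2) rs lin_closed[OF s] in auto)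
qed

lemma injective_retract:
  fixes X P :: "('a, 'm) module"
  assumes P: "injective R P" and s: "lin R X P s" and r: "lin R P X r" and rs: "\<And>x. x \<in> carrier X \<Longrightarrow> r (s x) = x"
  shows "injective R X"
  unfolding injective_iff
proof (intro conjI allI impI)
  show "left_module R X" using s by (rule lin_mods)
  fix L M :: "('a, 'm) module" and i f
  assume a: "lin R L M i \<and> inj_on i (carrier L) \<and> lin R L X f"
  obtain g where g: "lin R M P g" "\<forall>x\<in>carrier L. g (i x) = s (f x)"
    using injective_extend[OF P, of L M i "\<lambda>x. s (f x)"] lin_comp[OF _ s] a by blast
  show "\<exists>g. lin R M X g \<and> (\<forall>x\<in>carrier L. g (i x) = f x)"
    by (rule exI[of _ "\<lambda>x. r (g x)"]) (use lin_comp[OF g(1) r] g(2) rs a lin_closed[of R L X f] in auto)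
qed

lemma inj_on_retract:
  assumes "\<And>x. x \<in> A \<Longrightarrow> r (s x) = x" shows "inj_on s A"
  using assms by (metis inj_onI)

lemma pif_retract:
  assumes P: "pif P" and s: "lin R X P s" and r: "lin R P X r" and rs: "\<And>x. x \<in> carrier X \<Longrightarrow> r (s x) = x"
  shows "pif X"
  using P projective_retract[OF _ s r rs] injective_retract[OF _ s r rs]
    finlen_inj[OF K s inj_on_retract[of _ r s, OF rs]] by (auto simp: pif_def)

lemma projective_dsum:
  fixes P Q :: "('a, 'm) module"
  assumes P: "projective R P" and Q: "projective R Q"
  shows "projective R (dsum P Q)"
  unfolding projective_iff
proof (intro conjI allI impI)
  have mP: "left_module R P" and mQ: "left_module R Q" using P Q by (auto simp: projective_def)
  note d = lin_dsum[OF inf mP mQ]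
  show "left_module R (dsum P Q)" by (rule dsum_module[OF inf mP mQ])
  fix L M :: "('a, 'm) module" and p f
  assume a: "lin R L M p \<and> p ` carrier L = carrier M \<and> lin R (dsum P Q) M f"
  then have p: "lin R L M p" "p ` carrier L = carrier M" and f: "lin R (dsum P Q) M f" by auto
  obtain g1 where g1: "lin R P L g1" "\<forall>x\<in>carrier P. p (g1 x) = f (prc x \<zero>\<^bsub>Q\<^esub>)"
    using projective_lift[OF P p lin_comp[OF d(1) f]] by blast
  obtain g2 where g2: "lin R Q L g2" "\<forall>x\<in>carrier Q. p (g2 x) = f (prc \<zero>\<^bsub>P\<^esub> x)"
    using projective_lift[OF Q p lin_comp[OF d(2) f]] by blast
  have "p (g1 (fs u) \<oplus>\<^bsub>L\<^esub> g2 (sn u)) = f u" if u: "u \<in> carrier (dsum P Q)" for u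
  proof -
    obtain x y where xy: "u = prc x y" "x \<in> carrier P" "y \<in> carrier Q" using dsumE[OF inf u] .
    have "u = prc x \<zero>\<^bsub>Q\<^esub> \<oplus>\<^bsub>dsum P Q\<^esub> prc \<zero>\<^bsub>P\<^esub> y"
      using xy by (simp add: dsum_simps[OF inf] lm_add[OF mP] lm_add[OF mQ])
    moreover have "prc x \<zero>\<^bsub>Q\<^esub> \<in> carrier (dsum P Q)" "prc \<zero>\<^bsub>P\<^esub> y \<in> carrier (dsum P Q)"
      using xy by (simp_all add: dsum_simps[OF inf] lm_closed[OF mP] lm_closed[OF mQ])
    ultimately have "f u = f (prc x \<zero>\<^bsub>Q\<^esub>) \<oplus>\<^bsub>M\<^esub> f (prc \<zero>\<^bsub>P\<^esub> y)"
      using lin_simps(2)[OF f] by metis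
    then show ?thesis
      using xy g1(2) g2(2) lin_closed[OF g1(1)] lin_closed[OF g2(1)]
      by (simp add: prc_simps[OF inf] lin_simps[OF p(1)])
  qed
  then show "\<exists>g. lin R (dsum P Q) L g \<and> (\<forall>x\<in>carrier (dsum P Q). p (g x) = f x)"
    using lin_copair[OF inf g1(1) g2(1)] by blast
qed

lemma injective_dsum:
  fixes P Q :: "('a, 'm) module"
  assumes P: "injective R P" and Q: "injective R Q"
  shows "injective R (dsum P Q)"
  unfolding injective_iff
proof (intro conjI allI impI)
  have mP: "left_module R P" and mQ: "left_module R Q" using P Q by (auto simp: injective_def)
  note d = lin_dsum[OF inf mP mQ]
  show "left_module R (dsum P Q)" by (rule dsum_module[OF inf mP mQ])
  fix L M :: "('a, 'm) module" and i f
  assume a: "lin R L M i \<and> inj_on i (carrier L) \<and> lin R L (dsum P Q) f"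
  then have i: "lin R L M i" "inj_on i (carrier L)" and f: "lin R L (dsum P Q) f" by auto
  obtain g1 where g1: "lin R M P g1" "\<forall>x\<in>carrier L. g1 (i x) = fs (f x)"
    using injective_extend[OF P i lin_comp[OF f d(3)]] by blast
  obtain g2 where g2: "lin R M Q g2" "\<forall>x\<in>carrier L. g2 (i x) = sn (f x)"
    using injective_extend[OF Q i lin_comp[OF f d(4)]] by blast
  have "prc (g1 (i x)) (g2 (i x)) = f x" if x: "x \<in> carrier L" for x
    using g1(2) g2(2) x dsum_carrier[OF inf, of "f x" P Q] lin_closed[OF f x] by simp
  then show "\<exists>g. lin R M (dsum P Q) g \<and> (\<forall>x\<in>carrier L. g (i x) = f x)"
    using lin_pair[OF inf g1(1) g2(1)] by blast
qed

lemma finlen_dsum: "left_module R L \<Longrightarrow> left_module R M \<Longrightarrow> finlen K L \<Longrightarrow> finlen K M \<Longrightarrow> finlen K (dsum L (M :: ('a, 'm) module))"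
  using finlen_ses[OF K ses_dsum(1)[OF inf]] by blast

lemma pif_dsum: "pif P \<Longrightarrow> pif Q \<Longrightarrow> pif (dsum P Q)"
  using projective_dsum injective_dsum finlen_dsum pif_module unfolding pif_def by blast

definition Zero :: "('a, 'm) module" where "Zero = Acopy\<lparr>carrier := {\<zero>\<^bsub>Acopy\<^esub>}\<rparr>"

lemma Zero_module: "left_module R Zero" "carrier Zero = {\<zero>\<^bsub>Zero\<^esub>}"
  using submod_module(1)[OF lin_mods(2)[OF Acopy(1)] submod_zero[OF lin_mods(2)[OF Acopy(1)]]]
  by (simp_all add: Zero_def)

lemma pif_Zero: "pif Zero"
proof (rule pif_retract[OF pif_Acopy lin_zero lin_zero])
qed (use Zero_module lin_mods(2)[OF Acopy(1)] in auto)

text \<open>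
  Among the maps from \<open>X\<close> to modules of this kind, one with minimal kernel is injective: a non-zero \<open>x\<close> in its
  kernel is detected by a map \<open>R x \<rightarrow> R\<close>, because annihilators in \<open>R\<close> of proper left ideals are non-zero; that
  map extends to \<open>X\<close> and can be added as a further component.
\<close>

lemma ex_embedding:
  fixes X :: "('a, 'm) module"
  assumes X: "left_module R X" and fl: "finlen K X"
  shows "\<exists>E i. pif E \<and> lin R X E i \<and> inj_on i (carrier X)"
proof -
  define P where "P = (\<lambda>(E, i). pif E \<and> lin R X E i)"
  define ker where "ker = (\<lambda>(E :: ('a, 'm) module, i). {x \<in> carrier X. i x = \<zero>\<^bsub>E\<^esub>})"
  have P0: "P (Zero, \<lambda>x. \<zero>\<^bsub>Zero\<^esub>)"
    using pif_Zero lin_zero[OF X Zero_module(1)] by (simp add: P_def)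
  have "subsp K X (ker Ei)" if "P Ei" for Ei
    using that submod_subsp[OF K X submod_ker] by (auto simp: P_def ker_def)
  then have "\<exists>x. P x \<and> (\<forall>y. P y \<longrightarrow> ker y \<subseteq> ker x \<longrightarrow> ker y = ker x)"
    by (rule finlen_minimal[of K X P, OF fl P0])
  then obtain Ei where Ei: "P Ei" "\<And>Fj. P Fj \<Longrightarrow> ker Fj \<subseteq> ker Ei \<Longrightarrow> ker Fj = ker Ei" by blast
  obtain E i where "Ei = (E, i)" by (cases Ei)
  then have E: "pif E" "lin R X E i"
    and min: "\<And>F j. pif F \<Longrightarrow> lin R X F j \<Longrightarrow> ker (F, j) \<subseteq> ker (E, i) \<Longrightarrow> ker (F, j) = ker (E, i)"
    using Ei by (auto simp: P_def)
  have "x = \<zero>\<^bsub>X\<^esub>" if x: "x \<in> carrier X" "i x = \<zero>\<^bsub>E\<^esub>" for x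
  proof (rule ccontr)
    assume nz: "x \<noteq> \<zero>\<^bsub>X\<^esub>"
    note lx = lin_from_regular[OF X x(1)]
    define I where "I = {a \<in> carrier (regular_module R). a \<odot>\<^bsub>X\<^esub> x = \<zero>\<^bsub>X\<^esub>}"
    have "submod R (regular_module R) I" using submod_ker[OF lx] by (simp add: I_def)
    moreover have "\<one> \<notin> I" using nz x by (simp add: I_def lm_one[OF X])
    ultimately obtain y where y: "y \<in> carrier R" "y \<noteq> \<zero>" "\<And>a. a \<in> I \<Longrightarrow> a \<otimes> y = \<zero>"
      using right_annihilator_nonzero by blast
    have ly: "lin R (regular_module R) (regular_module R) (\<lambda>a. a \<otimes> y)"
      using lin_from_regular[OF regular_left_module, of y] y by (simp add: regular_module_def)
    define U where "U = (\<lambda>a. a \<odot>\<^bsub>X\<^esub> x) ` carrier (regular_module R)"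
    have U: "submod R X U" using submod_image[OF lx submod_carrier[OF regular_left_module]] by (simp add: U_def)
    note mU = submod_module[OF X U]
    have cod: "lin R (regular_module R) (X\<lparr>carrier := U\<rparr>) (\<lambda>a. a \<odot>\<^bsub>X\<^esub> x)"
      using lin_simps[OF lx] by (intro linI[OF regular_left_module mU(1)]) (auto simp: U_def)
    obtain h where h: "lin R (X\<lparr>carrier := U\<rparr>) (regular_module R) h" "\<forall>a\<in>carrier (regular_module R). h (a \<odot>\<^bsub>X\<^esub> x) = a \<otimes> y"
      using lin_factor[OF cod _ ly] y(3) by (auto simp: U_def I_def regular_module_def)
    obtain g where g: "lin R X (regular_module R) g" "\<forall>u\<in>U. g u = h u"
      using extend_to_regular[OF mU(2) _ h(1)] by auto
    have "x \<in> U" unfolding U_def by (rule image_eqI[of _ _ \<one>]) (use x in \<open>simp_all add: lm_one[OF X] regular_module_def\<close>)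
    then have gx: "g x = y" using g(2) h(2)[rule_format, of \<one>] x y by (simp add: lm_one[OF X] regular_module_def)
    define j where "j z = prc (i z) (e (g z))" for z
    have j: "lin R X (dsum E Acopy) j"
      unfolding j_def by (rule lin_pair[OF inf E(2) lin_comp[OF g(1) Acopy(1)]])
    have "ker (dsum E Acopy, j) = ker (E, i)"
      by (rule min[OF pif_dsum[OF E(1) pif_Acopy] j]) (auto simp: ker_def j_def dsum_simps[OF inf])
    then have "j x = \<zero>\<^bsub>dsum E Acopy\<^esub>" using x by (auto simp: ker_def)
    then have "e y = \<zero>\<^bsub>Acopy\<^esub>" by (simp add: j_def dsum_simps[OF inf] gx)
    then have "e y = e \<zero>" using lin_simps(4)[OF Acopy(1)] by (simp add: regular_module_def)
    then show False using y(1,2) e by (metis inj_onD zero_closed)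
  qed
  then show ?thesis using E lin_inj_iff[OF E(2)] by blast
qed

text \<open>
  Dually, a map from such a module to \<open>X\<close> with maximal image is surjective.
\<close>

lemma ex_cover:
  fixes X :: "('a, 'm) module"
  assumes X: "left_module R X" and fl: "finlen K X"
  shows "\<exists>P p. pif P \<and> lin R P X p \<and> p ` carrier P = carrier X"
proof -
  define P where "P = (\<lambda>(E, i). pif E \<and> lin R E X i)"
  define im where "im = (\<lambda>(E :: ('a, 'm) module, i :: 'm \<Rightarrow> 'm). i ` carrier E)"
  have P0: "P (Zero, \<lambda>x. \<zero>\<^bsub>X\<^esub>)"
    using pif_Zero lin_zero[OF Zero_module(1) X] by (simp add: P_def)
  have "subsp K X (im Ei)" if "P Ei" for Ei
    using that submod_subsp[OF K X submod_image[OF _ submod_carrier[OF pif_module]]] by (auto simp: P_def im_def)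
  then have "\<exists>x. P x \<and> (\<forall>y. P y \<longrightarrow> im x \<subseteq> im y \<longrightarrow> im y = im x)"
    by (rule finlen_maximal[of K R X P, OF K X fl P0])
  then obtain Ei where Ei: "P Ei" "\<And>Fj. P Fj \<Longrightarrow> im Ei \<subseteq> im Fj \<Longrightarrow> im Fj = im Ei" by blast
  obtain E i where "Ei = (E, i)" by (cases Ei)
  then have E: "pif E" "lin R E X i"
    and max: "\<And>F j. pif F \<Longrightarrow> lin R F X j \<Longrightarrow> im (E, i) \<subseteq> im (F, j) \<Longrightarrow> im (F, j) = im (E, i)"
    using Ei by (auto simp: P_def)
  note mE = pif_module[OF E(1)] and mA = pif_module[OF pif_Acopy]
  have "x \<in> i ` carrier E" if x: "x \<in> carrier X" for x
  proof -
    obtain f where f: "lin R Acopy X f" "f (e \<one>) = x" using ex_lin_from_Acopy[OF X x] by blast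
    define j where "j u = i (fs u) \<oplus>\<^bsub>X\<^esub> f (sn u)" for u
    have j: "lin R (dsum E Acopy) X j" unfolding j_def by (rule lin_copair[OF inf E(2) f(1)])
    have j1: "j (prc y \<zero>\<^bsub>Acopy\<^esub>) = i y" if "y \<in> carrier E" for y
      using that lin_closed[OF E(2)] by (simp add: j_def prc_simps[OF inf] lin_simps[OF f(1)] lm_add[OF X])
    have "im (dsum E Acopy, j) = im (E, i)"
    proof (rule max[OF pif_dsum[OF E(1) pif_Acopy] j])
      show "im (E, i) \<subseteq> im (dsum E Acopy, j)"
      proof
        fix z assume "z \<in> im (E, i)"
        then obtain y where y: "y \<in> carrier E" "z = i y" by (auto simp: im_def)
        then have "z = j (prc y \<zero>\<^bsub>Acopy\<^esub>)" "prc y \<zero>\<^bsub>Acopy\<^esub> \<in> carrier (dsum E Acopy)"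
          by (simp_all add: j1 dsum_simps[OF inf] lm_closed[OF mA])
        then show "z \<in> im (dsum E Acopy, j)" by (auto simp: im_def)
      qed
    qed
    moreover have "j (prc \<zero>\<^bsub>E\<^esub> (e \<one>)) = x" using x by (simp add: j_def prc_simps[OF inf] lin_simps[OF E(2)] f lm_add[OF X])
    moreover have "prc \<zero>\<^bsub>E\<^esub> (e \<one>) \<in> carrier (dsum E Acopy)"
      using Acopy(2) by (auto simp: dsum_simps[OF inf] lm_closed[OF mE])
    ultimately show ?thesis by (auto simp: im_def)
  qed
  then show ?thesis using E lin_closed[OF E(2)] by blast
qed

end

section \<open>Maps factoring through projective modules\<close>

context self_injective_algebra
begin

definition fl :: "('a, 'm) module \<Rightarrow> bool" where
  "fl X \<longleftrightarrow> left_module R X \<and> finlen K X"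

text \<open>The maps that are zero in the stable category.\<close>

definition stz :: "('a, 'm) module \<Rightarrow> ('a, 'm) module \<Rightarrow> ('m \<Rightarrow> 'm) \<Rightarrow> bool" where
  "stz X Y f \<longleftrightarrow> (\<exists>(P :: ('a, 'm) module) g h. projective R P \<and> lin R X P g \<and> lin R P Y h \<and>
     (\<forall>x\<in>carrier X. f x = h (g x)))"

lemma stzE:
  assumes "stz X Y f"
  obtains P :: "('a, 'm) module" and g h where "projective R P" "lin R X P g" "lin R P Y h"
    "\<forall>x\<in>carrier X. f x = h (g x)"
  using assms unfolding stz_def by blast

lemma flD: "fl X \<Longrightarrow> left_module R X" "fl X \<Longrightarrow> finlen K X"
  by (auto simp: fl_def)

lemma fl_pif: "pif P \<Longrightarrow> fl P"
  using pif_module by (auto simp: fl_def pif_def)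

lemma fl_dsum: "fl X \<Longrightarrow> fl Y \<Longrightarrow> fl (dsum X Y)"
  using finlen_dsum dsum_module[OF inf] by (auto simp: fl_def)

lemma fl_ses:
  fixes X Y Z :: "('a, 'm) module"
  assumes "ses R X Y Z f g"
  shows "fl X \<Longrightarrow> fl Z \<Longrightarrow> fl Y" "fl Y \<Longrightarrow> fl X" "fl Y \<Longrightarrow> fl Z"
  using finlen_ses[OF K assms] finlen_inj[OF K sesD(1,3)[OF assms]] finlen_image[OF K sesD(2,4)[OF assms]]
    sesD(7,8,9)[OF assms] by (auto simp: fl_def)

lemma stz_via:
  fixes P X Y :: "('a, 'm) module"
  shows "projective R P \<Longrightarrow> lin R X P g \<Longrightarrow> lin R P Y h \<Longrightarrow> stz X Y (\<lambda>x. h (g x))"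
  by (auto simp: stz_def)

lemma stz_lin: "stz X Y f \<Longrightarrow> lin R X Y f"
  by (erule stzE, rule lin_cong, erule (1) lin_comp) auto

lemma stz_cong: "stz X Y f \<Longrightarrow> (\<And>x. x \<in> carrier X \<Longrightarrow> f x = g x) \<Longrightarrow> stz X Y g"
  unfolding stz_def by metis

lemma stz_post:
  assumes f: "stz X Y f" and g: "lin R Y Z g" shows "stz X Z (\<lambda>x. g (f x))"
proof -
  obtain P :: "('a, 'm) module" and a b where *: "projective R P" "lin R X P a" "lin R P Y b" "\<forall>x\<in>carrier X. f x = b (a x)"
    using f by (rule stzE)
  show ?thesis by (rule stz_cong[OF stz_via[OF *(1,2) lin_comp[OF *(3) g]]]) (use *(4) in simp)
qed

lemma stz_pre:
  assumes f: "stz Y Z f" and g: "lin R X Y g" shows "stz X Z (\<lambda>x. f (g x))"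
proof -
  obtain P :: "('a, 'm) module" and a b where *: "projective R P" "lin R Y P a" "lin R P Z b" "\<forall>x\<in>carrier Y. f x = b (a x)"
    using f by (rule stzE)
  show ?thesis by (rule stz_cong[OF stz_via[OF *(1) lin_comp[OF g *(2)] *(3)]]) (use *(4) lin_closed[OF g] in simp)
qed

lemma stz_add:
  assumes f: "stz X Y f" and g: "stz X Y g" shows "stz X Y (\<lambda>x. f x \<oplus>\<^bsub>Y\<^esub> g x)"
proof -
  obtain P :: "('a, 'm) module" and a b where *: "projective R P" "lin R X P a" "lin R P Y b" "\<forall>x\<in>carrier X. f x = b (a x)"
    using f by (rule stzE)
  obtain Q :: "('a, 'm) module" and c d where **: "projective R Q" "lin R X Q c" "lin R Q Y d" "\<forall>x\<in>carrier X. g x = d (c x)"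
    using g by (rule stzE)
  show ?thesis
    by (rule stz_cong[OF stz_via[OF projective_dsum[OF *(1) **(1)] lin_pair[OF inf *(2) **(2)] lin_copair[OF inf *(3) **(3)]]])
      (use *(4) **(4) in \<open>simp add: prc_simps[OF inf]\<close>)
qed

lemma lin_neg: "lin R X Y f \<Longrightarrow> lin R X Y (\<lambda>x. \<ominus>\<^bsub>Y\<^esub> f x)"
  by (rule lin_cong[OF lin_sub[OF lin_zero[OF lin_mods]]]) (auto simp: lm_add[OF lin_mods(2)] lin_closed)

lemma stz_neg:
  assumes f: "stz X Y f" shows "stz X Y (\<lambda>x. \<ominus>\<^bsub>Y\<^esub> f x)"
  using stz_post[OF f lin_neg[OF lin_id[OF lin_mods(2)[OF stz_lin[OF f]]]]] .

lemma stz_sub: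
  assumes f: "stz X Y f" and g: "stz X Y g" shows "stz X Y (\<lambda>x. f x \<ominus>\<^bsub>Y\<^esub> g x)"
  unfolding a_minus_def by (rule stz_add[OF f stz_neg[OF g]])

lemma stz_zero: "left_module R X \<Longrightarrow> left_module R Y \<Longrightarrow> stz X Y (\<lambda>x. \<zero>\<^bsub>Y\<^esub>)"
  by (rule stz_via[OF _ lin_zero lin_zero, of Zero]) (use pif_Zero Zero_module in \<open>auto simp: pif_def\<close>)

lemma stz_to_projective: "projective R Y \<Longrightarrow> lin R X Y f \<Longrightarrow> stz X (Y :: ('a, 'm) module) f"
  by (rule stz_via[of Y X f Y "\<lambda>x. x"]) (auto intro: lin_id lin_mods)

lemma stz_from_projective: "projective R X \<Longrightarrow> lin R X Y f \<Longrightarrow> stz (X :: ('a, 'm) module) Y f"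
  by (rule stz_via[of X X "\<lambda>x. x" Y f]) (auto intro: lin_id lin_mods)

text \<open>
  A projective module that maps to \<open>Y\<close> can be replaced by any surjection onto \<open>Y\<close>, in particular by one of finite length.
\<close>

lemma stz_through_pif:
  assumes f: "stz X Y f" and Y: "fl Y"
  shows "\<exists>E g h. pif E \<and> lin R X E g \<and> lin R E Y h \<and> h ` carrier E = carrier Y \<and> (\<forall>x\<in>carrier X. f x = h (g x))"
proof -
  obtain P :: "('a, 'm) module" and a b where *: "projective R P" "lin R X P a" "lin R P Y b" "\<forall>x\<in>carrier X. f x = b (a x)"
    using f by (rule stzE)
  obtain E h where E: "pif E" "lin R E Y h" "h ` carrier E = carrier Y" using ex_cover[OF flD[OF Y]] by blast
  obtain c where c: "lin R P E c" "\<forall>x\<in>carrier P. h (c x) = b x" using projective_lift[OF *(1) E(2,3) *(3)] by blast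
  have "lin R X E (\<lambda>x. c (a x))" by (rule lin_comp[OF *(2) c(1)])
  moreover have "\<forall>x\<in>carrier X. f x = h (c (a x))" using *(4) c(2) lin_closed[OF *(2)] by simp
  ultimately show ?thesis using E by blast
qed

text \<open>
  Stably zero maps extend along monomorphisms, because they factor through a projective module of finite
  length and such a module is injective.
\<close>

lemma stz_extends:
  fixes M :: "('a, 'm) module"
  assumes f: "stz X Y f" and Y: "fl Y" and i: "lin R X M i" "inj_on i (carrier X)"
  shows "\<exists>u. lin R M Y u \<and> (\<forall>x\<in>carrier X. f x = u (i x))"
proof -
  obtain E g h where E: "pif E" "lin R X E g" "lin R E Y h" "\<forall>x\<in>carrier X. f x = h (g x)"
    using stz_through_pif[OF f Y] by blast
  obtain v where v: "lin R M E v" "\<forall>x\<in>carrier X. v (i x) = g x"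
    using injective_extend[OF _ i E(2)] E(1) by (auto simp: pif_def)
  show ?thesis
    by (rule exI[of _ "\<lambda>x. h (v x)"]) (use lin_comp[OF v(1) E(3)] v(2) E(4) in simp)
qed

lemma pif_of_stz_id:
  assumes X: "fl X" and f: "stz X X (\<lambda>x. x)"
  shows "pif X"
proof -
  obtain E i where E: "pif E" "lin R X E i" "inj_on i (carrier X)" using ex_embedding[OF flD[OF X]] by blast
  obtain u where u: "lin R E X u" "\<forall>x\<in>carrier X. x = u (i x)" using stz_extends[OF f X E(2,3)] by blast
  show ?thesis by (rule pif_retract[OF E(1,2) u(1)]) (use u(2) in simp)
qed

section \<open>Short exact sequences\<close>

lemma sesI:
  assumes f: "lin R L M f" and g: "lin R M N g"
    and inj: "\<And>x. x \<in> carrier L \<Longrightarrow> f x = \<zero>\<^bsub>M\<^esub> \<Longrightarrow> x = \<zero>\<^bsub>L\<^esub>"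
    and surj: "\<And>z. z \<in> carrier N \<Longrightarrow> \<exists>y\<in>carrier M. g y = z"
    and zero: "\<And>x. x \<in> carrier L \<Longrightarrow> g (f x) = \<zero>\<^bsub>N\<^esub>"
    and ex: "\<And>y. y \<in> carrier M \<Longrightarrow> g y = \<zero>\<^bsub>N\<^esub> \<Longrightarrow> \<exists>x\<in>carrier L. f x = y"
  shows "ses R L M N f g"
proof -
  have "inj_on f (carrier L)" using inj lin_inj_iff[OF f] by blast
  moreover have "g ` carrier M = carrier N" using surj lin_closed[OF g] by blast
  moreover have "\<forall>x\<in>carrier M. g x = \<zero>\<^bsub>N\<^esub> \<longleftrightarrow> x \<in> f ` carrier L" using zero ex by blast
  ultimately show ?thesis using f g by (simp add: ses_def)
qed

lemma sesE:
  assumes s: "ses R L M N f g"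
  shows "x \<in> carrier L \<Longrightarrow> f x = \<zero>\<^bsub>M\<^esub> \<Longrightarrow> x = \<zero>\<^bsub>L\<^esub>"
    and "z \<in> carrier N \<Longrightarrow> \<exists>y\<in>carrier M. g y = z"
    and "y \<in> carrier M \<Longrightarrow> g y = \<zero>\<^bsub>N\<^esub> \<Longrightarrow> \<exists>x\<in>carrier L. f x = y"
proof -
  show "x \<in> carrier L \<Longrightarrow> f x = \<zero>\<^bsub>M\<^esub> \<Longrightarrow> x = \<zero>\<^bsub>L\<^esub>"
    using lin_inj_iff[OF sesD(1)[OF s]] sesD(3)[OF s] by blast
  show "z \<in> carrier N \<Longrightarrow> \<exists>y\<in>carrier M. g y = z" using sesD(4)[OF s] by (metis imageE)
  show "y \<in> carrier M \<Longrightarrow> g y = \<zero>\<^bsub>N\<^esub> \<Longrightarrow> \<exists>x\<in>carrier L. f x = y" using sesD(5)[OF s] by (metis imageE)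
qed

lemma ses_split:
  fixes X Y Q :: "('a, 'm) module"
  assumes s: "ses R X Y Q i p" and Q: "projective R Q"
  shows "\<exists>sg r. lin R Q Y sg \<and> lin R Y X r \<and> (\<forall>q\<in>carrier Q. p (sg q) = q) \<and> (\<forall>x\<in>carrier X. r (i x) = x) \<and>
    (\<forall>q\<in>carrier Q. r (sg q) = \<zero>\<^bsub>X\<^esub>) \<and> (\<forall>y\<in>carrier Y. i (r y) \<oplus>\<^bsub>Y\<^esub> sg (p y) = y)"
proof -
  note i = sesD(1)[OF s] and p = sesD(2)[OF s] and mX = sesD(7)[OF s] and Y = sesD(8)[OF s] and mQ = sesD(9)[OF s]
  obtain sg where sg: "lin R Q Y sg" "\<forall>q\<in>carrier Q. p (sg q) = q"
    using projective_lift[OF Q p sesD(4)[OF s] lin_id[OF mQ]] by blast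
  note ps = lin_comp[OF p sg(1)]
  have c: "sg (p y) \<in> carrier Y" if "y \<in> carrier Y" for y using lin_closed[OF ps that] .
  have "\<exists>r. lin R Y X r \<and> (\<forall>y\<in>carrier Y. i (r y) = y \<ominus>\<^bsub>Y\<^esub> sg (p y))"
  proof (rule lin_corestrict[OF i sesD(3)[OF s] lin_sub[OF lin_id[OF Y] ps]])
    fix y assume y: "y \<in> carrier Y"
    have "p (y \<ominus>\<^bsub>Y\<^esub> sg (p y)) = \<zero>\<^bsub>Q\<^esub>"
      using y c[OF y] sg(2) lin_closed[OF p y] by (simp add: lin_simps[OF p] lm_add[OF mQ])
    then show "y \<ominus>\<^bsub>Y\<^esub> sg (p y) \<in> i ` carrier X" using sesD(5)[OF s] lm_closed(4)[OF Y y c[OF y]] by blast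
  qed
  then obtain r where r: "lin R Y X r" "\<forall>y\<in>carrier Y. i (r y) = y \<ominus>\<^bsub>Y\<^esub> sg (p y)" by blast
  have "r (i x) = x" if x: "x \<in> carrier X" for x
  proof -
    have "i (r (i x)) = i x"
      using r(2) x lin_closed[OF i x] by (simp add: sesD(6)[OF s] lin_simps[OF sg(1)] lm_add[OF Y])
    then show ?thesis using sesD(3)[OF s] x lin_closed[OF i x] lin_closed[OF r(1)] by (metis inj_onD)
  qed
  moreover have "r (sg q) = \<zero>\<^bsub>X\<^esub>" if q: "q \<in> carrier Q" for q
  proof -
    have "i (r (sg q)) = \<zero>\<^bsub>Y\<^esub>"
      using r(2) q sg(2) lin_closed[OF sg(1) q] by (simp add: lm_add[OF Y])
    then show ?thesis using sesE(1)[OF s] lin_closed[OF r(1) lin_closed[OF sg(1) q]] by blast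
  qed
  moreover have "i (r y) \<oplus>\<^bsub>Y\<^esub> sg (p y) = y" if y: "y \<in> carrier Y" for y
    using r(2) y c[OF y] by (simp add: lm_cancel[OF Y])
  ultimately show ?thesis using sg r(1) by blast
qed

lemma ses_reverse:
  fixes X Y Q :: "('a, 'm) module"
  assumes s: "ses R X Y Q i p" and sg: "lin R Q Y sg" and r: "lin R Y X r"
    and eq: "\<forall>q\<in>carrier Q. p (sg q) = q" "\<forall>x\<in>carrier X. r (i x) = x" "\<forall>q\<in>carrier Q. r (sg q) = \<zero>\<^bsub>X\<^esub>"
      "\<forall>y\<in>carrier Y. i (r y) \<oplus>\<^bsub>Y\<^esub> sg (p y) = y"
  shows "ses R Q Y X sg r"
proof (rule sesI[OF sg r])
  fix q assume q: "q \<in> carrier Q" "sg q = \<zero>\<^bsub>Y\<^esub>"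
  then have "q = p \<zero>\<^bsub>Y\<^esub>" using eq(1) by metis
  then show "q = \<zero>\<^bsub>Q\<^esub>" using lin_simps(4)[OF sesD(2)[OF s]] by simp
next
  fix x assume "x \<in> carrier X"
  then show "\<exists>y\<in>carrier Y. r y = x" using eq(2) lin_closed[OF sesD(1)[OF s]] by blast
next
  fix y assume y: "y \<in> carrier Y" "r y = \<zero>\<^bsub>X\<^esub>"
  have c: "sg (p y) \<in> carrier Y" using lin_closed[OF sg lin_closed[OF sesD(2)[OF s] y(1)]] .
  have "\<zero>\<^bsub>Y\<^esub> \<oplus>\<^bsub>Y\<^esub> sg (p y) = y" using eq(4) y lin_simps(4)[OF sesD(1)[OF s]] by metis
  then have "sg (p y) = y" using c by (simp add: lm_add[OF sesD(8)[OF s]])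
  then show "\<exists>q\<in>carrier Q. sg q = y" using lin_closed[OF sesD(2)[OF s] y(1)] by blast
qed (use eq(3) in blast)

lemma pif_ses:
  fixes X Y Q :: "('a, 'm) module"
  assumes s: "ses R X Y Q i p" and X: "pif X" and Q: "pif Q"
  shows "pif Y"
proof -
  obtain sg r where *: "lin R Q Y sg" "lin R Y X r" "\<forall>y\<in>carrier Y. i (r y) \<oplus>\<^bsub>Y\<^esub> sg (p y) = y"
    using ses_split[OF s] Q by (auto simp: pif_def)
  show ?thesis
    by (rule pif_retract[OF pif_dsum[OF X Q] lin_pair[OF inf *(2) sesD(2)[OF s]] lin_copair[OF inf sesD(1)[OF s] *(1)]])
      (use *(3) in \<open>simp add: prc_simps[OF inf]\<close>)
qed

lemma pif_sub:
  fixes X Y Q :: "('a, 'm) module"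
  assumes s: "ses R X Y Q i p" and Q: "pif Q" and Y: "pif Y"
  shows "pif X"
proof -
  obtain r where "lin R Y X r" "\<forall>x\<in>carrier X. r (i x) = x"
    using ses_split[OF s] Q by (auto simp: pif_def)
  then show ?thesis using pif_retract[OF Y sesD(1)[OF s]] by blast
qed

text \<open>
  For \<open>X \<subseteq> Y \<subseteq> Z\<close> the quotient \<open>Z/X\<close> is an extension of \<open>Z/Y\<close> by \<open>Y/X\<close>.
\<close>

lemma ses_trans:
  fixes X Y Q Z Q' :: "('a, 'm) module"
  assumes s: "ses R X Y Q i p" and t: "ses R Y Z Q' j q"
  shows "\<exists>(W :: ('a, 'm) module) k a b. ses R X Z W (\<lambda>x. j (i x)) k \<and> ses R Q W Q' a b"
proof -
  note i = sesD(1)[OF s] and p = sesD(2)[OF s] and j = sesD(1)[OF t] and q = sesD(2)[OF t]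
  have "inj_on (\<lambda>x. j (i x)) (carrier X)"
    using sesE(1)[OF t] sesE(1)[OF s] lin_closed[OF i] lin_inj_iff[OF lin_comp[OF i j]] by blast
  then obtain W :: "('a, 'm) module" and k where w: "ses R X Z W (\<lambda>x. j (i x)) k"
    using ses_cokernel[OF lin_comp[OF i j]] by blast
  note k = sesD(2)[OF w]
  obtain a where a: "lin R Q W a" "\<forall>y\<in>carrier Y. a (p y) = k (j y)"
    using ses_factor[OF s lin_comp[OF j k]] sesD(6)[OF w] by blast
  obtain b where b: "lin R W Q' b" "\<forall>z\<in>carrier Z. b (k z) = q z"
    using ses_factor[OF w q] sesD(6)[OF t] lin_closed[OF i] by blast
  have "ses R Q W Q' a b"
  proof (rule sesI[OF a(1) b(1)])
    fix x assume x: "x \<in> carrier Q" "a x = \<zero>\<^bsub>W\<^esub>"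
    obtain y where y: "y \<in> carrier Y" "p y = x" using sesE(2)[OF s x(1)] by blast
    then have "k (j y) = \<zero>\<^bsub>W\<^esub>" using a(2) x(2) by metis
    then obtain x' where x': "x' \<in> carrier X" "j (i x') = j y" using sesE(3)[OF w lin_closed[OF j y(1)]] by blast
    then have "i x' = y" using sesD(3)[OF t] lin_closed[OF i] y(1) by (metis inj_onD)
    then show "x = \<zero>\<^bsub>Q\<^esub>" using sesD(6)[OF s x'(1)] y(2) by simp
  next
    fix z assume "z \<in> carrier Q'"
    then obtain y where "y \<in> carrier Z" "q y = z" using sesE(2)[OF t] by blast
    then show "\<exists>w\<in>carrier W. b w = z" using b(2) lin_closed[OF k] by metis
  next
    fix x assume "x \<in> carrier Q"
    then obtain y where y: "y \<in> carrier Y" "p y = x" using sesE(2)[OF s] by blast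
    then show "b (a x) = \<zero>\<^bsub>Q'\<^esub>" using a(2) b(2) sesD(6)[OF t] lin_closed[OF j] by metis
  next
    fix w' assume w': "w' \<in> carrier W" "b w' = \<zero>\<^bsub>Q'\<^esub>"
    obtain z where z: "z \<in> carrier Z" "k z = w'" using sesE(2)[OF w w'(1)] by blast
    then have "q z = \<zero>\<^bsub>Q'\<^esub>" using b(2) w'(2) by metis
    then obtain y where "y \<in> carrier Y" "j y = z" using sesE(3)[OF t z(1)] by blast
    then show "\<exists>x\<in>carrier Q. a x = w'" using a(2) z(2) lin_closed[OF p] by metis
  qed
  then show ?thesis using w by blast
qed

text \<open>
  The module \<open>Z\<close> is the preimage of \<open>X' \<subseteq> V\<close> in \<open>Y\<close>.
\<close>

lemma ses_pullback:
  fixes S Y V X' T :: "('a, 'm) module"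
  assumes s: "ses R S Y V a b" and t: "ses R X' V T f g"
  shows "\<exists>(Z :: ('a, 'm) module) c d h k. ses R S Z X' c d \<and> ses R Z Y T h k"
proof -
  note a = sesD(1)[OF s] and b = sesD(2)[OF s] and f = sesD(1)[OF t] and g = sesD(2)[OF t] and mY = sesD(8)[OF s]
  note gb = lin_comp[OF b g]
  define U where "U = {y \<in> carrier Y. g (b y) = \<zero>\<^bsub>T\<^esub>}"
  have U: "submod R Y U" unfolding U_def by (rule submod_ker[OF gb])
  let ?Z = "Y\<lparr>carrier := U\<rparr>"
  note mZ = submod_module[OF mY U]
  have UY: "u \<in> U \<Longrightarrow> u \<in> carrier Y" for u by (simp add: U_def)
  have bU: "lin R ?Z V b" by (rule lin_comp[OF mZ(2) b])
  obtain d where d: "lin R ?Z X' d" "\<forall>z\<in>U. f (d z) = b z"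
    using lin_corestrict[OF f sesD(3)[OF t] bU] sesD(5)[OF t] lin_closed[OF b] by (auto simp: U_def)
  have aU: "a x \<in> U" if "x \<in> carrier S" for x
    using that lin_closed[OF a] by (simp add: U_def sesD(6)[OF s] lin_simps[OF g])
  have a': "lin R S ?Z a"
    by (rule linI[OF lin_mods(1)[OF a] mZ(1)]) (use aU in \<open>simp_all add: lin_simps[OF a]\<close>)
  have "ses R S ?Z X' a d"
  proof (rule sesI[OF a' d(1)])
    show "x \<in> carrier S \<Longrightarrow> a x = \<zero>\<^bsub>?Z\<^esub> \<Longrightarrow> x = \<zero>\<^bsub>S\<^esub>" for x using sesE(1)[OF s] by simp
  next
    fix z assume z: "z \<in> carrier X'"
    obtain y where y: "y \<in> carrier Y" "b y = f z" using sesE(2)[OF s lin_closed[OF f z]] by blast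
    then have yU: "y \<in> U" using sesD(6)[OF t z] by (simp add: U_def)
    then have "f (d y) = f z" using d(2) y by simp
    then have "d y = z" using sesD(3)[OF t] z lin_closed[OF d(1)] yU by (auto dest: inj_onD)
    then show "\<exists>y\<in>carrier ?Z. d y = z" using yU by auto
  next
    fix x assume x: "x \<in> carrier S"
    have "f (d (a x)) = \<zero>\<^bsub>V\<^esub>" using d(2) aU[OF x] sesD(6)[OF s x] by simp
    then show "d (a x) = \<zero>\<^bsub>X'\<^esub>" using sesE(1)[OF t] lin_closed[OF d(1)] aU[OF x] by simp
  next
    fix y assume y: "y \<in> carrier ?Z" "d y = \<zero>\<^bsub>X'\<^esub>"
    then have "b y = \<zero>\<^bsub>V\<^esub>" using d(2) lin_simps(4)[OF f] by force
    then show "\<exists>x\<in>carrier S. a x = y" using sesE(3)[OF s UY] y by simp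
  qed
  moreover have "ses R ?Z Y T (\<lambda>x. x) (\<lambda>y. g (b y))"
  proof (rule sesI[OF mZ(2) gb])
    fix z assume "z \<in> carrier T"
    then obtain v where v: "v \<in> carrier V" "g v = z" using sesE(2)[OF t] by blast
    then obtain y where "y \<in> carrier Y" "b y = v" using sesE(2)[OF s] by blast
    then show "\<exists>y\<in>carrier Y. g (b y) = z" using v by blast
  qed (auto simp: U_def)
  ultimately show ?thesis by blast
qed

section \<open>Cones\<close>

text \<open>
  For \<open>f : S \<rightarrow> X\<close> and an embedding \<open>\<iota> : S \<rightarrow> I\<close> into an injective module, the cone of \<open>f\<close> in the stable category is
  the cokernel of \<open>(f, \<iota>) : S \<rightarrow> X \<oplus> I\<close>.  Working with this cokernel replaces triangles by exact sequences.
\<close>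

lemma cone_exists:
  fixes S X I :: "('a, 'm) module"
  assumes f: "lin R S X f" and \<iota>: "lin R S I \<iota>" "inj_on \<iota> (carrier S)"
  shows "\<exists>(C :: ('a, 'm) module) c. ses R S (dsum X I) C (\<lambda>s. prc (f s) (\<iota> s)) c"
  by (rule ses_cokernel[OF lin_pair[OF inf f \<iota>(1)]])
    (use \<iota>(2) in \<open>auto simp: inj_on_def dsum_simps[OF inf]\<close>)

lemma dsum_split:
  fixes V I :: "('a, 'm) module"
  assumes V: "left_module R V" and I: "left_module R I" and w: "w \<in> carrier (dsum V I)"
  shows "fs w \<in> carrier V" "sn w \<in> carrier I" "w = prc (fs w) (sn w)"
  using w by (auto simp: dsum_carrier[OF inf])

text \<open>The octahedral axiom for \<open>p \<circ> f\<close> in terms of modules.\<close>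

lemma cone_quotient:
  fixes S X V T I C D :: "('a, 'm) module"
  assumes s: "ses R X V T i p" and f: "lin R S V f" and \<iota>: "lin R S I \<iota>" "inj_on \<iota> (carrier S)"
    and D: "ses R S (dsum V I) D (\<lambda>s. prc (f s) (\<iota> s)) d"
    and E: "ses R S (dsum T I) E (\<lambda>s. prc (p (f s)) (\<iota> s)) c"
  shows "\<exists>a b. ses R X D E a b"
proof -
  note i = sesD(1)[OF s] and p = sesD(2)[OF s] and d = sesD(2)[OF D] and c = sesD(2)[OF E]
  note mV = sesD(8)[OF s] and mT = sesD(9)[OF s] and mI = lin_mods(2)[OF \<iota>(1)] and mS = lin_mods(1)[OF f]
  note VI = dsum_split[OF mV mI] and TI = dsum_split[OF mT mI] and dv = lin_dsum[OF inf mV mI]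
  note ds = dsum_simps[OF inf] and pr = prc_simps[OF inf]
  have a: "lin R X D (\<lambda>x. d (prc (i x) \<zero>\<^bsub>I\<^esub>))"
    by (rule lin_comp[OF lin_comp[OF i dv(1)] d])
  have h: "lin R (dsum V I) E (\<lambda>w. c (prc (p (fs w)) (sn w)))"
    by (rule lin_comp[OF lin_pair[OF inf lin_comp[OF dv(3) p] dv(4)] c])
  obtain b where b: "lin R D E b" "\<forall>w\<in>carrier (dsum V I). b (d w) = c (prc (p (fs w)) (sn w))"
    using ses_factor[OF D h] sesD(6)[OF E] by (auto simp: pr)
  have "ses R X D E (\<lambda>x. d (prc (i x) \<zero>\<^bsub>I\<^esub>)) b"
  proof (rule sesI[OF a b(1)])
    fix x assume x: "x \<in> carrier X" "d (prc (i x) \<zero>\<^bsub>I\<^esub>) = \<zero>\<^bsub>D\<^esub>"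
    then obtain t where t: "t \<in> carrier S" "prc (f t) (\<iota> t) = prc (i x) \<zero>\<^bsub>I\<^esub>"
      using sesE(3)[OF D, of "prc (i x) \<zero>\<^bsub>I\<^esub>"] lin_closed[OF i] lm_closed(2)[OF mI] by (auto simp: ds)
    then have "t = \<zero>\<^bsub>S\<^esub>" using \<iota>(2) lin_inj_iff[OF \<iota>(1)] by (auto simp: ds)
    then have "i x = \<zero>\<^bsub>V\<^esub>" using t lin_simps(4)[OF f] by (simp add: ds)
    then show "x = \<zero>\<^bsub>X\<^esub>" using sesE(1)[OF s] x by blast
  next
    fix z assume "z \<in> carrier E"
    then obtain w where w: "w \<in> carrier (dsum T I)" "c w = z" using sesE(2)[OF E] by blast
    then obtain v where v: "v \<in> carrier V" "p v = fs w" using sesE(2)[OF s] TI(1) by blast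
    have vw: "prc v (sn w) \<in> carrier (dsum V I)" using v TI(2)[OF w(1)] by (simp add: ds)
    then have "b (d (prc v (sn w))) = z" using b(2) v w TI(3)[OF w(1)] by (simp add: pr)
    then show "\<exists>y\<in>carrier D. b y = z" using lin_closed[OF d vw] by blast
  next
    fix x assume x: "x \<in> carrier X"
    have "prc (i x) \<zero>\<^bsub>I\<^esub> \<in> carrier (dsum V I)" using x lin_closed[OF i] lm_closed(2)[OF mI] by (simp add: ds)
    then have "b (d (prc (i x) \<zero>\<^bsub>I\<^esub>)) = c \<zero>\<^bsub>dsum T I\<^esub>" using b(2) sesD(6)[OF s x] by (simp add: pr ds)
    then show "b (d (prc (i x) \<zero>\<^bsub>I\<^esub>)) = \<zero>\<^bsub>E\<^esub>" using lin_simps(4)[OF c] by simp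
  next
    fix y assume y: "y \<in> carrier D" "b y = \<zero>\<^bsub>E\<^esub>"
    obtain w where w: "w \<in> carrier (dsum V I)" "d w = y" using sesE(2)[OF D y(1)] by blast
    note w' = VI[OF w(1)]
    have "c (prc (p (fs w)) (sn w)) = \<zero>\<^bsub>E\<^esub>" using b(2) w y(2) by auto
    then obtain t where t: "t \<in> carrier S" "p (f t) = p (fs w)" "\<iota> t = sn w"
      using sesE(3)[OF E, of "prc (p (fs w)) (sn w)"] lin_closed[OF p w'(1)] w'(2) by (auto simp: ds)
    note ft = lin_closed[OF f t(1)]
    have "p (fs w \<ominus>\<^bsub>V\<^esub> f t) = \<zero>\<^bsub>T\<^esub>"
      using t w'(1) ft lin_closed[OF p] by (simp add: lin_simps[OF p] lm_add[OF mT])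
    then obtain x where x: "x \<in> carrier X" "i x = fs w \<ominus>\<^bsub>V\<^esub> f t"
      using sesE(3)[OF s] lm_closed(4)[OF mV w'(1) ft] by blast
    have m: "prc (i x) \<zero>\<^bsub>I\<^esub> \<in> carrier (dsum V I)" "prc (f t) (\<iota> t) \<in> carrier (dsum V I)"
      using lin_closed[OF i x(1)] lm_closed(2)[OF mI] ft lin_closed[OF \<iota>(1) t(1)] by (simp_all add: ds)
    have "w = prc (i x) \<zero>\<^bsub>I\<^esub> \<oplus>\<^bsub>dsum V I\<^esub> prc (f t) (\<iota> t)"
      using w' x t ft by (simp add: ds lm_cancel[OF mV] lm_add[OF mI])
    then have "d w = d (prc (i x) \<zero>\<^bsub>I\<^esub>) \<oplus>\<^bsub>D\<^esub> \<zero>\<^bsub>D\<^esub>"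
      using m sesD(6)[OF D t(1)] by (simp add: lin_simps[OF d])
    then have "d (prc (i x) \<zero>\<^bsub>I\<^esub>) = y"
      using w(2) lin_closed[OF d m(1)] by (simp add: lm_add[OF sesD(9)[OF D]])
    then show "\<exists>x\<in>carrier X. d (prc (i x) \<zero>\<^bsub>I\<^esub>) = y" using x(1) by blast
  qed
  then show ?thesis by blast
qed

text \<open>The octahedral axiom for \<open>i \<circ> f\<close> in terms of modules.\<close>

lemma cone_sub:
  fixes S X V T I C D :: "('a, 'm) module"
  assumes s: "ses R X V T i p" and f: "lin R S X f" and \<iota>: "lin R S I \<iota>" "inj_on \<iota> (carrier S)"
    and C: "ses R S (dsum X I) C (\<lambda>s. prc (f s) (\<iota> s)) c"
    and D: "ses R S (dsum V I) D (\<lambda>s. prc (i (f s)) (\<iota> s)) d"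
  shows "\<exists>a b. ses R C D T a b"
proof -
  note i = sesD(1)[OF s] and p = sesD(2)[OF s] and d = sesD(2)[OF D] and c = sesD(2)[OF C]
  note mX = sesD(7)[OF s] and mV = sesD(8)[OF s] and mT = sesD(9)[OF s] and mI = lin_mods(2)[OF \<iota>(1)] and mS = lin_mods(1)[OF f]
  note VI = dsum_split[OF mV mI] and XI = dsum_split[OF mX mI] and dv = lin_dsum[OF inf mV mI] and dx = lin_dsum[OF inf mX mI]
  note ds = dsum_simps[OF inf] and pr = prc_simps[OF inf]
  have h: "lin R (dsum X I) D (\<lambda>w. d (prc (i (fs w)) (sn w)))"
    by (rule lin_comp[OF lin_pair[OF inf lin_comp[OF dx(3) i] dx(4)] d])
  obtain a where a: "lin R C D a" "\<forall>w\<in>carrier (dsum X I). a (c w) = d (prc (i (fs w)) (sn w))"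
    using ses_factor[OF C h] sesD(6)[OF D] by (auto simp: pr)
  obtain b where b: "lin R D T b" "\<forall>w\<in>carrier (dsum V I). b (d w) = p (fs w)"
    using ses_factor[OF D lin_comp[OF dv(3) p]] sesD(6)[OF s] lin_closed[OF f] by (auto simp: pr)
  have "ses R C D T a b"
  proof (rule sesI[OF a(1) b(1)])
    fix y assume y: "y \<in> carrier C" "a y = \<zero>\<^bsub>D\<^esub>"
    obtain w where w: "w \<in> carrier (dsum X I)" "c w = y" using sesE(2)[OF C y(1)] by blast
    note w' = XI[OF w(1)]
    have "d (prc (i (fs w)) (sn w)) = \<zero>\<^bsub>D\<^esub>" using a(2) w y(2) by auto
    then obtain t where t: "t \<in> carrier S" "i (f t) = i (fs w)" "\<iota> t = sn w"
      using sesE(3)[OF D, of "prc (i (fs w)) (sn w)"] lin_closed[OF i w'(1)] w'(2) by (auto simp: ds)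
    have "f t = fs w" using sesD(3)[OF s] lin_closed[OF f t(1)] w'(1) t(2) by (metis inj_onD)
    then have "w = prc (f t) (\<iota> t)" using w' t by simp
    then show "y = \<zero>\<^bsub>C\<^esub>" using sesD(6)[OF C t(1)] w(2) by simp
  next
    fix z assume "z \<in> carrier T"
    then obtain v where v: "v \<in> carrier V" "p v = z" using sesE(2)[OF s] by blast
    have "prc v \<zero>\<^bsub>I\<^esub> \<in> carrier (dsum V I)" using v lm_closed(2)[OF mI] by (simp add: ds)
    then have "b (d (prc v \<zero>\<^bsub>I\<^esub>)) = z" "d (prc v \<zero>\<^bsub>I\<^esub>) \<in> carrier D" using b(2) v lin_closed[OF d] by (simp_all add: pr)
    then show "\<exists>y\<in>carrier D. b y = z" by blast
  next
    fix y assume y: "y \<in> carrier C"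
    obtain w where w: "w \<in> carrier (dsum X I)" "c w = y" using sesE(2)[OF C y(1)] by blast
    note w' = XI[OF w(1)]
    have "prc (i (fs w)) (sn w) \<in> carrier (dsum V I)" using w' lin_closed[OF i] by (simp add: ds)
    then show "b (a y) = \<zero>\<^bsub>T\<^esub>" using a(2) b(2) w w' sesD(6)[OF s] by (auto simp: pr)
  next
    fix y assume y: "y \<in> carrier D" "b y = \<zero>\<^bsub>T\<^esub>"
    obtain w where w: "w \<in> carrier (dsum V I)" "d w = y" using sesE(2)[OF D y(1)] by blast
    note w' = VI[OF w(1)]
    have "p (fs w) = \<zero>\<^bsub>T\<^esub>" using b(2) w y by auto
    then obtain x where x: "x \<in> carrier X" "i x = fs w" using sesE(3)[OF s w'(1)] by blast
    have m: "prc x (sn w) \<in> carrier (dsum X I)" using x w' by (simp add: ds)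
    have "a (c (prc x (sn w))) = y" using a(2) m x w w'(3) by (simp add: pr)
    then show "\<exists>x\<in>carrier C. a x = y" using lin_closed[OF c m] by blast
  qed
  then show ?thesis by blast
qed

text \<open>
  The stable inverse \<open>r\<close>, corrected by a map that factors through \<open>I\<close>, gives a retraction of the map \<open>(q, \<iota>)\<close>, and the
  complementary idempotent factors through a projective module.
\<close>

lemma pif_cone_of_stable_iso:
  assumes S: "fl S" and T: "fl T" and q: "lin R S T q" and r: "lin R T S r"
    and rq: "stz S S (\<lambda>s. r (q s) \<ominus>\<^bsub>S\<^esub> s)" and qr: "stz T T (\<lambda>t. t \<ominus>\<^bsub>T\<^esub> q (r t))"
    and I: "pif I" and \<iota>: "lin R S I \<iota>" "inj_on \<iota> (carrier S)"
    and E: "ses R S (dsum T I) E (\<lambda>s. prc (q s) (\<iota> s)) c"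
  shows "pif E"
proof -
  note mS = flD(1)[OF S] and mT = flD(1)[OF T] and mI = pif_module[OF I]
  note c = sesD(2)[OF E] and mE = sesD(9)[OF E] and mD = sesD(8)[OF E]
  note ds = dsum_simps[OF inf] and pr = prc_simps[OF inf] and d = lin_dsum[OF inf mT mI]
  have pI: "projective R I" using I by (simp add: pif_def)
  obtain u where u: "lin R I S u" "\<forall>s\<in>carrier S. r (q s) \<ominus>\<^bsub>S\<^esub> s = u (\<iota> s)"
    using stz_extends[OF rq S \<iota>] by blast
  define \<rho> where "\<rho> w = r (fs w) \<ominus>\<^bsub>S\<^esub> u (sn w)" for w
  have \<rho>: "lin R (dsum T I) S \<rho>" unfolding \<rho>_def by (rule lin_sub[OF lin_comp[OF d(3) r] lin_comp[OF d(4) u(1)]])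
  have \<rho>1: "\<rho> (prc (q s) (\<iota> s)) = s" if "s \<in> carrier S" for s
    using that u(2)[rule_format, OF that, symmetric] lin_closed[OF r lin_closed[OF q that]]
    by (simp add: \<rho>_def pr lm_cancel[OF mS])
  \<comment> \<open>The idempotent complementary to the retraction \<open>\<rho>\<close>; it factors over \<open>E\<close>.\<close>
  define \<epsilon> where "\<epsilon> w = w \<ominus>\<^bsub>dsum T I\<^esub> prc (q (\<rho> w)) (\<iota> (\<rho> w))" for w
  have j: "lin R S (dsum T I) (\<lambda>s. prc (q s) (\<iota> s))" by (rule sesD(1)[OF E])
  have \<epsilon>: "lin R (dsum T I) (dsum T I) \<epsilon>"
    unfolding \<epsilon>_def by (rule lin_sub[OF lin_id[OF mD] lin_comp[OF \<rho> j]])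
  have \<epsilon>0: "\<epsilon> (prc (q s) (\<iota> s)) = \<zero>\<^bsub>dsum T I\<^esub>" if "s \<in> carrier S" for s
    using lin_closed[OF j that] by (simp add: \<epsilon>_def \<rho>1[OF that] lm_add[OF mD])
  obtain sg where sg: "lin R E (dsum T I) sg" "\<forall>w\<in>carrier (dsum T I). sg (c w) = \<epsilon> w"
    using ses_factor[OF E \<epsilon> \<epsilon>0] by blast
  have c\<epsilon>: "c (\<epsilon> w) = c w" if w: "w \<in> carrier (dsum T I)" for w
    using w lin_closed[OF j lin_closed[OF \<rho> w]] lin_closed[OF c w] sesD(6)[OF E lin_closed[OF \<rho> w]]
    by (simp add: \<epsilon>_def lin_simps[OF c] lm_add[OF mE])
  have "stz (dsum T I) (dsum T I) \<epsilon>"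
  \<comment> \<open>It is the sum of \<open>t - q (r t)\<close> on \<open>T\<close> and of two maps through the projective module \<open>I\<close>.\<close>
  proof (rule stz_cong[OF stz_add[OF stz_post[OF stz_pre[OF qr d(3)] d(1)]
          stz_add[OF stz_via[OF pI d(4) lin_comp[OF lin_comp[OF u(1) q] d(1)]]
            stz_post[OF stz_to_projective[OF pI lin_sub[OF d(4) lin_comp[OF \<rho> \<iota>(1)]]] d(2)]]]])
    fix w assume w: "w \<in> carrier (dsum T I)"
    note w' = dsum_split[OF mT mI w]
    note cl = lin_closed[OF r w'(1)] lin_closed[OF u(1) w'(2)] lin_closed[OF \<rho> w]
    note cl' = lin_closed[OF q cl(1)] lin_closed[OF q cl(2)] lin_closed[OF \<iota>(1) cl(3)] lin_closed[OF q cl(3)]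
    have q\<rho>: "q (\<rho> w) = q (r (fs w)) \<ominus>\<^bsub>T\<^esub> q (u (sn w))" using cl by (simp add: \<rho>_def lin_simps[OF q])
    have diff: "prc x y \<ominus>\<^bsub>dsum T I\<^esub> prc x' y' = prc (x \<ominus>\<^bsub>T\<^esub> x') (y \<ominus>\<^bsub>I\<^esub> y')"
      if "x \<in> carrier T" "x' \<in> carrier T" "y \<in> carrier I" "y' \<in> carrier I" for x x' y y'
    proof -
      have "prc x y \<ominus>\<^bsub>dsum T I\<^esub> prc x' y' \<in> carrier (dsum T I)"
        using that lm_closed(4)[OF mD] by (simp add: ds)
      then have "prc x y \<ominus>\<^bsub>dsum T I\<^esub> prc x' y' =
          prc (fs (prc x y \<ominus>\<^bsub>dsum T I\<^esub> prc x' y')) (sn (prc x y \<ominus>\<^bsub>dsum T I\<^esub> prc x' y'))"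
        by (rule dsum_split(3)[OF mT mI])
      also have "\<dots> = prc (x \<ominus>\<^bsub>T\<^esub> x') (y \<ominus>\<^bsub>I\<^esub> y')"
        using that by (simp add: lin_simps(6)[OF d(3)] lin_simps(6)[OF d(4)] ds pr)
      finally show ?thesis .
    qed
    have "\<epsilon> w = prc (fs w) (sn w) \<ominus>\<^bsub>dsum T I\<^esub> prc (q (\<rho> w)) (\<iota> (\<rho> w))" using w'(3) by (simp add: \<epsilon>_def)
    also have "\<dots> = prc (fs w \<ominus>\<^bsub>T\<^esub> (q (r (fs w)) \<ominus>\<^bsub>T\<^esub> q (u (sn w)))) (sn w \<ominus>\<^bsub>I\<^esub> \<iota> (\<rho> w))"
      using w'(1,2) cl' lm_closed(4)[OF mT cl'(1,2)] by (simp add: diff q\<rho>)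
    finally have "\<epsilon> w = prc (fs w \<ominus>\<^bsub>T\<^esub> (q (r (fs w)) \<ominus>\<^bsub>T\<^esub> q (u (sn w)))) (sn w \<ominus>\<^bsub>I\<^esub> \<iota> (\<rho> w))" .
    moreover interpret T: abelian_group T by (rule lm_grp[OF mT])
    have "fs w \<ominus>\<^bsub>T\<^esub> (q (r (fs w)) \<ominus>\<^bsub>T\<^esub> q (u (sn w))) = (fs w \<ominus>\<^bsub>T\<^esub> q (r (fs w))) \<oplus>\<^bsub>T\<^esub> q (u (sn w))"
      using w'(1) cl' by (simp add: T.minus_eq T.minus_add T.a_assoc)
    moreover have "sn w \<ominus>\<^bsub>I\<^esub> \<iota> (\<rho> w) \<in> carrier I" "fs w \<ominus>\<^bsub>T\<^esub> q (r (fs w)) \<in> carrier T"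
      using w' cl' lm_closed(4)[OF mI] lm_closed(4)[OF mT] by blast+
    ultimately show "prc (fs w \<ominus>\<^bsub>T\<^esub> q (r (fs w))) \<zero>\<^bsub>I\<^esub> \<oplus>\<^bsub>dsum T I\<^esub>
        (prc (q (u (sn w))) \<zero>\<^bsub>I\<^esub> \<oplus>\<^bsub>dsum T I\<^esub> prc \<zero>\<^bsub>T\<^esub> (sn w \<ominus>\<^bsub>I\<^esub> \<iota> (\<rho> w))) = \<epsilon> w"
      using cl' by (simp add: ds lm_add[OF mT] lm_add[OF mI])
  qed
  then have "stz E E (\<lambda>z. c (\<epsilon> (sg z)))" using stz_post[OF stz_pre[OF _ sg(1)] c] by blast
  then have "stz E E (\<lambda>z. z)"
  proof (rule stz_cong)
    fix z assume "z \<in> carrier E"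
    then obtain w where w: "w \<in> carrier (dsum T I)" "c w = z" using sesE(2)[OF E] by blast
    then have "c (\<epsilon> (sg z)) = c (\<epsilon> (\<epsilon> w))" using sg(2) by auto
    then show "c (\<epsilon> (sg z)) = z" using c\<epsilon> w lin_closed[OF \<epsilon>] by simp
  qed
  then show ?thesis
    using pif_of_stz_id fl_ses(3)[OF E] fl_dsum[OF T fl_pif[OF I]] by blast
qed

end

section \<open>Filtered modules\<close>

text \<open>
  An orthogonal system \<open>\<B>\<close> and its perpendicular category among the modules of finite length.  Bricks enter
  through the fact that every stably non-zero endomorphism is a stable isomorphism.
\<close>

locale weakly_simple_minded = self_injective_algebra R K e
  for R :: "('a, 'r) ring_scheme" (structure) and K :: "'a set" and e :: "'a \<Rightarrow> 'm" +
  fixes \<B> :: "('a, 'm) module set"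
  assumes brick_fl: "S \<in> \<B> \<Longrightarrow> fl S"
    and bricks_finite: "finite \<B>"
    and brick_stable_inverse: "S \<in> \<B> \<Longrightarrow> lin R S S q \<Longrightarrow> \<not> stz S S q \<Longrightarrow>
      \<exists>r. lin R S S r \<and> stz S S (\<lambda>s. r (q s) \<ominus>\<^bsub>S\<^esub> s) \<and> stz S S (\<lambda>s. s \<ominus>\<^bsub>S\<^esub> q (r s))"
    and bricks_orthogonal: "S \<in> \<B> \<Longrightarrow> T \<in> \<B> \<Longrightarrow> S \<noteq> T \<Longrightarrow> lin R S T q \<Longrightarrow> stz S T q"
    and bricks_perp: "fl X \<Longrightarrow> (\<And>S f. S \<in> \<B> \<Longrightarrow> lin R S X f \<Longrightarrow> stz S X f) \<Longrightarrow> pif X"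
begin

text \<open>
  The class \<open>(\<B>)\<^sub>n\<close> in terms of modules.  Since \<open>Q\<close> is projective, \<open>V\<close> is the direct sum of \<open>X\<close> and \<open>Q\<close>; allowing such
  a summand to be removed makes the class closed under stable isomorphism.
\<close>

primrec filt :: "nat \<Rightarrow> ('a, 'm) module \<Rightarrow> bool" where
  "filt 0 X \<longleftrightarrow> pif X"
| "filt (Suc n) X \<longleftrightarrow> (\<exists>X' (V :: ('a, 'm) module) T Q f g i p. filt n X' \<and> T \<in> \<B> \<and> pif Q \<and>
     ses R X' V T f g \<and> ses R X V Q i p)"

lemma filt_SucE:
  assumes "filt (Suc n) X"
  obtains X' V T Q :: "('a, 'm) module" and f g i p where "filt n X'" "T \<in> \<B>" "pif Q"
    "ses R X' V T f g" "ses R X V Q i p"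
  using assms unfolding filt.simps by blast

lemma filt_SucI:
  fixes X' V T Q :: "('a, 'm) module"
  assumes "filt n X'" "T \<in> \<B>" "pif Q" "ses R X' V T f g" "ses R X V Q i p"
  shows "filt (Suc n) X"
  using assms unfolding filt.simps by blast

lemma filt_fl: "filt n X \<Longrightarrow> fl X"
proof (induction n arbitrary: X)
  case 0
  then show ?case by (simp add: fl_pif)
next
  case (Suc n)
  obtain X' V T Q :: "('a, 'm) module" and f g i p where *: "filt n X'" "T \<in> \<B>" "pif Q"
      "ses R X' V T f g" "ses R X V Q i p"
    by (rule filt_SucE[OF Suc.prems])
  have "fl V" by (rule fl_ses(1)[OF *(4) Suc.IH[OF *(1)] brick_fl[OF *(2)]])
  then show ?case by (rule fl_ses(2)[OF *(5)])
qed

lemma filt_sub: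
  assumes s: "ses R X Y Q i p" and Q: "pif Q" and Y: "filt n Y"
  shows "filt n X"
proof (cases n)
  case 0
  then show ?thesis using pif_sub[OF s Q] Y by simp
next
  case (Suc m)
  obtain X' V T Q' :: "('a, 'm) module" and f g j q where *: "filt m X'" "T \<in> \<B>" "pif Q'"
      "ses R X' V T f g" "ses R Y V Q' j q"
    by (rule filt_SucE[OF Y[unfolded Suc]])
  obtain W :: "('a, 'm) module" and k a b where w: "ses R X V W (\<lambda>x. j (i x)) k" "ses R Q W Q' a b"
    using ses_trans[OF s *(5)] by blast
  have "pif W" by (rule pif_ses[OF w(2) Q *(3)])
  then show ?thesis using filt_SucI[OF *(1,2) _ *(4) w(1)] Suc by blast
qed

lemma ses_Zero:
  assumes h: "lin R X Y h" "inj_on h (carrier X)" "h ` carrier X = carrier Y"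
  shows "ses R X Y Zero h (\<lambda>_. \<zero>\<^bsub>Zero\<^esub>)"
proof (rule sesI[OF h(1) lin_zero[OF lin_mods(2)[OF h(1)] Zero_module(1)]])
  show "x \<in> carrier X \<Longrightarrow> h x = \<zero>\<^bsub>Y\<^esub> \<Longrightarrow> x = \<zero>\<^bsub>X\<^esub>" for x using h(2) lin_inj_iff[OF h(1)] by blast
  show "z \<in> carrier Zero \<Longrightarrow> \<exists>y\<in>carrier Y. \<zero>\<^bsub>Zero\<^esub> = z" for z
    using Zero_module(2) lm_closed(2)[OF lin_mods(2)[OF h(1)]] by auto
  show "y \<in> carrier Y \<Longrightarrow> \<exists>x\<in>carrier X. h x = y" for y using h(3) by (metis imageE)
qed simp

lemma filt_intro:
  assumes "filt n X'" "T \<in> \<B>" "ses R X' X T f g"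
  shows "filt (Suc n) (X :: ('a, 'm) module)"
proof -
  have "ses R X X Zero (\<lambda>x. x) (\<lambda>_. \<zero>\<^bsub>Zero\<^esub>)"
    by (rule ses_Zero[OF lin_id[OF sesD(8)[OF assms(3)]]]) auto
  then show ?thesis by (rule filt_SucI[OF assms(1,2) pif_Zero assms(3)])
qed

lemma ses_dsum_right:
  fixes X Y Z E :: "('a, 'm) module"
  assumes s: "ses R X Y Z f g" and E: "left_module R E"
  shows "ses R (dsum X E) (dsum Y E) Z (\<lambda>w. prc (f (fs w)) (sn w)) (\<lambda>w. g (fs w))"
proof -
  note f = sesD(1)[OF s] and g = sesD(2)[OF s] and mX = sesD(7)[OF s] and mY = sesD(8)[OF s]
  note ds = dsum_simps[OF inf] and pr = prc_simps[OF inf]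
  note dx = lin_dsum[OF inf mX E] and dy = lin_dsum[OF inf mY E]
  note wx = dsum_split[OF mX E] and wy = dsum_split[OF mY E]
  show ?thesis
  proof (rule sesI[OF lin_pair[OF inf lin_comp[OF dx(3) f] dx(4)] lin_comp[OF dy(3) g]])
    fix x assume x: "x \<in> carrier (dsum X E)" "prc (f (fs x)) (sn x) = \<zero>\<^bsub>dsum Y E\<^esub>"
    then have "fs x = \<zero>\<^bsub>X\<^esub>" "sn x = \<zero>\<^bsub>E\<^esub>" using sesE(1)[OF s wx(1)] by (auto simp: ds)
    then show "x = \<zero>\<^bsub>dsum X E\<^esub>" using wx(3)[OF x(1)] by (simp add: ds)
  next
    fix z assume "z \<in> carrier Z"
    then obtain y where "y \<in> carrier Y" "g y = z" using sesE(2)[OF s] by blast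
    then have "prc y \<zero>\<^bsub>E\<^esub> \<in> carrier (dsum Y E)" "g (fs (prc y \<zero>\<^bsub>E\<^esub>)) = z"
      using lm_closed(2)[OF E] by (simp_all add: ds pr)
    then show "\<exists>y\<in>carrier (dsum Y E). g (fs y) = z" by blast
  next
    fix y assume y: "y \<in> carrier (dsum Y E)" "g (fs y) = \<zero>\<^bsub>Z\<^esub>"
    obtain x where x: "x \<in> carrier X" "f x = fs y" using sesE(3)[OF s wy(1)[OF y(1)] y(2)] by blast
    have "prc x (sn y) \<in> carrier (dsum X E)" "prc (f (fs (prc x (sn y)))) (sn (prc x (sn y))) = y"
      using x wy(2,3)[OF y(1)] by (simp_all add: ds pr)
    then show "\<exists>x\<in>carrier (dsum X E). prc (f (fs x)) (sn x) = y" by blast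
  qed (simp add: pr sesD(6)[OF s] wx)
qed

lemma filt_dsum_pif: "filt n X \<Longrightarrow> pif E \<Longrightarrow> filt n (dsum X E)"
proof (induction n arbitrary: X)
  case 0
  then show ?case by (simp add: pif_dsum)
next
  case (Suc n)
  obtain X' V T Q :: "('a, 'm) module" and f g i p where *: "filt n X'" "T \<in> \<B>" "pif Q"
      "ses R X' V T f g" "ses R X V Q i p"
    by (rule filt_SucE[OF Suc.prems(1)])
  have "filt n (dsum X' E)" by (rule Suc.IH[OF *(1) Suc.prems(2)])
  then show ?case
    by (rule filt_SucI[OF _ *(2,3) ses_dsum_right[OF *(4) pif_module[OF Suc.prems(2)]]
          ses_dsum_right[OF *(5) pif_module[OF Suc.prems(2)]]])
qed

lemma filt_extension_pif:
  assumes s: "ses R X D E i p" and E: "pif E" and X: "filt n X"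
  shows "filt n D"
proof -
  obtain sg r where *: "lin R E D sg" "lin R D X r" "\<forall>q\<in>carrier E. p (sg q) = q" "\<forall>x\<in>carrier X. r (i x) = x"
      "\<forall>q\<in>carrier E. r (sg q) = \<zero>\<^bsub>X\<^esub>" "\<forall>y\<in>carrier D. i (r y) \<oplus>\<^bsub>D\<^esub> sg (p y) = y"
    using ses_split[OF s] E by (auto simp: pif_def)
  note i = sesD(1)[OF s] and p = sesD(2)[OF s] and mX = sesD(7)[OF s] and mE = sesD(9)[OF s]
  have "ses R D (dsum X E) Zero (\<lambda>y. prc (r y) (p y)) (\<lambda>_. \<zero>\<^bsub>Zero\<^esub>)"
  proof (rule ses_Zero[OF lin_pair[OF inf *(2) p]])
    show "inj_on (\<lambda>y. prc (r y) (p y)) (carrier D)"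
    proof (rule inj_onI)
      fix y z assume yz: "y \<in> carrier D" "z \<in> carrier D" "prc (r y) (p y) = prc (r z) (p z)"
      then have "i (r y) \<oplus>\<^bsub>D\<^esub> sg (p y) = i (r z) \<oplus>\<^bsub>D\<^esub> sg (p z)" by (simp add: dsum_simps[OF inf])
      then show "y = z" using *(6) yz by simp
    qed
    show "(\<lambda>y. prc (r y) (p y)) ` carrier D = carrier (dsum X E)"
    proof
      show "(\<lambda>y. prc (r y) (p y)) ` carrier D \<subseteq> carrier (dsum X E)"
        using lin_closed[OF *(2)] lin_closed[OF p] by (auto simp: dsum_simps[OF inf])
      show "carrier (dsum X E) \<subseteq> (\<lambda>y. prc (r y) (p y)) ` carrier D"
      proof
        fix w assume w: "w \<in> carrier (dsum X E)"
        note w' = dsum_split[OF mX mE w]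
        let ?y = "i (fs w) \<oplus>\<^bsub>D\<^esub> sg (sn w)"
        have c: "i (fs w) \<in> carrier D" "sg (sn w) \<in> carrier D" using w' lin_closed[OF i] lin_closed[OF *(1)] by blast+
        have "r ?y = fs w" "p ?y = sn w"
          using c w'(1,2) *(3,4,5) sesD(6)[OF s]
          by (simp_all add: lin_simps[OF *(2)] lin_simps[OF p] lm_add[OF mX] lm_add[OF mE])
        then have "w = prc (r ?y) (p ?y)" using w'(3) by simp
        then show "w \<in> (\<lambda>y. prc (r y) (p y)) ` carrier D"
          using lm_closed(1)[OF sesD(8)[OF s] c] by (rule image_eqI)
      qed
    qed
  qed
  then show ?thesis using filt_sub[OF _ pif_Zero filt_dsum_pif[OF X E]] by blast
qed

text \<open>
  The cone of a non-zero map from a brick \<open>S\<close> to an object of \<open>(\<B>)\<^sub>n\<close> lies in \<open>(\<B>)\<^sub>n\<^sub>-\<^sub>1\<close>.  Up to projective summands \<open>X\<close> is an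
  extension of a brick \<open>T\<close> by \<open>X'\<close>.  If the composite \<open>S \<rightarrow> X \<rightarrow> T\<close> is stably zero, then \<open>f\<close> agrees stably with
  a map into \<open>X'\<close>; induction applies to this map, and the cone of \<open>f\<close> is an extension of \<open>T\<close> by the cone of the
  new map.  Otherwise \<open>S = T\<close>, the composite is a stable isomorphism, and the cone of \<open>f\<close> is \<open>X'\<close> up to projective
  summands.
\<close>

lemma filt_cone:
  assumes "filt n X" and S: "S \<in> \<B>" and f: "lin R S X f" "\<not> stz S X f"
    and I: "pif I" and \<iota>: "lin R S I \<iota>" "inj_on \<iota> (carrier S)"
    and C: "ses R S (dsum X I) C (\<lambda>s. prc (f s) (\<iota> s)) c"
  shows "\<exists>m. n = Suc m \<and> filt m C"
  using assms(1) f C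
proof (induction n arbitrary: X f C c)
  case 0
  then have "stz S X f" by (intro stz_to_projective) (auto simp: pif_def)
  then show ?case using 0 by simp
next
  case (Suc n)
  obtain X' V T Q :: "('a, 'm) module" and f0 g i p where *: "filt n X'" "T \<in> \<B>" "pif Q"
      "ses R X' V T f0 g" "ses R X V Q i p"
    by (rule filt_SucE[OF Suc.prems(1)])
  note i = sesD(1)[OF *(5)] and g = sesD(2)[OF *(4)] and f0 = sesD(1)[OF *(4)]
  note f = Suc.prems(2) and C = Suc.prems(4)
  note mV = sesD(8)[OF *(4)] and mI = pif_module[OF I] and mT = sesD(9)[OF *(4)]
  note ds = dsum_simps[OF inf] and pr = prc_simps[OF inf]
  have pI: "projective R I" using I by (simp add: pif_def)
  obtain rr where rr: "lin R V X rr" "\<forall>x\<in>carrier X. rr (i x) = x"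
    using ses_split[OF *(5)] *(3) by (auto simp: pif_def)
  note f1 = lin_comp[OF f i]
  have f1n: "\<not> stz S V (\<lambda>s. i (f s))"
  proof
    assume "stz S V (\<lambda>s. i (f s))"
    then have "stz S X (\<lambda>s. rr (i (f s)))" using stz_post rr(1) by blast
    then have "stz S X f" by (rule stz_cong) (use rr(2) lin_closed[OF f] in simp)
    then show False using Suc.prems(3) by simp
  qed
  obtain D :: "('a, 'm) module" and d where D: "ses R S (dsum V I) D (\<lambda>s. prc (i (f s)) (\<iota> s)) d"
    using cone_exists[OF f1 \<iota>] by blast
  obtain a b where "ses R C D Q a b" using cone_sub[OF *(5) f \<iota> C D] by blast
  then have reduce: "filt n D \<Longrightarrow> filt n C" using filt_sub *(3) by blast
  note q = lin_comp[OF f1 g]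
  \<comment> \<open>\<open>D\<close>, the cone of \<open>i \<circ> f\<close>, differs from \<open>C\<close> by the projective summand \<open>Q\<close> only.\<close>
  have "filt n D"
  proof (cases "stz S T (\<lambda>s. g (i (f s)))")
    case True
    obtain u where u: "lin R I T u" "\<forall>s\<in>carrier S. g (i (f s)) = u (\<iota> s)"
      using stz_extends[OF True brick_fl[OF *(2)] \<iota>] by blast
    obtain v where v: "lin R I V v" "\<forall>y\<in>carrier I. g (v y) = u y"
      using projective_lift[OF pI g sesD(4)[OF *(4)] u(1)] by blast
    define h where "h s = i (f s) \<ominus>\<^bsub>V\<^esub> v (\<iota> s)" for s
    note v\<iota> = lin_comp[OF \<iota>(1) v(1)]
    have h: "lin R S V h" unfolding h_def by (rule lin_sub[OF f1 v\<iota>])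
    have gh: "g (h s) = \<zero>\<^bsub>T\<^esub>" if s: "s \<in> carrier S" for s
    proof -
      have "g (h s) = g (i (f s)) \<ominus>\<^bsub>T\<^esub> g (v (\<iota> s))"
        using lin_closed[OF f1 s] lin_closed[OF v\<iota> s] by (simp add: h_def lin_simps[OF g])
      also have "\<dots> = \<zero>\<^bsub>T\<^esub>"
        using u(2) v(2) s lin_closed[OF \<iota>(1) s] lin_closed[OF q s] lm_add(3)[OF mT] by metis
      finally show ?thesis .
    qed
    obtain f' where f': "lin R S X' f'" "\<forall>s\<in>carrier S. f0 (f' s) = h s"
      using lin_corestrict[OF f0 sesD(3)[OF *(4)] h] gh sesD(5)[OF *(4)] lin_closed[OF h] by blast
    have f'n: "\<not> stz S X' f'"
    proof
      assume "stz S X' f'"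
      then have "stz S V (\<lambda>s. f0 (f' s) \<oplus>\<^bsub>V\<^esub> v (\<iota> s))"
        by (intro stz_add stz_post[OF _ f0] stz_via[OF pI \<iota>(1) v(1)])
      then have "stz S V (\<lambda>s. i (f s))"
        by (rule stz_cong) (use f'(2) lin_closed[OF f1] lin_closed[OF v\<iota>] in \<open>simp add: h_def lm_cancel[OF mV]\<close>)
      then show False using f1n by simp
    qed
    obtain C' :: "('a, 'm) module" and c' where C': "ses R S (dsum X' I) C' (\<lambda>s. prc (f' s) (\<iota> s)) c'"
      using cone_exists[OF f'(1) \<iota>] by blast
    obtain m where m: "n = Suc m" "filt m C'" using Suc.IH[OF *(1) f'(1) f'n C'] by blast
    note dv = lin_dsum[OF inf mV mI] and VI = dsum_split[OF mV mI]
    \<comment> \<open>The cones of \<open>i \<circ> f\<close> and of \<open>i \<circ> f - v \<circ> \<iota>\<close> agree up to the shear \<open>(x, y) \<mapsto> (x + v y, y)\<close>.\<close>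
    define t where "t w = prc (fs w \<oplus>\<^bsub>V\<^esub> v (sn w)) (sn w)" for w
    have t: "lin R (dsum V I) (dsum V I) t"
      unfolding t_def by (rule lin_pair[OF inf lin_add[OF dv(3) lin_comp[OF dv(4) v(1)]] dv(4)])
    have t1: "t (prc x y) = prc (x \<oplus>\<^bsub>V\<^esub> v y) y" for x y by (simp add: t_def pr)
    have D': "ses R S (dsum V I) D (\<lambda>s. prc (f0 (f' s)) (\<iota> s)) (\<lambda>w. d (t w))"
    proof (rule sesI[OF lin_pair[OF inf lin_comp[OF f'(1) f0] \<iota>(1)] lin_comp[OF t sesD(2)[OF D]]])
      fix x assume "x \<in> carrier S" "prc (f0 (f' x)) (\<iota> x) = \<zero>\<^bsub>dsum V I\<^esub>"
      then show "x = \<zero>\<^bsub>S\<^esub>" using \<iota>(2) lin_inj_iff[OF \<iota>(1)] by (simp add: ds)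
    next
      fix z assume "z \<in> carrier D"
      then obtain w where w: "w \<in> carrier (dsum V I)" "d w = z" using sesE(2)[OF D] by blast
      note w' = VI[OF w(1)]
      let ?w = "prc (fs w \<ominus>\<^bsub>V\<^esub> v (sn w)) (sn w)"
      have "?w \<in> carrier (dsum V I)" "t ?w = w"
        using w'(1,2) lin_closed[OF v(1)] w'(3)[symmetric] by (simp_all add: ds t1 lm_closed[OF mV] lm_cancel[OF mV])
      then show "\<exists>w\<in>carrier (dsum V I). d (t w) = z" using w(2) by metis
    next
      fix s assume s: "s \<in> carrier S"
      have "t (prc (f0 (f' s)) (\<iota> s)) = prc (i (f s)) (\<iota> s)"
        using f'(2) s lin_closed[OF f1] lin_closed[OF v\<iota>] by (simp add: t1 h_def lm_cancel[OF mV])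
      then show "d (t (prc (f0 (f' s)) (\<iota> s))) = \<zero>\<^bsub>D\<^esub>" using sesD(6)[OF D s] by simp
    next
      fix w assume w: "w \<in> carrier (dsum V I)" "d (t w) = \<zero>\<^bsub>D\<^esub>"
      note w' = VI[OF w(1)]
      obtain s where s: "s \<in> carrier S" "prc (i (f s)) (\<iota> s) = t w"
        using sesE(3)[OF D lin_closed[OF t w(1)] w(2)] by blast
      then have e: "i (f s) = fs w \<oplus>\<^bsub>V\<^esub> v (sn w)" "\<iota> s = sn w" by (simp_all add: t_def ds)
      have "f0 (f' s) = i (f s) \<ominus>\<^bsub>V\<^esub> v (\<iota> s)" using f'(2) s(1) by (simp add: h_def)
      also have "\<dots> = fs w" unfolding e using w' lin_closed[OF v(1)] by (simp add: lm_cancel[OF mV])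
      finally have "prc (f0 (f' s)) (\<iota> s) = w" using e(2) w'(3) by simp
      then show "\<exists>s\<in>carrier S. prc (f0 (f' s)) (\<iota> s) = w" using s(1) by blast
    qed
    obtain a' b' where "ses R C' D T a' b'" using cone_sub[OF *(4) f'(1) \<iota> C' D'] by blast
    then show ?thesis using filt_intro[OF m(2) *(2)] m(1) by blast
  next
    case False
    have ST: "S = T" using bricks_orthogonal[OF S *(2) _ q] False by blast
    obtain r where r: "lin R T S r" "stz S S (\<lambda>s. r (g (i (f s))) \<ominus>\<^bsub>S\<^esub> s)" "stz T T (\<lambda>t. t \<ominus>\<^bsub>T\<^esub> g (i (f (r t))))"
      using brick_stable_inverse[OF S, of "\<lambda>s. g (i (f s))"] q False ST by auto
    obtain E :: "('a, 'm) module" and c1 where E: "ses R S (dsum T I) E (\<lambda>s. prc (g (i (f s))) (\<iota> s)) c1"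
      using cone_exists[OF q \<iota>] by blast
    have "pif E" by (rule pif_cone_of_stable_iso[OF brick_fl[OF S] brick_fl[OF *(2)] q r I \<iota> E])
    moreover obtain a' b' where "ses R X' D E a' b'" using cone_quotient[OF *(4) f1 \<iota> D E] by blast
    ultimately show ?thesis using filt_extension_pif *(1) by blast
  qed
  then show ?case using reduce by blast
qed

text \<open>
  The inclusion of \<open>\<B> \<star> (\<B>)\<^sub>m\<close> in \<open>(\<B>)\<^sub>m\<^sub>+\<^sub>1\<close>, by associativity of \<open>\<star>\<close>: the preimage in \<open>Z\<close> of the submodule
  \<open>W'\<close> of \<open>W\<close> is an extension of \<open>W'\<close> by \<open>S\<close>, and its quotient in \<open>Z\<close> is a brick, up to \<open>Q\<close>.
\<close>

lemma filt_star:
  assumes S: "S \<in> \<B>"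
  shows "ses R S Z W a b \<Longrightarrow> filt m W \<Longrightarrow> filt (Suc m) Z"
proof (induction m arbitrary: Z W a b)
  case 0
  then have W: "projective R W" "pif W" by (auto simp: pif_def)
  obtain sg r where *: "lin R W Z sg" "lin R Z S r" "\<forall>q\<in>carrier W. b (sg q) = q" "\<forall>x\<in>carrier S. r (a x) = x"
      "\<forall>q\<in>carrier W. r (sg q) = \<zero>\<^bsub>S\<^esub>" "\<forall>y\<in>carrier Z. a (r y) \<oplus>\<^bsub>Z\<^esub> sg (b y) = y"
    using ses_split[OF 0(1) W(1)] by blast
  have "ses R W Z S sg r" by (rule ses_reverse[OF 0(1) *])
  then show ?case using filt_intro[of 0 W S] W(2) S by simp
next
  case (Suc m)
  note s = Suc.prems(1)
  obtain W' V T Q :: "('a, 'm) module" and f g i p where *: "filt m W'" "T \<in> \<B>" "pif Q"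
      "ses R W' V T f g" "ses R W V Q i p"
    by (rule filt_SucE[OF Suc.prems(2)])
  obtain sg r where **: "lin R Q V sg" "lin R V W r" "\<forall>q\<in>carrier Q. p (sg q) = q" "\<forall>x\<in>carrier W. r (i x) = x"
      "\<forall>q\<in>carrier Q. r (sg q) = \<zero>\<^bsub>W\<^esub>" "\<forall>y\<in>carrier V. i (r y) \<oplus>\<^bsub>V\<^esub> sg (p y) = y"
    using ses_split[OF *(5)] *(3) by (auto simp: pif_def)
  note a = sesD(1)[OF s] and b = sesD(2)[OF s] and i = sesD(1)[OF *(5)] and p = sesD(2)[OF *(5)]
  note mZ = sesD(8)[OF s] and mQ = pif_module[OF *(3)] and mV = sesD(8)[OF *(4)] and mW = sesD(9)[OF s] and mS = sesD(7)[OF s]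
  note ds = dsum_simps[OF inf] and pr = prc_simps[OF inf] and dz = lin_dsum[OF inf mZ mQ] and ZQ = dsum_split[OF mZ mQ]
  \<comment> \<open>\<open>W\<close> is \<open>V\<close> without the summand \<open>Q\<close>, so \<open>Q\<close> is added to \<open>Z\<close> and removed at the end.\<close>
  have \<beta>: "lin R (dsum Z Q) V (\<lambda>w. i (b (fs w)) \<oplus>\<^bsub>V\<^esub> sg (sn w))"
    by (rule lin_copair[OF inf lin_comp[OF b i] **(1)])
  have "ses R S (dsum Z Q) V (\<lambda>s. prc (a s) \<zero>\<^bsub>Q\<^esub>) (\<lambda>w. i (b (fs w)) \<oplus>\<^bsub>V\<^esub> sg (sn w))"
  proof (rule sesI[OF lin_comp[OF a dz(1)] \<beta>])
    fix x assume "x \<in> carrier S" "prc (a x) \<zero>\<^bsub>Q\<^esub> = \<zero>\<^bsub>dsum Z Q\<^esub>"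
    then show "x = \<zero>\<^bsub>S\<^esub>" using sesE(1)[OF s] by (simp add: ds)
  next
    fix v assume v: "v \<in> carrier V"
    obtain z where z: "z \<in> carrier Z" "b z = r v" using sesE(2)[OF s lin_closed[OF **(2) v]] by blast
    have "prc z (p v) \<in> carrier (dsum Z Q)" using z lin_closed[OF p v] by (simp add: ds)
    moreover have "i (b (fs (prc z (p v)))) \<oplus>\<^bsub>V\<^esub> sg (sn (prc z (p v))) = v" using z **(6) v by (simp add: pr)
    ultimately show "\<exists>w\<in>carrier (dsum Z Q). i (b (fs w)) \<oplus>\<^bsub>V\<^esub> sg (sn w) = v" by blast
  next
    fix x assume "x \<in> carrier S"
    then show "i (b (fs (prc (a x) \<zero>\<^bsub>Q\<^esub>))) \<oplus>\<^bsub>V\<^esub> sg (sn (prc (a x) \<zero>\<^bsub>Q\<^esub>)) = \<zero>\<^bsub>V\<^esub>"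
      by (simp add: pr sesD(6)[OF s] lin_simps(4)[OF i] lin_simps(4)[OF **(1)] lm_add[OF mV] lm_closed[OF mV])
  next
    fix w assume w: "w \<in> carrier (dsum Z Q)" "i (b (fs w)) \<oplus>\<^bsub>V\<^esub> sg (sn w) = \<zero>\<^bsub>V\<^esub>"
    note w' = ZQ[OF w(1)]
    note bw = lin_closed[OF b w'(1)]
    note c = lin_closed[OF i bw] lin_closed[OF **(1) w'(2)]
    have "p (i (b (fs w)) \<oplus>\<^bsub>V\<^esub> sg (sn w)) = sn w"
      using c w'(2) **(3) sesD(6)[OF *(5) bw] by (simp add: lin_simps[OF p] lm_add[OF mQ])
    then have sn: "sn w = \<zero>\<^bsub>Q\<^esub>" using w(2) lin_simps(4)[OF p] by simp
    have "r (i (b (fs w)) \<oplus>\<^bsub>V\<^esub> sg (sn w)) = b (fs w)"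
      using c w'(2) **(4,5) bw by (simp add: lin_simps[OF **(2)] lm_add[OF mW])
    then have "b (fs w) = \<zero>\<^bsub>W\<^esub>" using w(2) lin_simps(4)[OF **(2)] by simp
    then obtain x where "x \<in> carrier S" "a x = fs w" using sesE(3)[OF s w'(1)] by blast
    then show "\<exists>x\<in>carrier S. prc (a x) \<zero>\<^bsub>Q\<^esub> = w" using sn w'(3) by metis
  qed
  then obtain Y :: "('a, 'm) module" and c' d' h' k' where Y: "ses R S Y W' c' d'" "ses R Y (dsum Z Q) T h' k'"
    using ses_pullback[OF _ *(4)] by blast
  have "filt (Suc m) Y" by (rule Suc.IH[OF Y(1) *(1)])
  then have "filt (Suc (Suc m)) (dsum Z Q)" using filt_intro *(2) Y(2) by blast
  then show ?case using filt_sub[OF ses_dsum(1)[OF inf mZ mQ] *(3)] by blast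
qed

text \<open>
  Extension closures are closed under retracts.  Unless \<open>X\<close> is zero in the stable category, it receives a
  non-zero map from a brick \<open>S\<close>, and the composite with \<open>i\<close> is non-zero as well.  The cone of \<open>S \<rightarrow> X\<close> is a
  retract of the cone of \<open>S \<rightarrow> F\<close>, which has smaller length.  By induction the cone is filtered, hence so is \<open>X\<close>,
  which is an extension of the cone by \<open>S\<close> up to the summand \<open>I\<close>.
\<close>

lemma filt_retract:
  assumes "filt n F" "fl X" "lin R X F i" "lin R F X p" "\<And>x. x \<in> carrier X \<Longrightarrow> p (i x) = x"
  shows "\<exists>m. filt m X"
  using assms
proof (induction n arbitrary: F X i p rule: less_induct)
  case (less n)
  note i = less.prems(3) and p = less.prems(4) and pi = less.prems(5)
  show ?case
  proof (cases "pif X")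
    case True
    then have "filt 0 X" by simp
    then show ?thesis by blast
  next
    case False
    then obtain S f where S: "S \<in> \<B>" and f: "lin R S X f" "\<not> stz S X f" using bricks_perp[OF less.prems(2)] by blast
    note S' = flD[OF brick_fl[OF S]]
    obtain I \<iota> where I: "pif I" and \<iota>: "lin R S I \<iota>" "inj_on \<iota> (carrier S)" using ex_embedding[OF S'] by blast
    note mX = lin_mods(1)[OF i] and mF = lin_mods(2)[OF i] and mI = pif_module[OF I]
    note ds = dsum_simps[OF inf] and pr = prc_simps[OF inf] and dx = lin_dsum[OF inf mX mI] and df = lin_dsum[OF inf mF mI]
    note f1 = lin_comp[OF f(1) i]
    have f1n: "\<not> stz S F (\<lambda>s. i (f s))"
    proof
      assume "stz S F (\<lambda>s. i (f s))"
      then have "stz S X (\<lambda>s. p (i (f s)))" using stz_post p by blast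
      then have "stz S X f" by (rule stz_cong) (use pi lin_closed[OF f(1)] in simp)
      then show False using f(2) by simp
    qed
    obtain C :: "('a, 'm) module" and c where C: "ses R S (dsum X I) C (\<lambda>s. prc (f s) (\<iota> s)) c"
      using cone_exists[OF f(1) \<iota>] by blast
    obtain C' :: "('a, 'm) module" and c' where C': "ses R S (dsum F I) C' (\<lambda>s. prc (i (f s)) (\<iota> s)) c'"
      using cone_exists[OF f1 \<iota>] by blast
    obtain m where m: "n = Suc m" "filt m C'" using filt_cone[OF less.prems(1) S f1 f1n I \<iota> C'] by blast
    have h: "lin R (dsum X I) C' (\<lambda>w. c' (prc (i (fs w)) (sn w)))"
      by (rule lin_comp[OF lin_pair[OF inf lin_comp[OF dx(3) i] dx(4)] sesD(2)[OF C']])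
    obtain j where j: "lin R C C' j" "\<forall>w\<in>carrier (dsum X I). j (c w) = c' (prc (i (fs w)) (sn w))"
      using ses_factor[OF C h] sesD(6)[OF C'] by (auto simp: pr)
    have h': "lin R (dsum F I) C (\<lambda>w. c (prc (p (fs w)) (sn w)))"
      by (rule lin_comp[OF lin_pair[OF inf lin_comp[OF df(3) p] df(4)] sesD(2)[OF C]])
    obtain q where q: "lin R C' C q" "\<forall>w\<in>carrier (dsum F I). q (c' w) = c (prc (p (fs w)) (sn w))"
      using ses_factor[OF C' h'] sesD(6)[OF C] pi lin_closed[OF f(1)] by (auto simp: pr)
    have "q (j z) = z" if z: "z \<in> carrier C" for z
    proof -
      obtain w where w: "w \<in> carrier (dsum X I)" "c w = z" using sesE(2)[OF C z] by blast
      note w' = dsum_split[OF mX mI w(1)]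
      have "prc (i (fs w)) (sn w) \<in> carrier (dsum F I)" using w' lin_closed[OF i] by (simp add: ds)
      then have "q (j (c w)) = c (prc (fs w) (sn w))" using j(2) w(1) q(2) pi w'(1) by (simp add: pr)
      then show ?thesis using w w'(3) by simp
    qed
    moreover have "fl C" using fl_ses(3)[OF C] fl_dsum[OF less.prems(2) fl_pif[OF I]] by blast
    ultimately obtain l where "filt l C" using less.IH[OF _ m(2) _ j(1) q(1)] m(1) by blast
    then have "filt (Suc l) (dsum X I)" using filt_star[OF S C] by blast
    then have "filt (Suc l) X" using filt_sub[OF ses_dsum(1)[OF inf mX mI] I] by blast
    then show ?thesis by blast
  qed
qed

end

section \<open>Finite generation\<close>

context self_injective_algebra
begin

lemma finlen_finite_generators:
  fixes S :: "('a, 's) module"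
  assumes mS: "left_module R S" and S: "finlen K S"
  shows "\<exists>G. finite G \<and> G \<subseteq> carrier S \<and> (\<forall>U. submod R S U \<longrightarrow> G \<subseteq> U \<longrightarrow> U = carrier S)"
proof -
  define Sp where "Sp G = \<Inter>{U. submod R S U \<and> G \<subseteq> U}" for G
  have Sp_sub: "submod R S (Sp G)" if "G \<subseteq> carrier S" for G
  proof -
    have c: "submod R S (carrier S) \<and> G \<subseteq> carrier S" using that submod_carrier[OF mS] by simp
    then have "Sp G \<subseteq> carrier S" unfolding Sp_def by blast
    then show ?thesis unfolding submod_def Sp_def by auto
  qed
  have "\<exists>G. (finite G \<and> G \<subseteq> carrier S) \<and> (\<forall>H. finite H \<and> H \<subseteq> carrier S \<longrightarrow> Sp G \<subseteq> Sp H \<longrightarrow> Sp H = Sp G)"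
    by (rule finlen_maximal[of K R S "\<lambda>G. finite G \<and> G \<subseteq> carrier S" "{}", OF K mS S])
      (use submod_subsp[OF K mS Sp_sub] in auto)
  then obtain G where Gm: "(finite G \<and> G \<subseteq> carrier S) \<and>
      (\<forall>H. finite H \<and> H \<subseteq> carrier S \<longrightarrow> Sp G \<subseteq> Sp H \<longrightarrow> Sp H = Sp G)" by (rule exE)
  then have G: "finite G" "G \<subseteq> carrier S"
    and max: "finite H \<Longrightarrow> H \<subseteq> carrier S \<Longrightarrow> Sp G \<subseteq> Sp H \<Longrightarrow> Sp H = Sp G" for H by simp_all
  have "x \<in> Sp G" if x: "x \<in> carrier S" for x
  proof -
    have "Sp (insert x G) = Sp G" by (rule max) (use G x in \<open>auto simp: Sp_def\<close>)
    moreover have "x \<in> Sp (insert x G)" by (auto simp: Sp_def)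
    ultimately show ?thesis by simp
  qed
  then have "U = carrier S" if "submod R S U" "G \<subseteq> U" for U
    using that unfolding Sp_def submod_def by blast
  then show ?thesis using G by blast
qed

lemma ex_finite_generators:
  assumes "fl S"
  shows "\<exists>G. finite G \<and> G \<subseteq> carrier S \<and> (\<forall>U. submod R S U \<longrightarrow> G \<subseteq> U \<longrightarrow> U = carrier S)"
  by (rule finlen_finite_generators[OF flD[OF assms]])

lemma submod_equalizer:
  assumes f: "lin R L M f" and g: "lin R L M g"
  shows "submod R L {x \<in> carrier L. f x = g x}"
  using lm_closed[OF lin_mods(1)[OF f]] by (auto simp: submod_def lin_simps[OF f] lin_simps[OF g])

text \<open>
  The \<open>K\<close>-subspaces of the space of linear maps \<open>S \<rightarrow> X\<close>.
\<close>

definition homsp :: "('a, 'm) module \<Rightarrow> ('a, 'm) module \<Rightarrow> ('m \<Rightarrow> 'm) set \<Rightarrow> bool" where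
  "homsp S X N \<longleftrightarrow> N \<subseteq> {f \<in> extensional (carrier S). lin R S X f} \<and>
     (\<lambda>s\<in>carrier S. \<zero>\<^bsub>X\<^esub>) \<in> N \<and>
     (\<forall>f\<in>N. \<forall>g\<in>N. (\<lambda>s\<in>carrier S. f s \<ominus>\<^bsub>X\<^esub> g s) \<in> N) \<and>
     (\<forall>c\<in>K. \<forall>f\<in>N. (\<lambda>s\<in>carrier S. c \<odot>\<^bsub>X\<^esub> f s) \<in> N)"

text \<open>
  The space of linear maps is finite-dimensional.  The measure of \<open>N\<close> adds up the measures of the spaces of leading coefficients of \<open>N\<close>, where a linear
  map is regarded as the tuple of its values on a finite list of generators.
\<close>

lemma homsp_measure:
  assumes S: "fl S" and X: "fl X"
  shows "\<exists>(d :: ('m \<Rightarrow> 'm) set \<Rightarrow> nat) b. \<forall>N. homsp S X N \<longrightarrow>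
    d N < b \<and> (\<forall>N'. homsp S X N' \<longrightarrow> N \<subset> N' \<longrightarrow> d N < d N')"
proof -
  note mS = flD(1)[OF S] and mX = flD(1)[OF X]
  obtain \<delta> :: "'m set \<Rightarrow> nat" where \<delta>: "\<forall>U V. subsp K X U \<longrightarrow> subsp K X V \<longrightarrow> U \<subset> V \<longrightarrow> \<delta> U < \<delta> V"
    using flD(2)[OF X] by (auto simp: finlen_def)
  have \<delta>_le: "\<delta> U \<le> \<delta> V" if "subsp K X U" "subsp K X V" "U \<subseteq> V" for U V
  proof (cases "U = V")
    case False
    then have "\<delta> U < \<delta> V" using \<delta> that by blast
    then show ?thesis by simp
  qed simp
  obtain G where G: "finite G" "G \<subseteq> carrier S" and gen: "\<And>U. submod R S U \<Longrightarrow> G \<subseteq> U \<Longrightarrow> U = carrier S"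
    using ex_finite_generators[OF S] by blast
  obtain gs where gs: "set gs = G" using finite_list[OF G(1)] by blast
  have gsS: "gs ! i \<in> carrier S" if "i < length gs" for i using that gs G(2) nth_mem by blast
  define lead where "lead N i = {f (gs ! i) |f. f \<in> N \<and> (\<forall>j<i. f (gs ! j) = \<zero>\<^bsub>X\<^esub>)}" for N i
  define d where "d N = (\<Sum>i<length gs. \<delta> (lead N i))" for N
  have lead: "subsp K X (lead N i)" if N: "homsp S X N" and i: "i < length gs" for N i
    unfolding subsp_def
  proof (intro conjI ballI subsetI)
    have gj: "gs ! j \<in> carrier S" if "j \<le> i" for j using gsS i that by simp
    have lin: "lin R S X f" if "f \<in> N" for f using N that by (auto simp: homsp_def)
    show "x \<in> carrier X" if "x \<in> lead N i" for x
      using that lin_closed[OF lin gsS[OF i]] by (auto simp: lead_def)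
    show "\<zero>\<^bsub>X\<^esub> \<in> lead N i" unfolding lead_def mem_Collect_eq
      by (rule exI[of _ "\<lambda>s\<in>carrier S. \<zero>\<^bsub>X\<^esub>"]) (use N gj in \<open>auto simp: homsp_def\<close>)
    show "x \<ominus>\<^bsub>X\<^esub> y \<in> lead N i" if xy: "x \<in> lead N i" "y \<in> lead N i" for x y
    proof -
      obtain f where f: "f \<in> N" "x = f (gs ! i)" "\<forall>j<i. f (gs ! j) = \<zero>\<^bsub>X\<^esub>" using xy(1) by (auto simp: lead_def)
      obtain g where g: "g \<in> N" "y = g (gs ! i)" "\<forall>j<i. g (gs ! j) = \<zero>\<^bsub>X\<^esub>" using xy(2) by (auto simp: lead_def)
      show ?thesis unfolding lead_def mem_Collect_eq
        by (rule exI[of _ "\<lambda>s\<in>carrier S. f s \<ominus>\<^bsub>X\<^esub> g s"])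
          (use N f g gj in \<open>auto simp: homsp_def lm_add[OF mX] lm_closed[OF mX]\<close>)
    qed
    show "c \<odot>\<^bsub>X\<^esub> x \<in> lead N i" if cx: "c \<in> K" "x \<in> lead N i" for c x
    proof -
      obtain f where f: "f \<in> N" "x = f (gs ! i)" "\<forall>j<i. f (gs ! j) = \<zero>\<^bsub>X\<^esub>" using cx(2) by (auto simp: lead_def)
      show ?thesis unfolding lead_def mem_Collect_eq
        by (rule exI[of _ "\<lambda>s\<in>carrier S. c \<odot>\<^bsub>X\<^esub> f s"])
          (use N f cx K gj in \<open>auto simp: homsp_def lm_smult0[OF mX]\<close>)
    qed
  qed
  define b where "b = Suc (\<Sum>i<length gs. \<delta> (carrier X))"
  have "d N < b" if N: "homsp S X N" for N
  proof -
    have "\<delta> (lead N i) \<le> \<delta> (carrier X)" if "i < length gs" for i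
      by (rule \<delta>_le[OF lead[OF N that] subsp_carrier[OF K mX]]) (use lead[OF N that] in \<open>auto simp: subsp_def\<close>)
    then have "d N \<le> (\<Sum>i<length gs. \<delta> (carrier X))" unfolding d_def by (intro sum_mono) simp
    then show ?thesis by (simp add: b_def)
  qed
  moreover have "d N < d N'" if N: "homsp S X N" and N': "homsp S X N'" and sub: "N \<subset> N'" for N N'
  proof (rule ccontr)
    assume nl: "\<not> d N < d N'"
    have le: "lead N i \<subseteq> lead N' i" for i using sub unfolding lead_def by blast
    have eq: "lead N i = lead N' i" if i: "i < length gs" for i
    proof (rule ccontr)
      assume "lead N i \<noteq> lead N' i"
      then have "\<delta> (lead N i) < \<delta> (lead N' i)" using le \<delta> lead[OF N i] lead[OF N' i] by blast
      then have "d N < d N'" unfolding d_def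
        by (intro sum_strict_mono_ex1) (use i \<delta>_le[OF lead[OF N] lead[OF N'] le] in auto)
      then show False using nl by simp
    qed
    have "f \<in> N" if f: "f \<in> N'" for f
    proof -
      have lf: "lin R S X f" "f \<in> extensional (carrier S)" using N' f by (auto simp: homsp_def)
      have "\<exists>h\<in>N. \<forall>j<i. f (gs ! j) = h (gs ! j)" if "i \<le> length gs" for i
        using that
      proof (induction i)
        case 0
        then show ?case using N by (auto simp: homsp_def)
      next
        case (Suc i)
        then obtain h where h: "h \<in> N" "\<forall>j<i. f (gs ! j) = h (gs ! j)" by auto
        have i: "i < length gs" using Suc.prems by simp
        have lh: "lin R S X h" using N h by (auto simp: homsp_def)
        have gj: "gs ! j \<in> carrier S" if "j \<le> i" for j using gsS i that by simp
        have fh: "(\<lambda>s\<in>carrier S. f s \<ominus>\<^bsub>X\<^esub> h s) \<in> N'" using N' f h sub by (auto simp: homsp_def)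
        have "f (gs ! i) \<ominus>\<^bsub>X\<^esub> h (gs ! i) \<in> lead N' i" unfolding lead_def mem_Collect_eq
          by (rule exI[of _ "\<lambda>s\<in>carrier S. f s \<ominus>\<^bsub>X\<^esub> h s"])
            (use fh gj h(2) lin_closed[OF lh] in \<open>auto simp: lm_add[OF mX]\<close>)
        then have "f (gs ! i) \<ominus>\<^bsub>X\<^esub> h (gs ! i) \<in> lead N i" by (simp only: eq[OF i])
        then obtain k where k: "k \<in> N" "f (gs ! i) \<ominus>\<^bsub>X\<^esub> h (gs ! i) = k (gs ! i)" "\<forall>j<i. k (gs ! j) = \<zero>\<^bsub>X\<^esub>"
          by (auto simp: lead_def)
        have lk: "lin R S X k" using N k by (auto simp: homsp_def)
        define z where "z = (\<lambda>s\<in>carrier S. (\<lambda>s\<in>carrier S. \<zero>\<^bsub>X\<^esub>) s \<ominus>\<^bsub>X\<^esub> k s)"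
        have z: "z \<in> N" using N k(1) by (auto simp: homsp_def z_def)
        have "(\<lambda>s\<in>carrier S. h s \<ominus>\<^bsub>X\<^esub> z s) \<in> N" using N z h(1) by (auto simp: homsp_def)
        moreover have "h s \<ominus>\<^bsub>X\<^esub> z s = h s \<oplus>\<^bsub>X\<^esub> k s" if "s \<in> carrier S" for s
          using that lin_closed[OF lk] by (simp add: z_def lm_add[OF mX]) (simp add: a_minus_def lm_add[OF mX])
        moreover have "h (gs ! i) \<oplus>\<^bsub>X\<^esub> k (gs ! i) = f (gs ! i)"
          using k(2)[symmetric] lin_closed[OF lf(1)] lin_closed[OF lh] gj by (simp add: lm_cancel[OF mX])
        moreover have "h (gs ! j) \<oplus>\<^bsub>X\<^esub> k (gs ! j) = f (gs ! j)" if "j < i" for j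
          using k(3) h(2) that lin_closed[OF lh] gj by (simp add: lm_add[OF mX])
        ultimately show ?case using gj
          by (intro bexI[of _ "\<lambda>s\<in>carrier S. h s \<ominus>\<^bsub>X\<^esub> z s"]) (auto simp: less_Suc_eq)
      qed
      then obtain h where h: "h \<in> N" "\<forall>j<length gs. f (gs ! j) = h (gs ! j)" by blast
      have lh: "lin R S X h" "h \<in> extensional (carrier S)" using N h by (auto simp: homsp_def)
      have "G \<subseteq> {x \<in> carrier S. f x = h x}" using h(2) G(2) unfolding gs[symmetric] by (auto simp: in_set_conv_nth)
      then have "{x \<in> carrier S. f x = h x} = carrier S" using gen[OF submod_equalizer[OF lf(1) lh(1)]] by blast
      then have "f = h" using lf(2) lh(2) by (intro extensionalityI) auto
      then show "f \<in> N" using h(1) by simp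
    qed
    then show False using sub by blast
  qed
  ultimately show ?thesis by (intro exI[of _ d] exI[of _ b]) blast
qed

lemma lin_into_sub:
  assumes f: "lin R L M f" and U: "submod R M U" and im: "\<And>x. x \<in> carrier L \<Longrightarrow> f x \<in> U"
  shows "lin R L (M\<lparr>carrier := U\<rparr>) f"
  by (rule linI[OF lin_mods(1)[OF f] submod_module(1)[OF lin_mods(2)[OF f] U]])
    (use im in \<open>simp_all add: lin_simps[OF f]\<close>)

lemma lin_scalar:
  assumes M: "left_module R M" and c: "c \<in> K"
  shows "lin R M M (\<lambda>x. c \<odot>\<^bsub>M\<^esub> x)"
proof (rule linI[OF M M])
  have cR: "c \<in> carrier R" using c K by blast
  then show "c \<odot>\<^bsub>M\<^esub> x \<in> carrier M" if "x \<in> carrier M" for x using that by (simp add: lm_closed[OF M])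
  show "c \<odot>\<^bsub>M\<^esub> (x \<oplus>\<^bsub>M\<^esub> y) = c \<odot>\<^bsub>M\<^esub> x \<oplus>\<^bsub>M\<^esub> c \<odot>\<^bsub>M\<^esub> y" if "x \<in> carrier M" "y \<in> carrier M" for x y
    using that cR by (simp add: lm_smult[OF M])
  show "c \<odot>\<^bsub>M\<^esub> (a \<odot>\<^bsub>M\<^esub> x) = a \<odot>\<^bsub>M\<^esub> (c \<odot>\<^bsub>M\<^esub> x)" if "a \<in> carrier R" "x \<in> carrier M" for a x
    using that cR K_central[OF c that(1)] by (simp add: lm_smult(3)[OF M, symmetric])
qed

lemma cone_inclusion:
  fixes S Z I Z1 :: "('a, 'm) module"
  assumes \<phi>: "lin R S Z \<phi>" and \<iota>: "lin R S I \<iota>" "inj_on \<iota> (carrier S)"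
    and C: "ses R S (dsum Z I) Z1 (\<lambda>s. prc (\<phi> s) (\<iota> s)) c"
  shows "lin R Z Z1 (\<lambda>z. c (prc z \<zero>\<^bsub>I\<^esub>))" and "inj_on (\<lambda>z. c (prc z \<zero>\<^bsub>I\<^esub>)) (carrier Z)"
proof -
  note mZ = lin_mods(2)[OF \<phi>] and mI = lin_mods(2)[OF \<iota>(1)]
  show l: "lin R Z Z1 (\<lambda>z. c (prc z \<zero>\<^bsub>I\<^esub>))" by (rule lin_comp[OF lin_dsum(1)[OF inf mZ mI] sesD(2)[OF C]])
  have "z = \<zero>\<^bsub>Z\<^esub>" if z: "z \<in> carrier Z" "c (prc z \<zero>\<^bsub>I\<^esub>) = \<zero>\<^bsub>Z1\<^esub>" for z
  proof -
    obtain s where s: "s \<in> carrier S" "prc (\<phi> s) (\<iota> s) = prc z \<zero>\<^bsub>I\<^esub>"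
      using sesE(3)[OF C _ z(2)] z(1) lm_closed(2)[OF mI] by (auto simp: dsum_simps[OF inf])
    then have "s = \<zero>\<^bsub>S\<^esub>" using \<iota>(2) lin_inj_iff[OF \<iota>(1)] by (simp add: dsum_simps[OF inf])
    then show ?thesis using s(2) lin_simps(4)[OF \<phi>] by (simp add: dsum_simps[OF inf])
  qed
  then show "inj_on (\<lambda>z. c (prc z \<zero>\<^bsub>I\<^esub>)) (carrier Z)" using lin_inj_iff[OF l] by blast
qed

end

section \<open>Killing the maps from the bricks\<close>

context weakly_simple_minded
begin

text \<open>
  The composite \<open>X \<rightarrow> Z\<close> of finitely many inclusions into cones of maps from bricks.
\<close>

inductive chain :: "('a, 'm) module \<Rightarrow> ('a, 'm) module \<Rightarrow> ('m \<Rightarrow> 'm) \<Rightarrow> bool" for X where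
  base: "chain X X (\<lambda>x. x)"
| step: "chain X Z j \<Longrightarrow> S \<in> \<B> \<Longrightarrow> pif I \<Longrightarrow> lin R S Z \<phi> \<Longrightarrow> lin R S I \<iota> \<Longrightarrow> inj_on \<iota> (carrier S) \<Longrightarrow>
    ses R S (dsum Z I) Z1 (\<lambda>s. prc (\<phi> s) (\<iota> s)) c \<Longrightarrow> chain X Z1 (\<lambda>x. c (prc (j x) \<zero>\<^bsub>I\<^esub>))"

lemma chain_props:
  assumes "chain X Z j" "fl X"
  shows "fl Z" "lin R X Z j" "inj_on j (carrier X)"
proof -
  have "fl Z \<and> lin R X Z j \<and> inj_on j (carrier X)"
    using assms
  proof (induction rule: chain.induct)
    case base
    then show ?case using lin_id[OF flD(1)] by (simp add: inj_on_def)
  next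
    case (step Z j S I \<phi> \<iota> Z1 c)
    note ci = cone_inclusion[OF step(4,5,6,7)]
    have j: "lin R X Z j" "inj_on j (carrier X)" "fl Z" using step by auto
    have "inj_on (\<lambda>x. c (prc (j x) \<zero>\<^bsub>I\<^esub>)) (carrier X)"
      using ci(2) j(2) lin_closed[OF j(1)] unfolding inj_on_def by blast
    then show ?case using lin_comp[OF j(1) ci(1)] fl_ses(3)[OF step(7)] fl_dsum[OF j(3) fl_pif[OF step(3)]] by blast
  qed
  then show "fl Z" "lin R X Z j" "inj_on j (carrier X)" by auto
qed

lemma chain_trans:
  assumes "chain Y Z k" "chain X Y j"
  shows "chain X Z (\<lambda>x. k (j x))"
  using assms
proof (induction rule: chain.induct)
  case base
  then show ?case by simp
next
  case (step Z k S I \<phi> \<iota> Z1 c)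
  then show ?case using chain.step[of X Z "\<lambda>x. k (j x)"] by blast
qed

text \<open>
  The maps \<open>S \<rightarrow> X\<close> that become stably zero in \<open>Z\<close> form a space \<open>N Z j\<close>.  Choose a chain for which it is as large as
  possible.  If some \<open>j \<circ> f\<close> were stably non-zero, one more cone, that of \<open>j \<circ> f\<close>, would enlarge the space by \<open>f\<close>.
\<close>

lemma kill_brick:
  assumes X: "fl X" and S: "S \<in> \<B>"
  shows "\<exists>Z j. chain X Z j \<and> (\<forall>f. lin R S X f \<longrightarrow> stz S Z (\<lambda>s. j (f s)))"
proof -
  note mX = flD(1)[OF X] and mS = flD(1)[OF brick_fl[OF S]]
  define N where "N Z j = {f \<in> extensional (carrier S). lin R S X f \<and> stz S Z (\<lambda>s. j (f s))}" for Z j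
  obtain d :: "('m \<Rightarrow> 'm) set \<Rightarrow> nat" and b where d: "\<And>N. homsp S X N \<Longrightarrow> d N < b"
      "\<And>N N'. homsp S X N \<Longrightarrow> homsp S X N' \<Longrightarrow> N \<subset> N' \<Longrightarrow> d N < d N'"
    using homsp_measure[OF brick_fl[OF S] X] by blast
  have N: "homsp S X (N Z j)" if ch: "chain X Z j" for Z j
  proof -
    note j = chain_props(2)[OF ch X]
    note mZ = lin_mods(2)[OF j]
    show ?thesis unfolding homsp_def
    proof (intro conjI ballI)
      show "N Z j \<subseteq> {f \<in> extensional (carrier S). lin R S X f}" by (auto simp: N_def)
      have "stz S Z (\<lambda>s. j ((\<lambda>s\<in>carrier S. \<zero>\<^bsub>X\<^esub>) s))"
        by (rule stz_cong[OF stz_zero[OF mS mZ]]) (simp add: lin_simps(4)[OF j])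
      then show "(\<lambda>s\<in>carrier S. \<zero>\<^bsub>X\<^esub>) \<in> N Z j"
        using lin_cong[OF lin_zero[OF mS mX]] by (simp add: N_def)
      fix f assume f: "f \<in> N Z j"
      then have lf: "lin R S X f" "stz S Z (\<lambda>s. j (f s))" by (auto simp: N_def)
      {
        fix g assume g: "g \<in> N Z j"
        then have lg: "lin R S X g" "stz S Z (\<lambda>s. j (g s))" by (auto simp: N_def)
        have "stz S Z (\<lambda>s. j ((\<lambda>s\<in>carrier S. f s \<ominus>\<^bsub>X\<^esub> g s) s))"
          by (rule stz_cong[OF stz_sub[OF lf(2) lg(2)]])
            (use lin_closed[OF lf(1)] lin_closed[OF lg(1)] in \<open>simp add: lin_simps[OF j]\<close>)
        then show "(\<lambda>s\<in>carrier S. f s \<ominus>\<^bsub>X\<^esub> g s) \<in> N Z j"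
          using lin_cong[OF lin_sub[OF lf(1) lg(1)]] by (simp add: N_def)
      }
      fix c assume c: "c \<in> K"
      have "stz S Z (\<lambda>s. j ((\<lambda>s\<in>carrier S. c \<odot>\<^bsub>X\<^esub> f s) s))"
        by (rule stz_cong[OF stz_post[OF lf(2) lin_scalar[OF mZ c]]])
          (use lin_closed[OF lf(1)] c K in \<open>auto simp: lin_simps[OF j]\<close>)
      then show "(\<lambda>s\<in>carrier S. c \<odot>\<^bsub>X\<^esub> f s) \<in> N Z j"
        using lin_cong[OF lin_comp[OF lf(1) lin_scalar[OF mX c]]] by (simp add: N_def)
    qed
  qed
  define P where "P = (\<lambda>(Z, j). chain X Z j)"
  have "\<exists>Zj. P Zj \<and> (\<forall>Wk. P Wk \<longrightarrow> d (case_prod N Wk) \<le> d (case_prod N Zj))"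
    by (rule ex_has_greatest_nat[of P "(X, \<lambda>x. x)" _ b]) (use d(1)[OF N] chain.base in \<open>auto simp: P_def\<close>)
  then obtain Z j where Z: "chain X Z j" and max: "\<And>W k. chain X W k \<Longrightarrow> d (N W k) \<le> d (N Z j)"
    by (auto simp: P_def)
  note j = chain_props(2)[OF Z X]
  have "stz S Z (\<lambda>s. j (f s))" if f: "lin R S X f" for f
  proof (rule ccontr)
    assume n: "\<not> stz S Z (\<lambda>s. j (f s))"
    obtain I \<iota> where I: "pif I" and \<iota>: "lin R S I \<iota>" "inj_on \<iota> (carrier S)"
      using ex_embedding[OF flD[OF brick_fl[OF S]]] by blast
    note jf = lin_comp[OF f j]
    obtain W :: "('a, 'm) module" and c where W: "ses R S (dsum Z I) W (\<lambda>s. prc (j (f s)) (\<iota> s)) c"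
      using cone_exists[OF jf \<iota>] by blast
    note mZ = lin_mods(2)[OF j] and mI = pif_module[OF I]
    define k where "k x = c (prc (j x) \<zero>\<^bsub>I\<^esub>)" for x
    have ch: "chain X W k" unfolding k_def by (rule chain.step[OF Z S I jf \<iota> W])
    note ci = cone_inclusion(1)[OF jf \<iota> W]
    have "N Z j \<subseteq> N W k" using stz_post[OF _ ci] by (auto simp: N_def k_def)
    moreover have "restrict f (carrier S) \<in> N W k"
    proof -
      \<comment> \<open>In the cone, \<open>j \<circ> f\<close> agrees up to sign with a map through \<open>I\<close>.\<close>
      have "stz S W (\<lambda>s. \<ominus>\<^bsub>W\<^esub> c (prc \<zero>\<^bsub>Z\<^esub> (\<iota> s)))"
        using stz_neg[OF stz_via[OF _ \<iota>(1) lin_comp[OF lin_dsum(2)[OF inf mZ mI] sesD(2)[OF W]]]] I by (simp add: pif_def)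
      then have "stz S W (\<lambda>s. k (restrict f (carrier S) s))"
      proof (rule stz_cong)
        fix s assume s: "s \<in> carrier S"
        have cl: "prc (j (f s)) \<zero>\<^bsub>I\<^esub> \<in> carrier (dsum Z I)" "prc \<zero>\<^bsub>Z\<^esub> (\<iota> s) \<in> carrier (dsum Z I)"
          using s lin_closed[OF jf] lin_closed[OF \<iota>(1)] by (simp_all add: dsum_simps[OF inf] lm_closed[OF mZ] lm_closed[OF mI])
        have "c (prc (j (f s)) \<zero>\<^bsub>I\<^esub> \<oplus>\<^bsub>dsum Z I\<^esub> prc \<zero>\<^bsub>Z\<^esub> (\<iota> s)) = \<zero>\<^bsub>W\<^esub>"
          using sesD(6)[OF W s] s lin_closed[OF jf] lin_closed[OF \<iota>(1)] by (simp add: dsum_simps[OF inf] lm_add[OF mZ] lm_add[OF mI])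
        then have z: "c (prc (j (f s)) \<zero>\<^bsub>I\<^esub>) \<oplus>\<^bsub>W\<^esub> c (prc \<zero>\<^bsub>Z\<^esub> (\<iota> s)) = \<zero>\<^bsub>W\<^esub>"
          using cl by (simp add: lin_simps[OF sesD(2)[OF W]])
        interpret W: abelian_group W by (rule lm_grp[OF sesD(9)[OF W]])
        show "\<ominus>\<^bsub>W\<^esub> c (prc \<zero>\<^bsub>Z\<^esub> (\<iota> s)) = k (restrict f (carrier S) s)"
          using W.minus_equality[OF z] lin_closed[OF sesD(2)[OF W] cl(1)] lin_closed[OF sesD(2)[OF W] cl(2)] s by (simp add: k_def)
      qed
      then show ?thesis using lin_cong[OF f] by (simp add: N_def)
    qed
    moreover have "restrict f (carrier S) \<notin> N Z j"
      using n stz_cong[of S Z "\<lambda>s. j (restrict f (carrier S) s)" "\<lambda>s. j (f s)"] by (auto simp: N_def)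
    ultimately have "N Z j \<subset> N W k" by blast
    then have "d (N Z j) < d (N W k)" using d(2)[OF N[OF Z] N[OF ch]] by blast
    then show False using max[OF ch] by simp
  qed
  then show ?thesis using Z by blast
qed

lemma kill_all_bricks:
  assumes X: "fl X"
  shows "\<exists>Z j. chain X Z j \<and> (\<forall>S\<in>\<B>. \<forall>f. lin R S X f \<longrightarrow> stz S Z (\<lambda>s. j (f s)))"
proof -
  have "\<exists>Z j. chain X Z j \<and> (\<forall>S\<in>F. \<forall>f. lin R S X f \<longrightarrow> stz S Z (\<lambda>s. j (f s)))" if "finite F" "F \<subseteq> \<B>" for F
    using that
  proof (induction rule: finite_induct)
    case empty
    then show ?case using chain.base by blast
  next
    case (insert T F)
    then obtain Z j where Z: "chain X Z j" "\<forall>S\<in>F. \<forall>f. lin R S X f \<longrightarrow> stz S Z (\<lambda>s. j (f s))" by auto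
    note Z' = chain_props[OF Z(1) X]
    obtain W k where W: "chain Z W k" "\<forall>f. lin R T Z f \<longrightarrow> stz T W (\<lambda>s. k (f s))"
      using kill_brick[OF Z'(1), of T] insert.prems by blast
    have "stz S W (\<lambda>s. k (j (f s)))" if S: "S \<in> insert T F" and f: "lin R S X f" for S f
    proof (cases "S = T")
      case True
      then show ?thesis using W(2) lin_comp[OF f Z'(2)] by blast
    next
      case False
      then show ?thesis using Z(2) S f stz_post[OF _ chain_props(2)[OF W(1) Z'(1)]] by blast
    qed
    then show ?case using chain_trans[OF W(1) Z(1)] by blast
  qed
  then show ?thesis using bricks_finite by blast
qed

text \<open>
  The induction walks down the chain and pulls \<open>V \<rightarrow> Z\<^sub>1\<close> back along the inclusion \<open>Z \<rightarrow> Z\<^sub>1\<close> of \<open>Z\<close> into a cone.  The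
  pullback \<open>U\<close> along \<open>Z \<oplus> I \<rightarrow> Z\<^sub>1\<close> is an extension of \<open>V\<close> by the brick \<open>S\<close>, hence filtered; the pullback \<open>W\<close> along \<open>Z \<rightarrow> Z\<^sub>1\<close> is the
  kernel of \<open>U \<rightarrow> I\<close>, hence filtered too.  The map from \<open>X\<close> lifts to \<open>W\<close> by the universal property.  At the bottom of
  the chain \<open>j\<close> is the identity of \<open>X\<close>, which then factors through a filtered module.
\<close>

lemma filt_retract_of_chain:
  assumes "chain X Z j" and X: "fl X" and V: "filt n V" and \<pi>: "lin R V Z \<pi>" "\<pi> ` carrier V = carrier Z"
    and \<theta>: "lin R X V \<theta>" "\<forall>x\<in>carrier X. \<pi> (\<theta> x) = j x"
  shows "\<exists>m F s a. filt m F \<and> lin R X F s \<and> lin R F X a \<and> (\<forall>x\<in>carrier X. a (s x) = x)"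
  using assms(1) V \<pi> \<theta>
proof (induction arbitrary: n V \<pi> \<theta> rule: chain.induct)
  case base
  then show ?case by blast
next
  case (step Z j S I \<phi> \<iota> Z1 c)
  note S = step.hyps(2) and I = step.hyps(3) and \<phi> = step.hyps(4) and \<iota> = step.hyps(5,6) and C = step.hyps(7)
  note V = step.prems(1) and \<pi> = step.prems(2,3) and \<theta> = step.prems(4,5)
  note c = sesD(2)[OF C] and mD = sesD(8)[OF C] and mZ1 = sesD(9)[OF C]
  note mZ = lin_mods(2)[OF \<phi>] and mI = pif_module[OF I] and mV = lin_mods(1)[OF \<pi>(1)] and mS = lin_mods(1)[OF \<phi>]
  note j = chain_props(2)[OF step.hyps(1) X]
  note ci = cone_inclusion(1)[OF \<phi> \<iota> C]
  note ds = dsum_simps[OF inf] and pr = prc_simps[OF inf]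
  let ?D = "dsum Z I"
  note dD = lin_dsum[OF inf mD mV] and dZ = lin_dsum[OF inf mZ mV] and dZI = lin_dsum[OF inf mZ mI]
  note DV = dsum_split[OF mD mV] and ZV = dsum_split[OF mZ mV] and ZI = dsum_split[OF mZ mI]
  have \<pi>surj: "\<exists>v\<in>carrier V. \<pi> v = z" if "z \<in> carrier Z1" for z using that \<pi>(2) by (metis imageE)
  define U where "U = {w \<in> carrier (dsum ?D V). c (fs w) \<ominus>\<^bsub>Z1\<^esub> \<pi> (sn w) = \<zero>\<^bsub>Z1\<^esub>}"
  have U: "submod R (dsum ?D V) U" unfolding U_def
    by (rule submod_ker[OF lin_sub[OF lin_comp[OF dD(3) c] lin_comp[OF dD(4) \<pi>(1)]]])
  have U_iff: "prc x v \<in> U \<longleftrightarrow> x \<in> carrier ?D \<and> v \<in> carrier V \<and> c x = \<pi> v" for x v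
    using lm_cancel(1)[OF mZ1 lin_closed[OF c] lin_closed[OF \<pi>(1)]] by (auto simp: U_def ds(1) pr)
  let ?U = "dsum ?D V\<lparr>carrier := U\<rparr>"
  note mU = submod_module[OF dsum_module[OF inf mD mV] U]
  have Uc: "w \<in> carrier (dsum ?D V)" if "w \<in> U" for w using that by (simp add: U_def)
  define W where "W = {w \<in> carrier (dsum Z V). c (prc (fs w) \<zero>\<^bsub>I\<^esub>) \<ominus>\<^bsub>Z1\<^esub> \<pi> (sn w) = \<zero>\<^bsub>Z1\<^esub>}"
  have W: "submod R (dsum Z V) W" unfolding W_def
    by (rule submod_ker[OF lin_sub[OF lin_comp[OF dZ(3) ci] lin_comp[OF dZ(4) \<pi>(1)]]])
  have W_iff: "prc x v \<in> W \<longleftrightarrow> x \<in> carrier Z \<and> v \<in> carrier V \<and> c (prc x \<zero>\<^bsub>I\<^esub>) = \<pi> v" for x v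
    using lm_cancel(1)[OF mZ1 lin_closed[OF ci] lin_closed[OF \<pi>(1)]] by (auto simp: W_def ds(1) pr)
  let ?W = "dsum Z V\<lparr>carrier := W\<rparr>"
  note mW = submod_module[OF dsum_module[OF inf mZ mV] W]
  have Wc: "w \<in> carrier (dsum Z V)" if "w \<in> W" for w using that by (simp add: W_def)
  have j1: "lin R S ?U (\<lambda>s. prc (prc (\<phi> s) (\<iota> s)) \<zero>\<^bsub>V\<^esub>)"
  proof (rule lin_into_sub[OF lin_comp[OF sesD(1)[OF C] dD(1)] U])
    fix s assume s: "s \<in> carrier S"
    show "prc (prc (\<phi> s) (\<iota> s)) \<zero>\<^bsub>V\<^esub> \<in> U"
      using lin_closed[OF sesD(1)[OF C] s] sesD(6)[OF C s] lin_simps(4)[OF \<pi>(1)] lm_closed(2)[OF mV] by (simp add: U_iff)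
  qed
  have "ses R S ?U V (\<lambda>s. prc (prc (\<phi> s) (\<iota> s)) \<zero>\<^bsub>V\<^esub>) sn"
  proof (rule sesI[OF j1 lin_comp[OF mU(2) dD(4)]])
    fix s assume "s \<in> carrier S" "prc (prc (\<phi> s) (\<iota> s)) \<zero>\<^bsub>V\<^esub> = \<zero>\<^bsub>?U\<^esub>"
    then show "s = \<zero>\<^bsub>S\<^esub>" using sesE(1)[OF C] by (simp add: ds)
  next
    fix v assume v: "v \<in> carrier V"
    obtain x where "x \<in> carrier ?D" "c x = \<pi> v" using sesE(2)[OF C lin_closed[OF \<pi>(1) v]] by blast
    then have "prc x v \<in> U" using v by (simp add: U_iff)
    then show "\<exists>w\<in>carrier ?U. sn w = v" by (intro bexI[of _ "prc x v"]) (simp_all add: pr)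
  next
    fix w assume w: "w \<in> carrier ?U" "sn w = \<zero>\<^bsub>V\<^esub>"
    then have wU: "w \<in> U" by simp
    note w' = DV[OF Uc[OF wU]]
    have "c (fs w) = \<zero>\<^bsub>Z1\<^esub>" using wU w'(3) w(2) U_iff[of "fs w" "sn w"] lin_simps(4)[OF \<pi>(1)] by simp
    then obtain s where s: "s \<in> carrier S" "prc (\<phi> s) (\<iota> s) = fs w" using sesE(3)[OF C w'(1)] by blast
    then have "prc (prc (\<phi> s) (\<iota> s)) \<zero>\<^bsub>V\<^esub> = w" using w'(3) w(2) by metis
    then show "\<exists>s\<in>carrier S. prc (prc (\<phi> s) (\<iota> s)) \<zero>\<^bsub>V\<^esub> = w" using s(1) by blast
  qed (simp add: pr)
  then have fU: "filt (Suc n) ?U" using filt_star[OF S] V by blast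
  have j2: "lin R ?W ?U (\<lambda>w. prc (prc (fs w) \<zero>\<^bsub>I\<^esub>) (sn w))"
  proof (rule lin_into_sub[OF lin_comp[OF mW(2) lin_pair[OF inf lin_comp[OF dZ(3) dZI(1)] dZ(4)]] U])
    fix w assume "w \<in> carrier ?W"
    then have wW: "w \<in> W" by simp
    note w' = ZV[OF Wc[OF wW]]
    show "prc (prc (fs w) \<zero>\<^bsub>I\<^esub>) (sn w) \<in> U"
      using wW w' W_iff[of "fs w" "sn w"] lm_closed(2)[OF mI] by (simp add: U_iff ds)
  qed
  have "ses R ?W ?U I (\<lambda>w. prc (prc (fs w) \<zero>\<^bsub>I\<^esub>) (sn w)) (\<lambda>w. sn (fs w))"
  proof (rule sesI[OF j2 lin_comp[OF mU(2) lin_comp[OF dD(3) dZI(4)]]])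
    fix w assume w: "w \<in> carrier ?W" "prc (prc (fs w) \<zero>\<^bsub>I\<^esub>) (sn w) = \<zero>\<^bsub>?U\<^esub>"
    then have "fs w = \<zero>\<^bsub>Z\<^esub>" "sn w = \<zero>\<^bsub>V\<^esub>" by (simp_all add: ds)
    then show "w = \<zero>\<^bsub>?W\<^esub>" using ZV(3)[OF Wc, of w] w(1) by (simp add: ds)
  next
    fix y assume y: "y \<in> carrier I"
    have D: "prc \<zero>\<^bsub>Z\<^esub> y \<in> carrier ?D" using y lm_closed(2)[OF mZ] by (simp add: ds)
    obtain v where "v \<in> carrier V" "\<pi> v = c (prc \<zero>\<^bsub>Z\<^esub> y)" using \<pi>surj[OF lin_closed[OF c D]] by blast
    then have "prc (prc \<zero>\<^bsub>Z\<^esub> y) v \<in> U" using D by (simp add: U_iff)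
    then show "\<exists>w\<in>carrier ?U. sn (fs w) = y" by (intro bexI[of _ "prc (prc \<zero>\<^bsub>Z\<^esub> y) v"]) (simp_all add: pr)
  next
    fix w assume w: "w \<in> carrier ?U" "sn (fs w) = \<zero>\<^bsub>I\<^esub>"
    then have wU: "w \<in> U" by simp
    note w' = DV[OF Uc[OF wU]]
    note w'' = ZI[OF w'(1)]
    have f: "prc (fs (fs w)) \<zero>\<^bsub>I\<^esub> = fs w" using w''(3) w(2) by metis
    have "prc (fs (fs w)) (sn w) \<in> W"
      using wU w' w''(1) U_iff[of "fs w" "sn w"] f by (simp add: W_iff)
    moreover have "prc (prc (fs (prc (fs (fs w)) (sn w))) \<zero>\<^bsub>I\<^esub>) (sn (prc (fs (fs w)) (sn w))) = w"
      using f w'(3) by (simp add: pr)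
    ultimately show "\<exists>x\<in>carrier ?W. prc (prc (fs x) \<zero>\<^bsub>I\<^esub>) (sn x) = w"
      by (intro bexI[of _ "prc (fs (fs w)) (sn w)"]) simp_all
  qed (simp add: pr)
  then have fW: "filt (Suc n) ?W" using filt_sub I fU by blast
  have fsurj: "fs ` carrier ?W = carrier Z"
  proof
    show "fs ` carrier ?W \<subseteq> carrier Z" using ZV(1)[OF Wc] by auto
    show "carrier Z \<subseteq> fs ` carrier ?W"
    proof
      fix z assume z: "z \<in> carrier Z"
      obtain v where "v \<in> carrier V" "\<pi> v = c (prc z \<zero>\<^bsub>I\<^esub>)" using \<pi>surj[OF lin_closed[OF ci z]] by blast
      then have "prc z v \<in> W" using z by (simp add: W_iff)
      then show "z \<in> fs ` carrier ?W" by (intro image_eqI[of _ _ "prc z v"]) (simp_all add: pr)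
    qed
  qed
  have t: "lin R X ?W (\<lambda>x. prc (j x) (\<theta> x))"
    by (rule lin_into_sub[OF lin_pair[OF inf j \<theta>(1)] W])
      (use \<theta>(2) lin_closed[OF j] lin_closed[OF \<theta>(1)] in \<open>simp add: W_iff\<close>)
  show ?case by (rule step.IH[OF fW lin_comp[OF mW(2) dZ(3)] fsurj t]) (simp add: pr)
qed

end

section \<open>Sequential colimits\<close>

primrec prefix_code :: "(nat \<Rightarrow> 'm) \<Rightarrow> nat \<Rightarrow> 'm" where
  "prefix_code y 0 = y 0"
| "prefix_code y (Suc n) = prc (prefix_code y n) (y (Suc n))"

lemma prefix_code_inj:
  assumes inf: "infinite (UNIV :: 'm set)"
  shows "prefix_code y n = prefix_code (z :: nat \<Rightarrow> 'm) n \<Longrightarrow> i \<le> n \<Longrightarrow> y i = z i"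
proof (induction n arbitrary: i)
  case (Suc n)
  have "fs (prefix_code y (Suc n)) = fs (prefix_code z (Suc n))"
    "sn (prefix_code y (Suc n)) = sn (prefix_code z (Suc n))"
    using Suc.prems(1) by simp_all
  then have "prefix_code y n = prefix_code z n" "y (Suc n) = z (Suc n)"
    by (simp_all add: prc_simps[OF inf])
  then show ?case using Suc.IH Suc.prems(2) by (cases "i = Suc n") auto
qed simp

text \<open>
  Sequences that eventually follow the maps \<open>j n\<close>.  The colimit of the system is the quotient of this module by the
  submodule \<open>vanishing\<close> of the sequences that are eventually zero.  This description avoids a disjoint union of
  the modules.
\<close>

definition threads :: "(nat \<Rightarrow> ('r, 'm) module) \<Rightarrow> (nat \<Rightarrow> 'm \<Rightarrow> 'm) \<Rightarrow> ('r, nat \<Rightarrow> 'm) module" where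
  "threads M j = \<lparr>carrier = {y. (\<forall>n. y n \<in> carrier (M n)) \<and> (\<exists>N. \<forall>n\<ge>N. y (Suc n) = j n (y n))},
     monoid.mult = undefined, one = undefined, ring.zero = (\<lambda>n. \<zero>\<^bsub>M n\<^esub>),
     add = (\<lambda>y z n. y n \<oplus>\<^bsub>M n\<^esub> z n), smult = (\<lambda>a y n. a \<odot>\<^bsub>M n\<^esub> y n)\<rparr>"

primrec push :: "(nat \<Rightarrow> 'm \<Rightarrow> 'm) \<Rightarrow> nat \<Rightarrow> nat \<Rightarrow> 'm \<Rightarrow> 'm" where
  "push j n 0 x = x"
| "push j n (Suc d) x = j (n + d) (push j n d x)"

text \<open>The element \<open>x\<close> of \<open>M n\<close> as an element of the colimit.\<close>

definition thread :: "(nat \<Rightarrow> ('r, 'm) module) \<Rightarrow> (nat \<Rightarrow> 'm \<Rightarrow> 'm) \<Rightarrow> nat \<Rightarrow> 'm \<Rightarrow> nat \<Rightarrow> 'm" where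
  "thread M j n x m = (if m < n then \<zero>\<^bsub>M m\<^esub> else push j n (m - n) x)"

context
  fixes R :: "('r, 'z) ring_scheme" and M :: "nat \<Rightarrow> ('r, 'm) module" and j :: "nat \<Rightarrow> 'm \<Rightarrow> 'm"
  assumes j: "\<And>n. lin R (M n) (M (Suc n)) (j n)"
begin

lemma thread_mod: "left_module R (M n)"
  using j lin_mods by blast

lemma threadsD:
  assumes "y \<in> carrier (threads M j)"
  shows "y n \<in> carrier (M n)" "\<exists>N. \<forall>n\<ge>N. y (Suc n) = j n (y n)"
  using assms by (auto simp: threads_def)

lemma threads_common:
  assumes "y \<in> carrier (threads M j)" "z \<in> carrier (threads M j)"
  shows "\<exists>N. \<forall>n\<ge>N. y (Suc n) = j n (y n) \<and> z (Suc n) = j n (z n)"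
proof -
  obtain N1 where "\<forall>n\<ge>N1. y (Suc n) = j n (y n)" using threadsD(2)[OF assms(1)] by blast
  moreover obtain N2 where "\<forall>n\<ge>N2. z (Suc n) = j n (z n)" using threadsD(2)[OF assms(2)] by blast
  ultimately show ?thesis by (intro exI[of _ "max N1 N2"]) simp
qed

lemma threads_ops:
  "(y \<oplus>\<^bsub>threads M j\<^esub> z) n = y n \<oplus>\<^bsub>M n\<^esub> z n" "(a \<odot>\<^bsub>threads M j\<^esub> y) n = a \<odot>\<^bsub>M n\<^esub> y n"
  "\<zero>\<^bsub>threads M j\<^esub> n = \<zero>\<^bsub>M n\<^esub>"
  by (simp_all add: threads_def)

lemma threadsI: "(\<And>n. y n \<in> carrier (M n)) \<Longrightarrow> (\<And>n. n \<ge> N \<Longrightarrow> y (Suc n) = j n (y n)) \<Longrightarrow> y \<in> carrier (threads M j)"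
  unfolding threads_def by auto

lemma threads_module: "left_module R (threads M j)"
proof (rule left_moduleI[OF lm_ring[OF thread_mod[of 0]]])
  note mM = thread_mod and js = lin_simps[OF j]
  show "x \<oplus>\<^bsub>threads M j\<^esub> y \<in> carrier (threads M j)"
    if xy: "x \<in> carrier (threads M j)" "y \<in> carrier (threads M j)" for x y
  proof -
    obtain N where "\<forall>n\<ge>N. x (Suc n) = j n (x n) \<and> y (Suc n) = j n (y n)" using threads_common[OF xy] by blast
    then show ?thesis using threadsD(1)[OF xy(1)] threadsD(1)[OF xy(2)]
      by (intro threadsI[of _ N]) (simp_all add: threads_ops js lm_closed[OF mM])
  qed
  show "\<zero>\<^bsub>threads M j\<^esub> \<in> carrier (threads M j)"
    by (intro threadsI[of _ 0]) (simp_all add: threads_ops js lm_closed[OF mM])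
  show "a \<odot>\<^bsub>threads M j\<^esub> x \<in> carrier (threads M j)" if ax: "a \<in> carrier R" "x \<in> carrier (threads M j)" for a x
  proof -
    obtain N where "\<forall>n\<ge>N. x (Suc n) = j n (x n)" using threadsD(2)[OF ax(2)] by blast
    then show ?thesis using threadsD(1)[OF ax(2)] ax(1)
      by (intro threadsI[of _ N]) (simp_all add: threads_ops js lm_closed[OF mM])
  qed
  show "\<exists>y\<in>carrier (threads M j). y \<oplus>\<^bsub>threads M j\<^esub> x = \<zero>\<^bsub>threads M j\<^esub>" if x: "x \<in> carrier (threads M j)" for x
  proof (rule bexI[of _ "\<lambda>n. \<ominus>\<^bsub>M n\<^esub> x n"])
    show "(\<lambda>n. \<ominus>\<^bsub>M n\<^esub> x n) \<oplus>\<^bsub>threads M j\<^esub> x = \<zero>\<^bsub>threads M j\<^esub>"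
      using threadsD(1)[OF x] by (intro ext) (simp add: threads_ops lm_add[OF mM])
    obtain N where "\<forall>n\<ge>N. x (Suc n) = j n (x n)" using threadsD(2)[OF x] by blast
    then show "(\<lambda>n. \<ominus>\<^bsub>M n\<^esub> x n) \<in> carrier (threads M j)" using threadsD(1)[OF x]
      by (intro threadsI[of _ N]) (simp_all add: js lm_closed[OF mM])
  qed
  fix x y z a b assume x: "x \<in> carrier (threads M j)"
  note x' = threadsD(1)[OF x]
  show "\<zero>\<^bsub>threads M j\<^esub> \<oplus>\<^bsub>threads M j\<^esub> x = x"
    using x' by (intro ext) (simp add: threads_ops lm_add[OF mM])
  show "\<one>\<^bsub>R\<^esub> \<odot>\<^bsub>threads M j\<^esub> x = x" using x' by (intro ext) (simp add: threads_ops lm_one[OF mM])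
  show "a \<in> carrier R \<Longrightarrow> b \<in> carrier R \<Longrightarrow> (a \<oplus>\<^bsub>R\<^esub> b) \<odot>\<^bsub>threads M j\<^esub> x = a \<odot>\<^bsub>threads M j\<^esub> x \<oplus>\<^bsub>threads M j\<^esub> b \<odot>\<^bsub>threads M j\<^esub> x"
    "a \<in> carrier R \<Longrightarrow> b \<in> carrier R \<Longrightarrow> (a \<otimes>\<^bsub>R\<^esub> b) \<odot>\<^bsub>threads M j\<^esub> x = a \<odot>\<^bsub>threads M j\<^esub> (b \<odot>\<^bsub>threads M j\<^esub> x)"
    using x' by (intro ext, simp add: threads_ops lm_smult[OF mM])+
  assume y: "y \<in> carrier (threads M j)"
  note y' = threadsD(1)[OF y]
  show "x \<oplus>\<^bsub>threads M j\<^esub> y = y \<oplus>\<^bsub>threads M j\<^esub> x"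
    using x' y' by (intro ext) (simp add: threads_ops lm_cancel(7)[OF mM x' y'])
  show "a \<in> carrier R \<Longrightarrow> a \<odot>\<^bsub>threads M j\<^esub> (x \<oplus>\<^bsub>threads M j\<^esub> y) = a \<odot>\<^bsub>threads M j\<^esub> x \<oplus>\<^bsub>threads M j\<^esub> a \<odot>\<^bsub>threads M j\<^esub> y"
    using x' y' by (intro ext) (simp add: threads_ops lm_smult[OF mM])
  assume z: "z \<in> carrier (threads M j)"
  show "x \<oplus>\<^bsub>threads M j\<^esub> y \<oplus>\<^bsub>threads M j\<^esub> z = x \<oplus>\<^bsub>threads M j\<^esub> (y \<oplus>\<^bsub>threads M j\<^esub> z)"
  proof (intro ext)
    fix n
    interpret abelian_group "M n" by (rule lm_grp[OF mM])
    show "(x \<oplus>\<^bsub>threads M j\<^esub> y \<oplus>\<^bsub>threads M j\<^esub> z) n = (x \<oplus>\<^bsub>threads M j\<^esub> (y \<oplus>\<^bsub>threads M j\<^esub> z)) n"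
      using x' y' threadsD(1)[OF z] by (simp add: threads_ops a_assoc)
  qed
qed

lemma threads_component: "lin R (threads M j) (M n) (\<lambda>y. y n)"
  by (rule linI[OF threads_module thread_mod]) (simp_all add: threads_ops threadsD(1))

lemma lin_push: "lin R (M n) (M (n + d)) (push j n d)"
proof (induction d)
  case 0
  have "lin R (M n) (M n) (push j n 0)" by (rule lin_cong[OF lin_id[OF thread_mod]]) simp
  then show ?case by (simp only: add_0_right)
next
  case (Suc d)
  have "lin R (M n) (M (Suc (n + d))) (\<lambda>x. j (n + d) (push j n d x))" by (rule lin_comp[OF Suc j])
  then have "lin R (M n) (M (Suc (n + d))) (push j n (Suc d))" by (rule lin_cong) simp
  then show ?case by (simp only: add_Suc_right)
qed

lemma push_inj:
  assumes inj: "\<And>n. inj_on (j n) (carrier (M n))" and x: "x \<in> carrier (M n)" "push j n d x = \<zero>\<^bsub>M (n + d)\<^esub>"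
  shows "x = \<zero>\<^bsub>M n\<^esub>"
  using x
proof (induction d)
  case (Suc d)
  have "push j n d x = \<zero>\<^bsub>M (n + d)\<^esub>"
    using Suc.prems inj lin_inj_iff[OF j, of "n + d"] lin_closed[OF lin_push] by simp
  then show ?case using Suc by simp
qed simp

lemma thread_step: "m \<ge> n \<Longrightarrow> thread M j n x (Suc m) = j m (thread M j n x m)"
  by (simp add: thread_def Suc_diff_le)

lemma thread_closed: "x \<in> carrier (M n) \<Longrightarrow> thread M j n x m \<in> carrier (M m)"
  using lin_closed[OF lin_push, of x n "m - n"]
  by (cases "m < n") (simp_all add: thread_def lm_closed[OF thread_mod])

lemma lin_thread: "lin R (M n) (threads M j) (thread M j n)"
proof (rule linI[OF thread_mod threads_module])
  show "thread M j n x \<in> carrier (threads M j)" if "x \<in> carrier (M n)" for x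
    by (rule threadsI[of _ n]) (use that thread_closed thread_step in auto)
  note p = lin_simps[OF lin_push[of n]]
  show "thread M j n (x \<oplus>\<^bsub>M n\<^esub> y) = thread M j n x \<oplus>\<^bsub>threads M j\<^esub> thread M j n y"
    if "x \<in> carrier (M n)" "y \<in> carrier (M n)" for x y
  proof
    fix m
    show "thread M j n (x \<oplus>\<^bsub>M n\<^esub> y) m = (thread M j n x \<oplus>\<^bsub>threads M j\<^esub> thread M j n y) m"
      using p(2)[OF that, of "m - n"] by (simp add: thread_def threads_ops lm_closed[OF thread_mod] lm_add[OF thread_mod])
  qed
  show "thread M j n (a \<odot>\<^bsub>M n\<^esub> x) = a \<odot>\<^bsub>threads M j\<^esub> thread M j n x"
    if "a \<in> carrier R" "x \<in> carrier (M n)" for a x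
  proof
    fix m
    show "thread M j n (a \<odot>\<^bsub>M n\<^esub> x) m = (a \<odot>\<^bsub>threads M j\<^esub> thread M j n x) m"
      using p(3)[OF that, of "m - n"] that by (simp add: thread_def threads_ops lm_smult0[OF thread_mod])
  qed
qed

lemma threads_eqI:
  assumes y: "\<forall>n\<ge>N. y (Suc n) = j n (y n)" and z: "\<forall>n\<ge>N. z (Suc n) = j n (z n)" and eq: "y N = z N"
  shows "n \<ge> N \<Longrightarrow> y n = z n"
  by (induction n rule: dec_induct) (use y z eq in auto)

definition vanishing :: "(nat \<Rightarrow> 'm) set" where
  "vanishing = {y \<in> carrier (threads M j). \<exists>N. \<forall>n\<ge>N. y n = \<zero>\<^bsub>M n\<^esub>}"

lemma submod_vanishing: "submod R (threads M j) vanishing"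
proof -
  note cl = lm_closed[OF threads_module]
  show ?thesis unfolding submod_def
  proof (intro conjI ballI)
    show "vanishing \<subseteq> carrier (threads M j)" "\<zero>\<^bsub>threads M j\<^esub> \<in> vanishing"
      using cl by (auto simp: vanishing_def threads_ops)
    show "x \<oplus>\<^bsub>threads M j\<^esub> y \<in> vanishing" if xy: "x \<in> vanishing" "y \<in> vanishing" for x y
    proof -
      obtain N1 N2 where "\<forall>n\<ge>N1. x n = \<zero>\<^bsub>M n\<^esub>" "\<forall>n\<ge>N2. y n = \<zero>\<^bsub>M n\<^esub>" using xy by (auto simp: vanishing_def)
      then have "\<forall>n\<ge>max N1 N2. (x \<oplus>\<^bsub>threads M j\<^esub> y) n = \<zero>\<^bsub>M n\<^esub>"
        by (simp add: threads_ops lm_add[OF thread_mod] lm_closed[OF thread_mod])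
      then show ?thesis using xy cl(1) unfolding vanishing_def by blast
    qed
    show "a \<odot>\<^bsub>threads M j\<^esub> x \<in> vanishing" if ax: "a \<in> carrier R" "x \<in> vanishing" for a x
    proof -
      obtain N where "\<forall>n\<ge>N. x n = \<zero>\<^bsub>M n\<^esub>" using ax by (auto simp: vanishing_def)
      then have "\<forall>n\<ge>N. (a \<odot>\<^bsub>threads M j\<^esub> x) n = \<zero>\<^bsub>M n\<^esub>"
        using ax by (simp add: threads_ops lm_smult0[OF thread_mod])
      then show ?thesis using ax cl(5) unfolding vanishing_def by blast
    qed
  qed
qed

lemma vanishing_diff:
  assumes y: "y \<in> carrier (threads M j)" and z: "z \<in> carrier (threads M j)"
  shows "y \<ominus>\<^bsub>threads M j\<^esub> z \<in> vanishing \<longleftrightarrow> (\<exists>N. \<forall>n\<ge>N. y n = z n)"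
proof -
  have "(y \<ominus>\<^bsub>threads M j\<^esub> z) n = y n \<ominus>\<^bsub>M n\<^esub> z n" for n
    by (rule lin_simps(6)[OF threads_component y z])
  then have "(y \<ominus>\<^bsub>threads M j\<^esub> z) n = \<zero>\<^bsub>M n\<^esub> \<longleftrightarrow> y n = z n" for n
    using lm_cancel(1)[OF thread_mod threadsD(1)[OF y] threadsD(1)[OF z]] by simp
  then show ?thesis using lm_closed(4)[OF threads_module y z] by (simp add: vanishing_def)
qed

text \<open>
  A sequence is determined by its values up to the place where it begins to follow the maps, so it is coded
  by a number and a finite list.  Thus the colimit has a copy on the type \<open>'m\<close>.
\<close>

lemma threads_small:
  assumes inf: "infinite (UNIV :: 'm set)"
  shows "\<exists>h :: (nat \<Rightarrow> 'm) \<Rightarrow> 'm. inj_on h (carrier (threads M j))"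
proof -
  obtain c :: "nat \<Rightarrow> 'm" where c: "inj c" using infinite_countable_subset[OF inf] by blast
  define N where "N y = (SOME N. \<forall>n\<ge>N. y (Suc n) = j n (y n))" for y
  have N: "\<forall>n\<ge>N y. y (Suc n) = j n (y n)" if "y \<in> carrier (threads M j)" for y
    unfolding N_def using threadsD(2)[OF that] by (rule someI_ex)
  have "inj_on (\<lambda>y. prc (c (N y)) (prefix_code y (N y))) (carrier (threads M j))"
  proof (rule inj_onI)
    fix y z assume yz: "y \<in> carrier (threads M j)" "z \<in> carrier (threads M j)"
      "prc (c (N y)) (prefix_code y (N y)) = prc (c (N z)) (prefix_code z (N z))"
    have e: "c (N y) = c (N z)" "prefix_code y (N y) = prefix_code z (N z)"
      using arg_cong[OF yz(3), of fs] arg_cong[OF yz(3), of sn] by (simp_all add: prc_simps[OF inf])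
    then have Nyz: "N y = N z" using c by (auto dest: injD)
    have le: "y n = z n" if "n \<le> N z" for n using prefix_code_inj[OF inf, of y "N z" z n] e(2) Nyz that by simp
    show "y = z"
    proof
      fix n
      show "y n = z n"
      proof (cases "n \<le> N z")
        case False
        then show ?thesis
          using threads_eqI[of "N z" y z n] N[OF yz(1)] N[OF yz(2)] Nyz le[of "N z"] by simp
      qed (rule le)
    qed
  qed
  then show ?thesis by blast
qed

end

text \<open>
  Here \<open>Y\<close> ranges over all modules, not only those of finite length: the perpendicular category is zero in
  the stable category of all modules too.
\<close>

locale weakly_simple_minded_big = weakly_simple_minded R K e \<B>
  for R :: "('a, 'r) ring_scheme" (structure) and K :: "'a set" and e :: "'a \<Rightarrow> 'm"
    and \<B> :: "('a, 'm) module set" +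
  assumes big_perp: "left_module R Y \<Longrightarrow> (\<And>S f. S \<in> \<B> \<Longrightarrow> lin R S Y f \<Longrightarrow> stz S Y f) \<Longrightarrow> stz Y Y (\<lambda>y. y)"
begin

text \<open>
  A map from a brick to the colimit \<open>Y\<close> comes from some \<open>M n\<close>, by finite generation, and dies in \<open>M (n + 1)\<close>.  So
  every such map is stably zero, and by assumption the identity of \<open>Y\<close> factors through a projective module \<open>P\<close>.
  The map \<open>P \<rightarrow> Y\<close> lifts to the module of threads, whose components then give maps \<open>P \<rightarrow> M n\<close>.  On the finitely
  generated module \<open>M 0\<close> the composite \<open>M 0 \<rightarrow> Y \<rightarrow> P \<rightarrow> M n\<close> agrees with the structure map for large \<open>n\<close>.
\<close>

lemma stz_push:
  fixes M :: "nat \<Rightarrow> ('a, 'm) module"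
  assumes fl: "\<And>n. fl (M n)" and j: "\<And>n. lin R (M n) (M (Suc n)) (j n)"
    and inj: "\<And>n. inj_on (j n) (carrier (M n))"
    and kill: "\<And>n S f. S \<in> \<B> \<Longrightarrow> lin R S (M n) f \<Longrightarrow> stz S (M (Suc n)) (\<lambda>s. j n (f s))"
  shows "\<exists>N. stz (M 0) (M N) (push j 0 N)"
proof -
  note mM = thread_mod[of R M j, OF j]
  let ?T = "threads M j"
  note mT = threads_module[of R M j, OF j]
  note thr = lin_thread[of R M j, OF j]
  note comp = threads_component[of R M j, OF j]
  note tD = threadsD[of R M j, OF j]
  note van = vanishing_diff[of R M j, OF j]
  obtain h :: "(nat \<Rightarrow> 'm) \<Rightarrow> 'm" where h: "inj_on h (carrier ?T)" using threads_small[of R M j, OF j inf] by blast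
  obtain Z :: "('a, 'm) module" where Z: "lin R ?T Z h" "h ` carrier ?T = carrier Z" using ex_copy[OF mT h] by blast
  obtain h' where h': "lin R Z ?T h'" "\<forall>y\<in>carrier ?T. h' (h y) = y" "\<forall>z\<in>carrier Z. h (h' z) = z"
    using lin_inverse[OF Z(1) h Z(2)] by blast
  let ?V = "vanishing M j"
  have sV: "submod R Z (h ` ?V)" by (rule submod_image[OF Z(1) submod_vanishing[of R M j, OF j]])
  obtain Y :: "('a, 'm) module" and q where q: "lin R Z Y q" "q ` carrier Z = carrier Y"
      "\<forall>z\<in>carrier Z. q z = \<zero>\<^bsub>Y\<^esub> \<longleftrightarrow> z \<in> h ` ?V"
    using ex_quotient[OF lin_mods(2)[OF Z(1)] sV] by blast
  note mY = lin_mods(2)[OF q(1)]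
  have VT: "?V \<subseteq> carrier ?T" by (auto simp: vanishing_def[of R M j, OF j])
  have qh: "lin R ?T Y (\<lambda>y. q (h y))" by (rule lin_comp[OF Z(1) q(1)])
  have qh0: "q (h y) = \<zero>\<^bsub>Y\<^esub> \<longleftrightarrow> y \<in> ?V" if "y \<in> carrier ?T" for y
    using q(3) lin_closed[OF Z(1) that] inj_on_image_mem_iff[OF h that VT] by simp
  have qh_eq: "q (h y) = q (h z) \<longleftrightarrow> (\<exists>N. \<forall>n\<ge>N. y n = z n)" if yz: "y \<in> carrier ?T" "z \<in> carrier ?T" for y z
  proof -
    have "q (h y) = q (h z) \<longleftrightarrow> q (h (y \<ominus>\<^bsub>?T\<^esub> z)) = \<zero>\<^bsub>Y\<^esub>"
      using yz by (simp add: lin_simps[OF qh] lm_cancel(1)[OF mY])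
    then show ?thesis using qh0[OF lm_closed(4)[OF mT yz]] van[OF yz] by simp
  qed
  have qsurj: "\<exists>t\<in>carrier ?T. q (h t) = y" if "y \<in> carrier Y" for y
    using that q(2) Z(2) by (metis imageE)
  define u where "u n x = q (h (thread M j n x))" for n x
  have u: "lin R (M n) Y (u n)" for n unfolding u_def by (rule lin_comp[OF thr qh])
  have u_inj: "inj_on (u n) (carrier (M n))" for n
  proof -
    have "x = \<zero>\<^bsub>M n\<^esub>" if x: "x \<in> carrier (M n)" "u n x = \<zero>\<^bsub>Y\<^esub>" for x
    proof -
      have "thread M j n x \<in> ?V" using qh0[OF lin_closed[OF thr x(1)]] x(2) by (simp add: u_def)
      then obtain N where N: "\<forall>m\<ge>N. thread M j n x m = \<zero>\<^bsub>M m\<^esub>" by (auto simp: vanishing_def[of R M j, OF j])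
      have "push j n N x = \<zero>\<^bsub>M (n + N)\<^esub>" using N[rule_format, of "n + N"] by (simp add: thread_def)
      then show ?thesis using push_inj[of R M j x n N, OF j inj x(1)] by simp
    qed
    then show ?thesis using lin_inj_iff[OF u] by blast
  qed
  have u_step: "u n x = u (Suc n) (j n x)" if x: "x \<in> carrier (M n)" for n x
  proof -
    have "thread M j n x m = thread M j (Suc n) (j n x) m" if m: "m \<ge> Suc n" for m
      using m
    proof (induction m rule: dec_induct)
      case base
      then show ?case by (simp add: thread_def)
    next
      case (step m)
      then show ?case using thread_step[of R M j n m x, OF j] thread_step[of R M j "Suc n" m "j n x", OF j] by simp
    qed
    then show ?thesis unfolding u_def
      using qh_eq[OF lin_closed[OF thr x] lin_closed[OF thr lin_closed[OF j x]]] by blast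
  qed
  \<comment> \<open>Compactness: a map from a module of finite length to the colimit comes from a stage of it.\<close>
  have factor: "\<exists>n f'. lin R S (M n) f' \<and> (\<forall>s\<in>carrier S. u n (f' s) = f s)"
    if S: "fl S" and f: "lin R S Y f" for S f
  proof -
    obtain G where G: "finite G" "G \<subseteq> carrier S" and gen: "\<And>U. submod R S U \<Longrightarrow> G \<subseteq> U \<Longrightarrow> U = carrier S"
      using ex_finite_generators[OF S] by blast
    have "\<exists>N. \<forall>n\<ge>N. f g \<in> u n ` carrier (M n)" if g: "g \<in> G" for g
    proof -
      obtain t where t: "t \<in> carrier ?T" "q (h t) = f g" using qsurj lin_closed[OF f] G(2) g by blast
      obtain N where N: "\<forall>n\<ge>N. t (Suc n) = j n (t n)" using tD(2)[OF t(1)] by blast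
      have "f g = u n (t n)" if n: "n \<ge> N" for n
      proof -
        have "thread M j n (t n) m = t m" if "m \<ge> n" for m
          using threads_eqI[of R M j n "thread M j n (t n)" t m, OF j] that N n thread_step[of R M j n _ "t n", OF j]
          by (simp add: thread_def)
        then show ?thesis unfolding t(2)[symmetric] u_def
          using qh_eq[OF t(1) lin_closed[OF thr tD(1)[OF t(1)]], of n] by metis
      qed
      then show ?thesis using tD(1)[OF t(1)] by blast
    qed
    then obtain N where N: "\<And>g n. g \<in> G \<Longrightarrow> n \<ge> N g \<Longrightarrow> f g \<in> u n ` carrier (M n)" by metis
    define n where "n = Max (insert 0 (N ` G))"
    have "f g \<in> u n ` carrier (M n)" if "g \<in> G" for g
      by (rule N[OF that]) (use G(1) that in \<open>simp add: n_def\<close>)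
    then have "G \<subseteq> {s \<in> carrier S. f s \<in> u n ` carrier (M n)}" using G(2) by blast
    then have "{s \<in> carrier S. f s \<in> u n ` carrier (M n)} = carrier S"
      by (rule gen[OF submod_vimage[OF f submod_image[OF u submod_carrier[OF mM]]]])
    then show ?thesis using lin_corestrict[OF u u_inj f] by blast
  qed
  have "stz S Y f" if S: "S \<in> \<B>" and f: "lin R S Y f" for S f
  proof -
    obtain n f' where f': "lin R S (M n) f'" "\<forall>s\<in>carrier S. u n (f' s) = f s" using factor[OF brick_fl[OF S] f] by blast
    show ?thesis
      by (rule stz_cong[OF stz_post[OF kill[OF S f'(1)] u]]) (use f' u_step lin_closed[OF f'(1)] in simp)
  qed
  then have "stz Y Y (\<lambda>y. y)" by (rule big_perp[OF mY])
  then obtain P :: "('a, 'm) module" and a b where P: "projective R P" "lin R Y P a" "lin R P Y b" "\<forall>y\<in>carrier Y. y = b (a y)"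
    by (rule stzE)
  obtain b' where b': "lin R P Z b'" "\<forall>x\<in>carrier P. q (b' x) = b x" using projective_lift[OF P(1) q(1,2) P(3)] by blast
  define \<theta> where "\<theta> x = h' (b' (a (u 0 x)))" for x
  have au: "lin R (M 0) P (\<lambda>x. a (u 0 x))" by (rule lin_comp[OF u P(2)])
  have \<theta>: "lin R (M 0) ?T \<theta>" unfolding \<theta>_def by (rule lin_comp[OF lin_comp[OF au b'(1)] h'(1)])
  have "\<exists>N. \<forall>n\<ge>N. \<theta> x n = thread M j 0 x n" if x: "x \<in> carrier (M 0)" for x
  proof -
    have "q (h (\<theta> x)) = u 0 x"
      using h'(3) b'(2) P(4) lin_closed[OF au x] lin_closed[OF b'(1)] lin_closed[OF u x] by (simp add: \<theta>_def)
    then show ?thesis using qh_eq[OF lin_closed[OF \<theta> x] lin_closed[OF thr x]] by (simp add: u_def)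
  qed
  then obtain N where N: "\<And>x n. x \<in> carrier (M 0) \<Longrightarrow> n \<ge> N x \<Longrightarrow> \<theta> x n = thread M j 0 x n" by metis
  obtain G where G: "finite G" "G \<subseteq> carrier (M 0)" and gen: "\<And>U. submod R (M 0) U \<Longrightarrow> G \<subseteq> U \<Longrightarrow> U = carrier (M 0)"
    using ex_finite_generators[OF fl[of 0]] by blast
  define n where "n = Max (insert 0 (N ` G))"
  have eqG: "\<theta> x n = thread M j 0 x n" if "x \<in> G" for x
    by (rule N) (use G that in \<open>auto simp: n_def\<close>)
  have "{x \<in> carrier (M 0). \<theta> x n = thread M j 0 x n} = carrier (M 0)"
    by (rule gen[OF submod_equalizer[OF lin_comp[OF \<theta> comp] lin_comp[OF thr comp]]]) (use eqG G(2) in blast)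
  moreover have "stz (M 0) (M n) (\<lambda>x. \<theta> x n)" unfolding \<theta>_def
    by (rule stz_via[OF P(1) au lin_comp[OF lin_comp[OF b'(1) h'(1)] comp]])
  ultimately have "stz (M 0) (M n) (push j 0 n)"
    by (elim stz_cong) (auto simp: thread_def)
  then show ?thesis by blast
qed

text \<open>
  Killing all maps from bricks again and again gives a sequence as in the previous lemma, starting with \<open>X\<close>.
  So the composite of finitely many steps is stably zero, that is, it factors through a projective module \<open>E\<close>, which
  is trivially filtered; pulling \<open>E\<close> back along the chain exhibits \<open>X\<close> as a retract of a filtered module.
\<close>

theorem filt_exhausts:
  assumes X: "fl X"
  shows "\<exists>m. filt m X"
proof -
  define nxt where "nxt Z = (SOME (W, j). chain Z W j \<and> (\<forall>S\<in>\<B>. \<forall>f. lin R S Z f \<longrightarrow> stz S W (\<lambda>s. j (f s))))" for Z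
  have nxt: "chain Z (fst (nxt Z)) (snd (nxt Z))"
      "\<And>S f. S \<in> \<B> \<Longrightarrow> lin R S Z f \<Longrightarrow> stz S (fst (nxt Z)) (\<lambda>s. snd (nxt Z) (f s))" if "fl Z" for Z
  proof -
    have "\<exists>p. case p of (W, j) \<Rightarrow> chain Z W j \<and> (\<forall>S\<in>\<B>. \<forall>f. lin R S Z f \<longrightarrow> stz S W (\<lambda>s. j (f s)))"
      using kill_all_bricks[OF that] by auto
    then have *: "case nxt Z of (W, j) \<Rightarrow> chain Z W j \<and> (\<forall>S\<in>\<B>. \<forall>f. lin R S Z f \<longrightarrow> stz S W (\<lambda>s. j (f s)))"
      unfolding nxt_def by (rule someI_ex)
    then show "chain Z (fst (nxt Z)) (snd (nxt Z))" by (cases "nxt Z") simp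
    show "stz S (fst (nxt Z)) (\<lambda>s. snd (nxt Z) (f s))" if "S \<in> \<B>" "lin R S Z f" for S f
      using * that by (cases "nxt Z") simp
  qed
  define M where "M n = ((\<lambda>Z. fst (nxt Z)) ^^ n) X" for n
  define j where "j n = snd (nxt (M n))" for n
  have M0: "M 0 = X" and MS: "M (Suc n) = fst (nxt (M n))" for n by (simp_all add: M_def)
  have flM: "fl (M n)" for n
  proof (induction n)
    case (Suc n)
    then show ?case using chain_props(1)[OF nxt(1)] by (simp add: MS)
  qed (simp add: M0 X)
  have ch: "chain (M n) (M (Suc n)) (j n)" for n using nxt(1)[OF flM] by (simp add: MS j_def)
  note props = chain_props[OF ch flM]
  have "\<exists>N. stz (M 0) (M N) (push j 0 N)"
    by (rule stz_push[of M j, OF flM props(2,3)]) (use nxt(2)[OF flM] in \<open>simp add: MS j_def\<close>)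
  then obtain N where N: "stz X (M N) (push j 0 N)" by (auto simp: M0)
  have "chain X (M n) (push j 0 n)" for n
  proof (induction n)
    case 0
    have "push j 0 0 = (\<lambda>x. x)" by (simp add: fun_eq_iff)
    then show ?case using chain.base by (simp add: M0)
  next
    case (Suc n)
    have "push j 0 (Suc n) = (\<lambda>x. j n (push j 0 n x))" by (simp add: fun_eq_iff)
    then show ?case using chain_trans[OF ch Suc] by simp
  qed
  note chN = this[of N]
  obtain E \<theta> \<pi> where E: "pif E" "lin R X E \<theta>" "lin R E (M N) \<pi>" "\<pi> ` carrier E = carrier (M N)"
      "\<forall>x\<in>carrier X. push j 0 N x = \<pi> (\<theta> x)"
    using stz_through_pif[OF N flM] by blast
  have "filt 0 E" using E(1) by simp
  then obtain m F s a where "filt m F" "lin R X F s" "lin R F X a" "\<forall>x\<in>carrier X. a (s x) = x"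
    using filt_retract_of_chain[OF chN X _ E(3,4,2)] E(5) by metis
  then show ?thesis using filt_retract[OF _ X] by blast
qed

end

section \<open>Finitely presented modules\<close>

lemma a_kernel_iff: "x \<in> a_kernel M N g \<longleftrightarrow> x \<in> carrier M \<and> g x = \<zero>\<^bsub>N\<^esub>"
  by (simp add: a_kernel_def kernel_def)

lemma free_module_simps:
  "carrier (free_module R n) = {..<n} \<rightarrow>\<^sub>E carrier R"
  "\<zero>\<^bsub>free_module R n\<^esub> = (\<lambda>i\<in>{..<n}. \<zero>\<^bsub>R\<^esub>)"
  "v \<oplus>\<^bsub>free_module R n\<^esub> w = (\<lambda>i\<in>{..<n}. v i \<oplus>\<^bsub>R\<^esub> w i)"
  "a \<odot>\<^bsub>free_module R n\<^esub> v = (\<lambda>i\<in>{..<n}. a \<otimes>\<^bsub>R\<^esub> v i)"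
  by (simp_all add: free_module_def)

lemma (in ring) free_module_module: "left_module R (free_module R n)"
proof (rule left_moduleI[OF ring_axioms], unfold free_module_simps, goal_cases)
  case (6 x)
  then show ?case
    by (intro bexI[of _ "\<lambda>i\<in>{..<n}. \<ominus> x i"]) (auto simp: l_neg PiE_iff extensional_def fun_eq_iff)
qed (auto simp: PiE_iff extensional_def fun_eq_iff a_ac l_distr r_distr m_assoc)

context self_injective_algebra
begin

lemma finlen_free_module: "finlen K (free_module R n)"
proof (induction n)
  case 0
  have "U = {\<zero>\<^bsub>free_module R 0\<^esub>}" if "subsp K (free_module R 0) U" for U
    using that by (auto simp: subsp_def free_module_simps PiE_def extensional_def fun_eq_iff)
  then show ?case unfolding finlen_def by blast
next
  case (Suc n)
  define f where "f a = (\<lambda>i\<in>{..<Suc n}. if i = n then a else \<zero>)" for a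
  define g where "g v = restrict v {..<n}" for v :: "nat \<Rightarrow> 'a"
  have f: "lin R (regular_module R) (free_module R (Suc n)) f"
    by (rule linI[OF regular_left_module free_module_module])
      (auto simp: f_def free_module_simps regular_module_def fun_eq_iff)
  have g: "lin R (free_module R (Suc n)) (free_module R n) g"
    by (rule linI[OF free_module_module free_module_module])
      (auto simp: g_def free_module_simps fun_eq_iff PiE_iff)
  have "ses R (regular_module R) (free_module R (Suc n)) (free_module R n) f g"
  proof (rule sesI[OF f g])
    fix a assume a: "f a = \<zero>\<^bsub>free_module R (Suc n)\<^esub>"
    have "f a n = \<zero>\<^bsub>free_module R (Suc n)\<^esub> n" using a by simp
    then show "a = \<zero>\<^bsub>regular_module R\<^esub>" by (simp add: f_def free_module_simps regular_module_def)
  next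
    fix v assume v: "v \<in> carrier (free_module R n)"
    show "\<exists>w\<in>carrier (free_module R (Suc n)). g w = v"
      by (rule bexI[of _ "\<lambda>i\<in>{..<Suc n}. if i = n then \<zero> else v i"])
        (use v in \<open>auto simp: g_def free_module_simps PiE_iff extensional_def fun_eq_iff\<close>)
  next
    fix a show "g (f a) = \<zero>\<^bsub>free_module R n\<^esub>"
      by (auto simp: g_def f_def free_module_simps fun_eq_iff)
  next
    fix v assume v: "v \<in> carrier (free_module R (Suc n))" "g v = \<zero>\<^bsub>free_module R n\<^esub>"
    have "v i = \<zero>" if "i < n" for i using fun_cong[OF v(2), of i] that by (simp add: g_def free_module_simps)
    then have "f (v n) = v" using v(1) by (auto simp: f_def free_module_simps PiE_iff extensional_def fun_eq_iff less_Suc_eq)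
    then show "\<exists>a\<in>carrier (regular_module R). f a = v"
      using v(1) by (auto simp: free_module_simps regular_module_def PiE_iff)
  qed
  then show ?case by (rule finlen_ses[OF K _ regular_finlen Suc])
qed

primrec comb :: "('a, 's) module \<Rightarrow> (nat \<Rightarrow> 's) \<Rightarrow> nat \<Rightarrow> (nat \<Rightarrow> 'a) \<Rightarrow> 's" where
  "comb M m 0 v = \<zero>\<^bsub>M\<^esub>"
| "comb M m (Suc n) v = comb M m n v \<oplus>\<^bsub>M\<^esub> v n \<odot>\<^bsub>M\<^esub> m n"

lemma lin_comb:
  assumes M: "left_module R M" and m: "\<And>i. i < N \<Longrightarrow> m i \<in> carrier M"
  shows "n \<le> N \<Longrightarrow> lin R (free_module R N) M (comb M m n)"
proof (induction n)
  case 0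
  show ?case by (rule lin_cong[OF lin_zero[OF free_module_module M]]) simp
next
  case (Suc n)
  have "lin R (free_module R N) M (\<lambda>v. v n \<odot>\<^bsub>M\<^esub> m n)"
    by (rule linI[OF free_module_module M])
      (use m[of n] Suc.prems in \<open>auto simp: free_module_simps PiE_iff lm_closed[OF M] lm_smult[OF M]\<close>)
  then have "lin R (free_module R N) M (\<lambda>v. comb M m n v \<oplus>\<^bsub>M\<^esub> v n \<odot>\<^bsub>M\<^esub> m n)"
    using lin_add Suc by simp
  then show ?case by (rule lin_cong) simp
qed

lemma ex_free_cover:
  fixes M :: "('a, 's) module"
  assumes M: "left_module R M" and fl: "finlen K M"
  shows "\<exists>n g. lin R (free_module R n) M g \<and> g ` carrier (free_module R n) = carrier M"
proof -
  obtain G where G: "finite G" "G \<subseteq> carrier M" and gen: "\<And>U. submod R M U \<Longrightarrow> G \<subseteq> U \<Longrightarrow> U = carrier M"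
    using finlen_finite_generators[OF M fl] by blast
  obtain gs where gs: "set gs = G" using finite_list[OF G(1)] by blast
  let ?n = "length gs"
  let ?g = "comb M ((!) gs) ?n"
  have m: "gs ! i \<in> carrier M" if "i < ?n" for i using that gs G(2) nth_mem by blast
  have g: "lin R (free_module R ?n) M ?g" by (rule lin_comb[OF M m]) auto
  have unit: "gs ! i \<in> ?g ` carrier (free_module R ?n)" if i: "i < ?n" for i
  proof -
    define u where "u = (\<lambda>k\<in>{..<?n}. if k = i then \<one> else \<zero>)"
    have "comb M ((!) gs) k u = (if i < k then gs ! i else \<zero>\<^bsub>M\<^esub>)" if "k \<le> ?n" for k
      using that
    proof (induction k)
      case (Suc k)
      then show ?case using m[of k] m[OF i]
        by (auto simp: u_def less_Suc_eq lm_one[OF M] lm_add[OF M] lm_smult0[OF M] lm_closed[OF M])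
    qed simp
    then have "?g u = gs ! i" using i by simp
    moreover have "u \<in> carrier (free_module R ?n)" by (auto simp: u_def free_module_simps)
    ultimately show ?thesis by (metis image_eqI)
  qed
  have "G \<subseteq> ?g ` carrier (free_module R ?n)" unfolding gs[symmetric] using unit by (auto simp: in_set_conv_nth)
  then have "?g ` carrier (free_module R ?n) = carrier M"
    by (rule gen[OF submod_image[OF g submod_carrier[OF free_module_module]]])
  then show ?thesis using g by blast
qed

text \<open>
  Free modules of finite rank have finite length, and a kernel in such a module has again a finite free
  cover.
\<close>

lemma finitely_presented_iff:
  fixes M :: "('a, 'm) module"
  assumes M: "left_module R M"
  shows "finitely_presented R M \<longleftrightarrow> finlen K M"
proof
  assume "finitely_presented R M"
  then obtain n g where g: "g \<in> mod_hom R (free_module R n) M" "g ` carrier (free_module R n) = carrier M"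
    unfolding finitely_presented_def by blast
  show "finlen K M"
    by (rule finlen_image[OF K lin_of_mod_hom[OF free_module_module M g(1)] g(2) finlen_free_module])
next
  assume fl: "finlen K M"
  obtain n g where g: "lin R (free_module R n) M g" "g ` carrier (free_module R n) = carrier M"
    using ex_free_cover[OF M fl] by blast
  let ?F = "free_module R n"
  let ?U = "{v \<in> carrier ?F. g v = \<zero>\<^bsub>M\<^esub>}"
  have U: "submod R ?F ?U" by (rule submod_ker[OF g(1)])
  note mU = submod_module[OF free_module_module U]
  have "finlen K (?F\<lparr>carrier := ?U\<rparr>)"
    by (rule finlen_inj[OF K mU(2) _ finlen_free_module]) simp
  then obtain m f where f: "lin R (free_module R m) (?F\<lparr>carrier := ?U\<rparr>) f"
      "f ` carrier (free_module R m) = ?U"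
    using ex_free_cover[OF mU(1)] by auto
  have f': "lin R (free_module R m) ?F f" by (rule lin_comp[OF f(1) mU(2)])
  show "finitely_presented R M" unfolding finitely_presented_def
    by (rule exI[of _ m], rule exI[of _ n], rule bexI[OF _ mod_hom_of_lin[OF f']], rule bexI[OF _ mod_hom_of_lin[OF g(1)]])
      (use f(2) g(2) in \<open>auto simp: a_kernel_iff image_iff\<close>)
qed

section \<open>Injective envelopes\<close>

lemma submodule_submod:
  assumes M: "left_module R M"
  shows "submodule U R M \<longleftrightarrow> submod R M U"
proof
  assume "submodule U R M"
  then interpret submodule U R M .
  show "submod R M U"
    using subset m_closed one_closed smult_closed by (auto simp: submod_def)
next
  assume U: "submod R M U"
  show "submodule U R M"
  proof (intro submodule.intro subgroup.intro submodule_axioms.intro)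
    show "inv\<^bsub>add_monoid M\<^esub> x \<in> U" if "x \<in> U" for x
      using submod_neg(1)[OF M U that] by (simp add: a_inv_def)
  qed (use U in \<open>auto simp: submod_def\<close>)
qed

lemma short_exact_iff:
  "short_exact R L M N f g \<longleftrightarrow> ses R L M N f g \<and> f \<in> mod_hom R L M \<and> g \<in> mod_hom R M N"
  unfolding short_exact_def ses_def
  by (auto simp: a_kernel_iff lin_closed lin_of_mod_hom dest: lin_mods)

lemma injective_envelope_iff:
  "injective_envelope R L I \<iota> \<longleftrightarrow> injective R I \<and> \<iota> \<in> mod_hom R L I \<and> inj_on \<iota> (carrier L) \<and>
    (\<forall>U. submod R I U \<and> U \<inter> \<iota> ` carrier L = {\<zero>\<^bsub>I\<^esub>} \<longrightarrow> U = {\<zero>\<^bsub>I\<^esub>})"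
proof (cases "left_module R I")
  case True
  then show ?thesis by (simp add: injective_envelope_def submodule_submod)
qed (simp add: injective_envelope_def injective_def)

text \<open>
  Among the endomorphisms of an injective \<open>E \<supseteq> L\<close> that fix \<open>L\<close>, one with image as small and kernel as
  large as possible is, by Fitting's lemma, up to an automorphism a projection, and its image is an
  injective envelope.
\<close>

lemma ex_injective_envelope:
  assumes L: "fl L"
  shows "\<exists>G \<iota>. injective_envelope R L G \<iota>"
proof -
  note mL = flD(1)[OF L]
  obtain E i where E: "pif E" "lin R L E i" "inj_on i (carrier L)" using ex_embedding[OF flD[OF L]] by blast
  note mE = pif_module[OF E(1)]
  have iE: "injective R E" "finlen K E" using E(1) by (auto simp: pif_def)
  obtain \<delta> :: "'m set \<Rightarrow> nat" where \<delta>: "\<forall>U V. subsp K E U \<longrightarrow> subsp K E V \<longrightarrow> U \<subset> V \<longrightarrow> \<delta> U < \<delta> V"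
    using iE(2) by (auto simp: finlen_def)
  have \<delta>_le: "\<delta> U \<le> \<delta> V" if "subsp K E U" "subsp K E V" "U \<subseteq> V" for U V
  proof (cases "U = V")
    case False
    then have "\<delta> U < \<delta> V" using \<delta> that by blast
    then show ?thesis by simp
  qed simp
  define ker where "ker h = {x \<in> carrier E. h x = \<zero>\<^bsub>E\<^esub>}" for h
  define P where "P h \<longleftrightarrow> lin R E E h \<and> (\<forall>x\<in>carrier L. h (i x) = i x)" for h
  have sp: "subsp K E (ker h)" "subsp K E (h ` carrier E)" "ker h \<subseteq> carrier E" "\<delta> (ker h) \<le> \<delta> (carrier E)"
    if "lin R E E h" for h
  proof -
    show k: "subsp K E (ker h)" unfolding ker_def by (rule submod_subsp[OF K mE submod_ker[OF that]])
    show "subsp K E (h ` carrier E)" by (rule submod_subsp[OF K mE submod_image[OF that submod_carrier[OF mE]]])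
    show "ker h \<subseteq> carrier E" by (auto simp: ker_def)
    then show "\<delta> (ker h) \<le> \<delta> (carrier E)" by (rule \<delta>_le[OF k subsp_carrier[OF K mE]])
  qed
  have P0: "P (\<lambda>x. x)" using lin_id[OF mE] by (simp add: P_def)
  obtain h where h: "P h" and min: "\<And>k. P k \<Longrightarrow>
      \<delta> (h ` carrier E) + (\<delta> (carrier E) - \<delta> (ker h)) \<le> \<delta> (k ` carrier E) + (\<delta> (carrier E) - \<delta> (ker k))"
    using ex_has_least_nat[of P, OF P0, of "\<lambda>h. \<delta> (h ` carrier E) + (\<delta> (carrier E) - \<delta> (ker h))"] by blast
  have lh: "lin R E E h" and hi: "\<And>x. x \<in> carrier L \<Longrightarrow> h (i x) = i x" using h by (auto simp: P_def)
  have stable: "k ` carrier E = h ` carrier E \<and> ker k = ker h"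
    if k: "P k" "k ` carrier E \<subseteq> h ` carrier E" "ker h \<subseteq> ker k" for k
  proof -
    have lk: "lin R E E k" using k by (auto simp: P_def)
    note a = \<delta>_le[OF sp(2)[OF lk] sp(2)[OF lh] k(2)] \<delta>_le[OF sp(1)[OF lh] sp(1)[OF lk] k(3)]
      sp(4)[OF lh] sp(4)[OF lk] min[OF k(1)]
    have "\<not> k ` carrier E \<subset> h ` carrier E"
    proof
      assume "k ` carrier E \<subset> h ` carrier E"
      then have "\<delta> (k ` carrier E) < \<delta> (h ` carrier E)" using \<delta> sp(2)[OF lk] sp(2)[OF lh] by blast
      then show False using a by linarith
    qed
    moreover have "\<not> ker h \<subset> ker k"
    proof
      assume "ker h \<subset> ker k"
      then have "\<delta> (ker h) < \<delta> (ker k)" using \<delta> sp(1)[OF lk] sp(1)[OF lh] by blast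
      then show False using a by linarith
    qed
    ultimately show ?thesis using k by blast
  qed
  have hh: "P (\<lambda>x. h (h x))" using lin_comp[OF lh lh] hi by (simp add: P_def)
  have hh': "(\<lambda>x. h (h x)) ` carrier E = h ` carrier E \<and> ker (\<lambda>x. h (h x)) = ker h"
    by (rule stable[OF hh]) (use lin_closed[OF lh] lin_simps(4)[OF lh] in \<open>auto simp: ker_def\<close>)
  define U where "U = h ` carrier E"
  have sU: "submod R E U" unfolding U_def by (rule submod_image[OF lh submod_carrier[OF mE]])
  let ?G = "E\<lparr>carrier := U\<rparr>"
  note mG = submod_module[OF mE sU]
  have UE: "x \<in> U \<Longrightarrow> x \<in> carrier E" for x using sU by (auto simp: submod_def)
  have hU: "lin R ?G ?G h" by (rule lin_into_sub[OF lin_comp[OF mG(2) lh] sU]) (use UE in \<open>auto simp: U_def\<close>)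
  have injU: "inj_on h U"
  proof -
    have "x = \<zero>\<^bsub>E\<^esub>" if x: "x \<in> U" "h x = \<zero>\<^bsub>E\<^esub>" for x
    proof -
      obtain y where y: "y \<in> carrier E" "x = h y" using x(1) by (auto simp: U_def)
      then have "y \<in> ker (\<lambda>x. h (h x))" using x(2) by (simp add: ker_def)
      then have "y \<in> ker h" using hh' by simp
      then show ?thesis using y by (simp add: ker_def)
    qed
    then show ?thesis using lin_inj_iff[OF hU] by simp
  qed
  have surjU: "h ` U = U" using hh' unfolding U_def by (simp add: image_image)
  obtain t where t: "lin R ?G ?G t" "\<forall>x\<in>U. t (h x) = x" "\<forall>x\<in>U. h (t x) = x"
    using lin_inverse[OF hU] injU surjU by auto
  have hE: "lin R E ?G h" by (rule lin_into_sub[OF lh sU]) (auto simp: U_def)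
  have pG: "pif ?G"
    by (rule pif_retract[OF E(1) mG(2) lin_comp[OF hE t(1)]]) (use t(2) in simp)
  have iU: "i x \<in> U" if "x \<in> carrier L" for x
    using hi[OF that] lin_closed[OF E(2) that] unfolding U_def by (metis image_eqI)
  have iG: "lin R L ?G i" by (rule lin_into_sub[OF E(2) sU iU])
  have "W = {\<zero>\<^bsub>?G\<^esub>}" if W: "submod R ?G W" "W \<inter> i ` carrier L = {\<zero>\<^bsub>?G\<^esub>}" for W
  proof (rule ccontr)
    assume nW: "W \<noteq> {\<zero>\<^bsub>?G\<^esub>}"
    have WU: "W \<subseteq> U" "\<zero>\<^bsub>E\<^esub> \<in> W" using W(1) by (auto simp: submod_def)
    then obtain w where w: "w \<in> W" "w \<noteq> \<zero>\<^bsub>E\<^esub>" using nW by auto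
    have sW: "submod R E W" using W(1) WU UE by (auto simp: submod_def)
    obtain Q :: "('a, 'm) module" and q where q: "lin R E Q q" "q ` carrier E = carrier Q"
        "\<forall>x\<in>carrier E. q x = \<zero>\<^bsub>Q\<^esub> \<longleftrightarrow> x \<in> W"
      using ex_quotient[OF mE sW] by blast
    have "inj_on (\<lambda>x. q (i x)) (carrier L)"
    proof -
      have "x = \<zero>\<^bsub>L\<^esub>" if x: "x \<in> carrier L" "q (i x) = \<zero>\<^bsub>Q\<^esub>" for x
      proof -
        have "i x \<in> W" using q(3) lin_closed[OF E(2) x(1)] x(2) by blast
        then have "i x = \<zero>\<^bsub>E\<^esub>" using W(2) x(1) by auto
        then show ?thesis using E(3) lin_inj_iff[OF E(2)] x(1) by blast
      qed
      then show ?thesis using lin_inj_iff[OF lin_comp[OF E(2) q(1)]] by blast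
    qed
    then obtain g where g: "lin R Q E g" "\<forall>x\<in>carrier L. g (q (i x)) = i x"
      using injective_extend[OF iE(1) lin_comp[OF E(2) q(1)] _ E(2)] by blast
    define k where "k x = h (g (q (h x)))" for x
    have lk: "lin R E E k" unfolding k_def by (rule lin_comp[OF lin_comp[OF lin_comp[OF lh q(1)] g(1)] lh])
    have "P k" using lk hi g(2) by (simp add: P_def k_def)
    moreover have "k ` carrier E \<subseteq> h ` carrier E"
      using lin_closed[OF lin_comp[OF lin_comp[OF lh q(1)] g(1)]] by (auto simp: k_def)
    moreover have "ker h \<subseteq> ker k"
      by (auto simp: ker_def k_def lin_simps(4)[OF q(1)] lin_simps(4)[OF g(1)] lin_simps(4)[OF lh])
    ultimately have "ker k = ker h" using stable by blast
    moreover obtain y where y: "y \<in> carrier E" "w = h y" using w(1) WU(1) by (auto simp: U_def)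
    moreover have "q w = \<zero>\<^bsub>Q\<^esub>" using q(3) w(1) WU(1) UE by blast
    then have "y \<in> ker k" using y by (simp add: ker_def k_def lin_simps(4)[OF g(1)] lin_simps(4)[OF lh])
    ultimately show False using w(2) by (auto simp: ker_def)
  qed
  then have "injective_envelope R L ?G (restrict i (carrier L))"
    unfolding injective_envelope_iff using pG mod_hom_of_lin[OF iG] E(3) by (auto simp: pif_def)
  then show ?thesis by blast
qed

text \<open>
  The envelope embeds into every injective module that contains \<open>L\<close>, since the kernel of an extension of the
  embedding of \<open>L\<close> meets \<open>L\<close> trivially; being injective it is a direct summand there.
\<close>

lemma pif_injective_envelope:
  assumes L: "fl L" and I: "injective_envelope R L I \<iota>"
  shows "pif I"
proof -
  have inj: "injective R I" "\<iota> \<in> mod_hom R L I" "inj_on \<iota> (carrier L)"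
    and ess: "\<And>U. submod R I U \<Longrightarrow> U \<inter> \<iota> ` carrier L = {\<zero>\<^bsub>I\<^esub>} \<Longrightarrow> U = {\<zero>\<^bsub>I\<^esub>}"
    using I unfolding injective_envelope_iff by auto
  have mI: "left_module R I" using inj(1) by (simp add: injective_def)
  note \<iota> = lin_of_mod_hom[OF flD(1)[OF L] mI inj(2)]
  obtain E i where E: "pif E" "lin R L E i" "inj_on i (carrier L)" using ex_embedding[OF flD[OF L]] by blast
  obtain g where g: "lin R I E g" "\<forall>x\<in>carrier L. g (\<iota> x) = i x"
    using injective_extend[OF _ \<iota> inj(3) E(2)] E(1) by (auto simp: pif_def)
  have "{x \<in> carrier I. g x = \<zero>\<^bsub>E\<^esub>} \<inter> \<iota> ` carrier L = {\<zero>\<^bsub>I\<^esub>}"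
  proof -
    have "\<iota> x = \<zero>\<^bsub>I\<^esub>" if x: "x \<in> carrier L" "g (\<iota> x) = \<zero>\<^bsub>E\<^esub>" for x
    proof -
      have "i x = \<zero>\<^bsub>E\<^esub>" using g(2) x by simp
      then have "x = \<zero>\<^bsub>L\<^esub>" using E(3) lin_inj_iff[OF E(2)] x(1) by blast
      then show ?thesis using lin_simps(4)[OF \<iota>] by simp
    qed
    moreover have "\<zero>\<^bsub>I\<^esub> \<in> \<iota> ` carrier L" using lin_simps(4)[OF \<iota>] lm_closed(2)[OF flD(1)[OF L]] by (metis image_eqI)
    ultimately show ?thesis using lin_simps(4)[OF g(1)] lm_closed(2)[OF mI] by auto
  qed
  then have "{x \<in> carrier I. g x = \<zero>\<^bsub>E\<^esub>} = {\<zero>\<^bsub>I\<^esub>}" by (rule ess[OF submod_ker[OF g(1)]])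
  then have ginj: "inj_on g (carrier I)" using lin_inj_iff[OF g(1)] by blast
  obtain r where "lin R E I r" "\<forall>x\<in>carrier I. r (g x) = x"
    using injective_extend[OF inj(1) g(1) ginj lin_id[OF mI]] by blast
  then show ?thesis using pif_retract[OF E(1) g(1)] by blast
qed

end

section \<open>Stable morphism spaces\<close>

text \<open>The stable class of a linear map that need not be extensional.\<close>

definition cls :: "('k, 'a) module \<Rightarrow> ('a, 'm) module \<Rightarrow> ('a, 'm) module \<Rightarrow> ('m \<Rightarrow> 'm) \<Rightarrow> ('m \<Rightarrow> 'm) set" where
  "cls A L M f = stable_class A L M (restrict f (carrier L))"

locale self_injective_fd_algebra = self_injective_algebra A K e
  for A :: "('k, 'a) module" and K :: "'a set" and e :: "'a \<Rightarrow> 'm"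
begin

lemma proj_hom_iff:
  assumes L: "left_module A L" and M: "left_module A M"
  shows "f \<in> proj_hom A L M \<longleftrightarrow> f \<in> mod_hom A L M \<and> stz L M f"
proof
  assume "f \<in> proj_hom A L M"
  then obtain P :: "('a, 'm) module" and g h where f: "f \<in> mod_hom A L M" and P: "projective A P"
      "g \<in> mod_hom A L P" "h \<in> mod_hom A P M" "f = compose (carrier L) h g"
    by (auto simp: proj_hom_def)
  have mP: "left_module A P" using P(1) by (simp add: projective_def)
  have "stz L M f"
    by (rule stz_cong[OF stz_via[OF P(1) lin_of_mod_hom[OF L mP P(2)] lin_of_mod_hom[OF mP M P(3)]]])
      (simp add: P(4) compose_def)
  then show "f \<in> mod_hom A L M \<and> stz L M f" using f by simp
next
  assume f: "f \<in> mod_hom A L M \<and> stz L M f"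
  then obtain P :: "('a, 'm) module" and g h where P: "projective A P" "lin A L P g" "lin A P M h" "\<forall>x\<in>carrier L. f x = h (g x)"
    by (auto elim: stzE)
  have "f = compose (carrier L) (restrict h (carrier P)) (restrict g (carrier L))"
  proof -
    have "restrict f (carrier L) = compose (carrier L) (restrict h (carrier P)) (restrict g (carrier L))"
      using P(4) lin_closed[OF P(2)] by (auto simp: compose_def fun_eq_iff)
    then show ?thesis using f mod_hom_restrict[of f A L M] by simp
  qed
  then show "f \<in> proj_hom A L M"
    using f P(1) mod_hom_of_lin[OF P(2)] mod_hom_of_lin[OF P(3)] unfolding proj_hom_def by blast
qed

lemma mem_cls:
  assumes f: "lin A L M f"
  shows "h \<in> cls A L M f \<longleftrightarrow> h \<in> mod_hom A L M \<and> stz L M (\<lambda>x. h x \<ominus>\<^bsub>M\<^esub> f x)"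
proof -
  note L = lin_mods(1)[OF f] and M = lin_mods(2)[OF f]
  have e: "cls A L M f = {\<lambda>x\<in>carrier L. p x \<oplus>\<^bsub>M\<^esub> f x |p. p \<in> proj_hom A L M}"
    by (auto simp: cls_def stable_class_def a_r_coset_def r_coset_def Hom_module_def fun_eq_iff)
  show ?thesis
  proof
    assume "h \<in> cls A L M f"
    then obtain p where p: "p \<in> proj_hom A L M" "h = (\<lambda>x\<in>carrier L. p x \<oplus>\<^bsub>M\<^esub> f x)" unfolding e by blast
    have p': "p \<in> mod_hom A L M" "stz L M p" using p(1) proj_hom_iff[OF L M] by auto
    note lp = stz_lin[OF p'(2)]
    have "h \<in> mod_hom A L M" unfolding p(2) by (rule mod_hom_of_lin[OF lin_add[OF lp f]])
    moreover have "stz L M (\<lambda>x. h x \<ominus>\<^bsub>M\<^esub> f x)"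
      by (rule stz_cong[OF p'(2)]) (use lin_closed[OF lp] lin_closed[OF f] in \<open>simp add: p(2) lm_cancel[OF M]\<close>)
    ultimately show "h \<in> mod_hom A L M \<and> stz L M (\<lambda>x. h x \<ominus>\<^bsub>M\<^esub> f x)" by blast
  next
    assume h: "h \<in> mod_hom A L M \<and> stz L M (\<lambda>x. h x \<ominus>\<^bsub>M\<^esub> f x)"
    define p where "p = (\<lambda>x\<in>carrier L. h x \<ominus>\<^bsub>M\<^esub> f x)"
    have lh: "lin A L M h" using lin_of_mod_hom[OF L M] h by blast
    have "p \<in> mod_hom A L M" unfolding p_def by (rule mod_hom_of_lin[OF lin_sub[OF lh f]])
    moreover have "stz L M p" using h by (elim conjE stz_cong) (simp add: p_def)
    ultimately have "p \<in> proj_hom A L M" using proj_hom_iff[OF L M] by blast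
    moreover have "h = (\<lambda>x\<in>carrier L. p x \<oplus>\<^bsub>M\<^esub> f x)"
    proof -
      have "restrict h (carrier L) = (\<lambda>x\<in>carrier L. p x \<oplus>\<^bsub>M\<^esub> f x)"
        using lin_closed[OF lh] lin_closed[OF f] by (auto simp: p_def fun_eq_iff lm_cancel[OF M])
      then show ?thesis using h mod_hom_restrict[of h A L M] by simp
    qed
    ultimately show "h \<in> cls A L M f" unfolding e by blast
  qed
qed

lemma stz_diff_trans:
  assumes "lin A L M f" "lin A L M g" "lin A L M h" "stz L M (\<lambda>x. f x \<ominus>\<^bsub>M\<^esub> g x)" "stz L M (\<lambda>x. g x \<ominus>\<^bsub>M\<^esub> h x)"
  shows "stz L M (\<lambda>x. f x \<ominus>\<^bsub>M\<^esub> h x)"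
proof (rule stz_cong[OF stz_add[OF assms(4,5)]])
  fix x assume x: "x \<in> carrier L"
  interpret M: abelian_group M by (rule lm_grp[OF lin_mods(2)[OF assms(1)]])
  show "f x \<ominus>\<^bsub>M\<^esub> g x \<oplus>\<^bsub>M\<^esub> (g x \<ominus>\<^bsub>M\<^esub> h x) = f x \<ominus>\<^bsub>M\<^esub> h x"
    using lin_closed[OF assms(1) x] lin_closed[OF assms(2) x] lin_closed[OF assms(3) x]
    by (simp add: M.minus_eq M.a_assoc M.r_neg1)
qed

lemma stz_diff_sym:
  assumes f: "lin A L M f" and g: "lin A L M g" and s: "stz L M (\<lambda>x. f x \<ominus>\<^bsub>M\<^esub> g x)"
  shows "stz L M (\<lambda>x. g x \<ominus>\<^bsub>M\<^esub> f x)"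
proof (rule stz_cong[OF stz_neg[OF s]])
  fix x assume x: "x \<in> carrier L"
  interpret M: abelian_group M by (rule lm_grp[OF lin_mods(2)[OF f]])
  show "\<ominus>\<^bsub>M\<^esub> (f x \<ominus>\<^bsub>M\<^esub> g x) = g x \<ominus>\<^bsub>M\<^esub> f x"
    using lin_closed[OF f x] lin_closed[OF g x] by (simp add: M.minus_eq M.minus_add M.a_comm)
qed

lemma stz_diff_refl: "lin A L M f \<Longrightarrow> (\<And>x. x \<in> carrier L \<Longrightarrow> f x = g x) \<Longrightarrow> stz L M (\<lambda>x. f x \<ominus>\<^bsub>M\<^esub> g x)"
  by (rule stz_cong[OF stz_zero[OF lin_mods]], assumption, assumption)
    (metis lin_closed lin_mods(2) lm_add(3))

lemma cls_eqI:
  assumes f: "lin A L M f" and g: "lin A L M g" and s: "stz L M (\<lambda>x. f x \<ominus>\<^bsub>M\<^esub> g x)"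
  shows "cls A L M f = cls A L M g"
proof -
  note L = lin_mods(1)[OF f] and M = lin_mods(2)[OF f]
  have "stz L M (\<lambda>x. h x \<ominus>\<^bsub>M\<^esub> f x) \<longleftrightarrow> stz L M (\<lambda>x. h x \<ominus>\<^bsub>M\<^esub> g x)" if h: "h \<in> mod_hom A L M" for h
    using stz_diff_trans[OF lin_of_mod_hom[OF L M h] f g _ s]
      stz_diff_trans[OF lin_of_mod_hom[OF L M h] g f _ stz_diff_sym[OF f g s]] by blast
  then show ?thesis using mem_cls[OF f] mem_cls[OF g] by blast
qed

lemma cls_self:
  fixes L M :: "('a, 'm) module"
  assumes f: "lin A L M f" shows "restrict f (carrier L) \<in> cls A L M f"
proof -
  have "lin A L M (restrict f (carrier L))" by (rule lin_cong[OF f]) simp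
  then have "stz L M (\<lambda>x. restrict f (carrier L) x \<ominus>\<^bsub>M\<^esub> f x)" by (rule stz_diff_refl) simp
  then show ?thesis using mem_cls[OF f] mod_hom_of_lin[OF f] by simp
qed

lemma cls_eqD:
  assumes f: "lin A L M f" and g: "lin A L M g" and eq: "cls A L M f = cls A L M g"
  shows "stz L M (\<lambda>x. f x \<ominus>\<^bsub>M\<^esub> g x)"
proof -
  have "stz L M (\<lambda>x. restrict f (carrier L) x \<ominus>\<^bsub>M\<^esub> g x)"
    using cls_self[OF f] mem_cls[OF g] eq by blast
  then show ?thesis by (rule stz_cong) simp
qed

lemma stable_class_cls: "f \<in> mod_hom A L M \<Longrightarrow> stable_class A L M f = cls A L M f"
  by (simp add: cls_def mod_hom_restrict)

lemma stable_Hom_carrier: "carrier (stable_Hom A L M) = {stable_class A L M f |f. f \<in> mod_hom A L M}"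
  by (auto simp: stable_Hom_def A_RCOSETS_def' stable_class_def Hom_module_def)

lemma cls_carrier: "lin A L M f \<Longrightarrow> cls A L M f \<in> carrier (stable_Hom A L M)"
  using mod_hom_of_lin unfolding stable_Hom_carrier cls_def by blast

lemma cls_exists:
  assumes "left_module A L" "left_module A M" "F \<in> carrier (stable_Hom A L M)"
  shows "\<exists>f. lin A L M f \<and> F = cls A L M f"
  using assms lin_of_mod_hom stable_class_cls unfolding stable_Hom_carrier by blast

lemma cls_zero:
  fixes L M :: "('a, 'm) module"
  assumes L: "left_module A L" and M: "left_module A M"
  shows "cls A L M (\<lambda>x. \<zero>\<^bsub>M\<^esub>) = proj_hom A L M"
proof -
  have "stz L M (\<lambda>x. h x \<ominus>\<^bsub>M\<^esub> \<zero>\<^bsub>M\<^esub>) \<longleftrightarrow> stz L M h" if "h \<in> mod_hom A L M" for h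
  proof -
    have "h x \<ominus>\<^bsub>M\<^esub> \<zero>\<^bsub>M\<^esub> = h x" if "x \<in> carrier L" for x
      using lin_closed[OF lin_of_mod_hom[OF L M \<open>h \<in> mod_hom A L M\<close>] that] by (simp add: lm_add[OF M])
    then show ?thesis using stz_cong[of L M h "\<lambda>x. h x \<ominus>\<^bsub>M\<^esub> \<zero>\<^bsub>M\<^esub>"] stz_cong[of L M "\<lambda>x. h x \<ominus>\<^bsub>M\<^esub> \<zero>\<^bsub>M\<^esub>" h] by auto
  qed
  then show ?thesis using mem_cls[OF lin_zero[OF L M]] proj_hom_iff[OF L M] by blast
qed

lemma stable_Hom_zero_iff:
  assumes L: "left_module A L" and M: "left_module A M"
  shows "stable_Hom_zero A L M \<longleftrightarrow> (\<forall>f. lin A L M f \<longrightarrow> stz L M f)"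
proof -
  note z = lin_zero[OF L M]
  have iff: "cls A L M f = proj_hom A L M \<longleftrightarrow> stz L M f" if f: "lin A L M f" for f
  proof -
    have "cls A L M f = proj_hom A L M \<longleftrightarrow> stz L M (\<lambda>x. f x \<ominus>\<^bsub>M\<^esub> \<zero>\<^bsub>M\<^esub>)"
      unfolding cls_zero[OF L M, symmetric] using cls_eqI[OF f z] cls_eqD[OF f z] by blast
    also have "\<dots> \<longleftrightarrow> stz L M f"
    proof -
      have "f x \<ominus>\<^bsub>M\<^esub> \<zero>\<^bsub>M\<^esub> = f x" if "x \<in> carrier L" for x
        using lin_closed[OF f that] by (simp add: lm_add[OF M])
      then show ?thesis using stz_cong[of L M f "\<lambda>x. f x \<ominus>\<^bsub>M\<^esub> \<zero>\<^bsub>M\<^esub>"] stz_cong[of L M "\<lambda>x. f x \<ominus>\<^bsub>M\<^esub> \<zero>\<^bsub>M\<^esub>" f] by auto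
    qed
    finally show ?thesis .
  qed
  have zero: "\<zero>\<^bsub>stable_Hom A L M\<^esub> = proj_hom A L M" by (simp add: stable_Hom_def)
  show ?thesis
  proof
    assume Z: "stable_Hom_zero A L M"
    show "\<forall>f. lin A L M f \<longrightarrow> stz L M f"
    proof (intro allI impI)
      fix f assume f: "lin A L M f"
      have "cls A L M f = proj_hom A L M" using cls_carrier[OF f] Z unfolding stable_Hom_zero_def zero by simp
      then show "stz L M f" using iff[OF f] by simp
    qed
  next
    assume r: "\<forall>f. lin A L M f \<longrightarrow> stz L M f"
    have "proj_hom A L M \<in> carrier (stable_Hom A L M)" using cls_carrier[OF z] cls_zero[OF L M] by simp
    moreover have "F = proj_hom A L M" if F: "F \<in> carrier (stable_Hom A L M)" for F
    proof -
      obtain f where f: "lin A L M f" "F = cls A L M f" using cls_exists[OF L M F] by blast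
      then show ?thesis using iff[OF f(1)] r by simp
    qed
    ultimately show "stable_Hom_zero A L M" unfolding stable_Hom_zero_def zero by blast
  qed
qed

lemma cls_comp:
  fixes L M N :: "('a, 'm) module"
  assumes f: "lin A L M f" and g: "lin A M N g"
  shows "stable_comp A L N (cls A M N g) (cls A L M f) = cls A L N (\<lambda>x. g (f x))"
proof -
  note L = lin_mods(1)[OF f] and M = lin_mods(2)[OF f] and N = lin_mods(2)[OF g]
  have "stable_class A L N (compose (carrier L) g' f') = cls A L N (\<lambda>x. g (f x))"
    if g': "g' \<in> cls A M N g" and f': "f' \<in> cls A L M f" for g' f'
  proof -
    have lg: "lin A M N g'" "stz M N (\<lambda>x. g' x \<ominus>\<^bsub>N\<^esub> g x)" using g' mem_cls[OF g] lin_of_mod_hom[OF M N] by blast+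
    have lf: "lin A L M f'" "stz L M (\<lambda>x. f' x \<ominus>\<^bsub>M\<^esub> f x)" using f' mem_cls[OF f] lin_of_mod_hom[OF L M] by blast+
    have "stable_class A L N (compose (carrier L) g' f') = cls A L N (\<lambda>x. g' (f' x))"
      by (simp add: cls_def compose_def restrict_def)
    also have "\<dots> = cls A L N (\<lambda>x. g (f x))"
    proof (rule cls_eqI[OF lin_comp[OF lf(1) lg(1)] lin_comp[OF f g]])
      have "stz L N (\<lambda>x. g (f' x) \<ominus>\<^bsub>N\<^esub> g (f x))"
        by (rule stz_cong[OF stz_post[OF lf(2) g]])
          (use lin_closed[OF lf(1)] lin_closed[OF f] in \<open>simp add: lin_simps[OF g]\<close>)
      then show "stz L N (\<lambda>x. g' (f' x) \<ominus>\<^bsub>N\<^esub> g (f x))"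
        by (rule stz_diff_trans[OF lin_comp[OF lf(1) lg(1)] lin_comp[OF lf(1) g] lin_comp[OF f g] stz_pre[OF lg(2) lf(1)]])
    qed
    finally show ?thesis .
  qed
  moreover have "restrict g (carrier M) \<in> cls A M N g" "restrict f (carrier L) \<in> cls A L M f"
    using cls_self f g by auto
  ultimately show ?thesis unfolding stable_comp_def by blast
qed

lemma cls_id: "stable_class A L L (id_hom L) = cls A L L (\<lambda>x. x)"
  by (simp add: cls_def id_hom_def)

lemma stable_isoI:
  assumes f: "lin A L M f" and g: "lin A M L g"
    and gf: "stz L L (\<lambda>x. g (f x) \<ominus>\<^bsub>L\<^esub> x)" and fg: "stz M M (\<lambda>y. f (g y) \<ominus>\<^bsub>M\<^esub> y)"
  shows "stable_iso A L M (cls A L M f)"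
  unfolding stable_iso_def cls_id
proof (intro conjI bexI[of _ "cls A M L g"])
  show "stable_comp A L L (cls A M L g) (cls A L M f) = cls A L L (\<lambda>x. x)"
    unfolding cls_comp[OF f g] by (rule cls_eqI[OF lin_comp[OF f g] lin_id[OF lin_mods(1)[OF f]] gf])
  show "stable_comp A M M (cls A L M f) (cls A M L g) = cls A M M (\<lambda>x. x)"
    unfolding cls_comp[OF g f] by (rule cls_eqI[OF lin_comp[OF g f] lin_id[OF lin_mods(1)[OF g]] fg])
qed (use cls_carrier f g in auto)

text \<open>
  The isomorphism with the field \<open>k\<close> takes the zero class to 0 because the zero class absorbs every
  class under composition; so it takes other classes to units.
\<close>

lemma stable_brick_inverse:
  fixes M :: "('a, 'm) module"
  assumes k: "field k" and M: "left_module A M" and b: "stable_brick k A M"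
    and q: "lin A M M q" "\<not> stz M M q"
  shows "\<exists>r. lin A M M r \<and> stz M M (\<lambda>s. r (q s) \<ominus>\<^bsub>M\<^esub> s) \<and> stz M M (\<lambda>s. s \<ominus>\<^bsub>M\<^esub> q (r s))"
proof -
  interpret k: field k by fact
  let ?E = "stable_End A M"
  obtain \<phi> where \<phi>: "\<phi> \<in> ring_iso ?E k" using b unfolding stable_brick_def by blast
  have car: "carrier ?E = carrier (stable_Hom A M M)" and mul: "F \<otimes>\<^bsub>?E\<^esub> G = stable_comp A M M F G"
    and one: "\<one>\<^bsub>?E\<^esub> = cls A M M (\<lambda>x. x)" for F G
    by (simp_all add: stable_End_def cls_id)
  have bij: "bij_betw \<phi> (carrier ?E) (carrier k)" and hom: "\<And>F G. F \<in> carrier ?E \<Longrightarrow> G \<in> carrier ?E \<Longrightarrow> \<phi> (F \<otimes>\<^bsub>?E\<^esub> G) = \<phi> F \<otimes>\<^bsub>k\<^esub> \<phi> G"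
    and hom1: "\<phi> \<one>\<^bsub>?E\<^esub> = \<one>\<^bsub>k\<^esub>" and \<phi>c: "\<And>F. F \<in> carrier ?E \<Longrightarrow> \<phi> F \<in> carrier k"
    using \<phi> by (auto simp: ring_iso_def ring_hom_def)
  have surj: "\<exists>f. lin A M M f \<and> \<phi> (cls A M M f) = c" if c: "c \<in> carrier k" for c
  proof -
    obtain F where "F \<in> carrier ?E" "\<phi> F = c" using bij c unfolding bij_betw_def by (metis imageE)
    then show ?thesis using cls_exists[OF M M] car by auto
  qed
  have cE: "cls A M M f \<in> carrier ?E" if "lin A M M f" for f using cls_carrier[OF that] car by simp
  have inj: "cls A M M f = cls A M M g" if "\<phi> (cls A M M f) = \<phi> (cls A M M g)" "lin A M M f" "lin A M M g" for f g
    using bij that cE unfolding bij_betw_def by (meson inj_onD)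
  have comp: "\<phi> (cls A M M (\<lambda>x. g (f x))) = \<phi> (cls A M M g) \<otimes>\<^bsub>k\<^esub> \<phi> (cls A M M f)" if "lin A M M f" "lin A M M g" for f g
    using hom[OF cE[OF that(2)] cE[OF that(1)]] cls_comp[OF that] mul by simp
  note z = lin_zero[OF M M]
  obtain f0 where f0: "lin A M M f0" "\<phi> (cls A M M f0) = \<zero>\<^bsub>k\<^esub>" using surj[OF k.zero_closed] by blast
  have "\<phi> (cls A M M (\<lambda>x. \<zero>\<^bsub>M\<^esub>)) = \<zero>\<^bsub>k\<^esub>"
    using comp[OF f0(1) z] f0(2) \<phi>c[OF cE[OF z]] by simp
  moreover have "cls A M M q \<noteq> cls A M M (\<lambda>x. \<zero>\<^bsub>M\<^esub>)"
  proof
    assume "cls A M M q = cls A M M (\<lambda>x. \<zero>\<^bsub>M\<^esub>)"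
    then have "stz M M (\<lambda>x. q x \<ominus>\<^bsub>M\<^esub> \<zero>\<^bsub>M\<^esub>)" using cls_eqD[OF q(1) z] by blast
    then have "stz M M q" by (rule stz_cong) (simp add: lin_closed[OF q(1)] lm_add[OF M])
    then show False using q(2) by simp
  qed
  ultimately have "\<phi> (cls A M M q) \<noteq> \<zero>\<^bsub>k\<^esub>" using inj[OF _ q(1) z] by metis
  then have u: "\<phi> (cls A M M q) \<in> Units k" using k.field_Units \<phi>c[OF cE[OF q(1)]] by simp
  obtain r where r: "lin A M M r" "\<phi> (cls A M M r) = inv\<^bsub>k\<^esub> (\<phi> (cls A M M q))"
    using surj[OF k.Units_inv_closed[OF u]] by blast
  have id: "lin A M M (\<lambda>x. x)" by (rule lin_id[OF M])
  have "\<phi> (cls A M M (\<lambda>x. r (q x))) = \<phi> (cls A M M (\<lambda>x. x))" "\<phi> (cls A M M (\<lambda>x. q (r x))) = \<phi> (cls A M M (\<lambda>x. x))"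
    using comp[OF q(1) r(1)] comp[OF r(1) q(1)] r(2) u hom1 one by simp_all
  then have "cls A M M (\<lambda>x. r (q x)) = cls A M M (\<lambda>x. x)" "cls A M M (\<lambda>x. x) = cls A M M (\<lambda>x. q (r x))"
    using inj lin_comp[OF q(1) r(1)] lin_comp[OF r(1) q(1)] id by metis+
  then show ?thesis
    using cls_eqD[OF lin_comp[OF q(1) r(1)] id] cls_eqD[OF id lin_comp[OF r(1) q(1)]] r(1) by blast
qed

lemma fp_iff: "M \<in> fp_left_modules A \<longleftrightarrow> fl (M :: ('a, 'm) module)"
  by (auto simp: fp_left_modules_def fl_def finitely_presented_iff)

lemma zero_objects_fp: "M \<in> zero_objects A (fp_left_modules A) \<longleftrightarrow> pif (M :: ('a, 'm) module)"
proof
  assume "M \<in> zero_objects A (fp_left_modules A)"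
  then have M: "fl M" "stable_Hom_zero A M M" by (auto simp: zero_objects_def fp_iff)
  then have "stz M M (\<lambda>x. x)" using stable_Hom_zero_iff[OF flD(1) flD(1)] lin_id[OF flD(1)] by blast
  then show "pif M" using pif_of_stz_id M(1) by blast
next
  assume M: "pif M"
  then have p: "projective A M" "fl M" using fl_pif by (auto simp: pif_def)
  have "stable_Hom_zero A M N" "stable_Hom_zero A N M" if "fl N" for N
    using stable_Hom_zero_iff[OF flD(1) flD(1), of M N] stable_Hom_zero_iff[OF flD(1) flD(1), of N M] p that
      stz_from_projective[OF p(1)] stz_to_projective[OF p(1)] by blast+
  then show "M \<in> zero_objects A (fp_left_modules A)" using p(2) by (simp add: zero_objects_def fp_iff)
qed

section \<open>Triangles\<close>

lemma cosyzygy: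
  assumes L: "fl L" and c: "cosyzygy_seq A L = (I, \<iota>, \<pi>, C)"
  shows "injective_envelope A L I \<iota>" "short_exact A L I C \<iota> \<pi>" "pif I" "fl C"
proof -
  have ex: "\<exists>p. case p of (I, \<iota>, \<pi>, C) \<Rightarrow> injective_envelope A L I \<iota> \<and> short_exact A L I C \<iota> \<pi>"
  proof -
    obtain J \<kappa> where J: "injective_envelope A L J \<kappa>" using ex_injective_envelope[OF L] by blast
    then have \<kappa>: "\<kappa> \<in> mod_hom A L J" "inj_on \<kappa> (carrier L)" "left_module A J"
      by (auto simp: injective_envelope_iff injective_def)
    note lk = lin_of_mod_hom[OF flD(1)[OF L] \<kappa>(3,1)]
    obtain D :: "('a, 'm) module" and \<rho> where D: "ses A L J D \<kappa> \<rho>" using ses_cokernel[OF lk \<kappa>(2)] by blast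
    have "ses A L J D \<kappa> (restrict \<rho> (carrier J))"
      using D lin_cong[OF sesD(2)[OF D], of "restrict \<rho> (carrier J)"] by (simp add: ses_def)
    then have "short_exact A L J D \<kappa> (restrict \<rho> (carrier J))"
      using \<kappa>(1) mod_hom_of_lin[OF sesD(2)[OF D]] by (simp add: short_exact_iff)
    then show ?thesis using J by auto
  qed
  have "case cosyzygy_seq A L of (I, \<iota>, \<pi>, C) \<Rightarrow> injective_envelope A L I \<iota> \<and> short_exact A L I C \<iota> \<pi>"
    unfolding cosyzygy_seq_def by (rule someI_ex[OF ex])
  then show *: "injective_envelope A L I \<iota>" "short_exact A L I C \<iota> \<pi>" using c by simp_all
  show I: "pif I" by (rule pif_injective_envelope[OF L *(1)])
  show "fl C" using fl_ses(3)[of L I C \<iota> \<pi>] *(2) fl_pif[OF I] by (simp add: short_exact_iff)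
qed

text \<open>
  Two maps of cokernels induced by extensions of the identity of \<open>L\<close> differ by a map that factors through the
  injective envelope, hence through a projective module.
\<close>

lemma Sigma_mor_id:
  assumes L: "fl L"
  shows "Sigma_mor A L L (cls A L L (\<lambda>x. x)) = cls A (Sigma_obj A L) (Sigma_obj A L) (\<lambda>x. x)"
proof -
  obtain I \<iota> \<pi> C where c: "cosyzygy_seq A L = (I, \<iota>, \<pi>, C)" by (cases "cosyzygy_seq A L")
  note cs = cosyzygy[OF L c]
  have s: "ses A L I C \<iota> \<pi>" and hom: "\<iota> \<in> mod_hom A L I" "\<pi> \<in> mod_hom A I C"
    using cs(2) by (auto simp: short_exact_iff)
  note \<iota> = sesD(1)[OF s] and \<pi> = sesD(2)[OF s] and mI = sesD(8)[OF s] and mC = sesD(9)[OF s] and mL = flD(1)[OF L]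
  have pI: "projective A I" using cs(3) by (simp add: pif_def)
  have C: "Sigma_obj A L = C" by (simp add: Sigma_obj_def c)
  have eq: "stable_class A C C t = cls A C C (\<lambda>x. x)"
    if f: "f \<in> cls A L L (\<lambda>x. x)" and j: "j \<in> mod_hom A I I" and t: "t \<in> mod_hom A C C"
      and e1: "compose (carrier L) j \<iota> = compose (carrier L) \<iota> f"
      and e2: "compose (carrier I) t \<pi> = compose (carrier I) \<pi> j" for t f j
  proof -
    have lf: "lin A L L f" "stz L L (\<lambda>x. f x \<ominus>\<^bsub>L\<^esub> x)"
      using f mem_cls[OF lin_id[OF mL]] lin_of_mod_hom[OF mL mL] by blast+
    note lj = lin_of_mod_hom[OF mI mI j] and lt = lin_of_mod_hom[OF mC mC t]
    have e1': "j (\<iota> x) = \<iota> (f x)" if "x \<in> carrier L" for x using fun_cong[OF e1, of x] that by (simp add: compose_def)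
    have e2': "t (\<pi> y) = \<pi> (j y)" if "y \<in> carrier I" for y using fun_cong[OF e2, of y] that by (simp add: compose_def)
    obtain u where u: "lin A I L u" "\<forall>x\<in>carrier L. f x \<ominus>\<^bsub>L\<^esub> x = u (\<iota> x)"
      using stz_extends[OF lf(2) L \<iota> sesD(3)[OF s]] by blast
    define v where "v y = (j y \<ominus>\<^bsub>I\<^esub> y) \<ominus>\<^bsub>I\<^esub> \<iota> (u y)" for y
    have lv: "lin A I I v" unfolding v_def
      by (rule lin_sub[OF lin_sub[OF lj lin_id[OF mI]] lin_comp[OF u(1) \<iota>]])
    have "v (\<iota> x) = \<zero>\<^bsub>I\<^esub>" if x: "x \<in> carrier L" for x
      using x u(2)[rule_format, OF x, symmetric] lin_closed[OF lf(1) x] lin_closed[OF \<iota>] lm_closed(4)[OF mI]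
      by (simp add: v_def e1' lin_simps[OF \<iota>] lm_add[OF mI])
    then obtain w where w: "lin A C I w" "\<forall>y\<in>carrier I. w (\<pi> y) = v y" using ses_factor[OF s lv] by blast
    have "stz C C (\<lambda>x. t x \<ominus>\<^bsub>C\<^esub> x)"
    proof (rule stz_cong[OF stz_via[OF pI w(1) \<pi>]])
      fix x assume "x \<in> carrier C"
      then obtain y where y: "y \<in> carrier I" "\<pi> y = x" using sesE(2)[OF s] by blast
      note cl = lin_closed[OF lj y(1)] lin_closed[OF u(1) y(1)] lin_closed[OF \<iota> lin_closed[OF u(1) y(1)]]
      have "\<pi> (w x) = \<pi> (v y)" using w(2) y by auto
      also have "\<dots> = \<pi> (j y) \<ominus>\<^bsub>C\<^esub> \<pi> y"
        using y(1) cl lin_closed[OF \<pi>] lm_closed(4)[OF mI] lm_closed(4)[OF mC]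
        by (simp add: v_def lin_simps[OF \<pi>] sesD(6)[OF s] lm_add[OF mC])
      finally show "\<pi> (w x) = t x \<ominus>\<^bsub>C\<^esub> x" using e2' y by auto
    qed
    then show ?thesis using cls_eqI[OF lt lin_id[OF mC]] stable_class_cls[OF t] by simp
  qed
  have id: "id_hom M \<in> mod_hom A M M" if "left_module A M" for M :: "('a, 'm) module"
    using mod_hom_of_lin[OF lin_id[OF that]] by (simp add: id_hom_def)
  have ex: "id_hom L \<in> cls A L L (\<lambda>x. x) \<and> id_hom I \<in> mod_hom A I I \<and> id_hom C \<in> mod_hom A C C \<and>
      compose (carrier L) (id_hom I) \<iota> = compose (carrier L) \<iota> (id_hom L) \<and>
      compose (carrier I) (id_hom C) \<pi> = compose (carrier I) \<pi> (id_hom I)"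
    using cls_self[OF lin_id[OF mL]] id mI mC lin_closed[OF \<iota>] lin_closed[OF \<pi>]
    by (auto simp: id_hom_def compose_def fun_eq_iff)
  have "{stable_class A C C s |s f j. f \<in> cls A L L (\<lambda>x. x) \<and> j \<in> mod_hom A I I \<and> s \<in> mod_hom A C C \<and>
             compose (carrier L) j \<iota> = compose (carrier L) \<iota> f \<and>
             compose (carrier I) s \<pi> = compose (carrier I) \<pi> j} = {cls A C C (\<lambda>x. x)}"
    using eq ex by blast
  then show ?thesis by (simp add: Sigma_mor_def c C)
qed

text \<open>
  The pushout \<open>N\<close> of an injective envelope of \<open>X'\<close> along \<open>f : X' \<rightarrow> V\<close> is an extension of \<open>T\<close> by an
  injective module, hence stably isomorphic to \<open>T\<close>.
\<close>

lemma triangle_of_ses: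
  fixes X' V T X Q :: "('a, 'm) module"
  assumes s: "ses A X' V T f g" and t: "ses A X V Q i p" and Q: "pif Q"
    and X': "fl X'" and T: "fl T"
  shows "\<exists>F G H. is_triangle A (fp_left_modules A) X' X T F G H"
proof -
  have V: "fl V" by (rule fl_ses(1)[OF s X' T])
  have X: "fl X" by (rule fl_ses(2)[OF t V])
  obtain I \<iota> \<pi> C where c: "cosyzygy_seq A X' = (I, \<iota>, \<pi>, C)" by (cases "cosyzygy_seq A X'")
  note cs = cosyzygy[OF X' c]
  have si: "ses A X' I C \<iota> \<pi>" and hom\<pi>: "\<pi> \<in> mod_hom A I C"
    using cs(2) by (auto simp: short_exact_iff)
  have SC: "Sigma_obj A X' = C" by (simp add: Sigma_obj_def c)
  note \<iota> = sesD(1)[OF si] and \<pi> = sesD(2)[OF si] and f = sesD(1)[OF s] and g = sesD(2)[OF s] and i = sesD(1)[OF t] and p = sesD(2)[OF t]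
  note mI = sesD(8)[OF si] and mC = sesD(9)[OF si] and mV = sesD(8)[OF s] and mT = sesD(9)[OF s] and mX' = sesD(7)[OF s] and mX = sesD(7)[OF t]
  note ds = dsum_simps[OF inf] and pr = prc_simps[OF inf] and d = lin_dsum[OF inf mV mI] and VI = dsum_split[OF mV mI]
  have pI: "projective A I" "injective A I" using cs(3) by (auto simp: pif_def)
  obtain N :: "('a, 'm) module" and n where N: "ses A X' (dsum V I) N (\<lambda>s. prc (f s) (\<iota> s)) n"
    using cone_exists[OF f \<iota> sesD(3)[OF si]] by blast
  note ln = sesD(2)[OF N] and mN = sesD(9)[OF N]
  have flN: "fl N" by (rule fl_ses(3)[OF N fl_dsum[OF V fl_pif[OF cs(3)]]])
  define \<nu> where "\<nu> v = n (prc v \<zero>\<^bsub>I\<^esub>)" for v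
  have \<nu>: "lin A V N \<nu>" "inj_on \<nu> (carrier V)"
    unfolding \<nu>_def by (rule cone_inclusion[OF f \<iota> sesD(3)[OF si] N])+
  define u where "u y = n (prc \<zero>\<^bsub>V\<^esub> y)" for y
  have u: "lin A I N u" unfolding u_def by (rule lin_comp[OF d(2) ln])
  have split: "n w = \<nu> (fs w) \<oplus>\<^bsub>N\<^esub> u (sn w)" if w: "w \<in> carrier (dsum V I)" for w
  proof -
    note w' = VI[OF w]
    have "w = prc (fs w) \<zero>\<^bsub>I\<^esub> \<oplus>\<^bsub>dsum V I\<^esub> prc \<zero>\<^bsub>V\<^esub> (sn w)"
      using w' by (simp add: ds lm_add[OF mV] lm_add[OF mI])
    moreover have "prc (fs w) \<zero>\<^bsub>I\<^esub> \<in> carrier (dsum V I)" "prc \<zero>\<^bsub>V\<^esub> (sn w) \<in> carrier (dsum V I)"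
      using w' by (simp_all add: ds lm_closed[OF mV] lm_closed[OF mI])
    ultimately show ?thesis unfolding \<nu>_def u_def using lin_simps(2)[OF ln] by metis
  qed
  have glue: "\<nu> (f x) \<oplus>\<^bsub>N\<^esub> u (\<iota> x) = \<zero>\<^bsub>N\<^esub>" if x: "x \<in> carrier X'" for x
    using split[of "prc (f x) (\<iota> x)"] sesD(6)[OF N x] lin_closed[OF f x] lin_closed[OF \<iota> x] by (simp add: ds pr)
  \<comment> \<open>the map to the suspension\<close>
  obtain h where h: "lin A N C h" "\<forall>w\<in>carrier (dsum V I). h (n w) = \<ominus>\<^bsub>C\<^esub> \<pi> (sn w)"
    using ses_factor[OF N lin_neg[OF lin_comp[OF d(4) \<pi>]]] sesD(6)[OF si]
      lm_add(5)[OF mC lm_closed(2)[OF mC]] lm_add(4)[OF mC lm_closed(2)[OF mC]] by (auto simp: pr)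
  have h\<nu>: "h (\<nu> v) = \<zero>\<^bsub>C\<^esub>" if "v \<in> carrier V" for v
    using h(2)[rule_format, of "prc v \<zero>\<^bsub>I\<^esub>"] that lin_simps(4)[OF \<pi>] lm_add(5)[OF mC lm_closed(2)[OF mC]] lm_add(4)[OF mC lm_closed(2)[OF mC]]
    by (simp add: \<nu>_def ds pr lm_closed[OF mI])
  have hu: "h (u y) = \<ominus>\<^bsub>C\<^esub> \<pi> y" if "y \<in> carrier I" for y
    using h(2)[rule_format, of "prc \<zero>\<^bsub>V\<^esub> y"] that by (simp add: u_def ds pr lm_closed[OF mV])
  have neg_inv: "\<ominus>\<^bsub>N\<^esub> u (\<iota> x) = \<nu> (f x)" if x: "x \<in> carrier X'" for x
  proof -
    interpret N: abelian_group N by (rule lm_grp[OF mN])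
    show ?thesis using N.minus_equality[OF glue[OF x]] lin_closed[OF \<nu>(1) lin_closed[OF f x]] lin_closed[OF u lin_closed[OF \<iota> x]] by simp
  qed
  have sh: "ses A V N C \<nu> h"
  proof (rule sesI[OF \<nu>(1) h(1)])
    show "x \<in> carrier V \<Longrightarrow> \<nu> x = \<zero>\<^bsub>N\<^esub> \<Longrightarrow> x = \<zero>\<^bsub>V\<^esub>" for x using \<nu>(2) lin_inj_iff[OF \<nu>(1)] by blast
  next
    fix z assume z: "z \<in> carrier C"
    then obtain y where y: "y \<in> carrier I" "\<pi> y = \<ominus>\<^bsub>C\<^esub> z" using sesE(2)[OF si lm_closed(3)[OF mC z]] by blast
    then have "h (u y) = z" using hu z by (simp add: lm_add[OF mC])
    then show "\<exists>y\<in>carrier N. h y = z" using lin_closed[OF u y(1)] by blast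
  next
    fix y assume y: "y \<in> carrier N" "h y = \<zero>\<^bsub>C\<^esub>"
    obtain w where w: "w \<in> carrier (dsum V I)" "n w = y" using sesE(2)[OF N y(1)] by blast
    note w' = VI[OF w(1)]
    have "\<ominus>\<^bsub>C\<^esub> \<pi> (sn w) = \<zero>\<^bsub>C\<^esub>" using h(2) w y(2) by auto
    then have "\<pi> (sn w) = \<zero>\<^bsub>C\<^esub>"
      using lm_add(8)[OF mC lin_closed[OF \<pi> w'(2)]] lm_add(5)[OF mC lm_closed(2)[OF mC]] lm_add(4)[OF mC lm_closed(2)[OF mC]] by simp
    then obtain x where x: "x \<in> carrier X'" "\<iota> x = sn w" using sesE(3)[OF si w'(2)] by blast
    note fx = lin_closed[OF f x(1)]
    have "y = \<nu> (fs w) \<ominus>\<^bsub>N\<^esub> \<nu> (f x)"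
    proof -
      have "y = \<nu> (fs w) \<oplus>\<^bsub>N\<^esub> u (\<iota> x)" using split[OF w(1)] w(2) x(2) by simp
      moreover have "u (\<iota> x) = \<ominus>\<^bsub>N\<^esub> \<nu> (f x)"
        using neg_inv[OF x(1)] lm_add(8)[OF mN lin_closed[OF u lin_closed[OF \<iota> x(1)]]] by simp
      ultimately show ?thesis by (simp add: a_minus_def)
    qed
    then have "\<nu> (fs w \<ominus>\<^bsub>V\<^esub> f x) = y" using w'(1) fx by (simp add: lin_simps[OF \<nu>(1)])
    then show "\<exists>v\<in>carrier V. \<nu> v = y" using lm_closed(4)[OF mV w'(1) fx] by blast
  qed (rule h\<nu>)
  \<comment> \<open>the stable isomorphism with \<open>T\<close>\<close>
  obtain m where m: "lin A N T m" "\<forall>w\<in>carrier (dsum V I). m (n w) = g (fs w)"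
    using ses_factor[OF N lin_comp[OF d(3) g]] sesD(6)[OF s] by (auto simp: pr)
  have m\<nu>: "m (\<nu> v) = g v" if "v \<in> carrier V" for v
    using m(2)[rule_format, of "prc v \<zero>\<^bsub>I\<^esub>"] that by (simp add: \<nu>_def ds pr lm_closed[OF mI])
  have mu: "m (u y) = \<zero>\<^bsub>T\<^esub>" if "y \<in> carrier I" for y
    using m(2)[rule_format, of "prc \<zero>\<^bsub>V\<^esub> y"] that lin_simps(4)[OF g] by (simp add: u_def ds pr lm_closed[OF mV])
  have sm: "ses A I N T u m"
  proof (rule sesI[OF u m(1)])
    fix y assume y: "y \<in> carrier I" "u y = \<zero>\<^bsub>N\<^esub>"
    then obtain x where x: "x \<in> carrier X'" "prc (f x) (\<iota> x) = prc \<zero>\<^bsub>V\<^esub> y"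
      using sesE(3)[OF N, of "prc \<zero>\<^bsub>V\<^esub> y"] by (auto simp: u_def ds lm_closed[OF mV])
    then have "x = \<zero>\<^bsub>X'\<^esub>" using sesE(1)[OF s] by (simp add: ds)
    then show "y = \<zero>\<^bsub>I\<^esub>" using x(2) lin_simps(4)[OF \<iota>] by (simp add: ds)
  next
    fix z assume "z \<in> carrier T"
    then obtain v where "v \<in> carrier V" "g v = z" using sesE(2)[OF s] by blast
    then show "\<exists>y\<in>carrier N. m y = z" using m\<nu> lin_closed[OF \<nu>(1)] by blast
  next
    fix y assume y: "y \<in> carrier N" "m y = \<zero>\<^bsub>T\<^esub>"
    obtain w where w: "w \<in> carrier (dsum V I)" "n w = y" using sesE(2)[OF N y(1)] by blast
    note w' = VI[OF w(1)]
    have "g (fs w) = \<zero>\<^bsub>T\<^esub>" using m(2) w y(2) by auto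
    then obtain x where x: "x \<in> carrier X'" "f x = fs w" using sesE(3)[OF s w'(1)] by blast
    note ix = lin_closed[OF \<iota> x(1)]
    have "y = u (sn w) \<ominus>\<^bsub>N\<^esub> u (\<iota> x)"
      using split[OF w(1)] w(2) x(2) neg_inv[OF x(1)]
        lm_cancel(7)[OF mN lin_closed[OF \<nu>(1) w'(1)] lin_closed[OF u w'(2)]] by (simp add: a_minus_def)
    then have "u (sn w \<ominus>\<^bsub>I\<^esub> \<iota> x) = y" using w'(2) ix by (simp add: lin_simps[OF u])
    then show "\<exists>z\<in>carrier I. u z = y" using lm_closed(4)[OF mI w'(2) ix] by blast
  qed (rule mu)
  obtain \<rho> where \<rho>: "lin A N I \<rho>" "\<forall>y\<in>carrier I. \<rho> (u y) = y"
    using injective_extend[OF pI(2) u sesD(3)[OF sm] lin_id[OF mI]] by blast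
  have l1: "lin A N N (\<lambda>y. y \<ominus>\<^bsub>N\<^esub> u (\<rho> y))" by (rule lin_sub[OF lin_id[OF mN] lin_comp[OF \<rho>(1) u]])
  obtain sg where sg: "lin A T N sg" "\<forall>y\<in>carrier N. sg (m y) = y \<ominus>\<^bsub>N\<^esub> u (\<rho> y)"
    using ses_factor[OF sm l1] \<rho>(2) lin_closed[OF u] lm_add(3)[OF mN] by auto
  have u\<rho>: "u (\<rho> y) \<in> carrier N" if "y \<in> carrier N" for y using lin_closed[OF u lin_closed[OF \<rho>(1) that]] .
  have msg: "m (sg z) = z" if z: "z \<in> carrier T" for z
  proof -
    obtain y where y: "y \<in> carrier N" "m y = z" using sesE(2)[OF sm z] by blast
    then have "m (sg z) = m (y \<ominus>\<^bsub>N\<^esub> u (\<rho> y))" using sg(2) by auto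
    then show ?thesis using y z u\<rho> mu lin_closed[OF \<rho>(1)] by (simp add: lin_simps[OF m(1)] lm_add[OF mT])
  qed
  have sgm: "stz N N (\<lambda>y. sg (m y) \<ominus>\<^bsub>N\<^esub> y)"
  proof (rule stz_cong[OF stz_neg[OF stz_via[OF pI(1) \<rho>(1) u]]])
    fix y assume y: "y \<in> carrier N"
    interpret N: abelian_group N by (rule lm_grp[OF mN])
    show "\<ominus>\<^bsub>N\<^esub> u (\<rho> y) = sg (m y) \<ominus>\<^bsub>N\<^esub> y"
      using sg(2) y u\<rho>[OF y] by (simp add: N.minus_eq N.a_assoc N.a_comm[of _ "\<ominus>\<^bsub>N\<^esub> y"] N.r_neg1 N.r_neg2)
  qed
  \<comment> \<open>the stable isomorphism of \<open>X\<close> with \<open>V\<close>\<close>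
  have pQ: "projective A Q" using Q by (simp add: pif_def)
  obtain \<tau> r where r: "lin A Q V \<tau>" "lin A V X r" "\<forall>x\<in>carrier X. r (i x) = x" "\<forall>y\<in>carrier V. i (r y) \<oplus>\<^bsub>V\<^esub> \<tau> (p y) = y"
    using ses_split[OF t pQ] by blast
  have ir: "stz V V (\<lambda>y. i (r y) \<ominus>\<^bsub>V\<^esub> y)"
  proof (rule stz_cong[OF stz_neg[OF stz_via[OF pQ p r(1)]]])
    fix y assume y: "y \<in> carrier V"
    interpret V: abelian_group V by (rule lm_grp[OF mV])
    have cl: "i (r y) \<in> carrier V" "\<tau> (p y) \<in> carrier V"
      using lin_closed[OF i lin_closed[OF r(2) y]] lin_closed[OF r(1) lin_closed[OF p y]] by auto
    have "i (r y) \<ominus>\<^bsub>V\<^esub> y = i (r y) \<ominus>\<^bsub>V\<^esub> (i (r y) \<oplus>\<^bsub>V\<^esub> \<tau> (p y))" using r(4) y by simp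
    also have "\<dots> = \<ominus>\<^bsub>V\<^esub> \<tau> (p y)" using cl by (simp add: V.minus_eq V.minus_add V.r_neg2)
    finally show "\<ominus>\<^bsub>V\<^esub> \<tau> (p y) = i (r y) \<ominus>\<^bsub>V\<^esub> y" by simp
  qed
  have i1: "stable_iso A X' X' (cls A X' X' (\<lambda>x. x))"
    by (rule stable_isoI[OF lin_id[OF mX'] lin_id[OF mX']]) (rule stz_diff_refl[OF lin_id[OF mX']], simp)+
  have i2: "stable_iso A X V (cls A X V i)"
    by (rule stable_isoI[OF i r(2) stz_diff_refl[OF lin_comp[OF i r(2)]] ir]) (use r(3) in simp)
  have i3: "stable_iso A T N (cls A T N sg)"
    by (rule stable_isoI[OF sg(1) m(1) stz_diff_refl[OF lin_comp[OF sg(1) m(1)]] sgm]) (use msg in simp)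
  have std: "standard_triangle A X' V N (restrict f (carrier X')) (restrict \<nu> (carrier V)) (restrict h (carrier N))"
    unfolding standard_triangle_def c prod.case
  proof (intro conjI bexI[of _ "restrict (\<lambda>y. \<ominus>\<^bsub>N\<^esub> u y) (carrier I)"])
    show "restrict f (carrier X') \<in> mod_hom A X' V" by (rule mod_hom_of_lin[OF f])
    have "ses A V N C (restrict \<nu> (carrier V)) (restrict h (carrier N))"
      using sh lin_cong[OF \<nu>(1), of "restrict \<nu> (carrier V)"] lin_cong[OF h(1), of "restrict h (carrier N)"]
      by (auto simp: ses_def inj_on_def)
    then show "short_exact A V N C (restrict \<nu> (carrier V)) (restrict h (carrier N))"
      using mod_hom_of_lin[OF \<nu>(1)] mod_hom_of_lin[OF h(1)] by (simp add: short_exact_iff)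
    show "restrict (\<lambda>y. \<ominus>\<^bsub>N\<^esub> u y) (carrier I) \<in> mod_hom A I N" by (rule mod_hom_of_lin[OF lin_neg[OF u]])
    show "compose (carrier X') (restrict (\<lambda>y. \<ominus>\<^bsub>N\<^esub> u y) (carrier I)) \<iota> =
        compose (carrier X') (restrict \<nu> (carrier V)) (restrict f (carrier X'))"
      using neg_inv lin_closed[OF \<iota>] lin_closed[OF f] by (auto simp: compose_def fun_eq_iff)
    have "h (\<ominus>\<^bsub>N\<^esub> u y) = \<pi> y" if "y \<in> carrier I" for y
      using that hu lin_closed[OF u] lin_closed[OF \<pi>] by (simp add: lin_simps[OF h(1)] lm_add[OF mC])
    then have "compose (carrier I) (restrict h (carrier N)) (restrict (\<lambda>y. \<ominus>\<^bsub>N\<^esub> u y) (carrier I)) = restrict \<pi> (carrier I)"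
      using lin_closed[OF u] lm_closed(3)[OF mN] by (auto simp: compose_def fun_eq_iff)
    then show "compose (carrier I) (restrict h (carrier N)) (restrict (\<lambda>y. \<ominus>\<^bsub>N\<^esub> u y) (carrier I)) = \<pi>"
      using mod_hom_restrict[OF hom\<pi>] by simp
  qed
  have classes: "stable_class A X' V (restrict f (carrier X')) = cls A X' V f"
    "stable_class A V N (restrict \<nu> (carrier V)) = cls A V N \<nu>"
    "stable_class A N C (restrict h (carrier N)) = cls A N C h" by (simp_all add: cls_def)
  note rf = lin_comp[OF f r(2)] and gi = lin_comp[OF i g] and hs = lin_comp[OF sg(1) h(1)]
  have "is_triangle A (fp_left_modules A) X' X T (cls A X' X (\<lambda>x. r (f x))) (cls A X T (\<lambda>x. g (i x))) (cls A T C (\<lambda>x. h (sg x)))"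
    unfolding is_triangle_def SC
  proof (intro conjI, goal_cases)
    case 7
    have e1: "stable_comp A X' V (cls A X V i) (cls A X' X (\<lambda>x. r (f x))) =
        stable_comp A X' V (stable_class A X' V (restrict f (carrier X'))) (cls A X' X' (\<lambda>x. x))"
      unfolding classes cls_comp[OF rf i] cls_comp[OF lin_id[OF mX'] f]
      by (rule cls_eqI[OF lin_comp[OF rf i] f stz_pre[OF ir f]])
    have e2: "stable_comp A X N (cls A T N sg) (cls A X T (\<lambda>x. g (i x))) =
        stable_comp A X N (stable_class A V N (restrict \<nu> (carrier V))) (cls A X V i)"
      unfolding classes cls_comp[OF gi sg(1)] cls_comp[OF i \<nu>(1)]
    proof (rule cls_eqI[OF lin_comp[OF gi sg(1)] lin_comp[OF i \<nu>(1)] stz_cong[OF stz_pre[OF sgm lin_comp[OF i \<nu>(1)]]]])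
      fix x assume "x \<in> carrier X"
      then show "sg (m (\<nu> (i x))) \<ominus>\<^bsub>N\<^esub> \<nu> (i x) = sg (g (i x)) \<ominus>\<^bsub>N\<^esub> \<nu> (i x)" using m\<nu> lin_closed[OF i] by simp
    qed
    have e3: "stable_comp A T C (Sigma_mor A X' X' (cls A X' X' (\<lambda>x. x))) (cls A T C (\<lambda>x. h (sg x))) =
        stable_comp A T C (stable_class A N C (restrict h (carrier N))) (cls A T N sg)"
      unfolding classes Sigma_mor_id[OF X'] SC cls_comp[OF hs lin_id[OF mC]] cls_comp[OF sg(1) h(1)] ..
    show ?case
      using X' V flN std i1 i2 i3 e1 e2 e3 SC by (intro bexI[of _ X'] bexI[of _ V] bexI[of _ N] exI conjI) (simp_all add: fp_iff)
  qed (use X X' T in \<open>simp_all add: fp_iff cls_carrier rf gi hs\<close>)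
  then show ?thesis by blast
qed

end

section \<open>Finite-dimensional algebras\<close>

text \<open>
  On a finite field the map \<open>x \<mapsto> x\<^sup>2 - x\<close> takes the value \<open>0\<close> twice, so it misses some \<open>c\<close>, and \<open>x\<^sup>2 - x - c\<close> has no
  root.
\<close>

lemma (in algebraically_closed) infinite_carrier: "infinite (carrier L)"
proof
  assume fin: "finite (carrier L)"
  define f where "f x = x \<otimes> x \<ominus> x" for x
  have "\<not> inj_on f (carrier L)"
  proof
    assume "inj_on f (carrier L)"
    moreover have "f \<zero> = f \<one>" by (simp add: f_def minus_eq r_neg)
    ultimately show False using one_not_zero by (metis inj_onD one_closed zero_closed)
  qed
  moreover have "f ` carrier L \<subseteq> carrier L" by (auto simp: f_def)
  ultimately have "f ` carrier L \<noteq> carrier L"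
    using fin eq_card_imp_inj_on[OF fin, of f] by auto
  then obtain c where c: "c \<in> carrier L" "c \<notin> f ` carrier L" using \<open>f ` carrier L \<subseteq> carrier L\<close> by blast
  define p where "p = [\<one>, \<ominus> \<one>, \<ominus> c]"
  have p: "p \<in> carrier (poly_ring L)"
    using c(1) by (simp add: p_def univ_poly_carrier[symmetric] polynomial_def)
  have "size (roots p) = degree p" using roots_over_carrier[OF p] by (simp add: splitted_def)
  then have "roots p \<noteq> {#}" by (auto simp: p_def)
  then obtain x where "x \<in># roots p" by blast
  then have "is_root p x" using roots_mem_iff_is_root[OF p] by simp
  then have x: "x \<in> carrier L" "eval p x = \<zero>" by (auto simp: is_root_def)
  then have "f x \<ominus> c = \<zero>" using c(1) by (simp add: p_def f_def minus_eq l_minus a_assoc)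
  then have "c = f x" using x(1) c(1) by (simp add: f_def)
  then show False using c(2) x(1) by blast
qed

primrec kspan :: "('k, 'a) module \<Rightarrow> 'k set \<Rightarrow> 'a list \<Rightarrow> 'a set" where
  "kspan A C [] = {\<zero>\<^bsub>A\<^esub>}"
| "kspan A C (b # bs) = {c \<odot>\<^bsub>A\<^esub> b \<oplus>\<^bsub>A\<^esub> w |c w. c \<in> C \<and> w \<in> kspan A C bs}"

lemma module_left_module: "module k A \<Longrightarrow> left_module k A"
  by (intro left_module.intro left_module_axioms.intro)
    (auto simp: module_def module_axioms_def cring_def)

lemma subsp_kspan:
  assumes A: "left_module k A" and bs: "set bs \<subseteq> carrier A" and comm: "cring k"
  shows "subsp (carrier k) A (kspan A (carrier k) bs)"
proof -
  interpret k: cring k by fact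
  show ?thesis
    using bs
  proof (induction bs)
    case Nil
    then show ?case by (auto simp: subsp_def lm_closed[OF A] lm_add[OF A] lm_smult0[OF A])
  next
    case (Cons b bs)
    let ?W = "kspan A (carrier k) bs"
    have b: "b \<in> carrier A" and W: "subsp (carrier k) A ?W" using Cons by auto
    have Wc: "w \<in> carrier A" if "w \<in> ?W" for w using W that by (auto simp: subsp_def)
    show ?case unfolding subsp_def
    proof (intro conjI ballI)
      show "kspan A (carrier k) (b # bs) \<subseteq> carrier A" using b Wc by (auto simp: lm_closed[OF A])
      have "\<zero>\<^bsub>A\<^esub> = \<zero>\<^bsub>k\<^esub> \<odot>\<^bsub>A\<^esub> b \<oplus>\<^bsub>A\<^esub> \<zero>\<^bsub>A\<^esub>" using b by (simp add: lm_smult0[OF A] lm_add[OF A] lm_closed[OF A])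
      then show "\<zero>\<^bsub>A\<^esub> \<in> kspan A (carrier k) (b # bs)" using W by (auto simp: subsp_def)
      show "x \<ominus>\<^bsub>A\<^esub> y \<in> kspan A (carrier k) (b # bs)" if xy: "x \<in> kspan A (carrier k) (b # bs)" "y \<in> kspan A (carrier k) (b # bs)" for x y
      proof -
        obtain c w where x: "x = c \<odot>\<^bsub>A\<^esub> b \<oplus>\<^bsub>A\<^esub> w" "c \<in> carrier k" "w \<in> ?W" using xy(1) by auto
        obtain c' w' where y: "y = c' \<odot>\<^bsub>A\<^esub> b \<oplus>\<^bsub>A\<^esub> w'" "c' \<in> carrier k" "w' \<in> ?W" using xy(2) by auto
        have "x \<ominus>\<^bsub>A\<^esub> y = (c \<ominus>\<^bsub>k\<^esub> c') \<odot>\<^bsub>A\<^esub> b \<oplus>\<^bsub>A\<^esub> (w \<ominus>\<^bsub>A\<^esub> w')"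
          using x y b Wc by (simp add: lm_add4(2)[OF A] lm_smult0(6)[OF A] lm_closed[OF A])
        moreover have "w \<ominus>\<^bsub>A\<^esub> w' \<in> ?W" using W x y by (auto simp: subsp_def)
        ultimately show ?thesis using x y by auto
      qed
      show "c \<odot>\<^bsub>A\<^esub> x \<in> kspan A (carrier k) (b # bs)" if cx: "c \<in> carrier k" "x \<in> kspan A (carrier k) (b # bs)" for c x
      proof -
        obtain c' w where x: "x = c' \<odot>\<^bsub>A\<^esub> b \<oplus>\<^bsub>A\<^esub> w" "c' \<in> carrier k" "w \<in> ?W" using cx(2) by auto
        have "c \<odot>\<^bsub>A\<^esub> x = (c \<otimes>\<^bsub>k\<^esub> c') \<odot>\<^bsub>A\<^esub> b \<oplus>\<^bsub>A\<^esub> (c \<odot>\<^bsub>A\<^esub> w)"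
          using x cx(1) b Wc by (simp add: lm_smult[OF A] lm_closed[OF A])
        moreover have "c \<odot>\<^bsub>A\<^esub> w \<in> ?W" using W x cx(1) by (auto simp: subsp_def)
        ultimately show ?thesis using x cx(1) by auto
      qed
    qed
  qed
qed

text \<open>
  Induction on the spanning list: besides the measure of the intersection with the span of the rest it
  counts whether the subspace has elements outside of it.
\<close>

lemma kspan_measure:
  assumes A: "left_module k A" and k: "field k" and bs: "set bs \<subseteq> carrier A"
  shows "\<exists>d :: 'a set \<Rightarrow> nat. \<forall>U V. subsp (carrier k) A U \<longrightarrow> subsp (carrier k) A V \<longrightarrow>
    V \<subseteq> kspan (A :: ('k, 'a) module) (carrier k) bs \<longrightarrow> U \<subset> V \<longrightarrow> d U < d V"
proof -
  interpret k: field k by fact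
  show ?thesis
    using bs
  proof (induction bs)
    case Nil
    have "\<not> (subsp (carrier k) A U \<and> U \<subset> V \<and> V \<subseteq> {\<zero>\<^bsub>A\<^esub>})" for U V by (auto simp: subsp_def)
    then show ?case by (intro exI[of _ "\<lambda>_. 0"]) auto
  next
    case (Cons b bs)
    let ?W = "kspan A (carrier k) bs"
    have b: "b \<in> carrier A" and W: "subsp (carrier k) A ?W"
      using Cons.prems subsp_kspan[OF A _ k.is_cring] by auto
    have Wc: "w \<in> carrier A" if "w \<in> ?W" for w using W that by (auto simp: subsp_def)
    obtain d :: "'a set \<Rightarrow> nat" where d: "\<forall>U V. subsp (carrier k) A U \<longrightarrow> subsp (carrier k) A V \<longrightarrow>
        V \<subseteq> ?W \<longrightarrow> U \<subset> V \<longrightarrow> d U < d V"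
      using Cons by auto
    note d = d[rule_format]
    have int: "subsp (carrier k) A (U \<inter> ?W)" if "subsp (carrier k) A U" for U
      using that W unfolding subsp_def by blast
    have "d (U \<inter> ?W) + (if U \<subseteq> ?W then 0 else 1) < d (V \<inter> ?W) + (if V \<subseteq> ?W then 0 else 1)"
      if U: "subsp (carrier k) A U" and V: "subsp (carrier k) A V" "V \<subseteq> kspan A (carrier k) (b # bs)" and UV: "U \<subset> V" for U V
    proof (cases "U \<inter> ?W = V \<inter> ?W")
      case False
      then have "d (U \<inter> ?W) < d (V \<inter> ?W)" using d[OF int[OF U] int[OF V(1)]] UV by blast
      moreover have "V \<subseteq> ?W \<Longrightarrow> U \<subseteq> ?W" using UV by blast
      ultimately show ?thesis by auto
    next
      case True
      have nV: "\<not> V \<subseteq> ?W" using True UV by blast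
      have "U \<subseteq> ?W"
      proof (rule ccontr)
        assume "\<not> U \<subseteq> ?W"
        then obtain u where u: "u \<in> U" "u \<notin> ?W" by blast
        moreover have "u \<in> kspan A (carrier k) (b # bs)" using u(1) UV V(2) by blast
        ultimately obtain c w where c: "u = c \<odot>\<^bsub>A\<^esub> b \<oplus>\<^bsub>A\<^esub> w" "c \<in> carrier k" "w \<in> ?W" by auto
        have "c \<noteq> \<zero>\<^bsub>k\<^esub>"
        proof
          assume "c = \<zero>\<^bsub>k\<^esub>"
          then have "u = w" using c b Wc by (simp add: lm_smult0[OF A] lm_add[OF A])
          then show False using u c by simp
        qed
        then have cu: "c \<in> Units k" using k.field_Units c(2) by simp
        have "v \<in> U" if v: "v \<in> V" for v
        proof -
          have "v \<in> kspan A (carrier k) (b # bs)" using V(2) v by blast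
          then obtain c' w' where c': "v = c' \<odot>\<^bsub>A\<^esub> b \<oplus>\<^bsub>A\<^esub> w'" "c' \<in> carrier k" "w' \<in> ?W" by auto
          define q where "q = c' \<otimes>\<^bsub>k\<^esub> inv\<^bsub>k\<^esub> c"
          have q: "q \<in> carrier k" "q \<otimes>\<^bsub>k\<^esub> c = c'" using c(2) c'(2) cu by (simp_all add: q_def k.m_assoc)
          have qU: "q \<odot>\<^bsub>A\<^esub> u \<in> U" using U u(1) q(1) by (auto simp: subsp_def)
          have cU: "x \<in> carrier A" if "x \<in> U" for x using U that by (auto simp: subsp_def)
          have cV: "x \<in> carrier A" if "x \<in> V" for x using V that by (auto simp: subsp_def)
          have "q \<odot>\<^bsub>A\<^esub> u = c' \<odot>\<^bsub>A\<^esub> b \<oplus>\<^bsub>A\<^esub> q \<odot>\<^bsub>A\<^esub> w"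
            using c b Wc[OF c(3)] q by (simp add: lm_smult(2)[OF A] lm_closed[OF A] lm_smult(3)[OF A, symmetric])
          then have "v \<ominus>\<^bsub>A\<^esub> q \<odot>\<^bsub>A\<^esub> u = w' \<ominus>\<^bsub>A\<^esub> q \<odot>\<^bsub>A\<^esub> w"
            using c' b Wc[OF c(3)] Wc[OF c'(3)] q(1)
            by (simp add: lm_add4(2)[OF A] lm_closed[OF A] lm_add[OF A])
          moreover have "w' \<ominus>\<^bsub>A\<^esub> q \<odot>\<^bsub>A\<^esub> w \<in> ?W" using W c c' q(1) by (auto simp: subsp_def)
          moreover have "v \<ominus>\<^bsub>A\<^esub> q \<odot>\<^bsub>A\<^esub> u \<in> V" using V(1) v qU UV by (auto simp: subsp_def)
          ultimately have "v \<ominus>\<^bsub>A\<^esub> q \<odot>\<^bsub>A\<^esub> u \<in> U" using True by auto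
          then have "(v \<ominus>\<^bsub>A\<^esub> q \<odot>\<^bsub>A\<^esub> u) \<oplus>\<^bsub>A\<^esub> q \<odot>\<^bsub>A\<^esub> u \<in> U" using subsp_add[OF A U] qU by blast
          then show "v \<in> U" using lm_cancel(2)[OF A cV[OF v] cU[OF qU]] by simp
        qed
        then show False using UV by blast
      qed
      then show ?thesis using True nV by simp
    qed
    then show ?case by (intro exI[of _ "\<lambda>U. d (U \<inter> ?W) + (if U \<subseteq> ?W then 0 else 1)"]) blast
  qed
qed

lemma finsum_mem_kspan:
  assumes A: "left_module k A" and "distinct bs" "set bs \<subseteq> carrier A" "c \<in> set bs \<rightarrow> carrier k"
  shows "(\<Oplus>\<^bsub>A\<^esub>b\<in>set bs. c b \<odot>\<^bsub>A\<^esub> b) \<in> kspan A (carrier k) bs"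
proof -
  interpret A: abelian_group A by (rule lm_grp[OF A])
  show ?thesis
    using assms(2-4)
  proof (induction bs)
    case (Cons b bs)
    then have "(\<Oplus>\<^bsub>A\<^esub>b\<in>set (b # bs). c b \<odot>\<^bsub>A\<^esub> b) = c b \<odot>\<^bsub>A\<^esub> b \<oplus>\<^bsub>A\<^esub> (\<Oplus>\<^bsub>A\<^esub>b\<in>set bs. c b \<odot>\<^bsub>A\<^esub> b)"
      by (auto simp: Pi_iff subset_iff intro!: A.finsum_insert lm_closed(5)[OF A])
    moreover have "(\<Oplus>\<^bsub>A\<^esub>b\<in>set bs. c b \<odot>\<^bsub>A\<^esub> b) \<in> kspan A (carrier k) bs" using Cons by auto
    ultimately show ?case using Cons.prems by auto
  qed simp
qed

text \<open>The image of the base field in the algebra, a central subset.\<close>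

definition scalars :: "'k ring \<Rightarrow> ('k, 'a) module \<Rightarrow> 'a set" where
  "scalars k A = (\<lambda>c. c \<odot>\<^bsub>A\<^esub> \<one>\<^bsub>A\<^esub>) ` carrier k"

lemma fd_algebraD:
  assumes "is_fd_algebra k A"
  shows "algebraically_closed k" "ring A" "module k A" "left_module k A" "field k"
    "c \<in> carrier k \<Longrightarrow> x \<in> carrier A \<Longrightarrow> (c \<odot>\<^bsub>A\<^esub> \<one>\<^bsub>A\<^esub>) \<otimes>\<^bsub>A\<^esub> x = c \<odot>\<^bsub>A\<^esub> x"
    "c \<in> carrier k \<Longrightarrow> x \<in> carrier A \<Longrightarrow> x \<otimes>\<^bsub>A\<^esub> (c \<odot>\<^bsub>A\<^esub> \<one>\<^bsub>A\<^esub>) = c \<odot>\<^bsub>A\<^esub> x"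
    "scalars k A \<subseteq> carrier A"
proof -
  show 1: "algebraically_closed k" "ring A" "module k A" using assms by (auto simp: is_fd_algebra_def)
  show "field k" using 1(1) by (rule algebraically_closed.axioms)
  show lA: "left_module k A" by (rule module_left_module[OF 1(3)])
  interpret A: ring A by (rule 1(2))
  have a: "\<And>c x y. c \<in> carrier k \<Longrightarrow> x \<in> carrier A \<Longrightarrow> y \<in> carrier A \<Longrightarrow>
      (c \<odot>\<^bsub>A\<^esub> x) \<otimes>\<^bsub>A\<^esub> y = c \<odot>\<^bsub>A\<^esub> (x \<otimes>\<^bsub>A\<^esub> y) \<and> x \<otimes>\<^bsub>A\<^esub> (c \<odot>\<^bsub>A\<^esub> y) = c \<odot>\<^bsub>A\<^esub> (x \<otimes>\<^bsub>A\<^esub> y)"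
    using assms unfolding is_fd_algebra_def by blast
  show "c \<in> carrier k \<Longrightarrow> x \<in> carrier A \<Longrightarrow> (c \<odot>\<^bsub>A\<^esub> \<one>\<^bsub>A\<^esub>) \<otimes>\<^bsub>A\<^esub> x = c \<odot>\<^bsub>A\<^esub> x"
    "c \<in> carrier k \<Longrightarrow> x \<in> carrier A \<Longrightarrow> x \<otimes>\<^bsub>A\<^esub> (c \<odot>\<^bsub>A\<^esub> \<one>\<^bsub>A\<^esub>) = c \<odot>\<^bsub>A\<^esub> x"
    using a[of c "\<one>\<^bsub>A\<^esub>" x] a[of c x "\<one>\<^bsub>A\<^esub>"] by simp_all
  show "scalars k A \<subseteq> carrier A" using lm_closed(5)[OF lA] by (auto simp: scalars_def)
qed

lemma finlen_regular_fd_algebra: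
  assumes fd: "is_fd_algebra k A"
  shows "finlen (scalars k A) (regular_module A)"
proof -
  note A = fd_algebraD[OF fd]
  interpret A: ring A by (rule A(2))
  obtain B where B: "B \<subseteq> carrier A" "finite B"
    and span: "\<And>x. x \<in> carrier A \<Longrightarrow> \<exists>c\<in>B \<rightarrow> carrier k. x = (\<Oplus>\<^bsub>A\<^esub>b\<in>B. c b \<odot>\<^bsub>A\<^esub> b)"
    using fd unfolding is_fd_algebra_def by blast
  obtain bs where bs: "set bs = B" "distinct bs" using finite_distinct_list[OF B(2)] by blast
  have car: "carrier A \<subseteq> kspan A (carrier k) bs"
    using span finsum_mem_kspan[OF A(4) bs(2)] B(1) bs(1) by blast
  have sp: "subsp (scalars k A) (regular_module A) U \<longleftrightarrow> subsp (carrier k) A U" for U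
  proof -
    have "x \<ominus>\<^bsub>regular_module A\<^esub> y = x \<ominus>\<^bsub>A\<^esub> y" for x y
      by (simp add: a_minus_def a_inv_def m_inv_def regular_module_def)
    then show ?thesis unfolding subsp_def scalars_def
      using A(6) by (auto simp: regular_module_def subset_iff)
  qed
  obtain d :: "'b set \<Rightarrow> nat" where d: "\<forall>U V. subsp (carrier k) A U \<longrightarrow> subsp (carrier k) A V \<longrightarrow>
      V \<subseteq> kspan A (carrier k) bs \<longrightarrow> U \<subset> V \<longrightarrow> d U < d V"
    using kspan_measure[OF A(4,5)] bs(1) B(1) by blast
  show ?thesis unfolding finlen_def sp
  proof (intro exI[of _ d] allI impI)
    fix U V assume UV: "subsp (carrier k) A U" "subsp (carrier k) A V" "U \<subset> V"
    have "V \<subseteq> kspan A (carrier k) bs" using UV(2) car unfolding subsp_def by (meson subset_trans)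
    then show "d U < d V" by (rule d[rule_format, OF UV(1,2) _ UV(3)])
  qed
qed

lemma infinite_fd_algebra:
  assumes fd: "is_fd_algebra k A" and nz: "\<one>\<^bsub>A\<^esub> \<noteq> \<zero>\<^bsub>A\<^esub>"
  shows "infinite (carrier A)"
proof
  assume fin: "finite (carrier A)"
  note A = fd_algebraD[OF fd]
  interpret k: field k by (rule A(5))
  interpret A: ring A by (rule A(2))
  have "inj_on (\<lambda>c. c \<odot>\<^bsub>A\<^esub> \<one>\<^bsub>A\<^esub>) (carrier k)"
  proof (rule inj_onI, rule ccontr)
    fix c d assume cd: "c \<in> carrier k" "d \<in> carrier k" "c \<odot>\<^bsub>A\<^esub> \<one>\<^bsub>A\<^esub> = d \<odot>\<^bsub>A\<^esub> \<one>\<^bsub>A\<^esub>" "c \<noteq> d"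
    then have "c \<ominus>\<^bsub>k\<^esub> d \<in> Units k" using k.field_Units by simp
    moreover have "(c \<ominus>\<^bsub>k\<^esub> d) \<odot>\<^bsub>A\<^esub> \<one>\<^bsub>A\<^esub> = \<zero>\<^bsub>A\<^esub>"
      using cd by (simp add: lm_smult0(6)[OF A(4)] lm_add[OF A(4)] lm_closed[OF A(4)])
    ultimately have "(inv\<^bsub>k\<^esub> (c \<ominus>\<^bsub>k\<^esub> d) \<otimes>\<^bsub>k\<^esub> (c \<ominus>\<^bsub>k\<^esub> d)) \<odot>\<^bsub>A\<^esub> \<one>\<^bsub>A\<^esub> = \<zero>\<^bsub>A\<^esub>"
      using cd by (simp add: lm_smult(3)[OF A(4)] lm_smult0[OF A(4)] del: k.Units_l_inv)
    then show False using \<open>c \<ominus>\<^bsub>k\<^esub> d \<in> Units k\<close> nz by (simp add: lm_one[OF A(4)])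
  qed
  then have "finite (carrier k)"
    using fin A(8) unfolding scalars_def by (metis finite_imageD finite_subset)
  then show False using algebraically_closed.infinite_carrier[OF A(1)] by contradiction
qed

section \<open>Simple-minded systems\<close>

text \<open>Over the zero algebra every module is zero, and so a zero object.\<close>

lemma zero_objects_zero_algebra:
  assumes A: "ring A" and z: "\<one>\<^bsub>A\<^esub> = \<zero>\<^bsub>A\<^esub>" and T: "\<T> \<subseteq> left_modules A"
  shows "zero_objects A \<T> = (\<T> :: ('a, 'm) module set)"
proof -
  have car: "carrier M = {\<zero>\<^bsub>M\<^esub>}" if "left_module A M" for M :: "('a, 'm) module"
  proof -
    have "x = \<zero>\<^bsub>M\<^esub>" if "x \<in> carrier M" for x
      using lm_one[OF \<open>left_module A M\<close> that] lm_smult0(1)[OF \<open>left_module A M\<close> that] z by simp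
    then show ?thesis using lm_closed(2)[OF \<open>left_module A M\<close>] by blast
  qed
  have "stable_Hom_zero A L M" if L: "left_module A L" and M: "left_module A M" for L M :: "('a, 'm) module"
  proof -
    define z where "z = (\<lambda>x\<in>carrier L. \<zero>\<^bsub>M\<^esub>)"
    have hom: "mod_hom A L M = {z}"
    proof -
      have "f = z" if "f \<in> mod_hom A L M" for f
        using that car[OF M] by (auto simp: z_def mod_hom_def PiE_iff extensional_def fun_eq_iff)
      moreover have "z \<in> mod_hom A L M" unfolding z_def by (rule mod_hom_of_lin[OF lin_zero[OF L M]])
      ultimately show ?thesis by blast
    qed
    have pL: "projective A L" unfolding projective_iff
    proof (intro conjI allI impI L)
      fix N P :: "('a, 'm) module" and p f
      assume a: "lin A N P p \<and> p ` carrier N = carrier P \<and> lin A L P f"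
      have m: "left_module A N" "left_module A P"
        using lin_mods(1,2)[of A N P p] a by simp_all
      have "p \<zero>\<^bsub>N\<^esub> = f x" if "x \<in> carrier L" for x
        using a that car[OF m(2)] lin_closed[of A L P f x] lin_closed[of A N P p "\<zero>\<^bsub>N\<^esub>"] lm_closed(2)[OF m(1)] by simp
      then show "\<exists>g. lin A L N g \<and> (\<forall>x\<in>carrier L. p (g x) = f x)"
        using lin_zero[OF L m(1)] by (intro exI[of _ "\<lambda>x. \<zero>\<^bsub>N\<^esub>"] conjI ballI)
    qed
    have "z \<in> proj_hom A L M" unfolding proj_hom_def
    proof (intro CollectI conjI exI[of _ L] pL)
      show "z \<in> mod_hom A L M" using hom by simp
      show "\<exists>g\<in>mod_hom A L L. \<exists>h\<in>mod_hom A L M. z = compose (carrier L) h g"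
        by (rule bexI[OF _ mod_hom_of_lin[OF lin_id[OF L]]], rule bexI[of _ z])
          (auto simp: hom z_def compose_def fun_eq_iff)
    qed
    then have proj: "proj_hom A L M = {z}" using hom unfolding proj_hom_def by blast
    have "a_rcosets\<^bsub>Hom_module A L M\<^esub> {z} = {{z}}"
      using hom lm_add(1)[OF M lm_closed(2)[OF M]]
      by (simp add: A_RCOSETS_def' a_r_coset_def r_coset_def Hom_module_def) (simp add: z_def fun_eq_iff)
    then show ?thesis unfolding stable_Hom_zero_def stable_Hom_def proj by simp
  qed
  then show ?thesis using T unfolding zero_objects_def left_modules_def by blast
qed

lemma ext_power_subset: "ext_power A \<T> \<S> n \<subseteq> \<T>"
  by (cases n) (auto simp: zero_objects_def star_def)

theorem theorem1p1:
  fixes k :: "'k ring" and A :: "('k, 'a) module" and \<S> :: "('a, 'm) module set"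
    and e :: "'a \<Rightarrow> 'm"
  assumes universe: "inj_on e (carrier A)"
    and algebra: "is_fd_algebra k A"
    and self_injective: "self_injective A"
    and finite: "finite \<S>"
    and orthogonal: "orthogonal_system k A (fp_left_modules A) \<S>"
    and suspension: "Sigma_obj A ` \<S> \<subseteq> ext_closure A (fp_left_modules A) \<S>"
    and weakly_simple_minded: "weakly_simple_minded_system k A (fp_left_modules A) \<S>"
    and condition: "perp A (fp_left_modules A) \<S> = zero_objects A (fp_left_modules A) \<Longrightarrow>
      perp A (left_modules A) \<S> = zero_objects A (left_modules A)"
  shows "simple_minded_system k A (fp_left_modules A) \<S>"
proof (cases "\<one>\<^bsub>A\<^esub> = \<zero>\<^bsub>A\<^esub>")
  case True
  \<comment> \<open>This case is separate because the universe may then be finite and offers no room for direct sums.\<close>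
  have "fp_left_modules A \<subseteq> left_modules A" by (auto simp: fp_left_modules_def left_modules_def)
  then have "ext_power A (fp_left_modules A) \<S> 0 = fp_left_modules A"
    using zero_objects_zero_algebra[OF fd_algebraD(2)[OF algebra] True] by simp
  then have "ext_closure A (fp_left_modules A) \<S> = fp_left_modules A"
    using ext_power_subset unfolding ext_closure_def by blast
  then show ?thesis using orthogonal by (simp add: simple_minded_system_def)
next
  case False
  note A = fd_algebraD[OF algebra]
  have inf: "infinite (UNIV :: 'm set)"
    using infinite_fd_algebra[OF algebra False] universe
    by (metis finite_imageD finite_subset subset_UNIV)
  interpret A: ring A by (rule A(2))
  interpret self_injective_algebra A "scalars k A" e
  proof unfold_locales
    show "scalars k A \<subseteq> carrier A" by (rule A(8))
    show "c \<otimes>\<^bsub>A\<^esub> a = a \<otimes>\<^bsub>A\<^esub> c" if "c \<in> scalars k A" "a \<in> carrier A" for c a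
      using that A(6,7) by (auto simp: scalars_def)
    show "finlen (scalars k A) (regular_module A)" by (rule finlen_regular_fd_algebra[OF algebra])
    show "injective A (regular_module A)" using self_injective by (simp add: self_injective_def)
  qed (rule inf universe)+
  interpret self_injective_fd_algebra A "scalars k A" e ..
  let ?T = "fp_left_modules A :: ('a, 'm) module set"
  have ST: "\<S> \<subseteq> ?T" and brick: "\<And>M. M \<in> \<S> \<Longrightarrow> stable_brick k A M"
    and orth: "\<And>M N. M \<in> \<S> \<Longrightarrow> N \<in> \<S> \<Longrightarrow> M \<noteq> N \<Longrightarrow> stable_Hom_zero A M N"
    using orthogonal by (auto simp: orthogonal_system_def)
  have Sfl: "fl S" if "S \<in> \<S>" for S using ST that fp_iff by blast
  note mod = flD(1)
  have weak: "M \<in> zero_objects A ?T" if "M \<in> ?T" "\<And>S. S \<in> \<S> \<Longrightarrow> stable_Hom_zero A S M" for M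
    using weakly_simple_minded that unfolding weakly_simple_minded_system_def by blast
  have "perp A ?T \<S> = zero_objects A ?T"
  proof
    show "perp A ?T \<S> \<subseteq> zero_objects A ?T" using weak unfolding perp_def by blast
    show "zero_objects A ?T \<subseteq> perp A ?T \<S>" using ST unfolding perp_def zero_objects_def by blast
  qed
  then have big: "perp A (left_modules A) \<S> = zero_objects A (left_modules A)" by (rule condition)
  interpret weakly_simple_minded_big A "scalars k A" e \<S>
  proof unfold_locales
    show "fl S" if "S \<in> \<S>" for S using Sfl[OF that] .
    show "finite \<S>" by (rule finite)
    show "\<exists>r. lin A S S r \<and> stz S S (\<lambda>s. r (q s) \<ominus>\<^bsub>S\<^esub> s) \<and> stz S S (\<lambda>s. s \<ominus>\<^bsub>S\<^esub> q (r s))"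
      if "S \<in> \<S>" "lin A S S q" "\<not> stz S S q" for S q
      by (rule stable_brick_inverse[OF A(5) mod[OF Sfl[OF that(1)]] brick[OF that(1)] that(2,3)])
    show "stz S T q" if "S \<in> \<S>" "T \<in> \<S>" "S \<noteq> T" "lin A S T q" for S T q
      using orth[OF that(1-3)] that(4) stable_Hom_zero_iff[OF mod[OF Sfl[OF that(1)]] mod[OF Sfl[OF that(2)]]] by blast
    show "pif M" if M: "fl M" "\<And>S f. S \<in> \<S> \<Longrightarrow> lin A S M f \<Longrightarrow> stz S M f" for M
    proof -
      have "stable_Hom_zero A S M" if "S \<in> \<S>" for S
        using stable_Hom_zero_iff[OF mod[OF Sfl[OF that]] mod[OF M(1)]] M(2)[OF that] by blast
      then show ?thesis using weak M(1) fp_iff zero_objects_fp by blast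
    qed
    show "stz Y Y (\<lambda>y. y)" if Y: "left_module A Y" "\<And>S f. S \<in> \<S> \<Longrightarrow> lin A S Y f \<Longrightarrow> stz S Y f" for Y
    proof -
      have "stable_Hom_zero A S Y" if "S \<in> \<S>" for S
        using stable_Hom_zero_iff[OF mod[OF Sfl[OF that]] Y(1)] Y(2)[OF that] by blast
      then have "Y \<in> zero_objects A (left_modules A)"
        unfolding big[symmetric] using Y(1) by (simp add: perp_def left_modules_def)
      then have "stable_Hom_zero A Y Y" by (auto simp: zero_objects_def)
      then show ?thesis using stable_Hom_zero_iff[OF Y(1) Y(1)] lin_id[OF Y(1)] by blast
    qed
  qed
  \<comment> \<open>The exact sequences of a filtration give triangles.\<close>
  have power: "filt n M \<Longrightarrow> M \<in> ext_power A ?T \<S> n" for n M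
  proof (induction n arbitrary: M)
    case 0
    then show ?case by (simp add: zero_objects_fp)
  next
    case (Suc n)
    obtain X' V S Q :: "('a, 'm) module" and f g i p where *: "filt n X'" "S \<in> \<S>" "pif Q"
        "ses A X' V S f g" "ses A M V Q i p"
      by (rule filt_SucE[OF Suc.prems])
    obtain F G H where "is_triangle A ?T X' M S F G H"
      using triangle_of_ses[OF *(4,5,3) filt_fl[OF *(1)] Sfl[OF *(2)]] by blast
    then show ?case
      using Suc.IH[OF *(1)] *(2) filt_fl[OF Suc.prems] fp_iff unfolding ext_power.simps star_def by blast
  qed
  have "ext_closure A ?T \<S> = ?T"
  proof
    show "ext_closure A ?T \<S> \<subseteq> ?T" using ext_power_subset unfolding ext_closure_def by blast
    show "?T \<subseteq> ext_closure A ?T \<S>"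
    proof
      fix M assume "M \<in> ?T"
      then have "fl M" by (simp only: fp_iff)
      then obtain n where "filt n M" using filt_exhausts by blast
      then show "M \<in> ext_closure A ?T \<S>" using power unfolding ext_closure_def by blast
    qed
  qed
  then show ?thesis using orthogonal by (simp add: simple_minded_system_def)
qed

end
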